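(* Let $M$ be a smooth $n$-dimensional manifold, $\mathcal{Q}\to M$ a smooth fibre bundle, $\mathcal{Q}^I:=J^1\mathcal{Q}$, and $\mathcal{P}:=V^*\mathcal{Q}\otimes_{\mathcal{Q}}\Lambda^{n-1}M$ regarded as a bundle over $M$, with $\widetilde{\omega}^I$ the canonical $\Lambda^nM$-valued vertical two-form on $J^1\mathcal{P}$. There is a canonical (i.e. independent of any choice of coordinates or trivialisations) mapping $$\Psi:J^1\mathcal{P}\longrightarrow V^*\mathcal{Q}^I\otimes_{\mathcal{Q}^I}\Lambda^nM$$ respecting the fibrations over $\mathcal{Q}^I$ (i.e. covering the identity of $\mathcal{Q}^I$), such that, for every point $\eta$ of the target space, the inverse image $\Psi^{-1}(\eta)$ is a degeneracy leaf of $\widetilde{\omega}^I$. In particular, $\Psi$ is surjective.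
   Context: $\Lambda^iM:=\bigwedge^iT^*M$, pulled back to whichever bundle over $M$ is indicated. For a bundle $B\to M$, $VB$ is the vertical tangent bundle, $V^*B$ its dual, and $\delta$ (vertical differential) is the exterior derivative along each fibre $B_x$ separately (factors in $\Lambda^iM$ treated as constants). In coordinates $(x^\mu,\varphi^K)$ on $\mathcal{Q}$, a point of $\mathcal{P}$ is $p=p^\mu_K\,\delta\varphi^K\otimes(\partial_\mu\lrcorner\, d^nx)$. $J^1\mathcal{P}$ is the first jet bundle of $\mathcal{P}\to M$, with coordinates $(x^\mu,\varphi^K,p^\mu_K,\varphi^K_{,\mu},p^\mu_{K,\nu})$; its projection to $\mathcal{Q}^I$ is the first jet prolongation of the projection $\mathcal{P}\to\mathcal{Q}$. The form $\widetilde{\omega}^I$ is the space-time exterior derivative of $\omega=\delta p^\mu_K\wedge\delta\varphi^K\otimes(\partial_\mu\lrcorner\, d^nx)$, i.e. $$\widetilde{\omega}^I=\left(\delta p^\mu_{K,\mu}\wedge\delta\varphi^K+\delta p^\mu_K\wedge\delta\varphi^K_{,\mu}\right)\otimes d^nx .$$ Its degeneracy leaves are the leaves of the distribution of vectors $X$ tangent to the fibres $(J^1\mathcal{P})_x$ with $X\lrcorner\,\widetilde{\omega}^I=0$. *)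

theory Defs
  imports "HOL-Analysis.Analysis"
begin

subsection \<open>Smooth maps between normed spaces\<close>

text \<open>For a finite-dimensional domain this is the usual notion of a \<open>C\<^sup>k\<close> map on an open set.\<close>

primrec Ck_on :: "nat \<Rightarrow> 'a::real_normed_vector set \<Rightarrow> ('a \<Rightarrow> 'b::real_normed_vector) \<Rightarrow> bool" where
  "Ck_on 0 S f \<longleftrightarrow> continuous_on S f"
| "Ck_on (Suc k) S f \<longleftrightarrow>
     (\<forall>x\<in>S. f differentiable (at x)) \<and> (\<forall>v. Ck_on k S (\<lambda>x. frechet_derivative f (at x) v))"

definition smooth_on :: "'a::real_normed_vector set \<Rightarrow> ('a \<Rightarrow> 'b::real_normed_vector) \<Rightarrow> bool" where
  "smooth_on S f \<longleftrightarrow> (\<forall>k. Ck_on k S f)"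


subsection \<open>Manifolds\<close>

text \<open>A manifold is a maximal atlas; its point set and its topology are read off from the atlas.
  The model is a normed vector space, which \<open>smooth_manifold\<close> requires to be finite-dimensional.
  It is not taken to be a Euclidean space because dimension 0 would then be excluded.\<close>

type_synonym ('p, 'a) chart = "'p set \<times> ('p \<Rightarrow> 'a)"
type_synonym ('p, 'a) atlas = "('p, 'a) chart set"

definition transition :: "('p, 'a) chart \<Rightarrow> ('p, 'b) chart \<Rightarrow> 'a \<Rightarrow> 'b" where
  "transition c d = snd d \<circ> inv_into (fst c) (snd c)"

definition is_chart_in :: "'p set \<Rightarrow> ('p, 'a::real_normed_vector) chart \<Rightarrow> bool" where
  "is_chart_in X c \<longleftrightarrow> fst c \<subseteq> X \<and> inj_on (snd c) (fst c) \<and> open (snd c ` fst c)"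

definition smooth_transition ::
  "('p, 'a::real_normed_vector) chart \<Rightarrow> ('p, 'a) chart \<Rightarrow> bool" where
  "smooth_transition c d \<longleftrightarrow>
     open (snd c ` (fst c \<inter> fst d)) \<and> smooth_on (snd c ` (fst c \<inter> fst d)) (transition c d)"

definition max_atlas :: "'p set \<Rightarrow> ('p, 'a::real_normed_vector) atlas \<Rightarrow> ('p, 'a) atlas" where
  "max_atlas X C =
     {c. is_chart_in X c \<and> (\<forall>d\<in>C. smooth_transition c d \<and> smooth_transition d c)}"

definition points :: "('p, 'a) atlas \<Rightarrow> 'p set" where
  "points A = \<Union> (fst ` A)"

definition mfd_topology :: "('p, 'a::real_normed_vector) atlas \<Rightarrow> 'p topology" where
  "mfd_topology A =
     topology (\<lambda>V. V \<subseteq> points A \<and> (\<forall>c\<in>A. open (snd c ` (fst c \<inter> V))))"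

definition smooth_manifold :: "('p, 'a::real_normed_vector) atlas \<Rightarrow> bool" where
  "smooth_manifold A \<longleftrightarrow>
     (\<exists>B::'a set. finite B \<and> span B = UNIV) \<and>
     A = max_atlas (points A) A \<and>
     Hausdorff_space (mfd_topology A) \<and> second_countable (mfd_topology A)"

definition open_submanifold :: "('p, 'a) atlas \<Rightarrow> 'p set \<Rightarrow> ('p, 'a) atlas" where
  "open_submanifold A U = {c \<in> A. fst c \<subseteq> U}"

definition product_manifold ::
  "('p, 'a::real_normed_vector) atlas \<Rightarrow> ('q, 'b::real_normed_vector) atlas
    \<Rightarrow> ('p \<times> 'q, 'a \<times> 'b) atlas" where
  "product_manifold A B =
     max_atlas (points A \<times> points B)
       {(fst c \<times> fst d, map_prod (snd c) (snd d)) | c d. c \<in> A \<and> d \<in> B}"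

definition smooth_map ::
  "('p, 'a::real_normed_vector) atlas \<Rightarrow> ('q, 'b::real_normed_vector) atlas \<Rightarrow> ('p \<Rightarrow> 'q) \<Rightarrow> bool"
  where
  "smooth_map A B f \<longleftrightarrow>
     (\<forall>p\<in>points A. \<exists>c\<in>A. \<exists>d\<in>B. p \<in> fst c \<and> f ` fst c \<subseteq> fst d \<and>
        smooth_on (snd c ` fst c) (snd d \<circ> f \<circ> inv_into (fst c) (snd c)))"

definition diffeomorphism ::
  "('p, 'a::real_normed_vector) atlas \<Rightarrow> ('q, 'b::real_normed_vector) atlas \<Rightarrow> ('p \<Rightarrow> 'q) \<Rightarrow> bool"
  where
  "diffeomorphism A B f \<longleftrightarrow>
     bij_betw f (points A) (points B) \<and> smooth_map A B f \<and>
     smooth_map B A (inv_into (points A) f)"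


subsection \<open>Tangent vectors\<close>

text \<open>A tangent vector at \<open>p\<close> is the family of its components in all charts around \<open>p\<close>
  (with value 0 on all other charts); the vector space operations are pointwise.\<close>

type_synonym ('p, 'a) tvec = "('p, 'a) chart \<Rightarrow> 'a"

definition charts_at :: "('p, 'a) atlas \<Rightarrow> 'p \<Rightarrow> ('p, 'a) chart set" where
  "charts_at A p = {c \<in> A. p \<in> fst c}"

definition tangent_space ::
  "('p, 'a::real_normed_vector) atlas \<Rightarrow> 'p \<Rightarrow> ('p, 'a) tvec set" where
  "tangent_space A p =
     {v. (\<forall>c. c \<notin> charts_at A p \<longrightarrow> v c = 0) \<and>
         (\<forall>c\<in>charts_at A p. \<forall>d\<in>charts_at A p.
            v d = frechet_derivative (transition c d) (at (snd c p)) (v c))}"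

definition lincomb ::
  "real \<Rightarrow> ('c \<Rightarrow> 'a::real_normed_vector) \<Rightarrow> real \<Rightarrow> ('c \<Rightarrow> 'a) \<Rightarrow> 'c \<Rightarrow> 'a" where
  "lincomb r u s v = (\<lambda>c. r *\<^sub>R u c + s *\<^sub>R v c)"

text \<open>The vector at \<open>p\<close> with component \<open>w\<close> in the chart \<open>c\<close>.\<close>

definition tvec_of ::
  "('p, 'a::real_normed_vector) atlas \<Rightarrow> ('p, 'a) chart \<Rightarrow> 'p \<Rightarrow> 'a \<Rightarrow> ('p, 'a) tvec" where
  "tvec_of A c p w = (THE v. v \<in> tangent_space A p \<and> v c = w)"

definition tangent_map ::
  "('p, 'a::real_normed_vector) atlas \<Rightarrow> ('q, 'b::real_normed_vector) atlas \<Rightarrow> ('p \<Rightarrow> 'q) \<Rightarrow> 'p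
    \<Rightarrow> ('p, 'a) tvec \<Rightarrow> ('q, 'b) tvec" where
  "tangent_map A B f p v = (\<lambda>d.
     if d \<in> charts_at B (f p) then
       (let c = (SOME c. c \<in> charts_at A p) in
         frechet_derivative (snd d \<circ> f \<circ> inv_into (fst c) (snd c)) (at (snd c p)) (v c))
     else 0)"


subsection \<open>Maximal connected integral manifolds of a distribution\<close>

text \<open>An immersed submanifold is described by its own topology \<open>T\<close>: every point has a
  \<open>T\<close>-neighbourhood that is a slice \<open>{y. c y - c p \<in> W}\<close> of a chart \<open>c\<close> of the ambient
  manifold, and on which \<open>T\<close> is the topology of the ambient manifold. The tangent space of
  such a slice consists of the vectors whose component in \<open>c\<close> lies in \<open>W\<close>.\<close>

definition integral_manifold ::
  "('p, 'a::real_normed_vector) atlas \<Rightarrow> ('p \<Rightarrow> ('p, 'a) tvec set) \<Rightarrow> 'p topology \<Rightarrow> bool" where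
  "integral_manifold A D T \<longleftrightarrow>
     (\<forall>p\<in>topspace T. \<exists>c\<in>charts_at A p. \<exists>W. subspace W \<and>
        (let N = {y \<in> fst c. snd c y - snd c p \<in> W} in
          openin T N \<and> subtopology T N = subtopology (mfd_topology A) N \<and>
          (\<forall>y\<in>N. D y = {v \<in> tangent_space A y. v c \<in> W})))"

definition connected_integral_manifold ::
  "('p, 'a::real_normed_vector) atlas \<Rightarrow> ('p \<Rightarrow> ('p, 'a) tvec set) \<Rightarrow> 'p topology \<Rightarrow> bool" where
  "connected_integral_manifold A D T \<longleftrightarrow>
     topspace T \<noteq> {} \<and> connected_space T \<and> integral_manifold A D T"

definition leaf ::
  "('p, 'a::real_normed_vector) atlas \<Rightarrow> ('p \<Rightarrow> ('p, 'a) tvec set) \<Rightarrow> 'p set \<Rightarrow> bool" where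
  "leaf A D L \<longleftrightarrow>
     (\<exists>T. topspace T = L \<and> connected_integral_manifold A D T) \<and>
     (\<forall>T. connected_integral_manifold A D T \<and> L \<subseteq> topspace T \<longrightarrow> topspace T = L)"


subsection \<open>Exterior forms at a point\<close>

text \<open>A \<open>k\<close>-form on a vector space \<open>V\<close> of tangent vectors is a function of lists of vectors;
  it is 0 on lists that are not \<open>k\<close>-tuples of elements of \<open>V\<close>.\<close>

type_synonym ('p, 'a) form = "('p, 'a) tvec list \<Rightarrow> real"

definition tuples :: "nat \<Rightarrow> 'v set \<Rightarrow> 'v list set" where
  "tuples k V = {vs. length vs = k \<and> set vs \<subseteq> V}"

definition alt_forms ::
  "nat \<Rightarrow> ('p, 'a::real_normed_vector) tvec set \<Rightarrow> ('p, 'a) form set" where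
  "alt_forms k V =
     {\<alpha>. (\<forall>vs. vs \<notin> tuples k V \<longrightarrow> \<alpha> vs = 0) \<and>
         (\<forall>us ws r u s v. us @ u # ws \<in> tuples k V \<and> us @ v # ws \<in> tuples k V \<longrightarrow>
            \<alpha> (us @ lincomb r u s v # ws) = r * \<alpha> (us @ u # ws) + s * \<alpha> (us @ v # ws)) \<and>
         (\<forall>vs\<in>tuples k V. \<not> distinct vs \<longrightarrow> \<alpha> vs = 0)}"

text \<open>\<open>dnx\<close> is \<open>dx\<^sup>1 \<and> \<dots> \<and> dx\<^sup>n\<close> on the model space. The coordinates have to be listed in some
  order; another order only changes the sign of \<open>dnx\<close>.\<close>

definition basis_enum :: "nat \<Rightarrow> 'e::euclidean_space" where
  "basis_enum = (SOME e. bij_betw e {..<DIM('e)} Basis)"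

definition dnx :: "'e::euclidean_space list \<Rightarrow> real" where
  "dnx vs = (\<Sum>\<sigma> | \<sigma> permutes {..<DIM('e)}.
     of_int (sign \<sigma>) * (\<Prod>i<DIM('e). (vs ! i) \<bullet> basis_enum (\<sigma> i)))"


subsection \<open>Fibre bundles\<close>

definition smooth_fibre_bundle ::
  "('m, 'e::euclidean_space) atlas \<Rightarrow> ('f, 'g::real_normed_vector) atlas
    \<Rightarrow> ('q, 'e \<times> 'g) atlas \<Rightarrow> ('q \<Rightarrow> 'm) \<Rightarrow> bool" where
  "smooth_fibre_bundle M F Q \<pi> \<longleftrightarrow>
     smooth_manifold M \<and> smooth_manifold F \<and> smooth_manifold Q \<and>
     smooth_map Q M \<pi> \<and> \<pi> ` points Q = points M \<and>
     (\<forall>x\<in>points M. \<exists>U \<Phi>. openin (mfd_topology M) U \<and> x \<in> U \<and>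
        diffeomorphism (open_submanifold Q {q \<in> points Q. \<pi> q \<in> U})
          (product_manifold (open_submanifold M U) F) \<Phi> \<and>
        (\<forall>q\<in>points Q. \<pi> q \<in> U \<longrightarrow> fst (\<Phi> q) = \<pi> q))"

text \<open>In the following, \<open>M\<close> is the base, \<open>B\<close> the total space and \<open>\<pi>\<close> the projection of a bundle.
  An adapted chart consists of a chart \<open>(x\<^sup>\<mu>)\<close> of \<open>M\<close> and a chart \<open>(x\<^sup>\<mu>, \<phi>\<^sup>K)\<close> of \<open>B\<close>.\<close>

definition adapted ::
  "('m, 'e::euclidean_space) atlas \<Rightarrow> ('b, 'e \<times> 'h::real_normed_vector) atlas \<Rightarrow> ('b \<Rightarrow> 'm)
    \<Rightarrow> (('m, 'e) chart \<times> ('b, 'e \<times> 'h) chart) set" where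
  "adapted M B \<pi> =
     {(a, c). a \<in> M \<and> c \<in> B \<and> \<pi> ` fst c \<subseteq> fst a \<and> (\<forall>b\<in>fst c. fst (snd c b) = snd a (\<pi> b))}"

definition vertical_space ::
  "('m, 'e::euclidean_space) atlas \<Rightarrow> ('b, 'e \<times> 'h::real_normed_vector) atlas \<Rightarrow> ('b \<Rightarrow> 'm)
    \<Rightarrow> 'b \<Rightarrow> ('b, 'e \<times> 'h) tvec set" where
  "vertical_space M B \<pi> b = {v \<in> tangent_space B b. tangent_map B M \<pi> b v = (\<lambda>_. 0)}"


subsection \<open>First jet bundles\<close>

text \<open>The 1-jet of a local section \<open>s\<close> at \<open>x\<close>, i.e. the class of all local sections with the same
  value and the same differential at \<open>x\<close>, is represented by the value and the differential
  (the latter extended by 0 outside the tangent space at \<open>x\<close>).\<close>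

type_synonym ('m, 'e, 'b, 'h) jet = "'b \<times> (('m, 'e) tvec \<Rightarrow> ('b, 'e \<times> 'h) tvec)"

definition local_section ::
  "('m, 'e::euclidean_space) atlas \<Rightarrow> ('b, 'e \<times> 'h::real_normed_vector) atlas \<Rightarrow> ('b \<Rightarrow> 'm)
    \<Rightarrow> 'm set \<Rightarrow> ('m \<Rightarrow> 'b) \<Rightarrow> bool" where
  "local_section M B \<pi> U s \<longleftrightarrow>
     openin (mfd_topology M) U \<and> smooth_map (open_submanifold M U) B s \<and> (\<forall>x\<in>U. \<pi> (s x) = x)"

definition jet_of ::
  "('m, 'e::euclidean_space) atlas \<Rightarrow> ('b, 'e \<times> 'h::real_normed_vector) atlas
    \<Rightarrow> ('m \<Rightarrow> 'b) \<Rightarrow> 'm \<Rightarrow> ('m, 'e, 'b, 'h) jet" where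
  "jet_of M B s x =
     (s x, \<lambda>v. if v \<in> tangent_space M x then tangent_map M B s x v else (\<lambda>_. 0))"

definition J1_points ::
  "('m, 'e::euclidean_space) atlas \<Rightarrow> ('b, 'e \<times> 'h::real_normed_vector) atlas \<Rightarrow> ('b \<Rightarrow> 'm)
    \<Rightarrow> ('m, 'e, 'b, 'h) jet set" where
  "J1_points M B \<pi> = {jet_of M B s x | s x U. local_section M B \<pi> U s \<and> x \<in> U}"

definition J1_proj :: "('b \<Rightarrow> 'm) \<Rightarrow> ('m, 'e, 'b, 'h) jet \<Rightarrow> 'm" where
  "J1_proj \<pi> j = \<pi> (fst j)"

text \<open>The coordinates \<open>(x\<^sup>\<mu>, \<phi>\<^sup>K, \<phi>\<^sup>K\<^sub>,\<^sub>\<mu>)\<close>; the derivatives \<open>\<phi>\<^sup>K\<^sub>,\<^sub>\<mu>\<close> are collected in a linear map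
  from the model space of \<open>M\<close> to that of the fibre.\<close>

definition J1_chart ::
  "('m, 'e::euclidean_space) atlas \<Rightarrow> ('b, 'e \<times> 'h::real_normed_vector) atlas \<Rightarrow> ('b \<Rightarrow> 'm)
    \<Rightarrow> ('m, 'e) chart \<Rightarrow> ('b, 'e \<times> 'h) chart
    \<Rightarrow> (('m, 'e, 'b, 'h) jet, 'e \<times> 'h \<times> ('e \<Rightarrow>\<^sub>L 'h)) chart" where
  "J1_chart M B \<pi> a c =
     ({j \<in> J1_points M B \<pi>. fst j \<in> fst c},
      \<lambda>j. (fst (snd c (fst j)), snd (snd c (fst j)),
           Blinfun (\<lambda>w. snd (snd j (tvec_of M a (J1_proj \<pi> j) w) c))))"

definition J1 ::
  "('m, 'e::euclidean_space) atlas \<Rightarrow> ('b, 'e \<times> 'h::real_normed_vector) atlas \<Rightarrow> ('b \<Rightarrow> 'm)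
    \<Rightarrow> (('m, 'e, 'b, 'h) jet, 'e \<times> 'h \<times> ('e \<Rightarrow>\<^sub>L 'h)) atlas" where
  "J1 M B \<pi> =
     max_atlas (J1_points M B \<pi>) {J1_chart M B \<pi> a c | a c. (a, c) \<in> adapted M B \<pi>}"

definition J1_prolong ::
  "('m, 'e::euclidean_space) atlas \<Rightarrow> ('b, 'e \<times> 'h::real_normed_vector) atlas \<Rightarrow> ('b \<Rightarrow> 'm)
    \<Rightarrow> ('c, 'e \<times> 'k::real_normed_vector) atlas \<Rightarrow> ('b \<Rightarrow> 'c)
    \<Rightarrow> ('m, 'e, 'b, 'h) jet \<Rightarrow> ('m, 'e, 'c, 'k) jet" where
  "J1_prolong M B \<pi> C \<tau> j =
     (\<tau> (fst j),
      \<lambda>v. if v \<in> tangent_space M (J1_proj \<pi> j) then tangent_map B C \<tau> (fst j) (snd j v)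
          else (\<lambda>_. 0))"


subsection \<open>Vertical covectors with values in exterior forms on the base\<close>

text \<open>The set \<open>V\<^sup>*B \<otimes> \<Lambda>\<^sup>kM\<close>: pairs of a point \<open>b\<close> of \<open>B\<close> and a linear map from the vertical space
  at \<open>b\<close> to the \<open>k\<close>-forms on \<open>M\<close> at \<open>\<pi> b\<close> (extended by 0).\<close>

type_synonym ('m, 'e, 'b, 'h) vform = "'b \<times> (('b, 'e \<times> 'h) tvec \<Rightarrow> ('m, 'e) form)"

definition vform_points ::
  "nat \<Rightarrow> ('m, 'e::euclidean_space) atlas \<Rightarrow> ('b, 'e \<times> 'h::real_normed_vector) atlas
    \<Rightarrow> ('b \<Rightarrow> 'm) \<Rightarrow> ('m, 'e, 'b, 'h) vform set" where
  "vform_points k M B \<pi> =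
     {(b, l). b \<in> points B \<and>
        (\<forall>v\<in>vertical_space M B \<pi> b. l v \<in> alt_forms k (tangent_space M (\<pi> b))) \<and>
        (\<forall>u\<in>vertical_space M B \<pi> b. \<forall>v\<in>vertical_space M B \<pi> b. \<forall>r s.
           l (lincomb r u s v) = lincomb r (l u) s (l v)) \<and>
        (\<forall>v. v \<notin> vertical_space M B \<pi> b \<longrightarrow> l v = (\<lambda>_. 0))}"

text \<open>The multi-phase bundle \<open>V\<^sup>*B \<otimes> \<Lambda>\<^sup>n\<^sup>-\<^sup>1M\<close> with the coordinates \<open>(x\<^sup>\<mu>, \<phi>\<^sup>K, p\<^sup>\<mu>\<^sub>K)\<close> given by
  \<open>l = p\<^sup>\<mu>\<^sub>K \<delta>\<phi>\<^sup>K \<otimes> (\<partial>\<^sub>\<mu> \<lrcorner> d\<^sup>nx)\<close>; the \<open>p\<^sup>\<mu>\<^sub>K\<close> form a linear map from the model space of the fibre to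
  that of \<open>M\<close>. Contraction with \<open>\<partial>\<^sub>\<mu>\<close> inserts the vector in the first slot.\<close>

definition phase_points ::
  "('m, 'e::euclidean_space) atlas \<Rightarrow> ('b, 'e \<times> 'h::real_normed_vector) atlas
    \<Rightarrow> ('b \<Rightarrow> 'm) \<Rightarrow> ('m, 'e, 'b, 'h) vform set" where
  "phase_points M B \<pi> = vform_points (DIM('e) - 1) M B \<pi>"

definition phase_proj :: "('b \<Rightarrow> 'm) \<Rightarrow> ('m, 'e, 'b, 'h) vform \<Rightarrow> 'm" where
  "phase_proj \<pi> y = \<pi> (fst y)"

definition phase_chart ::
  "('m, 'e::euclidean_space) atlas \<Rightarrow> ('b, 'e \<times> 'h::real_normed_vector) atlas \<Rightarrow> ('b \<Rightarrow> 'm)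
    \<Rightarrow> ('m, 'e) chart \<Rightarrow> ('b, 'e \<times> 'h) chart
    \<Rightarrow> (('m, 'e, 'b, 'h) vform, 'e \<times> 'h \<times> ('h \<Rightarrow>\<^sub>L 'e)) chart" where
  "phase_chart M B \<pi> a c =
     ({y \<in> phase_points M B \<pi>. fst y \<in> fst c},
      \<lambda>y. (fst (snd c (fst y)), snd (snd c (fst y)),
           THE p. \<forall>v\<in>vertical_space M B \<pi> (fst y).
                    \<forall>vs\<in>tuples (DIM('e) - 1) (tangent_space M (\<pi> (fst y))).
                      snd y v vs = dnx (blinfun_apply p (snd (v c)) # map (\<lambda>w. w a) vs)))"

definition phase_bundle ::
  "('m, 'e::euclidean_space) atlas \<Rightarrow> ('b, 'e \<times> 'h::real_normed_vector) atlas \<Rightarrow> ('b \<Rightarrow> 'm)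
    \<Rightarrow> (('m, 'e, 'b, 'h) vform, 'e \<times> 'h \<times> ('h \<Rightarrow>\<^sub>L 'e)) atlas" where
  "phase_bundle M B \<pi> =
     max_atlas (phase_points M B \<pi>) {phase_chart M B \<pi> a c | a c. (a, c) \<in> adapted M B \<pi>}"

text \<open>The bundle \<open>V\<^sup>*B \<otimes> \<Lambda>\<^sup>nM\<close> with the coordinates \<open>(x\<^sup>\<mu>, \<phi>\<^sup>K, r\<^sub>K)\<close> given by
  \<open>l = r\<^sub>K \<delta>\<phi>\<^sup>K \<otimes> d\<^sup>nx\<close>.\<close>

definition top_points ::
  "('m, 'e::euclidean_space) atlas \<Rightarrow> ('b, 'e \<times> 'h::real_normed_vector) atlas
    \<Rightarrow> ('b \<Rightarrow> 'm) \<Rightarrow> ('m, 'e, 'b, 'h) vform set" where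
  "top_points M B \<pi> = vform_points DIM('e) M B \<pi>"

definition top_chart ::
  "('m, 'e::euclidean_space) atlas \<Rightarrow> ('b, 'e \<times> 'h::real_normed_vector) atlas \<Rightarrow> ('b \<Rightarrow> 'm)
    \<Rightarrow> ('m, 'e) chart \<Rightarrow> ('b, 'e \<times> 'h) chart
    \<Rightarrow> (('m, 'e, 'b, 'h) vform, 'e \<times> 'h \<times> ('h \<Rightarrow>\<^sub>L real)) chart" where
  "top_chart M B \<pi> a c =
     ({y \<in> top_points M B \<pi>. fst y \<in> fst c},
      \<lambda>y. (fst (snd c (fst y)), snd (snd c (fst y)),
           THE r. \<forall>v\<in>vertical_space M B \<pi> (fst y).
                    \<forall>vs\<in>tuples DIM('e) (tangent_space M (\<pi> (fst y))).
                      snd y v vs = blinfun_apply r (snd (v c)) * dnx (map (\<lambda>w. w a) vs)))"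

definition top_bundle ::
  "('m, 'e::euclidean_space) atlas \<Rightarrow> ('b, 'e \<times> 'h::real_normed_vector) atlas \<Rightarrow> ('b \<Rightarrow> 'm)
    \<Rightarrow> (('m, 'e, 'b, 'h) vform, 'e \<times> 'h \<times> ('h \<Rightarrow>\<^sub>L real)) atlas" where
  "top_bundle M B \<pi> =
     max_atlas (top_points M B \<pi>) {top_chart M B \<pi> a c | a c. (a, c) \<in> adapted M B \<pi>}"


subsection \<open>The bundles over a given \<open>Q\<close>\<close>

text \<open>\<open>Q\<^sup>I = J\<^sup>1Q\<close>, \<open>J\<^sup>1P\<close> for the multi-phase bundle \<open>P\<close> of \<open>Q\<close>, and \<open>V\<^sup>*Q\<^sup>I \<otimes> \<Lambda>\<^sup>nM\<close>.
  Coordinates on \<open>J\<^sup>1P\<close> are \<open>(x, (\<phi>, p), w)\<close> where \<open>w\<close> maps \<open>\<partial>\<^sub>\<mu>\<close> to \<open>(\<phi>\<^sub>,\<^sub>\<mu>, p\<^sub>,\<^sub>\<mu>)\<close>.\<close>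

type_synonym ('m, 'e, 'q, 'g) jet_phase =
  "('m, 'e, ('m, 'e, 'q, 'g) vform, 'g \<times> ('g \<Rightarrow>\<^sub>L 'e)) jet"

type_synonym ('e, 'g) jet_phase_model =
  "'e \<times> ('g \<times> ('g \<Rightarrow>\<^sub>L 'e)) \<times> ('e \<Rightarrow>\<^sub>L ('g \<times> ('g \<Rightarrow>\<^sub>L 'e)))"

type_synonym ('m, 'e, 'q, 'g) inf_form =
  "('m, 'e, ('m, 'e, 'q, 'g) jet, 'g \<times> ('e \<Rightarrow>\<^sub>L 'g)) vform"

type_synonym ('e, 'g) inf_form_model =
  "'e \<times> ('g \<times> ('e \<Rightarrow>\<^sub>L 'g)) \<times> (('g \<times> ('e \<Rightarrow>\<^sub>L 'g)) \<Rightarrow>\<^sub>L real)"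

definition J1P ::
  "('m, 'e::euclidean_space) atlas \<Rightarrow> ('q, 'e \<times> 'g::real_normed_vector) atlas \<Rightarrow> ('q \<Rightarrow> 'm)
    \<Rightarrow> (('m, 'e, 'q, 'g) jet_phase, ('e, 'g) jet_phase_model) atlas" where
  "J1P M Q \<pi> = J1 M (phase_bundle M Q \<pi>) (phase_proj \<pi>)"

definition J1P_proj :: "('q \<Rightarrow> 'm) \<Rightarrow> ('m, 'e, 'q, 'g) jet_phase \<Rightarrow> 'm" where
  "J1P_proj \<pi> = J1_proj (phase_proj \<pi>)"

definition J1P_chart ::
  "('m, 'e::euclidean_space) atlas \<Rightarrow> ('q, 'e \<times> 'g::real_normed_vector) atlas \<Rightarrow> ('q \<Rightarrow> 'm)
    \<Rightarrow> ('m, 'e) chart \<Rightarrow> ('q, 'e \<times> 'g) chart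
    \<Rightarrow> (('m, 'e, 'q, 'g) jet_phase, ('e, 'g) jet_phase_model) chart" where
  "J1P_chart M Q \<pi> a c =
     J1_chart M (phase_bundle M Q \<pi>) (phase_proj \<pi>) a (phase_chart M Q \<pi> a c)"

text \<open>The projection of \<open>J\<^sup>1P\<close> to \<open>Q\<^sup>I\<close>, i.e. the jet prolongation of the projection of \<open>P\<close> to \<open>Q\<close>.\<close>

definition J1P_to_QI ::
  "('m, 'e::euclidean_space) atlas \<Rightarrow> ('q, 'e \<times> 'g::real_normed_vector) atlas \<Rightarrow> ('q \<Rightarrow> 'm)
    \<Rightarrow> ('m, 'e, 'q, 'g) jet_phase \<Rightarrow> ('m, 'e, 'q, 'g) jet" where
  "J1P_to_QI M Q \<pi> = J1_prolong M (phase_bundle M Q \<pi>) (phase_proj \<pi>) Q fst"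

definition inf_target ::
  "('m, 'e::euclidean_space) atlas \<Rightarrow> ('q, 'e \<times> 'g::real_normed_vector) atlas \<Rightarrow> ('q \<Rightarrow> 'm)
    \<Rightarrow> (('m, 'e, 'q, 'g) inf_form, ('e, 'g) inf_form_model) atlas" where
  "inf_target M Q \<pi> = top_bundle M (J1 M Q \<pi>) (J1_proj \<pi>)"

definition inf_target_points ::
  "('m, 'e::euclidean_space) atlas \<Rightarrow> ('q, 'e \<times> 'g::real_normed_vector) atlas \<Rightarrow> ('q \<Rightarrow> 'm)
    \<Rightarrow> ('m, 'e, 'q, 'g) inf_form set" where
  "inf_target_points M Q \<pi> = top_points M (J1 M Q \<pi>) (J1_proj \<pi>)"

definition inf_target_chart ::
  "('m, 'e::euclidean_space) atlas \<Rightarrow> ('q, 'e \<times> 'g::real_normed_vector) atlas \<Rightarrow> ('q \<Rightarrow> 'm)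
    \<Rightarrow> ('m, 'e) chart \<Rightarrow> ('q, 'e \<times> 'g) chart
    \<Rightarrow> (('m, 'e, 'q, 'g) inf_form, ('e, 'g) inf_form_model) chart" where
  "inf_target_chart M Q \<pi> a c =
     top_chart M (J1 M Q \<pi>) (J1_proj \<pi>) a (J1_chart M Q \<pi> a c)"


subsection \<open>The canonical two-form on \<open>J\<^sup>1P\<close> and its degeneracy distribution\<close>

text \<open>For vertical vectors with components \<open>(0, (\<delta>\<phi>, \<delta>p), \<delta>w)\<close>, the following is the coefficient
  of \<open>d\<^sup>nx\<close> in \<open>(\<delta>p\<^sup>\<mu>\<^sub>K\<^sub>,\<^sub>\<mu> \<and> \<delta>\<phi>\<^sup>K + \<delta>p\<^sup>\<mu>\<^sub>K \<and> \<delta>\<phi>\<^sup>K\<^sub>,\<^sub>\<mu>) \<otimes> d\<^sup>nx\<close>; the vectors \<open>\<partial>\<^sub>\<mu>\<close> are the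
  elements of \<open>Basis\<close>, and \<open>\<alpha> \<and> \<beta>\<close> maps \<open>(X, Y)\<close> to \<open>\<alpha> X * \<beta> Y - \<alpha> Y * \<beta> X\<close>.\<close>

fun omega_half ::
  "('e::euclidean_space, 'g::real_normed_vector) jet_phase_model
    \<Rightarrow> ('e, 'g) jet_phase_model \<Rightarrow> real" where
  "omega_half (x, (\<phi>, p), w) (x', (\<phi>', p'), w') =
     (\<Sum>\<mu>\<in>Basis. blinfun_apply (snd (blinfun_apply w \<mu>)) \<phi>' \<bullet> \<mu>) +
     (\<Sum>\<mu>\<in>Basis. blinfun_apply p (fst (blinfun_apply w' \<mu>)) \<bullet> \<mu>)"

definition omega_coeff ::
  "('e::euclidean_space, 'g::real_normed_vector) jet_phase_model
    \<Rightarrow> ('e, 'g) jet_phase_model \<Rightarrow> real" where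
  "omega_coeff X Y = omega_half X Y - omega_half Y X"

definition J1P_vertical ::
  "('m, 'e::euclidean_space) atlas \<Rightarrow> ('q, 'e \<times> 'g::real_normed_vector) atlas \<Rightarrow> ('q \<Rightarrow> 'm)
    \<Rightarrow> ('m, 'e, 'q, 'g) jet_phase
    \<Rightarrow> (('m, 'e, 'q, 'g) jet_phase, ('e, 'g) jet_phase_model) tvec set" where
  "J1P_vertical M Q \<pi> y = vertical_space M (J1P M Q \<pi>) (J1P_proj \<pi>) y"

text \<open>The value on \<open>X\<close> and \<open>Y\<close> is the \<open>n\<close>-form on \<open>M\<close> given by the coordinate expression in every
  adapted chart.\<close>

definition omega_tilde ::
  "('m, 'e::euclidean_space) atlas \<Rightarrow> ('q, 'e \<times> 'g::real_normed_vector) atlas \<Rightarrow> ('q \<Rightarrow> 'm)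
    \<Rightarrow> ('m, 'e, 'q, 'g) jet_phase
    \<Rightarrow> (('m, 'e, 'q, 'g) jet_phase, ('e, 'g) jet_phase_model) tvec
    \<Rightarrow> (('m, 'e, 'q, 'g) jet_phase, ('e, 'g) jet_phase_model) tvec
    \<Rightarrow> ('m, 'e) form" where
  "omega_tilde M Q \<pi> y X Y =
     (THE \<alpha>. \<alpha> \<in> alt_forms DIM('e) (tangent_space M (J1P_proj \<pi> y)) \<and>
        (\<forall>(a, c)\<in>adapted M Q \<pi>. y \<in> fst (J1P_chart M Q \<pi> a c) \<longrightarrow>
           (\<forall>vs\<in>tuples DIM('e) (tangent_space M (J1P_proj \<pi> y)).
              \<alpha> vs = omega_coeff (X (J1P_chart M Q \<pi> a c)) (Y (J1P_chart M Q \<pi> a c))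
                       * dnx (map (\<lambda>v. v a) vs))))"

definition degeneracy ::
  "('m, 'e::euclidean_space) atlas \<Rightarrow> ('q, 'e \<times> 'g::real_normed_vector) atlas \<Rightarrow> ('q \<Rightarrow> 'm)
    \<Rightarrow> ('m, 'e, 'q, 'g) jet_phase
    \<Rightarrow> (('m, 'e, 'q, 'g) jet_phase, ('e, 'g) jet_phase_model) tvec set" where
  "degeneracy M Q \<pi> y =
     {X \<in> J1P_vertical M Q \<pi> y.
        \<forall>Y\<in>J1P_vertical M Q \<pi> y. omega_tilde M Q \<pi> y X Y = (\<lambda>_. 0)}"


subsection \<open>Independence of coordinates\<close>

text \<open>A map from \<open>J\<^sup>1P\<close> to \<open>V\<^sup>*Q\<^sup>I \<otimes> \<Lambda>\<^sup>nM\<close> does not depend on coordinates or trivialisations if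
  in all adapted charts of \<open>Q\<close> it has the same coordinate expression \<open>G\<close>, that is, if evaluating
  the rule \<open>G\<close> in any of these coordinate systems yields the map.\<close>

definition has_coordinate_rule ::
  "('m, 'e::euclidean_space) atlas \<Rightarrow> ('q, 'e \<times> 'g::real_normed_vector) atlas \<Rightarrow> ('q \<Rightarrow> 'm)
    \<Rightarrow> (('e, 'g) jet_phase_model \<Rightarrow> ('e, 'g) inf_form_model)
    \<Rightarrow> (('m, 'e, 'q, 'g) jet_phase \<Rightarrow> ('m, 'e, 'q, 'g) inf_form) \<Rightarrow> bool" where
  "has_coordinate_rule M Q \<pi> G \<Psi> \<longleftrightarrow>
     (\<forall>(a, c)\<in>adapted M Q \<pi>. \<forall>y\<in>fst (J1P_chart M Q \<pi> a c).
        \<Psi> y \<in> fst (inf_target_chart M Q \<pi> a c) \<and>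
        snd (inf_target_chart M Q \<pi> a c) (\<Psi> y) = G (snd (J1P_chart M Q \<pi> a c) y))"

end

theory Submission
  imports Defs
begin

text \<open>In adapted coordinates \<open>\<Psi>\<close> is the linear map
  \<open>(x, \<phi>, p, \<phi>\<^sub>,\<^sub>\<mu>, p\<^sub>,\<^sub>\<mu>) \<mapsto> (x, \<phi>, \<phi>\<^sub>,\<^sub>\<mu>, p\<^sup>\<mu>\<^sub>K\<^sub>,\<^sub>\<mu> \<delta>\<phi>\<^sup>K + p\<^sup>\<mu>\<^sub>K \<delta>\<phi>\<^sup>K\<^sub>,\<^sub>\<mu>)\<close>.
  The last component is the divergence of \<open>p(\<delta>\<phi>)\<close>, computed from the jets of \<open>p\<close> and \<open>\<delta>\<phi>\<close>;
  as \<open>p(\<delta>\<phi>)\<close> is an \<open>(n-1)\<close>-form on the base, the divergence does not depend on the coordinates by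
  the Piola identity and the symmetry of second derivatives. The vertical differential of this
  one-form is \<open>\<omega>\<close>, hence \<open>\<omega>\<close> does not depend on the coordinates either, and the
  coordinates of its degenerate vectors are exactly the kernel of the linear map. A fibre of \<open>\<Psi>\<close> is
  therefore an affine slice of a single adapted chart, and along any connected integral manifold
  the derivative of \<open>\<Psi>\<close> vanishes, so that \<open>\<Psi>\<close> is constant on it.\<close>

text \<open>The obstacle is the transformation of the derivatives of p, which contains second
  derivatives of the chart change; written out explicitly it would force inverse Jacobians to be
  differentiated. The transformation rules are therefore kept in contracted form: the new p is
  applied to an already transformed vertical vector, and a new jet to an already transformed base
  vector. Derivatives of these identities along lines give the rules for the derivatives of p and
  for the variations of the jets, and the second derivatives of the chart change of \<open>Q\<close>
  cancel when the two are added. Jets, phase forms and top forms all have charts whose image is a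
  full cylinder over a chart of the underlying bundle. One locale therefore yields the maximal atlas
  in each case, and its result is again a bundle with adapted charts, so that the constructions can
  be stacked. The cylinders also explain why a fibre of the map is connected: in its chart it is the
  full solution set of an affine equation, and nothing is cut off at the boundary of the
  chart.\<close>

section \<open>Finite-dimensional normed spaces\<close>

text \<open>Induction on the basis. The new vector \<open>a\<close> has positive distance from the
  span of the others: if points of \<open>a + span B\<close> tended to 0, the induction hypothesis
  would make their coefficients Cauchy, and the limit would place \<open>a\<close> in
  \<open>span B\<close>.\<close>

lemma coordinates_bounded:
  fixes B :: "'a::real_normed_vector set"
  assumes "finite B" "independent B"
  shows "\<exists>m>0. \<forall>c. (\<Sum>b\<in>B. \<bar>c b\<bar>) \<le> m * norm (\<Sum>b\<in>B. c b *\<^sub>R b)"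
  using assms
proof (induction B rule: finite_induct)
  case empty
  then show ?case by (auto intro!: exI[of _ 1])
next
  case (insert a B)
  then have ind: "independent B" and a: "a \<notin> span B"
    by (auto simp: independent_insert)
  obtain m where m: "m > 0" "\<And>c. (\<Sum>b\<in>B. \<bar>c b\<bar>) \<le> m * norm (\<Sum>b\<in>B. c b *\<^sub>R b)"
    using insert.IH[OF ind] by blast
  have "\<exists>d>0. \<forall>c. d \<le> norm (a + (\<Sum>b\<in>B. c b *\<^sub>R b))"
  proof (rule ccontr)
    assume "\<not> ?thesis"
    then have "\<forall>n. \<exists>c. norm (a + (\<Sum>b\<in>B. c b *\<^sub>R b)) < 1 / real (Suc n)"
      by (metis not_le zero_less_divide_1_iff of_nat_0_less_iff zero_less_Suc)
    then obtain C where C: "\<And>n. norm (a + (\<Sum>b\<in>B. C n b *\<^sub>R b)) < 1 / real (Suc n)"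
      by metis
    have lim: "(\<lambda>n. a + (\<Sum>b\<in>B. C n b *\<^sub>R b)) \<longlonglongrightarrow> 0"
      by (rule Lim_null_comparison[OF _ LIMSEQ_inverse_real_of_nat])
        (use C in \<open>auto simp: inverse_eq_divide intro!: always_eventually less_imp_le\<close>)
    have "convergent (\<lambda>n. C n b)" if "b \<in> B" for b
    proof -
      have "Cauchy (\<lambda>n. C n b)"
      proof (rule metric_CauchyI)
        fix e :: real assume "e > 0"
        have "Cauchy (\<lambda>n. a + (\<Sum>b\<in>B. C n b *\<^sub>R b))"
          using lim LIMSEQ_imp_Cauchy by blast
        then obtain N where N: "\<And>n k. n \<ge> N \<Longrightarrow> k \<ge> N \<Longrightarrow>
            dist (a + (\<Sum>b\<in>B. C n b *\<^sub>R b)) (a + (\<Sum>b\<in>B. C k b *\<^sub>R b)) < e / m"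
          using metric_CauchyD[OF _ divide_pos_pos[OF \<open>e > 0\<close> m(1)]] by blast
        have "dist (C n b) (C k b) < e" if "n \<ge> N" "k \<ge> N" for n k
        proof -
          have "\<bar>C n b - C k b\<bar> \<le> (\<Sum>b\<in>B. \<bar>C n b - C k b\<bar>)"
            using \<open>b \<in> B\<close> insert.hyps(1)
            by (intro member_le_sum[of b B "\<lambda>b. \<bar>C n b - C k b\<bar>"]) auto
          also have "\<dots> \<le> m * norm (\<Sum>b\<in>B. (C n b - C k b) *\<^sub>R b)"
            by (rule m(2)[of "\<lambda>b. C n b - C k b"])
          also have "(\<Sum>b\<in>B. (C n b - C k b) *\<^sub>R b)
              = (a + (\<Sum>b\<in>B. C n b *\<^sub>R b)) - (a + (\<Sum>b\<in>B. C k b *\<^sub>R b))"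
            by (simp add: sum_subtractf scaleR_left_diff_distrib)
          also have "m * norm \<dots> < m * (e / m)"
            using N[OF that] m(1) by (intro mult_strict_left_mono) (simp_all add: dist_norm)
          finally show ?thesis using m(1) by (simp add: dist_real_def)
        qed
        then show "\<exists>N. \<forall>n\<ge>N. \<forall>k\<ge>N. dist (C n b) (C k b) < e" by blast
      qed
      then show ?thesis by (simp add: Cauchy_convergent_iff)
    qed
    then obtain L where L: "\<And>b. b \<in> B \<Longrightarrow> (\<lambda>n. C n b) \<longlonglongrightarrow> L b"
      unfolding convergent_def by metis
    have "(\<lambda>n. a + (\<Sum>b\<in>B. C n b *\<^sub>R b)) \<longlonglongrightarrow> a + (\<Sum>b\<in>B. L b *\<^sub>R b)"
      by (intro tendsto_intros L)
    then have "a + (\<Sum>b\<in>B. L b *\<^sub>R b) = 0" using lim LIMSEQ_unique by blast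
    then have "a = - (\<Sum>b\<in>B. L b *\<^sub>R b)" by (simp add: eq_neg_iff_add_eq_0)
    moreover have "- (\<Sum>b\<in>B. L b *\<^sub>R b) \<in> span B"
      by (intro span_neg span_sum span_scale span_base)
    ultimately show False using a by simp
  qed
  then obtain d where d: "d > 0" "\<And>c. d \<le> norm (a + (\<Sum>b\<in>B. c b *\<^sub>R b))" by blast
  \<comment> \<open>Division by \<open>c a\<close> normalises the coefficient of \<open>a\<close> to
    1, where the distance \<open>d\<close> applies.\<close>
  have le: "\<bar>c a\<bar> \<le> norm (c a *\<^sub>R a + (\<Sum>b\<in>B. c b *\<^sub>R b)) / d" for c
  proof (cases "c a = 0")
    case False
    have "c a *\<^sub>R a + (\<Sum>b\<in>B. c b *\<^sub>R b) = c a *\<^sub>R (a + (\<Sum>b\<in>B. (c b / c a) *\<^sub>R b))"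
      using False by (simp add: scaleR_add_right scaleR_sum_right)
    then have "norm (c a *\<^sub>R a + (\<Sum>b\<in>B. c b *\<^sub>R b)) \<ge> \<bar>c a\<bar> * d"
      using d(2)[of "\<lambda>b. c b / c a"] by (simp add: mult_left_mono)
    then show ?thesis using d(1) by (simp add: field_simps)
  qed (use d in auto)
  \<comment> \<open>\<open>1 / d\<close> bounds the coefficient of \<open>a\<close>. For the others
    the constant \<open>m\<close> meets the norm of the sum without \<open>a\<close>, which by the
    triangle inequality is at most \<open>1 + norm a / d\<close> times the full norm.\<close>
  define K where "K = 1 / d + m * (1 + norm a / d)"
  have "K > 0" unfolding K_def using d(1) m(1) by (intro add_pos_nonneg) auto
  moreover have "(\<Sum>b\<in>insert a B. \<bar>c b\<bar>) \<le> K * norm (\<Sum>b\<in>insert a B. c b *\<^sub>R b)" for c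
  proof -
    define N where "N = norm (c a *\<^sub>R a + (\<Sum>b\<in>B. c b *\<^sub>R b))"
    have "norm (\<Sum>b\<in>B. c b *\<^sub>R b) \<le> N + \<bar>c a\<bar> * norm a"
      using norm_triangle_ineq4[of "c a *\<^sub>R a + (\<Sum>b\<in>B. c b *\<^sub>R b)" "c a *\<^sub>R a"] by (simp add: N_def)
    also have "\<dots> \<le> N + N / d * norm a"
      using mult_right_mono[OF le[of c], of "norm a"] by (simp add: N_def[symmetric])
    finally have "m * norm (\<Sum>b\<in>B. c b *\<^sub>R b) \<le> m * (N + N / d * norm a)"
      using m(1) by simp
    then have "(\<Sum>b\<in>B. \<bar>c b\<bar>) \<le> m * (N + N / d * norm a)" using m(2)[of c] by linarith
    moreover have "(\<Sum>b\<in>insert a B. \<bar>c b\<bar>) = \<bar>c a\<bar> + (\<Sum>b\<in>B. \<bar>c b\<bar>)"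
      "norm (\<Sum>b\<in>insert a B. c b *\<^sub>R b) = N"
      using insert.hyps by (auto simp: N_def)
    ultimately show ?thesis using le[of c] by (simp add: K_def N_def[symmetric] algebra_simps)
  qed
  ultimately show ?case by blast
qed

text \<open>Finite dimension as a finite resolution of the identity by bounded functionals; the
  \<open>b i\<close> may be dependent. In this form closure under products and operator spaces is a
  computation, and linear maps are visibly bounded.\<close>

definition fdim :: "'a::real_normed_vector itself \<Rightarrow> bool" where
  "fdim (T :: 'a itself) \<longleftrightarrow>
     (\<exists>(n::nat) (b :: nat \<Rightarrow> 'a) (l :: nat \<Rightarrow> 'a \<Rightarrow>\<^sub>L real). \<forall>x. x = (\<Sum>i<n. l i x *\<^sub>R b i))"

lemma fdimI:
  fixes b :: "'i \<Rightarrow> 'a::real_normed_vector" and l :: "'i \<Rightarrow> 'a \<Rightarrow> real"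
  assumes "finite I" "\<And>i. i \<in> I \<Longrightarrow> bounded_linear (l i)" "\<And>x. x = (\<Sum>i\<in>I. l i x *\<^sub>R b i)"
  shows "fdim TYPE('a)"
proof -
  obtain h where h: "bij_betw h {..<card I} I"
    using ex_bij_betw_nat_finite[OF assms(1)] atLeast0LessThan by metis
  have "x = (\<Sum>i<card I. Blinfun (l (h i)) x *\<^sub>R b (h i))" for x
  proof -
    have "(\<Sum>i<card I. Blinfun (l (h i)) x *\<^sub>R b (h i)) = (\<Sum>i<card I. l (h i) x *\<^sub>R b (h i))"
      using h assms(2) by (intro sum.cong) (auto simp: bounded_linear_Blinfun_apply bij_betwE)
    also have "\<dots> = (\<Sum>i\<in>I. l i x *\<^sub>R b i)" by (rule sum.reindex_bij_betw[OF h])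
    finally show ?thesis using assms(3) by simp
  qed
  then show ?thesis
    unfolding fdim_def
    by (intro exI[of _ "card I"] exI[of _ "\<lambda>i. b (h i)"] exI[of _ "\<lambda>i. Blinfun (l (h i))"] allI)
qed

text \<open>A purely algebraic spanning set is what \<open>smooth_manifold\<close> provides;
  boundedness of the coordinate functionals comes from \<open>coordinates_bounded\<close>.\<close>

lemma fdim_finite_span:
  fixes B :: "'a::real_normed_vector set"
  assumes "finite B" "span B = UNIV"
  shows "fdim TYPE('a)"
proof -
  obtain C where C: "C \<subseteq> B" "independent C" "B \<subseteq> span C"
    using maximal_independent_subset[of B] by blast
  have fin: "finite C" using C(1) assms(1) finite_subset by blast
  have sp: "span C = UNIV" using C(3) assms(2) span_mono span_span by (metis top.extremum_uniqueI)
  obtain m where m: "m > 0" "\<And>c. (\<Sum>b\<in>C. \<bar>c b\<bar>) \<le> m * norm (\<Sum>b\<in>C. c b *\<^sub>R b)"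
    using coordinates_bounded[OF fin C(2)] by blast
  have ex: "x = (\<Sum>b\<in>C. representation C x b *\<^sub>R b)" for x
    using real_vector.sum_representation_eq[OF C(2) _ fin subset_refl, of x] sp by auto
  have "bounded_linear (\<lambda>x. representation C x b)" if "b \<in> C" for b
  proof (rule bounded_linear_intro[where K = m])
    show "representation C (x + y) b = representation C x b + representation C y b" for x y
      using real_vector.representation_add[OF C(2), of x y] sp by (simp add: fun_eq_iff add.commute)
    show "representation C (r *\<^sub>R x) b = r *\<^sub>R representation C x b" for r x
      using real_vector.representation_scale[OF C(2), of x r] sp by (simp add: fun_eq_iff)
    show "norm (representation C x b) \<le> norm x * m" for x
    proof -
      have "\<bar>representation C x b\<bar> \<le> (\<Sum>b\<in>C. \<bar>representation C x b\<bar>)"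
        using that fin by (intro member_le_sum[of b C "\<lambda>b. \<bar>representation C x b\<bar>"]) auto
      also have "\<dots> \<le> m * norm x" using m(2)[of "representation C x"] ex[of x] by simp
      finally show ?thesis by (simp add: mult.commute)
    qed
  qed
  then show ?thesis using fin ex by (intro fdimI[of C "\<lambda>b x. representation C x b" "\<lambda>b. b"]) auto
qed

lemma fdim_coordinates:
  assumes "fdim TYPE('a::real_normed_vector)"
  obtains n :: nat and b :: "nat \<Rightarrow> 'a::real_normed_vector" and l :: "nat \<Rightarrow> 'a \<Rightarrow>\<^sub>L real"
  where "\<And>x. x = (\<Sum>i<n. l i x *\<^sub>R b i)"
  using assms unfolding fdim_def by blast

lemma fdim_euclidean [simp]: "fdim TYPE('e::euclidean_space)"
  by (rule fdimI[of Basis "\<lambda>b x. x \<bullet> b" "\<lambda>b. b"])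
    (auto simp: euclidean_representation bounded_linear_inner_left)

lemma fdim_prod [simp]:
  assumes "fdim TYPE('a::real_normed_vector)" "fdim TYPE('b::real_normed_vector)"
  shows "fdim TYPE('a \<times> 'b)"
proof -
  obtain n and b :: "nat \<Rightarrow> 'a" and l where 1: "\<And>x. x = (\<Sum>i<n. blinfun_apply (l i) x *\<^sub>R b i)"
    using fdim_coordinates[OF assms(1)] by metis
  obtain m and c :: "nat \<Rightarrow> 'b" and k where 2: "\<And>x. x = (\<Sum>i<m. blinfun_apply (k i) x *\<^sub>R c i)"
    using fdim_coordinates[OF assms(2)] by metis
  define L where "L i x = (case i of Inl i \<Rightarrow> l i (fst x) | Inr i \<Rightarrow> k i (snd x))"
    for i :: "nat + nat" and x :: "'a \<times> 'b"
  define e where "e i = (case i of Inl i \<Rightarrow> (b i, 0) | Inr i \<Rightarrow> (0, c i))" for i :: "nat + nat"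
  show ?thesis
  proof (rule fdimI[of "{..<n} <+> {..<m}" L e])
    show "bounded_linear (L i)" for i
      unfolding L_def by (cases i) (auto intro!: bounded_linear_intros)
    show "x = (\<Sum>i\<in>{..<n} <+> {..<m}. L i x *\<^sub>R e i)" for x
    proof -
      have "(\<Sum>i\<in>{..<n} <+> {..<m}. L i x *\<^sub>R e i)
          = (\<Sum>i<n. l i (fst x) *\<^sub>R (b i, 0)) + (\<Sum>i<m. k i (snd x) *\<^sub>R (0, c i))"
        by (subst sum.Plus) (auto simp: L_def e_def)
      also have "\<dots> = (fst x, snd x)"
        by (rule prod_eqI) (simp_all add: fst_sum snd_sum 1[symmetric] 2[symmetric])
      finally show ?thesis by simp
    qed
  qed auto
qed

text \<open>Expansion of an operator in the rank-one operators \<open>l i\<close> tensor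
  \<open>c j\<close>, with its matrix entries as coordinates.\<close>

lemma fdim_blinfun [simp]:
  assumes "fdim TYPE('a::real_normed_vector)" "fdim TYPE('b::real_normed_vector)"
  shows "fdim TYPE('a \<Rightarrow>\<^sub>L 'b)"
proof -
  obtain n and b :: "nat \<Rightarrow> 'a" and l where 1: "\<And>x. x = (\<Sum>i<n. blinfun_apply (l i) x *\<^sub>R b i)"
    using fdim_coordinates[OF assms(1)] by metis
  obtain m and c :: "nat \<Rightarrow> 'b" and k where 2: "\<And>x. x = (\<Sum>i<m. blinfun_apply (k i) x *\<^sub>R c i)"
    using fdim_coordinates[OF assms(2)] by metis
  define L where "L i f = k (snd i) (blinfun_apply f (b (fst i)))"
    for i :: "nat \<times> nat" and f :: "'a \<Rightarrow>\<^sub>L 'b"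
  define e where "e i = blinfun_scaleR_left (c (snd i)) o\<^sub>L l (fst i)" for i :: "nat \<times> nat"
  show ?thesis
  proof (rule fdimI[of "{..<n} \<times> {..<m}" L e])
    show "bounded_linear (L i)" for i
      unfolding L_def by (auto intro!: bounded_linear_intros)
    show "f = (\<Sum>i\<in>{..<n} \<times> {..<m}. L i f *\<^sub>R e i)" for f
    proof (rule blinfun_eqI)
      fix x
      have "blinfun_apply (\<Sum>i\<in>{..<n} \<times> {..<m}. L i f *\<^sub>R e i) x
          = (\<Sum>i<n. \<Sum>j<m. k j (f (b i)) *\<^sub>R l i x *\<^sub>R c j)"
        by (simp add: sum.cartesian_product' L_def e_def blinfun.sum_left blinfun.scaleR_left)
      also have "\<dots> = (\<Sum>i<n. l i x *\<^sub>R (\<Sum>j<m. k j (f (b i)) *\<^sub>R c j))"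
        by (simp add: scaleR_sum_right mult.commute)
      also have "\<dots> = (\<Sum>i<n. l i x *\<^sub>R f (b i))" by (simp add: 2[symmetric])
      also have "\<dots> = f (\<Sum>i<n. l i x *\<^sub>R b i)" by (simp add: blinfun.sum_right blinfun.scaleR_right)
      also have "\<dots> = f x" by (simp add: 1[symmetric])
      finally show "blinfun_apply f x = blinfun_apply (\<Sum>i\<in>{..<n} \<times> {..<m}. L i f *\<^sub>R e i) x" by simp
    qed
  qed auto
qed

lemma linear_imp_bounded_linear:
  fixes f :: "'a::real_normed_vector \<Rightarrow> 'b::real_normed_vector"
  assumes "fdim TYPE('a)" "linear f"
  shows "bounded_linear f"
proof -
  obtain n and b :: "nat \<Rightarrow> 'a" and l where 1: "\<And>x. x = (\<Sum>i<n. blinfun_apply (l i) x *\<^sub>R b i)"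
    using fdim_coordinates[OF assms(1)] by metis
  have "f x = (\<Sum>i<n. l i x *\<^sub>R f (b i))" for x
    using arg_cong[OF 1[of x], of f] by (simp add: linear_sum[OF assms(2)] linear_cmul[OF assms(2)])
  then have "f = (\<lambda>x. \<Sum>i<n. l i x *\<^sub>R f (b i))" by blast
  moreover have "bounded_linear (\<lambda>x. \<Sum>i<n. l i x *\<^sub>R f (b i))"
    by (intro bounded_linear_sum) (auto intro!: bounded_linear_intros)
  ultimately show ?thesis by simp
qed

section \<open>Smooth maps\<close>

abbreviation D :: "('a::real_normed_vector \<Rightarrow> 'b::real_normed_vector) \<Rightarrow> 'a \<Rightarrow> 'a \<Rightarrow> 'b" where
  "D f x \<equiv> frechet_derivative f (at x)"

lemma D_eqI: "(f has_derivative f') (at x) \<Longrightarrow> D f x = f'"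
  by (metis frechet_derivative_at)

lemma Ck_on_subset: "Ck_on k S f \<Longrightarrow> T \<subseteq> S \<Longrightarrow> Ck_on k T f"
  by (induction k arbitrary: f) (auto intro: continuous_on_subset)

lemma Ck_on_cong:
  assumes "open S" "\<And>x. x \<in> S \<Longrightarrow> f x = g x" "Ck_on k S f"
  shows "Ck_on k S g"
  using assms(2,3)
proof (induction k arbitrary: f g)
  case 0
  then show ?case by (auto cong: continuous_on_cong_simp)
next
  case (Suc k)
  have h: "(g has_derivative D f x) (at x)" if "x \<in> S" for x
    using Suc.prems that assms(1)
    by (intro has_derivative_transform_within_open[of f _ x UNIV S g])
      (auto simp: frechet_derivative_works)
  have "Ck_on k S (\<lambda>x. D g x v)" for v
    by (rule Suc.IH[of "\<lambda>x. D f x v"]) (use Suc.prems D_eqI[OF h] in auto)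
  then show ?case using h by (auto simp: differentiable_def)
qed

lemma Ck_on_Suc: "Ck_on (Suc k) S f \<Longrightarrow> Ck_on k S f"
proof (induction k arbitrary: f)
  case 0
  then show ?case
    by (auto intro!: continuous_at_imp_continuous_on differentiable_imp_continuous_within)
next
  case (Suc k)
  then show ?case by (metis Ck_on.simps(2))
qed

lemma Ck_on_const [simp]: "Ck_on k S (\<lambda>x. c)"
  by (induction k arbitrary: c) auto


lemma Ck_on_SucI:
  assumes "open S" "\<And>x. x \<in> S \<Longrightarrow> (f has_derivative f' x) (at x)" "\<And>v. Ck_on k S (\<lambda>x. f' x v)"
  shows "Ck_on (Suc k) S f"
proof -
  have "Ck_on k S (\<lambda>x. D f x v)" for v
    by (rule Ck_on_cong[OF assms(1) _ assms(3)[of v]]) (simp add: D_eqI[OF assms(2)])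
  then show ?thesis using assms(2) by (auto simp: differentiable_def)
qed

lemma Ck_on_SucD:
  assumes "Ck_on (Suc k) S f"
  shows "x \<in> S \<Longrightarrow> (f has_derivative D f x) (at x)" "Ck_on k S (\<lambda>x. D f x v)"
  using assms by (auto simp: frechet_derivative_works)

lemma Ck_on_linear:
  assumes "bounded_linear L" "open S"
  shows "Ck_on k S f \<Longrightarrow> Ck_on k S (\<lambda>x. L (f x))"
proof (induction k arbitrary: f)
  case 0
  then show ?case using bounded_linear.continuous_on[OF assms(1)] by auto
next
  case (Suc k)
  show ?case
    by (rule Ck_on_SucI[where f' = "\<lambda>x v. L (D f x v)"])
      (use assms Suc.IH Ck_on_SucD[OF Suc.prems] in \<open>auto intro: bounded_linear.has_derivative\<close>)
qed

lemma Ck_on_id [simp]: "Ck_on k S (\<lambda>x. x)"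
  by (cases k) auto

lemma Ck_on_add:
  assumes "open S"
  shows "Ck_on k S f \<Longrightarrow> Ck_on k S g \<Longrightarrow> Ck_on k S (\<lambda>x. f x + g x)"
proof (induction k arbitrary: f g)
  case (Suc k)
  show ?case
    by (rule Ck_on_SucI[where f' = "\<lambda>x v. D f x v + D g x v"])
      (use assms Suc.IH Ck_on_SucD[OF Suc.prems(1)] Ck_on_SucD[OF Suc.prems(2)]
        in \<open>auto intro: has_derivative_add\<close>)
qed (auto intro: continuous_on_add)

lemma Ck_on_Pair:
  assumes "open S"
  shows "Ck_on k S f \<Longrightarrow> Ck_on k S g \<Longrightarrow> Ck_on k S (\<lambda>x. (f x, g x))"
proof (induction k arbitrary: f g)
  case (Suc k)
  show ?case
    by (rule Ck_on_SucI[where f' = "\<lambda>x v. (D f x v, D g x v)"])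
      (use assms Suc.IH Ck_on_SucD[OF Suc.prems(1)] Ck_on_SucD[OF Suc.prems(2)]
        in \<open>auto intro: has_derivative_Pair\<close>)
qed (auto intro: continuous_on_Pair)

lemma Ck_on_sum:
  assumes "open S" "\<And>i. i \<in> I \<Longrightarrow> Ck_on k S (f i)"
  shows "Ck_on k S (\<lambda>x. \<Sum>i\<in>I. f i x)"
  using assms(2) by (induction I rule: infinite_finite_induct) (auto intro: Ck_on_add[OF assms(1)])

lemma Ck_on_bilinear:
  assumes "bounded_bilinear p" "open S"
  shows "Ck_on k S f \<Longrightarrow> Ck_on k S g \<Longrightarrow> Ck_on k S (\<lambda>x. p (f x) (g x))"
proof (induction k arbitrary: f g)
  case 0
  then show ?case using bounded_bilinear.continuous_on[OF assms(1)] by simp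
next
  case (Suc k)
  show ?case
    by (rule Ck_on_SucI[where f' = "\<lambda>x v. p (f x) (D g x v) + p (D f x v) (g x)"])
      (use assms Suc.IH Ck_on_SucD[OF Suc.prems(1)] Ck_on_SucD[OF Suc.prems(2)]
          Ck_on_Suc[OF Suc.prems(1)] Ck_on_Suc[OF Suc.prems(2)]
        in \<open>auto intro: bounded_bilinear.FDERIV Ck_on_add\<close>)
qed

text \<open>\<open>Ck_on\<close> differentiates in fixed directions only, whereas the chain rule
  produces \<open>D g (f x)\<close> in the moving direction \<open>D f x v\<close>. Expanding that
  direction in coordinates turns the derivative into a finite sum of products with fixed directions
  \<open>b i\<close>, to which the induction hypothesis applies.\<close>

lemma Ck_on_compose:
  fixes f :: "'a::real_normed_vector \<Rightarrow> 'b::real_normed_vector"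
    and g :: "'b \<Rightarrow> 'c::real_normed_vector"
  assumes "fdim TYPE('b)" "open S"
  shows "Ck_on k T g \<Longrightarrow> Ck_on k S f \<Longrightarrow> f ` S \<subseteq> T \<Longrightarrow> Ck_on k S (\<lambda>x. g (f x))"
proof (induction k arbitrary: g)
  case 0
  then show ?case using continuous_on_compose2[of T g S f] by simp
next
  case (Suc k)
  obtain n and b :: "nat \<Rightarrow> 'b" and l where b: "\<And>x. x = (\<Sum>i<n. blinfun_apply (l i) x *\<^sub>R b i)"
    using fdim_coordinates[OF assms(1)] by metis
  note f = Ck_on_SucD[OF Suc.prems(2)] and g = Ck_on_SucD[OF Suc.prems(1)]
  have D: "((\<lambda>x. g (f x)) has_derivative (\<lambda>v. \<Sum>i<n. l i (D f x v) *\<^sub>R D g (f x) (b i))) (at x)"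
    if "x \<in> S" for x
  proof -
    have g': "(g has_derivative D g (f x)) (at (f x))" using g(1) Suc.prems(3) that by auto
    have lin: "linear (D g (f x))" using g' has_derivative_linear by blast
    have "D g (f x) u = (\<Sum>i<n. l i u *\<^sub>R D g (f x) (b i))" for u
      using arg_cong[OF b[of u], of "D g (f x)"] by (simp add: linear_sum[OF lin] linear_cmul[OF lin])
    then have "D g (f x) \<circ> D f x = (\<lambda>v. \<Sum>i<n. l i (D f x v) *\<^sub>R D g (f x) (b i))"
      by (metis comp_apply)
    then show ?thesis using diff_chain_at[OF f(1)[OF that] g'] by (simp add: o_def)
  qed
  show ?case
  proof (rule Ck_on_SucI[OF assms(2) D])
    fix v
    show "Ck_on k S (\<lambda>x. \<Sum>i<n. l i (D f x v) *\<^sub>R D g (f x) (b i))"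
      by (intro Ck_on_sum assms(2) Ck_on_bilinear[OF bounded_bilinear_scaleR assms(2)]
        Ck_on_linear[OF blinfun.bounded_linear_right assms(2) f(2)]
        Suc.IH[OF g(2) Ck_on_Suc[OF Suc.prems(2)] Suc.prems(3)])
  qed simp
qed

lemma Ck_on_local:
  assumes "open S" "\<And>x. x \<in> S \<Longrightarrow> \<exists>U. open U \<and> x \<in> U \<and> Ck_on k U f"
  shows "Ck_on k S f"
  using assms(2)
proof (induction k arbitrary: f)
  case 0
  have "isCont f x" if x: "x \<in> S" for x
    using 0[OF x] by (auto simp: continuous_on_eq_continuous_at)
  then show ?case by (auto intro: continuous_at_imp_continuous_on)
next
  case (Suc k)
  have "f differentiable (at x)" if "x \<in> S" for x using Suc.prems[OF that] by auto
  moreover have "Ck_on k S (\<lambda>x. D f x v)" for v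
    by (rule Suc.IH) (use Suc.prems in fastforce)
  ultimately show ?case by auto
qed

lemma smooth_on_subset: "smooth_on S f \<Longrightarrow> T \<subseteq> S \<Longrightarrow> smooth_on T f"
  unfolding smooth_on_def using Ck_on_subset by blast

lemma smooth_on_cong:
  "open S \<Longrightarrow> smooth_on S f \<Longrightarrow> (\<And>x. x \<in> S \<Longrightarrow> f x = g x) \<Longrightarrow> smooth_on S g"
  unfolding smooth_on_def using Ck_on_cong by blast

lemma smooth_on_local:
  "open S \<Longrightarrow> (\<And>x. x \<in> S \<Longrightarrow> \<exists>U. open U \<and> x \<in> U \<and> smooth_on U f) \<Longrightarrow> smooth_on S f"
  unfolding smooth_on_def by (intro allI Ck_on_local) blast+

lemma smooth_on_const [simp]: "smooth_on S (\<lambda>x. c)"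
  by (simp add: smooth_on_def)

lemma smooth_on_id [simp]: "smooth_on S (\<lambda>x. x)"
  by (simp add: smooth_on_def)

lemma smooth_on_linear:
  "bounded_linear L \<Longrightarrow> open S \<Longrightarrow> smooth_on S f \<Longrightarrow> smooth_on S (\<lambda>x. L (f x))"
  unfolding smooth_on_def using Ck_on_linear by blast

lemma smooth_on_fst: "open S \<Longrightarrow> smooth_on S f \<Longrightarrow> smooth_on S (\<lambda>x. fst (f x))"
  by (rule smooth_on_linear[OF bounded_linear_fst])

lemma smooth_on_snd: "open S \<Longrightarrow> smooth_on S f \<Longrightarrow> smooth_on S (\<lambda>x. snd (f x))"
  by (rule smooth_on_linear[OF bounded_linear_snd])

lemma smooth_on_Pair:
  "open S \<Longrightarrow> smooth_on S f \<Longrightarrow> smooth_on S g \<Longrightarrow> smooth_on S (\<lambda>x. (f x, g x))"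
  unfolding smooth_on_def using Ck_on_Pair by blast

lemma smooth_on_sum:
  "open S \<Longrightarrow> (\<And>i. i \<in> I \<Longrightarrow> smooth_on S (f i)) \<Longrightarrow> smooth_on S (\<lambda>x. \<Sum>i\<in>I. f i x)"
  unfolding smooth_on_def using Ck_on_sum[of S I _ f] by blast

lemma smooth_on_bilinear:
  "bounded_bilinear p \<Longrightarrow> open S \<Longrightarrow> smooth_on S f \<Longrightarrow> smooth_on S g \<Longrightarrow> smooth_on S (\<lambda>x. p (f x) (g x))"
  unfolding smooth_on_def using Ck_on_bilinear by blast

lemma smooth_on_mult:
  fixes f g :: "_ \<Rightarrow> real"
  shows "open S \<Longrightarrow> smooth_on S f \<Longrightarrow> smooth_on S g \<Longrightarrow> smooth_on S (\<lambda>x. f x * g x)"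
  by (rule smooth_on_bilinear[OF bounded_bilinear_mult])

lemma smooth_on_scaleR:
  "open S \<Longrightarrow> smooth_on S f \<Longrightarrow> smooth_on S g \<Longrightarrow> smooth_on S (\<lambda>x. f x *\<^sub>R g x)"
  by (rule smooth_on_bilinear[OF bounded_bilinear_scaleR])

lemma smooth_on_prod:
  fixes f :: "_ \<Rightarrow> _ \<Rightarrow> real"
  assumes "open S"
  shows "(\<And>i. i \<in> I \<Longrightarrow> smooth_on S (f i)) \<Longrightarrow> smooth_on S (\<lambda>x. \<Prod>i\<in>I. f i x)"
  by (induction I rule: infinite_finite_induct) (auto intro: smooth_on_mult[OF assms])

lemma smooth_on_blinfun_apply:
  "open S \<Longrightarrow> smooth_on S f \<Longrightarrow> smooth_on S g \<Longrightarrow> smooth_on S (\<lambda>x. blinfun_apply (f x) (g x))"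
  by (rule smooth_on_bilinear[OF bounded_bilinear_blinfun_apply])

lemma smooth_on_compose:
  fixes f :: "'a::real_normed_vector \<Rightarrow> 'b::real_normed_vector"
  assumes "fdim TYPE('b)" "open S" "smooth_on T g" "smooth_on S f" "f ` S \<subseteq> T"
  shows "smooth_on S (\<lambda>x. g (f x))"
  using assms unfolding smooth_on_def by (blast intro: Ck_on_compose)

text \<open>An operator on a finite-dimensional space is a finite sum of rank-one operators formed
  from its values at the \<open>b i\<close>, so smoothness of all values gives smoothness in
  operator norm.\<close>

lemma smooth_on_blinfunI:
  fixes f :: "'a::real_normed_vector \<Rightarrow> 'b::real_normed_vector \<Rightarrow>\<^sub>L 'c::real_normed_vector"
  assumes "fdim TYPE('b)" "open S" "\<And>v. smooth_on S (\<lambda>x. f x v)"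
  shows "smooth_on S f"
proof -
  obtain n and b :: "nat \<Rightarrow> 'b" and l where b: "\<And>x. x = (\<Sum>i<n. blinfun_apply (l i) x *\<^sub>R b i)"
    using fdim_coordinates[OF assms(1)] by metis
  have "f x v = (\<Sum>i<n. blinfun_scaleR_left (f x (b i)) o\<^sub>L l i) v" for x v
    using arg_cong[OF b[of v], of "f x"]
    by (simp add: blinfun.sum_right blinfun.scaleR_right blinfun.sum_left)
  then have "f = (\<lambda>x. \<Sum>i<n. blinfun_scaleR_left (f x (b i)) o\<^sub>L l i)"
    by (intro ext blinfun_eqI)
  moreover have "smooth_on S (\<lambda>x. \<Sum>i<n. blinfun_scaleR_left (f x (b i)) o\<^sub>L l i)"
    by (intro smooth_on_sum assms(2) smooth_on_bilinear[OF bounded_bilinear_blinfun_compose assms(2) _ smooth_on_const]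
        smooth_on_linear[OF bounded_linear_blinfun_scaleR_left assms(2) assms(3)])
  ultimately show ?thesis by metis
qed

lemma smooth_on_has_derivative:
  assumes "smooth_on S f" "x \<in> S"
  shows "(f has_derivative D f x) (at x)"
proof -
  have "Ck_on (Suc 0) S f" using assms(1) smooth_on_def by blast
  then show ?thesis using assms(2) Ck_on_SucD(1) by blast
qed

lemma smooth_on_continuous: "smooth_on S f \<Longrightarrow> continuous_on S f"
  unfolding smooth_on_def by (metis Ck_on.simps(1))

lemma smooth_on_D: "smooth_on S f \<Longrightarrow> smooth_on S (\<lambda>x. D f x v)"
  unfolding smooth_on_def by (metis Ck_on.simps(2))

text \<open>The direction may vary as well, by the same expansion as in
  \<open>Ck_on_compose\<close>.\<close>

lemma smooth_on_D_apply:
  fixes f :: "'b::real_normed_vector \<Rightarrow> 'c::real_normed_vector"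
  assumes "fdim TYPE('b)" "open S" "smooth_on T f" "smooth_on S h" "h ` S \<subseteq> T" "smooth_on S v"
  shows "smooth_on S (\<lambda>x. D f (h x) (v x))"
proof -
  obtain n and b :: "nat \<Rightarrow> 'b" and l where b: "\<And>x. x = (\<Sum>i<n. blinfun_apply (l i) x *\<^sub>R b i)"
    using fdim_coordinates[OF assms(1)] by metis
  have "(\<Sum>i<n. l i (v x) *\<^sub>R D f (h x) (b i)) = D f (h x) (v x)" if "x \<in> S" for x
  proof -
    have lin: "linear (D f (h x))"
      using smooth_on_has_derivative[OF assms(3)] assms(5) that has_derivative_linear by blast
    show ?thesis
      using arg_cong[OF b[of "v x"], of "D f (h x)"] by (simp add: linear_sum[OF lin] linear_cmul[OF lin])
  qed
  moreover have "smooth_on S (\<lambda>x. \<Sum>i<n. l i (v x) *\<^sub>R D f (h x) (b i))"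
    by (intro smooth_on_sum assms(2) smooth_on_scaleR
        smooth_on_linear[OF blinfun.bounded_linear_right assms(2) assms(6)]
        smooth_on_compose[OF assms(1,2) smooth_on_D[OF assms(3)] assms(4,5)])
  ultimately show ?thesis by (rule smooth_on_cong[OF assms(2), rotated])
qed

text \<open>The second difference of \<open>f\<close> at \<open>x\<close> in the directions \<open>u\<close> and \<open>v\<close> is compared with the
  second derivative, using the mean value inequality in the direction \<open>u\<close>.\<close>

lemma second_derivative_symmetric:
  fixes f :: "'a::real_normed_vector \<Rightarrow> 'b::real_normed_vector"
  assumes "smooth_on S f" "open S" "x \<in> S"
  shows "D (\<lambda>y. D f y u) x v = D (\<lambda>y. D f y v) x u"
proof -
  have approx: "\<exists>d>0. \<forall>s. 0 < s \<and> s < d \<longrightarrow>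
      norm (f (x + s *\<^sub>R u + s *\<^sub>R v) - f (x + s *\<^sub>R u) - f (x + s *\<^sub>R v) + f x
        - (s * s) *\<^sub>R D (\<lambda>y. D f y u) x v) \<le> e * (s * s)" if e: "e > 0" for e u v
  proof -
    have cont: "continuous (at x) (\<lambda>y. D (\<lambda>z. D f z u) y v)"
      using smooth_on_continuous[OF smooth_on_D[OF smooth_on_D[OF assms(1)]]] assms(2,3)
      by (simp add: continuous_on_eq_continuous_at)
    obtain r where r: "r > 0" "ball x r \<subseteq> S" using assms(2,3) open_contains_ball by blast
    obtain q where q: "q > 0"
      "\<And>y. dist y x < q \<Longrightarrow> dist (D (\<lambda>z. D f z u) y v) (D (\<lambda>z. D f z u) x v) < e"
      using cont e unfolding continuous_at_eps_delta by blast
    \<comment> \<open>Small enough that every point \<open>x + a *\<^sub>R u + b *\<^sub>R v\<close>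
      with \<open>a\<close> and \<open>b\<close> between 0 and \<open>s < d\<close> lies in
      \<open>S\<close> and within the continuity radius \<open>q\<close>.\<close>
    define d where "d = min r q / (norm u + norm v + 1)"
    have pos: "norm u + norm v + 1 > 0" by (intro add_nonneg_pos) auto
    have "d > 0" using r(1) q(1) pos by (simp add: d_def)
    moreover have "norm (f (x + s *\<^sub>R u + s *\<^sub>R v) - f (x + s *\<^sub>R u) - f (x + s *\<^sub>R v) + f x
        - (s * s) *\<^sub>R D (\<lambda>y. D f y u) x v) \<le> e * (s * s)" if s: "0 < s" "s < d" for s
    proof -
      have near: "dist (x + a *\<^sub>R u + b *\<^sub>R v) x < min r q" if "0 \<le> a" "a \<le> s" "0 \<le> b" "b \<le> s" for a b
      proof -
        have "norm (a *\<^sub>R u + b *\<^sub>R v) \<le> a * norm u + b * norm v"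
          using that by (intro order_trans[OF norm_triangle_ineq]) simp
        also have "\<dots> \<le> s * norm u + s * norm v"
          using that by (intro add_mono mult_right_mono) auto
        also have "\<dots> \<le> s * (norm u + norm v + 1)" using s by (simp add: algebra_simps)
        also have "\<dots> < min r q" using s(2) pos by (simp add: d_def pos_less_divide_eq)
        finally show ?thesis by (simp add: dist_norm add.assoc)
      qed
      have inS: "x + a *\<^sub>R u + b *\<^sub>R v \<in> S" if "0 \<le> a" "a \<le> s" "0 \<le> b" "b \<le> s" for a b
        using near[OF that] r(2) by (auto simp: dist_commute)
      define E where "E = D (\<lambda>z. D f z u) x v"
      \<comment> \<open>The increment of \<open>f\<close> in direction \<open>v\<close> minus its
        predicted growth in \<open>a\<close>. Its derivative in \<open>a\<close> is estimated by a
        second mean value inequality, now in direction \<open>v\<close>, for the function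
        \<open>h\<close> below.\<close>
      define k where "k a = f (x + a *\<^sub>R u + s *\<^sub>R v) - f (x + a *\<^sub>R u) - (a * s) *\<^sub>R E" for a
      have k': "(k has_derivative (\<lambda>t. t *\<^sub>R (D f (x + a *\<^sub>R u + s *\<^sub>R v) u - D f (x + a *\<^sub>R u) u - s *\<^sub>R E)))
          (at a within {0..s})" if "a \<in> {0..s}" for a
      proof -
        have 1: "(f has_derivative D f (x + a *\<^sub>R u + s *\<^sub>R v)) (at (x + a *\<^sub>R u + s *\<^sub>R v))"
          using smooth_on_has_derivative[OF assms(1) inS[of a s]] that s(1) by auto
        have 2: "(f has_derivative D f (x + a *\<^sub>R u)) (at (x + a *\<^sub>R u))"
          using smooth_on_has_derivative[OF assms(1) inS[of a 0]] that s(1) by auto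
        have l: "linear (D f (x + a *\<^sub>R u + s *\<^sub>R v))" "linear (D f (x + a *\<^sub>R u))"
          using 1 2 has_derivative_linear by auto
        have 3: "((\<lambda>a. f (x + a *\<^sub>R u + s *\<^sub>R v)) has_derivative (\<lambda>t. D f (x + a *\<^sub>R u + s *\<^sub>R v) (t *\<^sub>R u)))
            (at a within {0..s})"
          by (rule has_derivative_compose[where g = f and f = "\<lambda>a. x + a *\<^sub>R u + s *\<^sub>R v", OF _ 1]) (auto intro!: derivative_eq_intros)
        have 4: "((\<lambda>a. f (x + a *\<^sub>R u)) has_derivative (\<lambda>t. D f (x + a *\<^sub>R u) (t *\<^sub>R u)))
            (at a within {0..s})"
          by (rule has_derivative_compose[where g = f and f = "\<lambda>a. x + a *\<^sub>R u", OF _ 2]) (auto intro!: derivative_eq_intros)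
        have 5: "((\<lambda>a. (a * s) *\<^sub>R E) has_derivative (\<lambda>t. (t * s) *\<^sub>R E)) (at a within {0..s})"
          by (auto intro!: derivative_eq_intros)
        show ?thesis unfolding k_def
          by (rule has_derivative_eq_rhs[OF has_derivative_diff[OF has_derivative_diff[OF 3 4] 5]])
            (simp add: linear_cmul[OF l(1)] linear_cmul[OF l(2)] scaleR_diff_right)
      qed
      have inner: "norm (D f (x + a *\<^sub>R u + s *\<^sub>R v) u - D f (x + a *\<^sub>R u) u - s *\<^sub>R E) \<le> e * s"
        if "a \<in> {0..s}" for a
      proof -
        define h where "h b = D f (x + a *\<^sub>R u + b *\<^sub>R v) u - b *\<^sub>R E" for b
        have h': "(h has_derivative (\<lambda>t. t *\<^sub>R (D (\<lambda>z. D f z u) (x + a *\<^sub>R u + b *\<^sub>R v) v - E))) (at b within {0..s})"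
          if "b \<in> {0..s}" for b
        proof -
          have 1: "((\<lambda>z. D f z u) has_derivative D (\<lambda>z. D f z u) (x + a *\<^sub>R u + b *\<^sub>R v)) (at (x + a *\<^sub>R u + b *\<^sub>R v))"
            using smooth_on_has_derivative[OF smooth_on_D[OF assms(1)] inS[of a b]] that \<open>a \<in> {0..s}\<close> by auto
          have l: "linear (D (\<lambda>z. D f z u) (x + a *\<^sub>R u + b *\<^sub>R v))" using 1 has_derivative_linear by auto
          have 3: "((\<lambda>b. D f (x + a *\<^sub>R u + b *\<^sub>R v) u) has_derivative
              (\<lambda>t. D (\<lambda>z. D f z u) (x + a *\<^sub>R u + b *\<^sub>R v) (t *\<^sub>R v))) (at b within {0..s})"
            by (rule has_derivative_compose[where g = "\<lambda>z. D f z u"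
                  and f = "\<lambda>b. x + a *\<^sub>R u + b *\<^sub>R v", OF _ 1])
              (auto intro!: derivative_eq_intros)
          have 5: "((\<lambda>b. b *\<^sub>R E) has_derivative (\<lambda>t. t *\<^sub>R E)) (at b within {0..s})"
            by (auto intro!: derivative_eq_intros)
          show ?thesis unfolding h_def
            by (rule has_derivative_eq_rhs[OF has_derivative_diff[OF 3 5]])
              (simp add: linear_cmul[OF l] scaleR_diff_right)
        qed
        have "norm (h s - h 0) \<le> e * norm (s - 0)"
        proof (rule differentiable_bound[OF _ h'])
          show "onorm (\<lambda>t. t *\<^sub>R (D (\<lambda>z. D f z u) (x + a *\<^sub>R u + b *\<^sub>R v) v - E)) \<le> e" if "b \<in> {0..s}" for b
          proof (rule onorm_le)
            have "norm (D (\<lambda>z. D f z u) (x + a *\<^sub>R u + b *\<^sub>R v) v - E) \<le> e"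
              using q(2)[of "x + a *\<^sub>R u + b *\<^sub>R v"] near[of a b] that \<open>a \<in> {0..s}\<close>
              by (auto simp: E_def dist_norm intro: less_imp_le)
            then show "norm (t *\<^sub>R (D (\<lambda>z. D f z u) (x + a *\<^sub>R u + b *\<^sub>R v) v - E)) \<le> e * norm t" for t
              using mult_left_mono[of _ e "\<bar>t\<bar>"] by (simp add: mult.commute[of e])
          qed
        qed (use s in auto)
        then show ?thesis using s by (simp add: h_def algebra_simps)
      qed
      have "norm (k s - k 0) \<le> (e * s) * norm (s - 0)"
      proof (rule differentiable_bound[OF _ k'])
        show "onorm (\<lambda>t. t *\<^sub>R (D f (x + a *\<^sub>R u + s *\<^sub>R v) u - D f (x + a *\<^sub>R u) u - s *\<^sub>R E)) \<le> e * s"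
          if "a \<in> {0..s}" for a
          by (rule onorm_le) (use mult_left_mono[OF inner[OF that], of "\<bar>t\<bar>" for t] in \<open>simp add: mult.commute[of "e * s"]\<close>)
      qed (use s in auto)
      then show ?thesis using s by (simp add: k_def E_def algebra_simps)
    qed
    ultimately show ?thesis by blast
  qed
  define A where "A = D (\<lambda>y. D f y u) x v"
  define B where "B = D (\<lambda>y. D f y v) x u"
  have "norm (A - B) \<le> e" if "e > 0" for e
  proof -
    have e2: "e / 2 > 0" using that by simp
    obtain d1 where d1: "d1 > 0" "\<And>s. 0 < s \<Longrightarrow> s < d1 \<Longrightarrow>
      norm (f (x + s *\<^sub>R u + s *\<^sub>R v) - f (x + s *\<^sub>R u) - f (x + s *\<^sub>R v) + f x - (s * s) *\<^sub>R A) \<le> e / 2 * (s * s)"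
      using approx[OF e2, of u v] unfolding A_def by blast
    obtain d2 where d2: "d2 > 0" "\<And>s. 0 < s \<Longrightarrow> s < d2 \<Longrightarrow>
      norm (f (x + s *\<^sub>R v + s *\<^sub>R u) - f (x + s *\<^sub>R v) - f (x + s *\<^sub>R u) + f x - (s * s) *\<^sub>R B) \<le> e / 2 * (s * s)"
      using approx[OF e2, of v u] unfolding B_def by blast
    define s where "s = min d1 d2 / 2"
    have s: "0 < s" "s < d1" "s < d2" using d1(1) d2(1) by (auto simp: s_def)
    define C where "C = f (x + s *\<^sub>R u + s *\<^sub>R v) - f (x + s *\<^sub>R u) - f (x + s *\<^sub>R v) + f x"
    have C': "C = f (x + s *\<^sub>R v + s *\<^sub>R u) - f (x + s *\<^sub>R v) - f (x + s *\<^sub>R u) + f x"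
      by (simp add: C_def add.commute add.left_commute)
    have "norm (C - (s * s) *\<^sub>R A) \<le> e / 2 * (s * s)" "norm (C - (s * s) *\<^sub>R B) \<le> e / 2 * (s * s)"
      using d1(2)[OF s(1,2)] d2(2)[OF s(1,3)] by (simp_all add: C_def[symmetric] C'[symmetric])
    moreover have "norm ((s * s) *\<^sub>R (A - B)) \<le> norm (C - (s * s) *\<^sub>R B) + norm (C - (s * s) *\<^sub>R A)"
      using norm_triangle_ineq4[of "C - (s * s) *\<^sub>R B" "C - (s * s) *\<^sub>R A"] by (simp add: algebra_simps)
    ultimately have "norm ((s * s) *\<^sub>R (A - B)) \<le> e * (s * s)" by linarith
    then have "(s * s) * norm (A - B) \<le> (s * s) * e" using s(1) by (simp add: mult.commute)
    then show ?thesis using s(1) by simp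
  qed
  then have "norm (A - B) \<le> 0" using field_le_epsilon[of "norm (A - B)" 0] by auto
  then show ?thesis by (simp add: A_def B_def)
qed

section \<open>Alternating forms\<close>

text \<open>A \<open>k\<close>-form is regarded as a function of a sequence of vectors which only depends on the
  entries with index less than \<open>k\<close>.\<close>

definition alternating :: "nat \<Rightarrow> ((nat \<Rightarrow> 'a::real_vector) \<Rightarrow> real) \<Rightarrow> bool" where
  "alternating k F \<longleftrightarrow>
     (\<forall>f. \<forall>j<k. linear (\<lambda>v. F (f(j := v)))) \<and>
     (\<forall>f. \<forall>i<k. \<forall>j<k. i \<noteq> j \<longrightarrow> f i = f j \<longrightarrow> F f = 0) \<and>
     (\<forall>f g. (\<forall>i<k. f i = g i) \<longrightarrow> F f = F g)"

lemma alternatingD: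
  assumes "alternating k F"
  shows "j < k \<Longrightarrow> linear (\<lambda>v. F (f(j := v)))"
    and "i < k \<Longrightarrow> j < k \<Longrightarrow> i \<noteq> j \<Longrightarrow> f i = f j \<Longrightarrow> F f = 0"
    and "(\<And>i. i < k \<Longrightarrow> f i = g i) \<Longrightarrow> F f = F g"
  using assms unfolding alternating_def by blast+

lemma alternating_cmult:
  assumes "alternating k F"
  shows "alternating k (\<lambda>f. c * F f)"
proof -
  have "linear (\<lambda>v. c * F (f(j := v)))" if "j < k" for f j
    by (intro linearI)
      (simp_all add: linear_add[OF alternatingD(1)[OF assms that, of f]]
        linear_cmul[OF alternatingD(1)[OF assms that, of f]] algebra_simps)
  moreover have "c * F f = 0" if "i < k" "j < k" "i \<noteq> j" "f i = f j" for f i j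
    using alternatingD(2)[OF assms that] by simp
  moreover have "c * F f = c * F g" if "\<forall>i<k. f i = g i" for f g
    using alternatingD(3)[OF assms, of f g] that by simp
  ultimately show ?thesis unfolding alternating_def by blast
qed

text \<open>Polarisation: the form vanishes when both slots contain
  \<open>f i + f j\<close>.\<close>

lemma alternating_swap:
  assumes "alternating k F" "i < k" "j < k" "i \<noteq> j"
  shows "F (f \<circ> Transposition.transpose i j) = - F f"
proof -
  note alt = alternatingD[OF assms(1)]
  define H where "H u v = F (f(i := u, j := v))" for u v
  have H1: "H (a + b) v = H a v + H b v" for a b v
    using linear_add[OF alt(1)[OF assms(2)], of "f(j := v)" a b] assms(4)
    by (simp add: H_def fun_upd_twist)
  have H2: "H u (a + b) = H u a + H u b" for a b u
    using linear_add[OF alt(1)[OF assms(3)], of "f(i := u)" a b] by (simp add: H_def)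
  have H0: "H u u = 0" for u
    unfolding H_def by (rule alt(2)[OF assms(2-4)]) (use assms(4) in auto)
  have "H (f i) (f j) + H (f j) (f i) = 0"
    using H0[of "f i + f j"] unfolding H1 H2 by (simp add: H0)
  then have "H (f j) (f i) = - H (f i) (f j)" by simp
  moreover have "f(i := f j, j := f i) = f \<circ> Transposition.transpose i j" "f(i := f i, j := f j) = f"
    using assms(4) by (auto simp: fun_eq_iff Transposition.transpose_def)
  ultimately show ?thesis by (simp add: H_def)
qed

lemma alternating_permute:
  assumes "alternating k F" "p permutes {..<k}"
  shows "F (f \<circ> p) = of_int (sign p) * F f"
  using finite_lessThan[of k] assms(2)
proof (induction p rule: permutes_rev_induct)
  case (swap a b p)
  have "F (f \<circ> (p \<circ> Transposition.transpose a b)) = - F (f \<circ> p)"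
    unfolding o_assoc by (rule alternating_swap[OF assms(1)]) (use swap(1-3) in auto)
  moreover have "sign (p \<circ> Transposition.transpose a b) = - sign p"
    using swap permutation_swap_id[of a b]
    by (subst sign_compose) (auto simp: permutation_permutes sign_swap_id)
  ultimately show ?case using swap by (simp add: o_def)
qed auto

text \<open>One enumeration of each k-element set of basis vectors suffices: other enumerations
  differ by a sign on both sides, repetitions give 0, and arbitrary entries are reached by
  linearity, one slot at a time.\<close>

lemma alternating_eqI:
  fixes F G :: "(nat \<Rightarrow> 'e::euclidean_space) \<Rightarrow> real"
  assumes F: "alternating k F" and G: "alternating k G"
    and eq: "\<And>S. S \<subseteq> Basis \<Longrightarrow> card S = k \<Longrightarrow> \<exists>h. bij_betw h {..<k} S \<and> F h = G h"
  shows "F f = G f"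
proof -
  have basis: "F f = G f" if fB: "f ` {..<k} \<subseteq> Basis" for f
  proof (cases "inj_on f {..<k}")
    case False
    then obtain i j where "i < k" "j < k" "i \<noteq> j" "f i = f j" by (auto simp: inj_on_def)
    then show ?thesis using alternatingD(2)[OF F] alternatingD(2)[OF G] by metis
  next
    case True
    then have "card (f ` {..<k}) = k" by (simp add: card_image)
    then obtain h where h: "bij_betw h {..<k} (f ` {..<k})" "F h = G h" using eq[OF fB] by blast
    define p where "p i = (if i \<in> {..<k} then inv_into {..<k} h (f i) else i)" for i
    have "bij_betw (\<lambda>i. inv_into {..<k} h (f i)) {..<k} {..<k}"
      using bij_betw_trans[OF inj_on_imp_bij_betw[OF True] bij_betw_inv_into[OF h(1)]] by (simp add: o_def)
    then have "bij_betw p {..<k} {..<k}"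
      by (rule bij_betw_cong[THEN iffD1, rotated]) (simp add: p_def)
    then have p: "p permutes {..<k}" by (rule bij_imp_permutes) (simp add: p_def)
    have fh: "f i = (h \<circ> p) i" if "i < k" for i
      using that h(1) by (auto simp: p_def bij_betw_def f_inv_into_f)
    have "F f = F (h \<circ> p)" by (rule alternatingD(3)[OF F fh])
    moreover have "G f = G (h \<circ> p)" by (rule alternatingD(3)[OF G fh])
    ultimately show ?thesis
      using alternating_permute[OF F p, of h] alternating_permute[OF G p, of h] h(2) by simp
  qed
  \<comment> \<open>The first \<open>m\<close> slots are arbitrary, the later ones lie in
    \<open>Basis\<close>; each induction step frees one more slot.\<close>
  have "F f = G f" if "m \<le> k" "f ` {m..<k} \<subseteq> Basis" for m f
    using that
  proof (induction m arbitrary: f)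
    case 0
    then show ?case using basis by (simp add: atLeast0LessThan)
  next
    case (Suc m)
    have lin: "linear (\<lambda>v. F (f(m := v)))" "linear (\<lambda>v. G (f(m := v)))"
      using Suc.prems alternatingD(1)[OF F] alternatingD(1)[OF G] by auto
    have "F (f(m := b)) = G (f(m := b))" if "b \<in> Basis" for b
      using Suc.prems that by (intro Suc.IH) auto
    then have "(\<lambda>v. F (f(m := v))) = (\<lambda>v. G (f(m := v)))"
      using linear_eq_stdbasis[OF lin] by blast
    then have "F (f(m := f m)) = G (f(m := f m))" by metis
    then show ?case by simp
  qed
  from this[of k f] show ?thesis by simp
qed

section \<open>The volume form\<close>

definition vol :: "(nat \<Rightarrow> 'e::euclidean_space) \<Rightarrow> real" where
  "vol f = dnx (map f [0..<DIM('e)])"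

lemma vol_alt:
  "vol f = (\<Sum>\<sigma> | \<sigma> permutes {..<DIM('e)}. of_int (sign \<sigma>) * (\<Prod>i<DIM('e). f i \<bullet> basis_enum (\<sigma> i)))"
  for f :: "nat \<Rightarrow> 'e::euclidean_space"
  unfolding vol_def dnx_def by (intro sum.cong refl arg_cong2[where f = "(*)"] prod.cong) auto

lemma dnx_eq_vol: "length vs = DIM('e) \<Longrightarrow> dnx vs = vol ((!) vs)" for vs :: "'e::euclidean_space list"
  unfolding vol_def by (metis map_nth)

lemma bij_betw_basis_enum: "bij_betw basis_enum {..<DIM('e)} (Basis :: 'e::euclidean_space set)"
proof -
  have "\<exists>e. bij_betw e {..<DIM('e)} (Basis :: 'e set)"
    using ex_bij_betw_nat_finite[OF finite_Basis] by (simp add: atLeast0LessThan)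
  then show ?thesis unfolding basis_enum_def by (rule someI_ex)
qed

lemma basis_enum_in_Basis: "i < DIM('e) \<Longrightarrow> (basis_enum i :: 'e::euclidean_space) \<in> Basis"
  using bij_betw_basis_enum[where 'e = 'e] by (auto simp: bij_betw_def)

lemma inner_basis_enum:
  "i < DIM('e) \<Longrightarrow> j < DIM('e) \<Longrightarrow>
    (basis_enum i :: 'e::euclidean_space) \<bullet> basis_enum j = (if i = j then 1 else 0)"
  using bij_betw_basis_enum[where 'e = 'e] basis_enum_in_Basis[where 'e = 'e]
  by (auto simp: inner_Basis bij_betw_def inj_on_def)

lemma alternating_vol: "alternating DIM('e) (vol :: (nat \<Rightarrow> 'e::euclidean_space) \<Rightarrow> real)"
  unfolding alternating_def
proof (intro conjI allI impI)
  fix f :: "nat \<Rightarrow> 'e" and j assume j: "j < DIM('e)"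
  have "(\<Prod>i<DIM('e). (f(j := v)) i \<bullet> basis_enum (\<sigma> i))
      = (v \<bullet> basis_enum (\<sigma> j)) * (\<Prod>i\<in>{..<DIM('e)} - {j}. f i \<bullet> basis_enum (\<sigma> i))" for v and \<sigma> :: "nat \<Rightarrow> nat"
    using j by (subst prod.remove[of _ j]) auto
  then show "linear (\<lambda>v. vol (f(j := v)))"
    unfolding vol_alt
    by (intro linear_compose_sum ballI linearI) (simp_all add: inner_add_left algebra_simps)
next
  fix f :: "nat \<Rightarrow> 'e" and i j assume ij: "i < DIM('e)" "j < DIM('e)" "i \<noteq> j" "f i = f j"
  \<comment> \<open>Reindexing the sum over permutations by \<open>t\<close> leaves \<open>f\<close>
    unchanged and flips every sign, so that \<open>vol f = - vol f\<close>.\<close>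
  define t where "t = Transposition.transpose i j"
  have t: "t permutes {..<DIM('e)}" unfolding t_def using ij by (intro permutes_swap_id) auto
  have ft: "f (t l) = f l" for l using ij by (auto simp: t_def Transposition.transpose_def)
  have "vol f = (\<Sum>\<sigma> | \<sigma> permutes {..<DIM('e)}.
      of_int (sign (\<sigma> \<circ> t)) * (\<Prod>l<DIM('e). f l \<bullet> basis_enum ((\<sigma> \<circ> t) l)))"
    unfolding vol_alt by (rule sum_permutations_compose_right[OF t])
  also have "\<dots> = (\<Sum>\<sigma> | \<sigma> permutes {..<DIM('e)}. - (of_int (sign \<sigma>) * (\<Prod>l<DIM('e). f l \<bullet> basis_enum (\<sigma> l))))"
  proof (rule sum.cong)
    fix \<sigma> assume "\<sigma> \<in> {\<sigma>. \<sigma> permutes {..<DIM('e)}}"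
    then have \<sigma>: "permutation \<sigma>" by (auto simp: permutation_permutes)
    have "sign (\<sigma> \<circ> t) = - sign \<sigma>"
      using \<sigma> ij by (subst sign_compose) (auto simp: t_def sign_swap_id permutation_swap_id)
    moreover have "(\<Prod>l<DIM('e). f l \<bullet> basis_enum ((\<sigma> \<circ> t) l)) = (\<Prod>l<DIM('e). f (t l) \<bullet> basis_enum (\<sigma> (t l)))"
      by (simp add: ft)
    moreover have "\<dots> = (\<Prod>l<DIM('e). f l \<bullet> basis_enum (\<sigma> l))"
      by (rule prod.permute[OF t, of "\<lambda>l. f l \<bullet> basis_enum (\<sigma> l)", unfolded o_def, symmetric])
    ultimately show "of_int (sign (\<sigma> \<circ> t)) * (\<Prod>l<DIM('e). f l \<bullet> basis_enum ((\<sigma> \<circ> t) l))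
        = - (of_int (sign \<sigma>) * (\<Prod>l<DIM('e). f l \<bullet> basis_enum (\<sigma> l)))" by simp
  qed simp
  also have "\<dots> = - vol f" by (simp add: vol_alt sum_negf)
  finally show "vol f = 0" by simp
next
  fix f g :: "nat \<Rightarrow> 'e" assume "\<forall>i<DIM('e). f i = g i"
  then show "vol f = vol g" unfolding vol_def by (intro arg_cong[where f = dnx] map_cong) auto
qed

lemma vol_basis_enum: "vol (basis_enum :: nat \<Rightarrow> 'e::euclidean_space) = 1"
proof -
  have "(\<Prod>i<DIM('e). (basis_enum i :: 'e) \<bullet> basis_enum (\<sigma> i)) = (if \<sigma> = id then 1 else 0)"
    if "\<sigma> permutes {..<DIM('e)}" for \<sigma>
  proof (cases "\<sigma> = id")
    case False
    then obtain i where i: "\<sigma> i \<noteq> i" by (auto simp: fun_eq_iff)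
    then have "i < DIM('e)" using permutes_not_in[OF that, of i] by auto
    moreover have "\<sigma> i < DIM('e)" using permutes_in_image[OF that, of i] \<open>i < DIM('e)\<close> by simp
    ultimately have "\<exists>i\<in>{..<DIM('e)}. (basis_enum i :: 'e) \<bullet> basis_enum (\<sigma> i) = 0"
      using i by (intro bexI[of _ i]) (auto simp: inner_basis_enum)
    then show ?thesis using False by (simp add: prod_zero_iff)
  qed (simp add: inner_basis_enum)
  then have "vol (basis_enum :: nat \<Rightarrow> 'e) = (\<Sum>\<sigma> | \<sigma> permutes {..<DIM('e)}. if \<sigma> = id then 1 else 0)"
    unfolding vol_alt by (intro sum.cong) (auto simp: sign_id)
  also have "\<dots> = 1" by (subst sum.delta) (auto simp: finite_permutations permutes_id)
  finally show ?thesis .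
qed

text \<open>Top forms are multiples of the volume form; both the trace formula and the
  multiplicativity of the determinant below rest on this.\<close>

lemma alternating_top:
  fixes F :: "(nat \<Rightarrow> 'e::euclidean_space) \<Rightarrow> real"
  assumes "alternating DIM('e) F"
  shows "F f = F basis_enum * vol f"
proof (rule alternating_eqI[OF assms])
  show "alternating DIM('e) (\<lambda>f :: nat \<Rightarrow> 'e. F basis_enum * vol f)"
    by (rule alternating_cmult[OF alternating_vol])
next
  fix S :: "'e set" assume "S \<subseteq> Basis" "card S = DIM('e)"
  then have "S = Basis" by (intro card_subset_eq) auto
  then show "\<exists>h. bij_betw h {..<DIM('e)} S \<and> F h = F basis_enum * vol h"
    using bij_betw_basis_enum[where 'e = 'e] vol_basis_enum[where 'e = 'e] by auto
qed

definition tr :: "('e::euclidean_space \<Rightarrow> 'e) \<Rightarrow> real" where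
  "tr T = (\<Sum>b\<in>Basis. T b \<bullet> b)"

lemma tr_basis_enum: "tr T = (\<Sum>i<DIM('e). T (basis_enum i) \<bullet> basis_enum i)" for T :: "'e::euclidean_space \<Rightarrow> 'e"
  unfolding tr_def by (rule sum.reindex_bij_betw[OF bij_betw_basis_enum, symmetric])

lemma tr_commute:
  fixes S T :: "'e::euclidean_space \<Rightarrow> 'e"
  assumes "linear S" "linear T"
  shows "tr (\<lambda>v. S (T v)) = tr (\<lambda>v. T (S v))"
proof -
  have *: "S (T b) \<bullet> b = (\<Sum>c\<in>Basis. (T b \<bullet> c) * (S c \<bullet> b))" if "linear S" for S T :: "'e \<Rightarrow> 'e" and b
  proof -
    have "S (T b) = S (\<Sum>c\<in>Basis. (T b \<bullet> c) *\<^sub>R c)" by (simp add: euclidean_representation)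
    then show ?thesis
      using that by (simp add: linear_sum linear_cmul inner_sum_left)
  qed
  have "tr (\<lambda>v. S (T v)) = (\<Sum>b\<in>Basis. \<Sum>c\<in>Basis. (T b \<bullet> c) * (S c \<bullet> b))"
    unfolding tr_def by (simp add: *[OF assms(1)])
  also have "\<dots> = (\<Sum>c\<in>Basis. \<Sum>b\<in>Basis. (S c \<bullet> b) * (T b \<bullet> c))"
    by (subst sum.swap) (simp add: mult.commute)
  finally show ?thesis unfolding tr_def by (simp add: *[OF assms(2)])
qed

text \<open>The left side is again an alternating form of top degree, hence a multiple of
  \<open>vol\<close>, and its value on the basis frame is the trace. It serves later to
  differentiate a Jacobian determinant.\<close>

lemma vol_derivation:
  fixes T :: "'e::euclidean_space \<Rightarrow> 'e"
  assumes "linear T"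
  shows "(\<Sum>i<DIM('e). vol (f(i := T (f i)))) = tr T * vol f"
proof -
  define F where "F f = (\<Sum>i<DIM('e). vol (f(i := T (f i))))" for f :: "nat \<Rightarrow> 'e"
  note vol = alternatingD[OF alternating_vol[where 'e = 'e]]
  have "alternating DIM('e) F"
    unfolding alternating_def
  proof (intro conjI allI impI)
    fix f :: "nat \<Rightarrow> 'e" and j assume j: "j < DIM('e)"
    have "linear (\<lambda>v. vol ((f(j := v))(i := T ((f(j := v)) i))))" for i
    proof (cases "i = j")
      case True
      then show ?thesis
        using linear_compose[OF assms vol(1)[OF j, of f]] by (simp add: o_def)
    next
      case False
      then show ?thesis
        using vol(1)[OF j, of "f(i := T (f i))"] by (simp add: fun_upd_twist)
    qed
    then show "linear (\<lambda>v. F (f(j := v)))"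
      unfolding F_def by (intro linear_compose_sum ballI)
  next
    fix f :: "nat \<Rightarrow> 'e" and i j assume ij: "i < DIM('e)" "j < DIM('e)" "i \<noteq> j" "f i = f j"
    have z: "vol (f(l := T (f l))) = 0" if "l \<notin> {i, j}" for l
      by (rule vol(2)[of i j]) (use ij that in auto)
    have "F f = (\<Sum>l\<in>{i,j}. vol (f(l := T (f l))))"
      unfolding F_def by (rule sum.mono_neutral_right) (use ij z in auto)
    also have "\<dots> = vol (f(i := T (f i))) + vol (f(j := T (f j)))" using ij(3) by simp
    \<comment> \<open>Since \<open>f i = f j\<close>, the two surviving terms are exchanged by the
      transposition of \<open>i\<close> and \<open>j\<close>.\<close>
    also have "vol (f(j := T (f j))) = - vol (f(i := T (f i)))"
    proof -
      have "f(j := T (f j)) = f(i := T (f i)) \<circ> Transposition.transpose i j"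
        using ij by (auto simp: fun_eq_iff Transposition.transpose_def)
      then show ?thesis using alternating_swap[OF alternating_vol ij(1-3)] by metis
    qed
    finally show "F f = 0" by (simp only: add.right_inverse)
  next
    fix f g :: "nat \<Rightarrow> 'e" assume "\<forall>i<DIM('e). f i = g i"
    then show "F f = F g" unfolding F_def by (intro sum.cong refl vol(3)) auto
  qed
  then have "F f = F basis_enum * vol f" by (rule alternating_top)
  moreover have "vol (basis_enum(i := T (basis_enum i))) = T (basis_enum i) \<bullet> (basis_enum i :: 'e)"
    if i: "i < DIM('e)" for i
  proof -
    have "vol (basis_enum(i := T (basis_enum i)))
        = vol (basis_enum(i := \<Sum>b\<in>Basis. (T (basis_enum i) \<bullet> b) *\<^sub>R (b :: 'e)))"
      by (simp add: euclidean_representation)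
    also have "\<dots> = (\<Sum>b\<in>Basis. (T (basis_enum i) \<bullet> b) * vol (basis_enum(i := b :: 'e)))"
      by (simp add: linear_sum[OF vol(1)[OF i, of basis_enum]] linear_cmul[OF vol(1)[OF i, of basis_enum]])
    also have "\<dots> = (\<Sum>j<DIM('e). (T (basis_enum i) \<bullet> basis_enum j) * vol (basis_enum(i := basis_enum j :: 'e)))"
      by (rule sum.reindex_bij_betw[OF bij_betw_basis_enum, symmetric])
    also have "\<dots> = (\<Sum>j<DIM('e). if j = i then T (basis_enum i) \<bullet> basis_enum i else 0)"
    proof (rule sum.cong)
      fix j assume "j \<in> {..<DIM('e)}"
      then have "vol (basis_enum(i := basis_enum j :: 'e)) = 0" if "j \<noteq> i"
        by (intro vol(2)[of i j]) (use i that in auto)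
      then show "(T (basis_enum i) \<bullet> basis_enum j) * vol (basis_enum(i := basis_enum j :: 'e))
          = (if j = i then T (basis_enum i) \<bullet> basis_enum i else 0)"
        by (auto simp: vol_basis_enum)
    qed simp
    finally show ?thesis using i by simp
  qed
  ultimately show ?thesis by (simp add: F_def tr_basis_enum)
qed

text \<open>The factor \<open>vol (\<lambda>i. A (basis_enum i))\<close> is the determinant of
  \<open>A\<close>; the left side is a top form in \<open>f\<close>.\<close>

lemma vol_linear_map:
  fixes A :: "'e::euclidean_space \<Rightarrow> 'e"
  assumes "linear A"
  shows "vol (\<lambda>i. A (f i)) = vol (\<lambda>i. A (basis_enum i)) * vol f"
proof (rule alternating_top)
  note vol = alternatingD[OF alternating_vol[where 'e = 'e]]
  show "alternating DIM('e) (\<lambda>f. vol (\<lambda>i. A (f i)))"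
    unfolding alternating_def
  proof (intro conjI allI impI)
    fix f :: "nat \<Rightarrow> 'e" and j assume j: "j < DIM('e)"
    have "(\<lambda>i. A ((f(j := v)) i)) = (\<lambda>i. A (f i))(j := A v)" for v by auto
    then show "linear (\<lambda>v. vol (\<lambda>i. A ((f(j := v)) i)))"
      using linear_compose[OF assms vol(1)[OF j, of "\<lambda>i. A (f i)"]] by (simp add: o_def)
  next
    fix f :: "nat \<Rightarrow> 'e" and i j assume "i < DIM('e)" "j < DIM('e)" "i \<noteq> j" "f i = f j"
    then show "vol (\<lambda>i. A (f i)) = 0" by (intro vol(2)[of i j]) auto
  next
    fix f g :: "nat \<Rightarrow> 'e" assume "\<forall>i<DIM('e). f i = g i"
    then show "vol (\<lambda>i. A (f i)) = vol (\<lambda>i. A (g i))" by (intro vol(3)) auto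
  qed
qed

lemma has_derivative_vol:
  fixes f :: "nat \<Rightarrow> 'a::real_normed_vector \<Rightarrow> 'e::euclidean_space"
  assumes "\<And>i. i < DIM('e) \<Longrightarrow> (f i has_derivative f' i) (at x)"
  shows "((\<lambda>x. vol (\<lambda>i. f i x)) has_derivative
    (\<lambda>v. \<Sum>i<DIM('e). vol ((\<lambda>j. f j x)(i := f' i v)))) (at x)"
proof -
  have "((\<lambda>x. vol (\<lambda>i. f i x)) has_derivative (\<lambda>v. \<Sum>\<sigma> | \<sigma> permutes {..<DIM('e)}. of_int (sign \<sigma>) *
      (\<Sum>i<DIM('e). (f' i v \<bullet> basis_enum (\<sigma> i)) * (\<Prod>j\<in>{..<DIM('e)} - {i}. f j x \<bullet> basis_enum (\<sigma> j))))) (at x)"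
    unfolding vol_alt
    by (intro has_derivative_sum has_derivative_mult_right has_derivative_prod has_derivative_inner_left assms) auto
  moreover have "(\<Sum>\<sigma> | \<sigma> permutes {..<DIM('e)}. of_int (sign \<sigma>) *
      (\<Sum>i<DIM('e). (f' i v \<bullet> basis_enum (\<sigma> i)) * (\<Prod>j\<in>{..<DIM('e)} - {i}. f j x \<bullet> basis_enum (\<sigma> j))))
    = (\<Sum>i<DIM('e). vol ((\<lambda>j. f j x)(i := f' i v)))" for v
  proof -
    have "(\<Prod>j<DIM('e). ((\<lambda>j. f j x)(i := f' i v)) j \<bullet> basis_enum (\<sigma> j))
        = (f' i v \<bullet> basis_enum (\<sigma> i)) * (\<Prod>j\<in>{..<DIM('e)} - {i}. f j x \<bullet> basis_enum (\<sigma> j))"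
      if "i < DIM('e)" for i and \<sigma> :: "nat \<Rightarrow> nat"
      using that by (subst prod.remove[of _ i]) auto
    then have "(\<Sum>i<DIM('e). vol ((\<lambda>j. f j x)(i := f' i v))) = (\<Sum>i<DIM('e).
      \<Sum>\<sigma> | \<sigma> permutes {..<DIM('e)}. of_int (sign \<sigma>) *
      ((f' i v \<bullet> basis_enum (\<sigma> i)) * (\<Prod>j\<in>{..<DIM('e)} - {i}. f j x \<bullet> basis_enum (\<sigma> j))))"
      unfolding vol_alt by simp
    then show ?thesis by (subst (asm) sum.swap) (simp add: sum_distrib_left)
  qed
  ultimately show ?thesis by (simp only:)
qed

lemma smooth_on_vol:
  fixes f :: "nat \<Rightarrow> 'a::real_normed_vector \<Rightarrow> 'e::euclidean_space"
  assumes "open S" "\<And>i. i < DIM('e) \<Longrightarrow> smooth_on S (f i)"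
  shows "smooth_on S (\<lambda>x. vol (\<lambda>i. f i x))"
  unfolding vol_alt
  by (intro smooth_on_sum smooth_on_mult smooth_on_prod smooth_on_const assms(1)
      smooth_on_linear[OF bounded_linear_inner_left] assms(2)) auto

lemma dim_pred: "DIM('e::euclidean_space) = Suc (DIM('e) - 1)"
  using DIM_positive[where 'a = 'e] by simp

text \<open>\<open>case_nat u f\<close> is the sequence \<open>f\<close> with \<open>u\<close> put
  in front, so the expression is the contraction of \<open>vol\<close> with \<open>u\<close>,
  inserted in the first slot as in \<open>phase_chart\<close>.\<close>

lemma alternating_contraction:
  "alternating (DIM('e) - 1) (\<lambda>f. vol (case_nat (u :: 'e::euclidean_space) f))"
  unfolding alternating_def
proof (intro conjI allI impI)
  note vol = alternatingD[OF alternating_vol[where 'e = 'e]]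
  fix f :: "nat \<Rightarrow> 'e" and j assume j: "j < DIM('e) - 1"
  have "case_nat u (f(j := v)) = (case_nat u f)(Suc j := v)" for v
    by (auto simp: fun_eq_iff split: nat.split)
  then show "linear (\<lambda>v. vol (case_nat u (f(j := v))))"
    using vol(1)[of "Suc j" "case_nat u f"] j by simp
next
  note vol = alternatingD[OF alternating_vol[where 'e = 'e]]
  fix f :: "nat \<Rightarrow> 'e" and i j assume "i < DIM('e) - 1" "j < DIM('e) - 1" "i \<noteq> j" "f i = f j"
  then show "vol (case_nat u f) = 0" by (intro vol(2)[of "Suc i" "Suc j"]) auto
next
  note vol = alternatingD[OF alternating_vol[where 'e = 'e]]
  fix f g :: "nat \<Rightarrow> 'e" assume "\<forall>i<DIM('e) - 1. f i = g i"
  then show "vol (case_nat u f) = vol (case_nat u g)"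
    by (intro vol(3)) (auto split: nat.split)
qed

lemma linear_vol_contraction: "linear (\<lambda>u. vol (case_nat u f))" for f :: "nat \<Rightarrow> 'e::euclidean_space"
proof -
  define g where "g = case_nat 0 f"
  have "case_nat u f = g(0 := u)" for u by (auto simp: g_def fun_eq_iff split: nat.split)
  then show ?thesis
    using alternatingD(1)[OF alternating_vol[where 'e = 'e], of 0 g] by simp
qed

text \<open>On a frame made of all basis vectors except \<open>b\<close>, each other component of
  \<open>u\<close> meets a repeated entry. The remaining factor is nonzero because
  \<open>vol\<close> would otherwise vanish on a frame of \<open>Basis\<close> and hence
  everywhere.\<close>

lemma vol_contraction_basis:
  fixes b :: "'e::euclidean_space"
  assumes b: "b \<in> Basis" and h: "bij_betw h {..<DIM('e) - 1} (Basis - {b})"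
  shows "vol (case_nat u h) = (u \<bullet> b) * vol (case_nat b h)" "vol (case_nat b h) \<noteq> 0"
proof -
  have zero: "vol (case_nat c h) = 0" if "c \<in> Basis" "c \<noteq> b" for c
  proof -
    have "c \<in> h ` {..<DIM('e) - 1}" using h that by (auto simp: bij_betw_def)
    then obtain i where i: "i < DIM('e) - 1" "h i = c" by auto
    then show ?thesis
      by (intro alternatingD(2)[OF alternating_vol, of 0 "Suc i"]) auto
  qed
  have "vol (case_nat u h) = vol (case_nat (\<Sum>c\<in>Basis. (u \<bullet> c) *\<^sub>R c) h)"
    by (simp add: euclidean_representation)
  also have "\<dots> = (\<Sum>c\<in>Basis. (u \<bullet> c) * vol (case_nat c h))"
    by (simp add: linear_sum[OF linear_vol_contraction] linear_cmul[OF linear_vol_contraction])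
  also have "\<dots> = (\<Sum>c\<in>Basis. if c = b then (u \<bullet> b) * vol (case_nat b h) else 0)"
    by (intro sum.cong) (auto simp: zero)
  finally show "vol (case_nat u h) = (u \<bullet> b) * vol (case_nat b h)" using b by simp
  show "vol (case_nat b h) \<noteq> 0"
  proof
    assume 0: "vol (case_nat b h) = 0"
    have bij: "bij_betw (case_nat b h) {..<DIM('e)} Basis"
    proof -
      have eq: "{..<DIM('e)} = insert 0 (Suc ` {..<DIM('e) - 1})"
        by (subst dim_pred) (rule lessThan_Suc_eq_insert_0)
      have "bij_betw (case_nat b h) (Suc ` {..<DIM('e) - 1}) (Basis - {b})"
        using h by (auto simp: bij_betw_def inj_on_def image_image)
      then have "bij_betw (case_nat b h) (insert 0 (Suc ` {..<DIM('e) - 1})) (insert b (Basis - {b}))"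
        using notIn_Un_bij_betw[of 0 "Suc ` {..<DIM('e) - 1}" "case_nat b h" "Basis - {b}"]
        by auto
      then show ?thesis using b by (simp only: eq[symmetric] insert_Diff)
    qed
    have "vol g = 0 * vol g" for g :: "nat \<Rightarrow> 'e"
    proof (rule alternating_eqI[OF alternating_vol])
      show "alternating DIM('e) (\<lambda>f :: nat \<Rightarrow> 'e. 0 * vol f)" by (rule alternating_cmult[OF alternating_vol])
      fix S :: "'e set" assume "S \<subseteq> Basis" "card S = DIM('e)"
      then have "S = Basis" by (intro card_subset_eq) auto
      then show "\<exists>h. bij_betw h {..<DIM('e)} S \<and> vol h = 0 * vol h" using bij 0 by auto
    qed
    from this[of basis_enum] show False using vol_basis_enum[where 'e = 'e] by simp
  qed
qed

lemma ex_enum_Basis_minus: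
  assumes "b \<in> Basis"
  shows "\<exists>h. bij_betw h {..<DIM('e) - 1} (Basis - {b :: 'e::euclidean_space})"
  using ex_bij_betw_nat_finite[of "Basis - {b}"] assms by (auto simp: atLeast0LessThan)

lemma vol_contraction_inject:
  fixes u :: "'e::euclidean_space"
  assumes "\<And>f. vol (case_nat u f) = vol (case_nat w f)"
  shows "u = w"
proof (rule euclidean_eqI)
  fix b :: 'e assume b: "b \<in> Basis"
  obtain h where h: "bij_betw h {..<DIM('e) - 1} (Basis - {b})" using ex_enum_Basis_minus[OF b] by blast
  show "u \<bullet> b = w \<bullet> b"
    using vol_contraction_basis[OF b h] assms[of h] by (metis mult_cancel_right)
qed

text \<open>The frame omitting the basis vector \<open>b\<close> determines the component of
  \<open>u\<close> along \<open>b\<close>, and these frames are enough to compare two (n-1)-forms.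
  With \<open>vol_contraction_inject\<close> this identifies (n-1)-forms with vectors.\<close>

lemma alternating_pred_dim:
  fixes F :: "(nat \<Rightarrow> 'e::euclidean_space) \<Rightarrow> real"
  assumes "alternating (DIM('e) - 1) F"
  shows "\<exists>u. \<forall>f. F f = vol (case_nat u f)"
proof -
  obtain h where h: "\<And>b. b \<in> Basis \<Longrightarrow> bij_betw (h b) {..<DIM('e) - 1} (Basis - {b :: 'e})"
    using ex_enum_Basis_minus by metis
  define u where "u = (\<Sum>b\<in>Basis. (F (h b) / vol (case_nat b (h b))) *\<^sub>R b)"
  have ub: "u \<bullet> b = F (h b) / vol (case_nat b (h b))" if "b \<in> Basis" for b
    using that by (simp add: u_def inner_sum_left_Basis)
  have "F f = vol (case_nat u f)" for f
  proof (rule alternating_eqI[OF assms alternating_contraction])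
    fix S :: "'e set" assume S: "S \<subseteq> Basis" "card S = DIM('e) - 1"
    have "card (Basis - S) = 1"
      using S finite_subset[OF S(1)] DIM_positive[where 'a = 'e] by (subst card_Diff_subset) auto
    then obtain b where "Basis - S = {b}" by (auto simp: card_1_singleton_iff)
    then have b: "b \<in> Basis" "S = Basis - {b}" using S by auto
    show "\<exists>h. bij_betw h {..<DIM('e) - 1} S \<and> F h = vol (case_nat u h)"
      using h[OF b(1)] vol_contraction_basis(1)[OF b(1) h[OF b(1)], of u]
        vol_contraction_basis(2)[OF b(1) h[OF b(1)]] b(2) ub[OF b(1)]
      by (intro exI[of _ "h b"]) auto
  qed
  then show ?thesis by blast
qed

section \<open>Atlases\<close>

text \<open>Charts are pairs, but quantifiers over charts should not be split.\<close>

declare split_paired_All [simp del] split_paired_Ex [simp del]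

abbreviation cinv :: "('p, 'a) chart \<Rightarrow> 'a \<Rightarrow> 'p" where
  "cinv c \<equiv> inv_into (fst c) (snd c)"

abbreviation img :: "('p, 'a) chart \<Rightarrow> 'a set" where
  "img c \<equiv> snd c ` fst c"

text \<open>The differential structure alone, with finite dimension in the form \<open>fdim\<close>;
  this is what is established for every bundle constructed below.\<close>

definition maxatlas :: "('p, 'a::real_normed_vector) atlas \<Rightarrow> bool" where
  "maxatlas A \<longleftrightarrow> fdim TYPE('a) \<and> A = max_atlas (points A) A"

lemma cinv_chart [simp]: "is_chart_in X c \<Longrightarrow> p \<in> fst c \<Longrightarrow> cinv c (snd c p) = p"
  by (simp add: is_chart_in_def)

lemma cinv_in: "z \<in> img c \<Longrightarrow> cinv c z \<in> fst c"
  by (rule inv_into_into)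

lemma chart_cinv: "z \<in> img c \<Longrightarrow> snd c (cinv c z) = z"
  by (rule f_inv_into_f)

lemma transition_chart [simp]: "is_chart_in X c \<Longrightarrow> p \<in> fst c \<Longrightarrow> transition c d (snd c p) = snd d p"
  by (simp add: transition_def)

lemma open_vimage_continuous_on:
  "continuous_on S f \<Longrightarrow> open S \<Longrightarrow> open T \<Longrightarrow> open {x \<in> S. f x \<in> T}"
  using continuous_open_preimage[of S f T] by (simp add: vimage_def Int_def)

text \<open>The change from \<open>c\<close> to \<open>d\<close> factors through \<open>e\<close> on
  the triple overlap. It is meant for two members of a maximal atlas that are compared through a
  generating chart \<open>e\<close>.\<close>

lemma transition_triple:
  fixes c d e :: "('p, 'a::real_normed_vector) chart"
  assumes "fdim TYPE('a)" and c: "is_chart_in X c" and e: "is_chart_in Y e"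
    and ce: "smooth_transition c e" and ed: "smooth_transition e d"
  shows "open (snd c ` (fst c \<inter> fst e \<inter> fst d))"
    and "smooth_on (snd c ` (fst c \<inter> fst e \<inter> fst d)) (transition c d)"
proof -
  have eq: "snd c ` (fst c \<inter> fst e \<inter> fst d)
      = {z \<in> snd c ` (fst c \<inter> fst e). transition c e z \<in> snd e ` (fst e \<inter> fst d)}"
  proof -
    have "p \<in> fst d" if "p \<in> fst c" "p \<in> fst e" "snd e p = snd e q" "q \<in> fst e" "q \<in> fst d" for p q
      using that e by (auto simp: is_chart_in_def inj_on_def)
    then show ?thesis using c by (auto simp: image_iff)
  qed
  show op: "open (snd c ` (fst c \<inter> fst e \<inter> fst d))"
    unfolding eq using ce ed
    by (intro open_vimage_continuous_on smooth_on_continuous) (auto simp: smooth_transition_def)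
  have "smooth_on (snd c ` (fst c \<inter> fst e \<inter> fst d)) (\<lambda>z. transition e d (transition c e z))"
  proof (rule smooth_on_compose[OF assms(1) op, where g = "transition e d" and f = "transition c e"])
    show "smooth_on (snd e ` (fst e \<inter> fst d)) (transition e d)" using ed by (simp add: smooth_transition_def)
    show "smooth_on (snd c ` (fst c \<inter> fst e \<inter> fst d)) (transition c e)"
      using ce by (rule_tac smooth_on_subset[of "snd c ` (fst c \<inter> fst e)"]) (auto simp: smooth_transition_def)
    show "transition c e ` snd c ` (fst c \<inter> fst e \<inter> fst d) \<subseteq> snd e ` (fst e \<inter> fst d)"
      using eq by blast
  qed
  then show "smooth_on (snd c ` (fst c \<inter> fst e \<inter> fst d)) (transition c d)"
    by (rule smooth_on_cong[OF op]) (use c e in auto)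
qed

text \<open>Two charts compatible with the generating family are compatible with each other: near
  each point of their overlap a generating chart mediates, and smoothness is local.\<close>

lemma max_atlas_maximal:
  fixes C :: "('p, 'a::real_normed_vector) atlas"
  assumes fd: "fdim TYPE('a)" and ch: "\<And>c. c \<in> C \<Longrightarrow> is_chart_in X c"
    and co: "\<And>c d. c \<in> C \<Longrightarrow> d \<in> C \<Longrightarrow> smooth_transition c d"
    and cov: "\<And>p. p \<in> X \<Longrightarrow> \<exists>c\<in>C. p \<in> fst c"
  shows "C \<subseteq> max_atlas X C" "points (max_atlas X C) = X" "maxatlas (max_atlas X C)"
proof -
  let ?A = "max_atlas X C"
  show sub: "C \<subseteq> ?A" using ch co by (auto simp: max_atlas_def)
  show pts: "points ?A = X"
  proof
    show "points ?A \<subseteq> X" by (auto simp: points_def max_atlas_def is_chart_in_def)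
    show "X \<subseteq> points ?A" using sub cov unfolding points_def by blast
  qed
  have tr: "smooth_transition c d" if "c \<in> ?A" "d \<in> ?A" for c d
  proof -
    have c: "is_chart_in X c" "\<And>e. e \<in> C \<Longrightarrow> smooth_transition c e" using that by (auto simp: max_atlas_def)
    have d: "\<And>e. e \<in> C \<Longrightarrow> smooth_transition e d" "fst d \<subseteq> X"
      using that by (auto simp: max_atlas_def is_chart_in_def)
    note tt = transition_triple[OF fd c(1) ch c(2) d(1)]
    have eq: "snd c ` (fst c \<inter> fst d) = (\<Union>e\<in>C. snd c ` (fst c \<inter> fst e \<inter> fst d))"
      using cov d(2) by blast
    have op: "open (snd c ` (fst c \<inter> fst d))" unfolding eq using tt(1) by blast
    have "smooth_on (snd c ` (fst c \<inter> fst d)) (transition c d)"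
    proof (rule smooth_on_local[OF op])
      fix z assume "z \<in> snd c ` (fst c \<inter> fst d)"
      then obtain e where "e \<in> C" "z \<in> snd c ` (fst c \<inter> fst e \<inter> fst d)" using eq by blast
      then show "\<exists>U. open U \<and> z \<in> U \<and> smooth_on U (transition c d)" using tt by blast
    qed
    then show ?thesis using op by (simp add: smooth_transition_def)
  qed
  have "?A = max_atlas X ?A"
  proof
    show "?A \<subseteq> max_atlas X ?A" using tr by (auto simp: max_atlas_def[of X ?A]) (simp add: max_atlas_def)
    show "max_atlas X ?A \<subseteq> ?A" using sub by (auto simp: max_atlas_def[of X])
  qed
  then show "maxatlas ?A" using fd pts by (simp add: maxatlas_def)
qed

lemma maxatlasD:
  assumes "maxatlas A"
  shows "c \<in> A \<Longrightarrow> is_chart_in (points A) c" "c \<in> A \<Longrightarrow> d \<in> A \<Longrightarrow> smooth_transition c d"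
  using assms unfolding maxatlas_def max_atlas_def by auto

lemma maxatlas_fdim: "maxatlas (A :: ('p, 'a::real_normed_vector) atlas) \<Longrightarrow> fdim TYPE('a)"
  by (simp add: maxatlas_def)

lemma maxatlasI:
  "maxatlas A \<Longrightarrow> is_chart_in (points A) c \<Longrightarrow>
    (\<And>d. d \<in> A \<Longrightarrow> smooth_transition c d \<and> smooth_transition d c) \<Longrightarrow> c \<in> A"
  unfolding maxatlas_def max_atlas_def by auto

lemma smooth_manifold_maxatlas: "smooth_manifold A \<Longrightarrow> maxatlas A"
  unfolding smooth_manifold_def maxatlas_def using fdim_finite_span by blast

lemma points_cover: "p \<in> points A \<Longrightarrow> \<exists>c\<in>A. p \<in> fst c"
  by (auto simp: points_def)

lemma chart_subset_points: "c \<in> A \<Longrightarrow> p \<in> fst c \<Longrightarrow> p \<in> points A"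
  by (auto simp: points_def)

lemma chart_inj: "maxatlas A \<Longrightarrow> c \<in> A \<Longrightarrow> p \<in> fst c \<Longrightarrow> q \<in> fst c \<Longrightarrow> snd c p = snd c q \<Longrightarrow> p = q"
  using maxatlasD(1) by (metis cinv_chart)

lemma open_img: "maxatlas A \<Longrightarrow> c \<in> A \<Longrightarrow> open (img c)"
  using maxatlasD(1)[of A c] by (simp add: is_chart_in_def)

lemma restrict_chart:
  assumes A: "maxatlas A" and c: "c \<in> A" and W: "open W"
  shows "({p \<in> fst c. snd c p \<in> W}, snd c) \<in> A"
proof -
  let ?r = "({p \<in> fst c. snd c p \<in> W}, snd c)"
  have ch: "is_chart_in (points A) c" using maxatlasD(1)[OF A c] .
  have img: "snd c ` {p \<in> fst c. snd c p \<in> W} = img c \<inter> W" by auto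
  have inj: "inj_on (snd c) {p \<in> fst c. snd c p \<in> W}"
    using ch by (auto simp: is_chart_in_def inj_on_def)
  have chr: "is_chart_in (points A) ?r"
    using ch W inj unfolding is_chart_in_def fst_conv snd_conv img by auto
  have inv: "cinv ?r z = cinv c z" if "z \<in> img c \<inter> W" for z
  proof -
    obtain q where q: "q \<in> fst c" "z = snd c q" "snd c q \<in> W" using \<open>z \<in> img c \<inter> W\<close> by blast
    then show ?thesis using cinv_chart[OF ch, of q] cinv_chart[OF chr, of q] by simp
  qed
  show ?thesis
  proof (rule maxatlasI[OF A chr], rule conjI)
    fix d assume d: "d \<in> A"
    have t: "smooth_transition c d" "smooth_transition d c" using maxatlasD(2)[OF A] c d by auto
    have eq: "snd c ` ({p \<in> fst c. snd c p \<in> W} \<inter> fst d) = snd c ` (fst c \<inter> fst d) \<inter> W" by auto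
    have op: "open (snd c ` (fst c \<inter> fst d) \<inter> W)" using t W by (auto simp: smooth_transition_def)
    have "smooth_on (snd c ` (fst c \<inter> fst d) \<inter> W) (transition ?r d)"
      by (rule smooth_on_cong[OF op smooth_on_subset[of "snd c ` (fst c \<inter> fst d)" "transition c d"]])
        (use t inv in \<open>auto simp: smooth_transition_def transition_def\<close>)
    then show "smooth_transition ?r d" using op by (simp add: smooth_transition_def eq)
    have eq: "snd d ` (fst d \<inter> {p \<in> fst c. snd c p \<in> W}) = {z \<in> snd d ` (fst d \<inter> fst c). transition d c z \<in> W}"
    proof -
      have "transition d c (snd d q) = snd c q" if "q \<in> fst d" for q
        by (rule transition_chart[OF maxatlasD(1)[OF A d] that])
      then show ?thesis by auto
    qed
    have op: "open {z \<in> snd d ` (fst d \<inter> fst c). transition d c z \<in> W}"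
      using t W by (intro open_vimage_continuous_on smooth_on_continuous) (auto simp: smooth_transition_def)
    have "smooth_on {z \<in> snd d ` (fst d \<inter> fst c). transition d c z \<in> W} (transition d ?r)"
      by (rule smooth_on_cong[OF op smooth_on_subset[of "snd d ` (fst d \<inter> fst c)" "transition d c"]])
        (use t in \<open>auto simp: smooth_transition_def transition_def\<close>)
    then show "smooth_transition d ?r" using op by (simp add: smooth_transition_def eq)
  qed
qed

lemma transition_rep:
  assumes A: "maxatlas A" and "c \<in> A" "d \<in> A"
  shows "open (snd c ` (fst c \<inter> fst d))" "smooth_on (snd c ` (fst c \<inter> fst d)) (transition c d)"
    "p \<in> fst c \<Longrightarrow> transition c d (snd c p) = snd d p"
  using maxatlasD(2)[OF assms] transition_chart[OF maxatlasD(1)[OF A assms(2)], of p d]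
  by (simp_all add: smooth_transition_def)

lemma has_derivative_transition:
  assumes "maxatlas A" "c \<in> A" "d \<in> A" "p \<in> fst c" "p \<in> fst d"
  shows "(transition c d has_derivative D (transition c d) (snd c p)) (at (snd c p))"
  using smooth_on_has_derivative[OF transition_rep(2)[OF assms(1-3)]] assms(4,5) by blast

section \<open>Smooth maps between manifolds\<close>

text \<open>The condition of \<open>smooth_map\<close> at a single point, so that a tangent map can
  be taken for a map that is smooth only near the point, such as a local section.\<close>

definition smooth_near ::
  "('p, 'a::real_normed_vector) atlas \<Rightarrow> ('q, 'b::real_normed_vector) atlas \<Rightarrow> ('p \<Rightarrow> 'q) \<Rightarrow> 'p \<Rightarrow> bool"
  where
  "smooth_near A B f p \<longleftrightarrow>
     (\<exists>c\<in>A. \<exists>d\<in>B. p \<in> fst c \<and> f ` fst c \<subseteq> fst d \<and> smooth_on (img c) (snd d \<circ> f \<circ> cinv c))"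

lemma smooth_map_near: "smooth_map A B f \<longleftrightarrow> (\<forall>p\<in>points A. smooth_near A B f p)"
  by (simp add: smooth_map_def smooth_near_def)

text \<open>Smoothness supplies some pair of charts; passing to prescribed ones costs a restriction
  to a neighbourhood \<open>W\<close>.\<close>

lemma smooth_near_rep:
  assumes A: "maxatlas A" and B: "maxatlas B" and f: "smooth_near A B f p"
    and c: "c \<in> A" "p \<in> fst c" and d: "d \<in> B" "f p \<in> fst d"
  obtains W where "open W" "snd c p \<in> W" "W \<subseteq> img c" "\<And>z. z \<in> W \<Longrightarrow> f (cinv c z) \<in> fst d"
    "smooth_on W (snd d \<circ> f \<circ> cinv c)"
proof -
  obtain c1 d1 where 1: "c1 \<in> A" "d1 \<in> B" "p \<in> fst c1" "f ` fst c1 \<subseteq> fst d1"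
    "smooth_on (img c1) (snd d1 \<circ> f \<circ> cinv c1)"
    using f unfolding smooth_near_def by blast
  let ?h = "snd d1 \<circ> f \<circ> cinv c1"
  let ?W1 = "snd c ` (fst c \<inter> fst c1)"
  note t = transition_rep[OF A c(1) 1(1)] and u = transition_rep[OF B 1(2) d(1)]
  note cc = cinv_chart[OF maxatlasD(1)[OF A c(1)]] cinv_chart[OF maxatlasD(1)[OF A 1(1)]]
  have sm: "smooth_on ?W1 (\<lambda>z. ?h (transition c c1 z))"
    by (rule smooth_on_compose[OF maxatlas_fdim[OF A] t(1) 1(5) t(2)]) (use t(3) in auto)
  \<comment> \<open>The points of the overlap whose image, read in \<open>d1\<close>, also lies in
    the domain of \<open>d\<close>.\<close>
  define W where "W = {z \<in> ?W1. ?h (transition c c1 z) \<in> snd d1 ` (fst d1 \<inter> fst d)}"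
  have op: "open W"
    unfolding W_def by (intro open_vimage_continuous_on smooth_on_continuous[OF sm] t(1) u(1))
  have eq: "snd d (f (cinv c z)) = transition d1 d (?h (transition c c1 z))" "f (cinv c z) \<in> fst d"
    if zW: "z \<in> W" for z
  proof -
    obtain q where q: "q \<in> fst c" "q \<in> fst c1" "z = snd c q" using zW unfolding W_def by blast
    then have "snd d1 (f q) \<in> snd d1 ` (fst d1 \<inter> fst d)" using zW t(3) cc by (simp add: W_def)
    moreover have "f q \<in> fst d1" using 1(4) q by auto
    ultimately have "f q \<in> fst d" using chart_inj[OF B 1(2)] by auto
    then show "snd d (f (cinv c z)) = transition d1 d (?h (transition c c1 z))" "f (cinv c z) \<in> fst d"
      using q t(3) cc u(3) \<open>f q \<in> fst d1\<close> by auto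
  qed
  have "smooth_on W (\<lambda>z. transition d1 d (?h (transition c c1 z)))"
    by (rule smooth_on_compose[OF maxatlas_fdim[OF B] op u(2) smooth_on_subset[OF sm]]) (auto simp: W_def)
  then have "smooth_on W (snd d \<circ> f \<circ> cinv c)"
    by (rule smooth_on_cong[OF op]) (simp add: eq(1))
  moreover have "snd c p \<in> W"
    using c 1 d t(3) cc by (auto simp: W_def)
  moreover have "W \<subseteq> img c" by (auto simp: W_def)
  ultimately show ?thesis using op eq(2) that by blast
qed

section \<open>The manifold topology\<close>

text \<open>\<open>topology\<close> can be evaluated only after the predicate is shown to be closed
  under finite intersections and unions; injectivity of the charts gives the intersections.\<close>

lemma openin_mfd:
  assumes A: "maxatlas A"
  shows "openin (mfd_topology A) V \<longleftrightarrow> V \<subseteq> points A \<and> (\<forall>c\<in>A. open (snd c ` (fst c \<inter> V)))"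
proof -
  have "istopology (\<lambda>V. V \<subseteq> points A \<and> (\<forall>c\<in>A. open (snd c ` (fst c \<inter> V))))"
    unfolding istopology_def
  proof (intro conjI allI impI ballI)
    fix S T c assume ST: "S \<subseteq> points A \<and> (\<forall>c\<in>A. open (snd c ` (fst c \<inter> S)))"
      "T \<subseteq> points A \<and> (\<forall>c\<in>A. open (snd c ` (fst c \<inter> T)))" and c: "c \<in> A"
    have "snd c ` (fst c \<inter> (S \<inter> T)) = snd c ` (fst c \<inter> S) \<inter> snd c ` (fst c \<inter> T)"
      using chart_inj[OF A c] by auto
    then show "open (snd c ` (fst c \<inter> (S \<inter> T)))" using ST c by auto
  next
    fix K c assume K: "\<forall>S\<in>K. S \<subseteq> points A \<and> (\<forall>c\<in>A. open (snd c ` (fst c \<inter> S)))" and c: "c \<in> A"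
    have "snd c ` (fst c \<inter> \<Union>K) = (\<Union>S\<in>K. snd c ` (fst c \<inter> S))" by auto
    then show "open (snd c ` (fst c \<inter> \<Union>K))" using K c by auto
  qed blast+
  then show ?thesis unfolding mfd_topology_def by (simp add: topology_inverse')
qed

lemma openin_chart_domain: "maxatlas A \<Longrightarrow> c \<in> A \<Longrightarrow> openin (mfd_topology A) (fst c)"
  unfolding openin_mfd using transition_rep(1)[of A _ c] chart_subset_points[of c A] by blast

lemma topspace_mfd: "maxatlas A \<Longrightarrow> topspace (mfd_topology A) = points A"
proof -
  assume A: "maxatlas A"
  have "openin (mfd_topology A) (points A)"
    unfolding openin_mfd[OF A]
    by (metis A Int_absorb2 chart_subset_points open_img subsetI)
  then show ?thesis
    using openin_mfd[OF A] by (metis openin_subset openin_topspace subset_antisym)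
qed

lemma continuous_map_cinv:
  assumes A: "maxatlas A" and c: "c \<in> A"
  shows "continuous_map (top_of_set (img c)) (mfd_topology A) (cinv c)"
proof (clarsimp simp: continuous_map_def topspace_mfd[OF A])
  have "openin (top_of_set (img c)) {z \<in> img c. cinv c z \<in> V}" if "openin (mfd_topology A) V" for V
  proof -
    have "{z \<in> img c. cinv c z \<in> V} = snd c ` (fst c \<inter> V)"
      using cinv_chart[OF maxatlasD(1)[OF A c]] by auto
    moreover have "open (snd c ` (fst c \<inter> V))" using that c openin_mfd[OF A] by blast
    ultimately show ?thesis by (intro open_subset) auto
  qed
  then show "cinv c \<in> img c \<rightarrow> points A \<and>
    (\<forall>U. openin (mfd_topology A) U \<longrightarrow> openin (top_of_set (img c)) {x \<in> img c. cinv c x \<in> U})"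
    using cinv_in[of _ c] chart_subset_points[OF c] by auto
qed

text \<open>For maximality, a chart inside \<open>U\<close> that is compatible with all charts
  contained in \<open>U\<close> must be compatible with each chart \<open>d\<close> of
  \<open>A\<close>; it meets only the part of \<open>d\<close> in \<open>U\<close>, which is itself
  a chart.\<close>

lemma open_submanifold_maxatlas:
  assumes A: "maxatlas A" and U: "openin (mfd_topology A) U"
  shows "maxatlas (open_submanifold A U)" "points (open_submanifold A U) = U"
proof -
  let ?A = "open_submanifold A U"
  have UA: "U \<subseteq> points A" "\<And>c. c \<in> A \<Longrightarrow> open (snd c ` (fst c \<inter> U))" using U openin_mfd[OF A] by auto
  have restr: "\<exists>d. d \<in> ?A \<and> fst d = fst c \<inter> U \<and> snd d = snd c" if "c \<in> A" for c
  proof -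
    have "({p \<in> fst c. snd c p \<in> snd c ` (fst c \<inter> U)}, snd c) \<in> A"
      by (rule restrict_chart[OF A that UA(2)[OF that]])
    moreover have "{p \<in> fst c. snd c p \<in> snd c ` (fst c \<inter> U)} = fst c \<inter> U"
      using chart_inj[OF A that] by auto
    ultimately show ?thesis by (auto simp: open_submanifold_def)
  qed
  show pts: "points ?A = U"
    using restr UA(1) points_cover[of _ A] by (fastforce simp: points_def open_submanifold_def)
  have "c \<in> ?A" if c: "is_chart_in U c" "\<And>d. d \<in> ?A \<Longrightarrow> smooth_transition c d \<and> smooth_transition d c" for c
  proof -
    have cU: "fst c \<subseteq> U" using c by (auto simp: is_chart_in_def)
    have "c \<in> A"
    proof (rule maxatlasI[OF A])
      show "is_chart_in (points A) c" using c UA by (auto simp: is_chart_in_def)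
      fix d assume d: "d \<in> A"
      obtain e where e: "e \<in> ?A" "fst e = fst d \<inter> U" "snd e = snd d" using restr[OF d] by blast
      have i: "fst c \<inter> fst e = fst c \<inter> fst d" "fst e \<inter> fst c = fst d \<inter> fst c" using e cU by auto
      have "transition c d = transition c e" using e by (simp add: transition_def)
      then have "smooth_transition c d" using c(2)[OF e(1)] e i by (simp add: smooth_transition_def)
      moreover have "smooth_transition d c"
      proof -
        have *: "open (snd d ` (fst d \<inter> fst c))" "smooth_on (snd d ` (fst d \<inter> fst c)) (transition e c)"
          using c(2)[OF e(1)] e i by (auto simp: smooth_transition_def)
        have eA: "e \<in> A" using e by (simp add: open_submanifold_def)
        have "smooth_on (snd d ` (fst d \<inter> fst c)) (transition d c)"
        proof (rule smooth_on_cong[OF *])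
          fix z assume "z \<in> snd d ` (fst d \<inter> fst c)"
          then obtain q where q: "q \<in> fst d" "q \<in> fst e" "z = snd d q" using cU e by auto
          then show "transition e c z = transition d c z"
            using transition_chart[OF maxatlasD(1)[OF A eA] q(2)] transition_chart[OF maxatlasD(1)[OF A d] q(1)] e(3) q(3)
            by metis
        qed
        then show ?thesis using * by (simp add: smooth_transition_def)
      qed
      ultimately show "smooth_transition c d \<and> smooth_transition d c" ..
    qed
    then show ?thesis using cU by (simp add: open_submanifold_def)
  qed
  moreover have "is_chart_in U c" "\<And>d. d \<in> ?A \<Longrightarrow> smooth_transition c d \<and> smooth_transition d c" if "c \<in> ?A" for c
    using that maxatlasD[OF A] by (auto simp: open_submanifold_def is_chart_in_def)
  ultimately have "?A = max_atlas U ?A" unfolding max_atlas_def by blast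
  then show "maxatlas ?A" using maxatlas_fdim[OF A] pts by (simp add: maxatlas_def)
qed

lemma smooth_near_open_submanifold: "smooth_near (open_submanifold A U) B f p \<Longrightarrow> smooth_near A B f p"
  unfolding smooth_near_def open_submanifold_def by blast

section \<open>Tangent vectors and tangent maps\<close>

lemma charts_at_iff: "c \<in> charts_at A p \<longleftrightarrow> c \<in> A \<and> p \<in> fst c"
  by (simp add: charts_at_def)

lemma D_transition_compose:
  assumes A: "maxatlas A" and c: "c \<in> charts_at A p" and d: "d \<in> charts_at A p" and e: "e \<in> charts_at A p"
  shows "D (transition d e) (snd d p) (D (transition c d) (snd c p) w) = D (transition c e) (snd c p) w"
proof -
  note cde = c[unfolded charts_at_iff] d[unfolded charts_at_iff] e[unfolded charts_at_iff]
  let ?S = "snd c ` (fst c \<inter> fst d \<inter> fst e)"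
  have op: "open ?S"
    using cde by (intro transition_triple(1)[OF maxatlas_fdim[OF A] maxatlasD(1)[OF A] maxatlasD(1)[OF A]]
      maxatlasD(2)[OF A]) auto
  have "(transition d e has_derivative D (transition d e) (snd d p)) (at (transition c d (snd c p)))"
    using has_derivative_transition[OF A, of d e p] transition_rep(3)[OF A, of c d p] cde by simp
  then have "(transition d e \<circ> transition c d has_derivative
      D (transition d e) (snd d p) \<circ> D (transition c d) (snd c p)) (at (snd c p))"
    using has_derivative_transition[OF A, of c d p] cde by (intro diff_chain_at) auto
  then have "(transition c e has_derivative
      D (transition d e) (snd d p) \<circ> D (transition c d) (snd c p)) (at (snd c p))"
    by (rule has_derivative_transform_within_open[OF _ op])
      (use cde transition_rep(3)[OF A, of c d] transition_rep(3)[OF A, of c e] transition_rep(3)[OF A, of d e] in auto)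
  then show ?thesis using D_eqI by (metis comp_apply)
qed

lemma D_transition_self:
  assumes A: "maxatlas A" and c: "c \<in> charts_at A p"
  shows "D (transition c c) (snd c p) w = w"
proof -
  have c': "c \<in> A" "p \<in> fst c" using c by (auto simp: charts_at_iff)
  have "(transition c c has_derivative (\<lambda>v. v)) (at (snd c p))"
    by (rule has_derivative_transform_within_open[OF has_derivative_ident open_img[OF A c'(1)]])
      (use c' transition_rep(3)[OF A c'(1) c'(1)] in auto)
  then show ?thesis using D_eqI by metis
qed

lemma tangentD:
  "v \<in> tangent_space A p \<Longrightarrow> c \<in> charts_at A p \<Longrightarrow> d \<in> charts_at A p \<Longrightarrow>
    v d = D (transition c d) (snd c p) (v c)"
  unfolding tangent_space_def by blast

lemma tangent_outside: "v \<in> tangent_space A p \<Longrightarrow> c \<notin> charts_at A p \<Longrightarrow> v c = 0"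
  unfolding tangent_space_def by blast

lemma tangent_eqI:
  assumes "u \<in> tangent_space A p" "v \<in> tangent_space A p" "c \<in> charts_at A p" "u c = v c"
  shows "u = v"
proof
  fix d show "u d = v d"
    using tangentD[OF assms(1,3), of d] tangentD[OF assms(2,3), of d] assms(4)
      tangent_outside[OF assms(1), of d] tangent_outside[OF assms(2), of d]
    by (cases "d \<in> charts_at A p") simp_all
qed

text \<open>Existence behind the \<open>THE\<close>: the component prescribed in \<open>c\<close> is
  propagated by the derivatives of the transitions, consistently by the chain rule.\<close>

lemma tvec_of:
  assumes A: "maxatlas A" and c: "c \<in> charts_at A p"
  shows "tvec_of A c p w \<in> tangent_space A p" "tvec_of A c p w c = w"
proof -
  define v where "v d = (if d \<in> charts_at A p then D (transition c d) (snd c p) w else 0)" for d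
  have v: "v \<in> tangent_space A p \<and> v c = w"
    unfolding tangent_space_def v_def mem_Collect_eq
    using D_transition_compose[OF A c] D_transition_self[OF A c] c by simp
  have "\<exists>!v. v \<in> tangent_space A p \<and> v c = w"
    by (rule ex1I[of _ v]) (use v tangent_eqI[OF _ _ c] in simp_all)
  from theI'[OF this] show "tvec_of A c p w \<in> tangent_space A p" "tvec_of A c p w c = w"
    unfolding tvec_of_def by auto
qed

lemma tvec_of_eq:
  assumes "maxatlas A" "c \<in> charts_at A p" "v \<in> tangent_space A p"
  shows "tvec_of A c p (v c) = v"
  using tangent_eqI[OF tvec_of(1)[OF assms(1,2)] assms(3,2)] tvec_of(2)[OF assms(1,2)] by blast

lemma tangent_lincomb:
  assumes A: "maxatlas A" and "u \<in> tangent_space A p" "v \<in> tangent_space A p"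
  shows "lincomb r u s v \<in> tangent_space A p"
proof -
  have "lincomb r u s v d = D (transition c d) (snd c p) (lincomb r u s v c)"
    if "c \<in> charts_at A p" "d \<in> charts_at A p" for c d
  proof -
    have lin: "linear (D (transition c d) (snd c p))"
      using has_derivative_linear[OF has_derivative_transition[OF A]] that unfolding charts_at_iff by blast
    show ?thesis
      unfolding lincomb_def linear_add[OF lin] linear_cmul[OF lin]
      using tangentD[OF assms(2) that] tangentD[OF assms(3) that] by simp
  qed
  moreover have "lincomb r u s v d = 0" if "d \<notin> charts_at A p" for d
    using tangent_outside[OF assms(2) that] tangent_outside[OF assms(3) that] by (simp add: lincomb_def)
  ultimately show ?thesis unfolding tangent_space_def by blast
qed

lemma has_derivative_rep:
  assumes A: "maxatlas A" and B: "maxatlas B" and f: "smooth_near A B f p"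
    and c: "c \<in> charts_at A p" and d: "d \<in> charts_at B (f p)"
  shows "((snd d \<circ> f \<circ> cinv c) has_derivative D (snd d \<circ> f \<circ> cinv c) (snd c p)) (at (snd c p))"
proof -
  obtain W where "snd c p \<in> W" "smooth_on W (snd d \<circ> f \<circ> cinv c)"
    using smooth_near_rep[OF A B f] c d by (metis charts_at_iff)
  then show ?thesis using smooth_on_has_derivative by blast
qed

text \<open>\<open>tangent_map\<close> is computed in a chart picked by \<open>SOME\<close>; the
  chain rule shows that every chart around the point gives the same result.\<close>

lemma tangent_map:
  assumes A: "maxatlas A" and B: "maxatlas B" and f: "smooth_near A B f p" and v: "v \<in> tangent_space A p"
  shows tangent_map_chart: "c \<in> charts_at A p \<Longrightarrow> d \<in> charts_at B (f p) \<Longrightarrow>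
      tangent_map A B f p v d = D (snd d \<circ> f \<circ> cinv c) (snd c p) (v c)"
    and tangent_map_in: "tangent_map A B f p v \<in> tangent_space B (f p)"
proof -
  have eq: "tangent_map A B f p v d = D (snd d \<circ> f \<circ> cinv c) (snd c p) (v c)"
    if c: "c \<in> charts_at A p" and d: "d \<in> charts_at B (f p)" for c d
  proof -
    define c0 where "c0 = (SOME c. c \<in> charts_at A p)"
    have c0: "c0 \<in> charts_at A p" unfolding c0_def using c by (rule someI)
    have cA: "c \<in> A" "p \<in> fst c" "c0 \<in> A" "p \<in> fst c0" using c c0 by (auto simp: charts_at_iff)
    have tp: "transition c c0 (snd c p) = snd c0 p" using transition_rep(3)[OF A] cA by blast
    have "((snd d \<circ> f \<circ> cinv c0) \<circ> transition c c0 has_derivative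
        D (snd d \<circ> f \<circ> cinv c0) (snd c0 p) \<circ> D (transition c c0) (snd c p)) (at (snd c p))"
      using has_derivative_transition[OF A] has_derivative_rep[OF A B f c0 d] cA tp
      by (intro diff_chain_at) auto
    then have "((snd d \<circ> f \<circ> cinv c) has_derivative
        D (snd d \<circ> f \<circ> cinv c0) (snd c0 p) \<circ> D (transition c c0) (snd c p)) (at (snd c p))"
    proof (rule has_derivative_transform_within_open[OF _ transition_rep(1)[OF A cA(1,3)]])
      fix z assume "z \<in> snd c ` (fst c \<inter> fst c0)"
      then obtain q where "q \<in> fst c" "q \<in> fst c0" "z = snd c q" by auto
      then show "((snd d \<circ> f \<circ> cinv c0) \<circ> transition c c0) z = (snd d \<circ> f \<circ> cinv c) z"
        using transition_rep(3)[OF A cA(1)] cinv_chart[OF maxatlasD(1)[OF A]] cA by simp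
    qed (use cA in blast)
    then have "D (snd d \<circ> f \<circ> cinv c) (snd c p) (v c)
        = D (snd d \<circ> f \<circ> cinv c0) (snd c0 p) (D (transition c c0) (snd c p) (v c))"
      using D_eqI by fastforce
    also have "D (transition c c0) (snd c p) (v c) = v c0" using tangentD[OF v c c0] by simp
    finally show ?thesis using d by (simp only: tangent_map_def c0_def Let_def if_True)
  qed
  then show "c \<in> charts_at A p \<Longrightarrow> d \<in> charts_at B (f p) \<Longrightarrow>
      tangent_map A B f p v d = D (snd d \<circ> f \<circ> cinv c) (snd c p) (v c)" .
  obtain c where c: "c \<in> charts_at A p" using f by (auto simp: smooth_near_def charts_at_iff)
  have "tangent_map A B f p v e = D (transition d e) (snd d (f p)) (tangent_map A B f p v d)"
    if d: "d \<in> charts_at B (f p)" and e: "e \<in> charts_at B (f p)" for d e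
  proof -
    have cc: "c \<in> A" "p \<in> fst c" "d \<in> B" "f p \<in> fst d" "e \<in> B" "f p \<in> fst e"
      using c d e by (auto simp: charts_at_iff)
    obtain W where W: "open W" "snd c p \<in> W" "W \<subseteq> img c" "\<And>z. z \<in> W \<Longrightarrow> f (cinv c z) \<in> fst d"
      using smooth_near_rep[OF A B f cc(1-4)] by metis
    have "(transition d e has_derivative D (transition d e) (snd d (f p))) (at ((snd d \<circ> f \<circ> cinv c) (snd c p)))"
      using has_derivative_transition[OF B cc(3,5,4,6)] cinv_chart[OF maxatlasD(1)[OF A cc(1)] cc(2)] by simp
    then have "(transition d e \<circ> (snd d \<circ> f \<circ> cinv c) has_derivative
        D (transition d e) (snd d (f p)) \<circ> D (snd d \<circ> f \<circ> cinv c) (snd c p)) (at (snd c p))"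
      using has_derivative_rep[OF A B f c d] by (rule_tac diff_chain_at)
    then have "((snd e \<circ> f \<circ> cinv c) has_derivative
        D (transition d e) (snd d (f p)) \<circ> D (snd d \<circ> f \<circ> cinv c) (snd c p)) (at (snd c p))"
      by (rule has_derivative_transform_within_open[OF _ W(1,2)])
        (use W(4) transition_rep(3)[OF B cc(3,5)] in auto)
    then show ?thesis using D_eqI eq[OF c d] eq[OF c e] by fastforce
  qed
  moreover have "tangent_map A B f p v d = 0" if "d \<notin> charts_at B (f p)" for d
    using that by (simp add: tangent_map_def)
  ultimately show "tangent_map A B f p v \<in> tangent_space B (f p)" unfolding tangent_space_def by blast
qed

section \<open>Bundles covered by adapted charts\<close>

text \<open>Local triviality in the form of a covering by adapted charts. Jet and form bundles over
  such a bundle have the same property, so the constructions iterate.\<close>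

locale adapted_bundle =
  fixes M :: "('m, 'e::euclidean_space) atlas" and B :: "('b, 'e \<times> 'h::real_normed_vector) atlas"
    and \<pi> :: "'b \<Rightarrow> 'm"
  assumes M: "maxatlas M" and B: "maxatlas B" and fdim_fibre: "fdim TYPE('h)"
    and cover: "b \<in> points B \<Longrightarrow> \<exists>a c. (a, c) \<in> adapted M B \<pi> \<and> b \<in> fst c"
begin

lemma adaptedD:
  assumes "(a, c) \<in> adapted M B \<pi>"
  shows "a \<in> M" "c \<in> B" "b \<in> fst c \<Longrightarrow> \<pi> b \<in> fst a" "b \<in> fst c \<Longrightarrow> fst (snd c b) = snd a (\<pi> b)"
    "b \<in> fst c \<Longrightarrow> a \<in> charts_at M (\<pi> b)" "b \<in> fst c \<Longrightarrow> c \<in> charts_at B b" "b \<in> fst c \<Longrightarrow> b \<in> points B"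
  using assms chart_subset_points[of c B b] by (auto simp: adapted_def charts_at_iff)

lemma cinv_snd [simp]: "(a, c) \<in> adapted M B \<pi> \<Longrightarrow> b \<in> fst c \<Longrightarrow> cinv c (snd c b) = b"
  using cinv_chart[OF maxatlasD(1)[OF B]] adaptedD(2) by metis

lemma proj_rep:
  assumes "(a, c) \<in> adapted M B \<pi>" "z \<in> img c"
  shows "snd a (\<pi> (cinv c z)) = fst z"
  using adaptedD(4)[OF assms(1) cinv_in[OF assms(2)]] chart_cinv[OF assms(2)] by simp

lemma smooth_near_proj:
  assumes "b \<in> points B"
  shows "smooth_near B M \<pi> b"
proof -
  obtain a c where ac: "(a, c) \<in> adapted M B \<pi>" "b \<in> fst c" using cover[OF assms] by blast
  have op: "open (img c)" using open_img[OF B] adaptedD(2)[OF ac(1)] by blast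
  have "smooth_on (img c) (snd a \<circ> \<pi> \<circ> cinv c)"
    by (rule smooth_on_cong[OF op smooth_on_fst[OF op smooth_on_id]]) (use proj_rep[OF ac(1)] in auto)
  moreover have "\<pi> ` fst c \<subseteq> fst a" using adaptedD(3)[OF ac(1)] by blast
  ultimately show ?thesis
    unfolding smooth_near_def using ac adaptedD(1,2)[OF ac(1)] by blast
qed

lemma tangent_proj:
  assumes ac: "(a, c) \<in> adapted M B \<pi>" "b \<in> fst c" and v: "v \<in> tangent_space B b"
  shows "tangent_map B M \<pi> b v a = fst (v c)"
proof -
  have op: "open (img c)" using open_img[OF B] adaptedD(2)[OF ac(1)] by blast
  have "((snd a \<circ> \<pi> \<circ> cinv c) has_derivative fst) (at (snd c b))"
    by (rule has_derivative_transform_within_open[OF has_derivative_fst[OF has_derivative_ident] op])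
      (use proj_rep[OF ac(1)] ac in auto)
  then show ?thesis
    using tangent_map_chart[OF B M smooth_near_proj v adaptedD(6)[OF ac] adaptedD(5)[OF ac]]
      adaptedD(7)[OF ac] D_eqI by fastforce
qed

lemma vertical_iff:
  assumes ac: "(a, c) \<in> adapted M B \<pi>" "b \<in> fst c"
  shows "v \<in> vertical_space M B \<pi> b \<longleftrightarrow> v \<in> tangent_space B b \<and> fst (v c) = 0"
proof (cases "v \<in> tangent_space B b")
  case True
  have t: "tangent_map B M \<pi> b v \<in> tangent_space M (\<pi> b)"
    by (rule tangent_map_in[OF B M smooth_near_proj[OF adaptedD(7)[OF ac]] True])
  have 0: "(\<lambda>_. 0) \<in> tangent_space M (\<pi> b)"
    using tangent_lincomb[OF M t t, of 0 0] by (simp add: lincomb_def)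
  have "tangent_map B M \<pi> b v = (\<lambda>_. 0) \<longleftrightarrow> tangent_map B M \<pi> b v a = 0"
    using tangent_eqI[OF t 0 adaptedD(5)[OF ac]] by auto
  then show ?thesis using True tangent_proj[OF ac True] by (simp add: vertical_space_def)
qed (simp add: vertical_space_def)

lemma transition_fst:
  assumes "(a, c) \<in> adapted M B \<pi>" "(a', c') \<in> adapted M B \<pi>" "b \<in> fst c" "b \<in> fst c'"
  shows "fst (transition c c' (snd c b)) = transition a a' (fst (snd c b))"
  using transition_rep(3)[OF B, of c c' b] transition_rep(3)[OF M, of a a' "\<pi> b"]
    adaptedD[OF assms(1)] adaptedD[OF assms(2)] assms(3,4) by simp

lemma D_transition_fst:
  assumes ac: "(a, c) \<in> adapted M B \<pi>" and ac': "(a', c') \<in> adapted M B \<pi>" and b: "b \<in> fst c" "b \<in> fst c'"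
  shows "fst (D (transition c c') (snd c b) v) = D (transition a a') (fst (snd c b)) (fst v)"
proof -
  have 1: "((\<lambda>z. fst (transition c c' z)) has_derivative (\<lambda>v. fst (D (transition c c') (snd c b) v))) (at (snd c b))"
    using has_derivative_transition[OF B, of c c' b] adaptedD(2)[OF ac] adaptedD(2)[OF ac'] b
    by (intro has_derivative_fst) auto
  have "(transition a a' has_derivative D (transition a a') (fst (snd c b))) (at (fst (snd c b)))"
    using has_derivative_transition[OF M, of a a' "\<pi> b"] adaptedD[OF ac] adaptedD[OF ac'] b by simp
  then have "((\<lambda>z. transition a a' (fst z)) has_derivative (\<lambda>v. D (transition a a') (fst (snd c b)) (fst v))) (at (snd c b))"
    by (rule has_derivative_compose[OF has_derivative_fst[OF has_derivative_ident], where g = "transition a a'"])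
  then have "((\<lambda>z. fst (transition c c' z)) has_derivative (\<lambda>v. D (transition a a') (fst (snd c b)) (fst v))) (at (snd c b))"
    by (rule has_derivative_transform_within_open[OF _ transition_rep(1)[OF B adaptedD(2)[OF ac] adaptedD(2)[OF ac']]])
      (use b transition_fst[OF ac ac'] in auto)
  then show ?thesis using 1 has_derivative_unique by metis
qed

lemma D_base_inverse:
  assumes ac: "(a, c) \<in> adapted M B \<pi>" and ac': "(a', c') \<in> adapted M B \<pi>" and b: "b \<in> fst c" "b \<in> fst c'"
  shows "D (transition a' a) (snd a' (\<pi> b)) (D (transition a a') (snd a (\<pi> b)) u) = u"
  using D_transition_compose[OF M adaptedD(5)[OF ac b(1)] adaptedD(5)[OF ac' b(2)] adaptedD(5)[OF ac b(1)]]
    D_transition_self[OF M adaptedD(5)[OF ac b(1)]] by simp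

lemma D_total_inverse:
  assumes ac: "(a, c) \<in> adapted M B \<pi>" and ac': "(a', c') \<in> adapted M B \<pi>" and b: "b \<in> fst c" "b \<in> fst c'"
  shows "D (transition c' c) (snd c' b) (D (transition c c') (snd c b) u) = u"
  using D_transition_compose[OF B adaptedD(6)[OF ac b(1)] adaptedD(6)[OF ac' b(2)] adaptedD(6)[OF ac b(1)]]
    D_transition_self[OF B adaptedD(6)[OF ac b(1)]] by simp

lemma linear_D_base:
  assumes "(a, c) \<in> adapted M B \<pi>" "(a', c') \<in> adapted M B \<pi>" "b \<in> fst c" "b \<in> fst c'"
  shows "linear (D (transition a a') (snd a (\<pi> b)))"
  by (rule has_derivative_linear[OF has_derivative_transition[OF M adaptedD(1)[OF assms(1)] adaptedD(1)[OF assms(2)]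
    adaptedD(3)[OF assms(1,3)] adaptedD(3)[OF assms(2,4)]]])

lemma linear_D_total:
  assumes "(a, c) \<in> adapted M B \<pi>" "(a', c') \<in> adapted M B \<pi>" "b \<in> fst c" "b \<in> fst c'"
  shows "linear (D (transition c c') (snd c b))"
  by (rule has_derivative_linear[OF has_derivative_transition[OF B adaptedD(2)[OF assms(1)] adaptedD(2)[OF assms(2)] assms(3,4)]])

text \<open>The overlap of two charts seen from a bundle over \<open>B\<close>: the additional
  coordinate in \<open>'w\<close> is unrestricted.\<close>

abbreviation dom_of :: "('b, 'e \<times> 'h) chart \<Rightarrow> ('b, 'e \<times> 'h) chart \<Rightarrow> ('e \<times> 'h \<times> 'w::real_normed_vector) set" where
  "dom_of c c' \<equiv> {y. (fst y, fst (snd y)) \<in> snd c ` (fst c \<inter> fst c')}"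

lemma fdim_total: "fdim TYPE('e \<times> 'h)"
  using fdim_fibre by simp

lemma open_dom_of:
  assumes "(a, c) \<in> adapted M B \<pi>" "(a', c') \<in> adapted M B \<pi>"
  shows "open (dom_of c c' :: ('e \<times> 'h \<times> 'w::real_normed_vector) set)"
  using open_vimage[OF transition_rep(1)[OF B adaptedD(2)[OF assms(1)] adaptedD(2)[OF assms(2)]],
      of "\<lambda>y :: 'e \<times> 'h \<times> 'w. (fst y, fst (snd y))"]
  by (simp add: vimage_def continuous_intros)

text \<open>The building blocks of all changes of fibre coordinates: the chart change, and the
  derivatives of the total and base changes in both directions applied to smoothly varying
  vectors.\<close>

lemma smooth_dom_of:
  fixes u :: "'e \<times> 'h \<times> 'w::real_normed_vector \<Rightarrow> 'e \<times> 'h" and t :: "'e \<times> 'h \<times> 'w \<Rightarrow> 'e"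
  assumes "(a, c) \<in> adapted M B \<pi>" "(a', c') \<in> adapted M B \<pi>"
  shows "smooth_on (dom_of c c') (\<lambda>y :: 'e \<times> 'h \<times> 'w. (fst y, fst (snd y)))"
    "smooth_on (dom_of c c') (\<lambda>y :: 'e \<times> 'h \<times> 'w. transition c c' (fst y, fst (snd y)))"
    "smooth_on (dom_of c c') u \<Longrightarrow> smooth_on (dom_of c c')
      (\<lambda>y. D (transition c c') (fst y, fst (snd y)) (u y))"
    "smooth_on (dom_of c c') u \<Longrightarrow> smooth_on (dom_of c c')
      (\<lambda>y. D (transition c' c) (transition c c' (fst y, fst (snd y))) (u y))"
    "smooth_on (dom_of c c') t \<Longrightarrow> smooth_on (dom_of c c')
      (\<lambda>y. D (transition a' a) (fst (transition c c' (fst y, fst (snd y)))) (t y))"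
    "smooth_on (dom_of c c') t \<Longrightarrow> smooth_on (dom_of c c') (\<lambda>y. D (transition a a') (fst y) (t y))"
proof -
  note cc = adaptedD(2)[OF assms(1)] adaptedD(2)[OF assms(2)]
  note aa = adaptedD(1)[OF assms(1)] adaptedD(1)[OF assms(2)]
  note op = open_dom_of[OF assms, where 'w = 'w]
  show 1: "smooth_on (dom_of c c') (\<lambda>y :: 'e \<times> 'h \<times> 'w. (fst y, fst (snd y)))"
    by (intro smooth_on_Pair smooth_on_fst smooth_on_snd op smooth_on_id)
  show 2: "smooth_on (dom_of c c') (\<lambda>y :: 'e \<times> 'h \<times> 'w. transition c c' (fst y, fst (snd y)))"
    by (rule smooth_on_compose[OF fdim_total op transition_rep(2)[OF B cc] 1]) auto
  have img: "fst (snd d b) \<in> snd a0 ` (fst a0 \<inter> fst a1)"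
    if "(a0, d) \<in> adapted M B \<pi>" "(a1, d') \<in> adapted M B \<pi>" "b \<in> fst d" "b \<in> fst d'" for a0 a1 d d' b
    using adaptedD(3,4)[OF that(1,3)] adaptedD(3)[OF that(2,4)] by auto
  have base: "fst y \<in> snd a ` (fst a \<inter> fst a')" if "y \<in> dom_of c c'" for y :: "'e \<times> 'h \<times> 'w"
  proof -
    obtain b where "b \<in> fst c" "b \<in> fst c'" "(fst y, fst (snd y)) = snd c b"
      using \<open>y \<in> dom_of c c'\<close> by auto
    then show ?thesis using img[OF assms, of b] by (metis fst_conv)
  qed
  show "smooth_on (dom_of c c') (\<lambda>y. D (transition c c') (fst y, fst (snd y)) (u y))"
    if "smooth_on (dom_of c c') u" for u :: "'e \<times> 'h \<times> 'w \<Rightarrow> 'e \<times> 'h"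
    by (rule smooth_on_D_apply[OF fdim_total op transition_rep(2)[OF B cc] 1 _ that]) auto
  show "smooth_on (dom_of c c') (\<lambda>y. D (transition c' c) (transition c c' (fst y, fst (snd y))) (u y))"
    if "smooth_on (dom_of c c') u" for u :: "'e \<times> 'h \<times> 'w \<Rightarrow> 'e \<times> 'h"
    by (rule smooth_on_D_apply[OF fdim_total op transition_rep(2)[OF B cc(2,1)] 2 _ that])
      (use transition_rep(3)[OF B cc] in auto)
  show "smooth_on (dom_of c c') (\<lambda>y. D (transition a' a) (fst (transition c c' (fst y, fst (snd y)))) (t y))"
    if "smooth_on (dom_of c c') t" for t :: "'e \<times> 'h \<times> 'w \<Rightarrow> 'e"
    by (rule smooth_on_D_apply[OF fdim_euclidean op transition_rep(2)[OF M aa(2,1)] smooth_on_fst[OF op 2] _ that])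
      (use transition_rep(3)[OF B cc] img[OF assms(2,1)] in auto)
  show "smooth_on (dom_of c c') (\<lambda>y. D (transition a a') (fst y) (t y))"
    if "smooth_on (dom_of c c') t" for t :: "'e \<times> 'h \<times> 'w \<Rightarrow> 'e"
    by (rule smooth_on_D_apply[OF fdim_euclidean op transition_rep(2)[OF M aa] smooth_on_fst[OF op smooth_on_id] _ that])
      (use base in blast)
qed

end

text \<open>A bundle over the total space of an adapted bundle whose fibre over \<open>b\<close> is parametrized, for every
  adapted chart around \<open>b\<close>, by \<open>K\<close>; \<open>k\<close> is the coordinate map and \<open>R\<close> the change of fibre
  coordinates.\<close>

locale fibred_atlas = adapted_bundle M B \<pi>
  for M :: "('m, 'e::euclidean_space) atlas" and B :: "('b, 'e \<times> 'h::real_normed_vector) atlas"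
    and \<pi> :: "'b \<Rightarrow> 'm" +
  fixes X :: "('b \<times> 'y) set"
    and k :: "('m, 'e) chart \<Rightarrow> ('b, 'e \<times> 'h) chart \<Rightarrow> 'b \<times> 'y \<Rightarrow> 'e \<times> 'h \<times> 'w::real_normed_vector"
    and K :: "('m, 'e) chart \<Rightarrow> ('b, 'e \<times> 'h) chart \<Rightarrow> 'b \<Rightarrow> 'w \<Rightarrow> 'b \<times> 'y"
    and R :: "('m, 'e) chart \<Rightarrow> ('b, 'e \<times> 'h) chart \<Rightarrow> ('m, 'e) chart \<Rightarrow> ('b, 'e \<times> 'h) chart
      \<Rightarrow> 'e \<times> 'h \<Rightarrow> 'w \<Rightarrow> 'w"
  assumes fdim_param: "fdim TYPE('w)"
    and base: "x \<in> X \<Longrightarrow> fst x \<in> points B"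
    and fst_K: "fst (K a c b w) = b"
    and K_in: "(a, c) \<in> adapted M B \<pi> \<Longrightarrow> b \<in> fst c \<Longrightarrow> K a c b w \<in> X"
    and K_onto: "(a, c) \<in> adapted M B \<pi> \<Longrightarrow> x \<in> X \<Longrightarrow> fst x \<in> fst c \<Longrightarrow> \<exists>w. x = K a c (fst x) w"
    and k_K: "(a, c) \<in> adapted M B \<pi> \<Longrightarrow> b \<in> fst c \<Longrightarrow>
      k a c (K a c b w) = (fst (snd c b), snd (snd c b), w)"
    and K_change: "(a, c) \<in> adapted M B \<pi> \<Longrightarrow> (a', c') \<in> adapted M B \<pi> \<Longrightarrow> b \<in> fst c \<Longrightarrow> b \<in> fst c' \<Longrightarrow>
      K a c b w = K a' c' b (R a c a' c' (snd c b) w)"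
    and smooth_R: "(a, c) \<in> adapted M B \<pi> \<Longrightarrow> (a', c') \<in> adapted M B \<pi> \<Longrightarrow>
      smooth_on (dom_of c c') (\<lambda>y. R a c a' c' (fst y, fst (snd y)) (snd (snd y)))"
begin

definition CH :: "('m, 'e) chart \<Rightarrow> ('b, 'e \<times> 'h) chart \<Rightarrow> ('b \<times> 'y, 'e \<times> 'h \<times> 'w) chart" where
  "CH a c = ({x \<in> X. fst x \<in> fst c}, k a c)"

definition AT :: "('b \<times> 'y, 'e \<times> 'h \<times> 'w) atlas" where
  "AT = max_atlas X {CH a c | a c. (a, c) \<in> adapted M B \<pi>}"

lemma CH_cases:
  assumes "(a, c) \<in> adapted M B \<pi>" "x \<in> fst (CH a c)"
  obtains b w where "b \<in> fst c" "x = K a c b w"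
  using K_onto[OF assms(1), of x] assms(2) that unfolding CH_def by auto

lemma K_in_CH: "(a, c) \<in> adapted M B \<pi> \<Longrightarrow> b \<in> fst c \<Longrightarrow> K a c b w \<in> fst (CH a c)"
  by (simp add: CH_def K_in fst_K)

lemma snd_CH: "(a, c) \<in> adapted M B \<pi> \<Longrightarrow> b \<in> fst c \<Longrightarrow>
    snd (CH a c) (K a c b w) = (fst (snd c b), snd (snd c b), w)"
  by (simp add: CH_def k_K)

text \<open>The fibre coordinate ranges over all of \<open>'w\<close>, so images are full cylinders
  over parts of \<open>img c\<close>. The set \<open>S\<close> covers both the whole chart and its
  overlap with another one.\<close>

lemma img_CH:
  assumes "(a, c) \<in> adapted M B \<pi>"
  shows "snd (CH a c) ` {x \<in> fst (CH a c). fst x \<in> S} = {y. (fst y, fst (snd y)) \<in> snd c ` (fst c \<inter> S)}"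
proof (intro equalityI subsetI)
  fix y assume "y \<in> snd (CH a c) ` {x \<in> fst (CH a c). fst x \<in> S}"
  then obtain x where x: "x \<in> fst (CH a c)" "fst x \<in> S" "y = snd (CH a c) x" by blast
  obtain b w where "b \<in> fst c" "x = K a c b w" using CH_cases[OF assms x(1)] .
  then show "y \<in> {y. (fst y, fst (snd y)) \<in> snd c ` (fst c \<inter> S)}"
    using x snd_CH[OF assms] fst_K by auto
next
  fix y :: "'e \<times> 'h \<times> 'w" assume "y \<in> {y. (fst y, fst (snd y)) \<in> snd c ` (fst c \<inter> S)}"
  then obtain b where b: "b \<in> fst c" "b \<in> S" "(fst y, fst (snd y)) = snd c b" by auto
  then have "y = snd (CH a c) (K a c b (snd (snd y)))"
    using snd_CH[OF assms b(1)] by (metis fst_conv prod.collapse snd_conv)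
  then show "y \<in> snd (CH a c) ` {x \<in> fst (CH a c). fst x \<in> S}"
    using K_in_CH[OF assms b(1)] b fst_K by (metis (mono_tags, lifting) image_eqI mem_Collect_eq)
qed

lemma img_CH_all:
  assumes "(a, c) \<in> adapted M B \<pi>"
  shows "img (CH a c) = {y. (fst y, fst (snd y)) \<in> img c}"
  using img_CH[OF assms, of UNIV] by simp

lemma inj_CH:
  assumes "(a, c) \<in> adapted M B \<pi>"
  shows "inj_on (snd (CH a c)) (fst (CH a c))"
proof (rule inj_onI)
  fix x y assume xy: "x \<in> fst (CH a c)" "y \<in> fst (CH a c)" "snd (CH a c) x = snd (CH a c) y"
  obtain b w where 1: "b \<in> fst c" "x = K a c b w" using CH_cases[OF assms xy(1)] .
  obtain b' w' where 2: "b' \<in> fst c" "y = K a c b' w'" using CH_cases[OF assms xy(2)] .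
  have "snd c b = snd c b'" "w = w'" using xy(3) 1 2 snd_CH[OF assms] by (simp_all add: prod_eq_iff)
  then show "x = y" using chart_inj[OF B adaptedD(2)[OF assms] 1(1) 2(1)] 1 2 by simp
qed

lemma is_chart_CH:
  assumes "(a, c) \<in> adapted M B \<pi>"
  shows "is_chart_in X (CH a c)"
  using inj_CH[OF assms] open_dom_of[OF assms assms, where 'w = 'w]
  by (simp add: is_chart_in_def img_CH_all[OF assms]) (simp add: CH_def)

lemma transition_CH:
  assumes "(a, c) \<in> adapted M B \<pi>" "(a', c') \<in> adapted M B \<pi>" "b \<in> fst c" "b \<in> fst c'"
  shows "transition (CH a c) (CH a' c') (fst (snd c b), snd (snd c b), w)
    = (fst (snd c' b), snd (snd c' b), R a c a' c' (snd c b) w)"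
proof -
  have "transition (CH a c) (CH a' c') (snd (CH a c) (K a c b w)) = snd (CH a' c') (K a c b w)"
    by (rule transition_chart[OF is_chart_CH[OF assms(1)] K_in_CH[OF assms(1,3)]])
  then show ?thesis
    using snd_CH[OF assms(1,3)] snd_CH[OF assms(2,4)] K_change[OF assms] by simp
qed

lemma smooth_transition_CH:
  assumes ac: "(a, c) \<in> adapted M B \<pi>" and ac': "(a', c') \<in> adapted M B \<pi>"
  shows "smooth_transition (CH a c) (CH a' c')"
proof -
  have eq: "snd (CH a c) ` (fst (CH a c) \<inter> fst (CH a' c')) = dom_of c c'"
    using img_CH[OF ac, of "fst c'"] by (simp add: CH_def Int_def conj_assoc conj_left_commute cong: conj_cong)
  note op = open_dom_of[OF ac ac']
  note cc = adaptedD(2)[OF ac] adaptedD(2)[OF ac']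
  have "smooth_on (dom_of c c') (\<lambda>y. (fst (transition c c' (fst y, fst (snd y))),
      snd (transition c c' (fst y, fst (snd y))), R a c a' c' (fst y, fst (snd y)) (snd (snd y))))"
    by (intro smooth_on_Pair smooth_on_fst smooth_on_snd op smooth_dom_of(2)[OF ac ac'] smooth_R[OF ac ac'])
  then have "smooth_on (dom_of c c') (transition (CH a c) (CH a' c'))"
  proof (rule smooth_on_cong[OF op])
    fix y :: "'e \<times> 'h \<times> 'w" assume "y \<in> dom_of c c'"
    then obtain b where b: "b \<in> fst c" "b \<in> fst c'" "(fst y, fst (snd y)) = snd c b" by auto
    then have y: "y = (fst (snd c b), snd (snd c b), snd (snd y))" by (metis fst_conv prod.collapse snd_conv)
    have "transition (CH a c) (CH a' c') y = (fst (snd c' b), snd (snd c' b), R a c a' c' (snd c b) (snd (snd y)))"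
      by (subst y) (rule transition_CH[OF ac ac' b(1,2)])
    then show "(fst (transition c c' (fst y, fst (snd y))), snd (transition c c' (fst y, fst (snd y))),
        R a c a' c' (fst y, fst (snd y)) (snd (snd y))) = transition (CH a c) (CH a' c') y"
      using b transition_rep(3)[OF B cc b(1)] by simp
  qed
  then show ?thesis unfolding smooth_transition_def eq using op by blast
qed

lemma AT_maximal:
  shows CH_in_AT: "(a, c) \<in> adapted M B \<pi> \<Longrightarrow> CH a c \<in> AT"
    and points_AT: "points AT = X" and maxatlas_AT: "maxatlas AT"
proof -
  have fd: "fdim TYPE('e \<times> 'h \<times> 'w)" using fdim_fibre fdim_param by simp
  have cov: "\<exists>C\<in>{CH a c | a c. (a, c) \<in> adapted M B \<pi>}. x \<in> fst C" if x: "x \<in> X" for x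
  proof -
    obtain a c where "(a, c) \<in> adapted M B \<pi>" "fst x \<in> fst c" using cover[OF base[OF x]] by blast
    then show ?thesis using x by (intro bexI[of _ "CH a c"]) (auto simp: CH_def)
  qed
  have ch: "is_chart_in X C" if "C \<in> {CH a c | a c. (a, c) \<in> adapted M B \<pi>}" for C
    using that is_chart_CH by blast
  have co: "smooth_transition C C'" if "C \<in> {CH a c | a c. (a, c) \<in> adapted M B \<pi>}"
    "C' \<in> {CH a c | a c. (a, c) \<in> adapted M B \<pi>}" for C C'
    using that smooth_transition_CH by blast
  note m = max_atlas_maximal[OF fd ch co cov, folded AT_def]
  show "(a, c) \<in> adapted M B \<pi> \<Longrightarrow> CH a c \<in> AT" using m(1) by blast
  show "points AT = X" "maxatlas AT" using m(2,3) by auto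
qed

lemma CH_adapted:
  assumes "(a, c) \<in> adapted M B \<pi>"
  shows "(a, CH a c) \<in> adapted M AT (\<lambda>x. \<pi> (fst x))"
proof -
  have "fst x \<in> fst c" if "x \<in> fst (CH a c)" for x using that by (simp add: CH_def)
  moreover have "fst (snd (CH a c) x) = snd a (\<pi> (fst x))" if x: "x \<in> fst (CH a c)" for x
  proof -
    obtain b w where "b \<in> fst c" "x = K a c b w" using CH_cases[OF assms x] .
    then show ?thesis using snd_CH[OF assms] adaptedD(4)[OF assms] fst_K by simp
  qed
  ultimately show ?thesis
    using adaptedD(1,3)[OF assms] CH_in_AT[OF assms] by (auto simp: adapted_def)
qed

text \<open>Closes the loop: the new total space satisfies the hypotheses under which a further
  bundle can be built over it.\<close>

lemma adapted_bundle_AT: "adapted_bundle M AT (\<lambda>x. \<pi> (fst x))"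
proof
  show "maxatlas M" by (rule M)
  show "maxatlas AT" by (rule maxatlas_AT)
  show "fdim TYPE('h \<times> 'w)" using fdim_fibre fdim_param by simp
  fix x assume x: "x \<in> points AT"
  then obtain a c where "(a, c) \<in> adapted M B \<pi>" "fst x \<in> fst c"
    using cover[OF base] points_AT by blast
  then show "\<exists>a C. (a, C) \<in> adapted M AT (\<lambda>x. \<pi> (fst x)) \<and> x \<in> fst C"
    using CH_adapted x points_AT by (intro exI[of _ a] exI[of _ "CH a c"]) (auto simp: CH_def)
qed

end

section \<open>The first jet bundle\<close>

context adapted_bundle
begin

text \<open>In coordinates the jet is the graph of \<open>w\<close>. The value 0 off the tangent
  space agrees with \<open>jet_of\<close>, so that equal jets are equal as functions.\<close>

definition jet_at :: "('m, 'e) chart \<Rightarrow> ('b, 'e \<times> 'h) chart \<Rightarrow> 'b \<Rightarrow> ('e \<Rightarrow>\<^sub>L 'h) \<Rightarrow> ('m, 'e, 'b, 'h) jet" where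
  "jet_at a c b w = (b, \<lambda>v. if v \<in> tangent_space M (\<pi> b)
     then tvec_of B c b (v a, blinfun_apply w (v a)) else (\<lambda>_. 0))"

lemma fst_jet_at [simp]: "fst (jet_at a c b w) = b"
  by (simp add: jet_at_def)

lemma smooth_near_local_section:
  assumes s: "local_section M B \<pi> U s" and x: "x \<in> U"
  shows "smooth_near M B s x"
proof -
  have "openin (mfd_topology M) U" using s by (simp add: local_section_def)
  then have "smooth_near (open_submanifold M U) B s x"
    using s x open_submanifold_maxatlas(2)[OF M] by (simp add: local_section_def smooth_map_near)
  then show ?thesis by (rule smooth_near_open_submanifold)
qed

text \<open>The section condition makes the base component of the derivative the identity; its fibre
  component is the required \<open>w\<close>.\<close>

lemma jet_of_eq_jet_at:
  assumes ac: "(a, c) \<in> adapted M B \<pi>" and s: "local_section M B \<pi> U s" and x: "x \<in> U" "s x \<in> fst c"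
  shows "\<exists>w. jet_of M B s x = jet_at a c (s x) w"
proof -
  have U: "openin (mfd_topology M) U" and \<pi>s: "\<And>y. y \<in> U \<Longrightarrow> \<pi> (s y) = y"
    using s by (auto simp: local_section_def)
  have sm: "smooth_near M B s x" by (rule smooth_near_local_section[OF s x(1)])
  have \<pi>x: "\<pi> (s x) = x" using \<pi>s x by blast
  note cs = adaptedD(5,6)[OF ac x(2)]
  have a: "a \<in> charts_at M x" using cs \<pi>x by simp
  have aM: "a \<in> M" "x \<in> fst a" "c \<in> B" using a adaptedD[OF ac] by (auto simp: charts_at_iff)
  obtain W where W: "open W" "snd a x \<in> W" "W \<subseteq> img a" "\<And>z. z \<in> W \<Longrightarrow> s (cinv a z) \<in> fst c"
    "smooth_on W (snd c \<circ> s \<circ> cinv a)"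
    using smooth_near_rep[OF M B sm aM(1,2,3) x(2)] by metis
  let ?h = "snd c \<circ> s \<circ> cinv a"
  let ?d = "D ?h (snd a x)"
  have hd: "(?h has_derivative ?d) (at (snd a x))" using smooth_on_has_derivative[OF W(5,2)] .
  have "fst (?d v) = v" for v
  proof -
    have "((\<lambda>z. fst (?h z)) has_derivative (\<lambda>v. v)) (at (snd a x))"
    proof (rule has_derivative_transform_within_open[OF has_derivative_ident])
      show "open (W \<inter> snd a ` (fst a \<inter> U))" using W(1) U aM(1) openin_mfd[OF M] by blast
      show "snd a x \<in> W \<inter> snd a ` (fst a \<inter> U)" using W aM x by blast
      fix z assume z: "z \<in> W \<inter> snd a ` (fst a \<inter> U)"
      then obtain y where y: "y \<in> fst a" "y \<in> U" "z = snd a y" by blast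
      have "cinv a z = y" using y cinv_chart[OF maxatlasD(1)[OF M aM(1)]] by simp
      then show "z = fst (?h z)"
        using z y W(4)[of z] adaptedD(4)[OF ac, of "s y"] \<pi>s[of y] by simp
    qed
    then show ?thesis using has_derivative_unique[OF has_derivative_fst[OF hd]] by metis
  qed
  then have d: "?d v = (v, snd (?d v))" for v by (metis prod.collapse)
  have bl: "bounded_linear (\<lambda>v. snd (?d v))"
    using bounded_linear_compose[OF bounded_linear_snd has_derivative_bounded_linear[OF hd]] .
  define w where "w = Blinfun (\<lambda>v. snd (?d v))"
  have w: "blinfun_apply w v = snd (?d v)" for v
    using bounded_linear_Blinfun_apply[OF bl] by (simp add: w_def)
  have "tangent_map M B s x v = tvec_of B c (s x) (v a, blinfun_apply w (v a))" if v: "v \<in> tangent_space M x" for v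
  proof (rule tangent_eqI[OF tangent_map_in[OF M B sm v] tvec_of(1)[OF B cs(2)] cs(2)])
    show "tangent_map M B s x v c = tvec_of B c (s x) (v a, blinfun_apply w (v a)) c"
      unfolding tvec_of(2)[OF B cs(2)] tangent_map_chart[OF M B sm v a cs(2)] w by (rule d)
  qed
  then have "jet_of M B s x = jet_at a c (s x) w"
    by (auto simp: jet_of_def jet_at_def \<pi>x fun_eq_iff)
  then show ?thesis by blast
qed

text \<open>The jet is realised by the section that is affine with slope \<open>w\<close> in the
  chart, over the part of the base where its graph stays in the image of the chart.\<close>

lemma jet_at_in_J1:
  assumes ac: "(a, c) \<in> adapted M B \<pi>" and b: "b \<in> fst c"
  shows "jet_at a c b w \<in> J1_points M B \<pi>"
proof -
  note aM = adaptedD[OF ac]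
  define x0 where "x0 = fst (snd c b)"
  define f0 where "f0 = snd (snd c b)"
  define g where "g z = (z, f0 + blinfun_apply w (z - x0))" for z
  have gd: "(g has_derivative (\<lambda>v. (v, blinfun_apply w v))) (at z)" for z
    unfolding g_def by (auto intro!: derivative_eq_intros bounded_linear.has_derivative[OF blinfun.bounded_linear_right])
  have gs: "smooth_on S g" if "open S" for S
  proof -
    have "smooth_on S (\<lambda>z. (z, (f0 - blinfun_apply w x0) + blinfun_apply w z))"
      using that smooth_on_linear[OF blinfun.bounded_linear_right that smooth_on_id]
      unfolding smooth_on_def by (auto intro!: Ck_on_Pair Ck_on_add)
    then show ?thesis
      by (rule smooth_on_cong[OF that]) (simp add: g_def blinfun.diff_right)
  qed
  define W where "W = {z. g z \<in> img c}"
  have "open W"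
    using open_vimage[OF open_img[OF B aM(2)], of g] smooth_on_continuous[OF gs[OF open_UNIV]]
    by (simp add: W_def vimage_def)
  define r where "r = ({p \<in> fst a. snd a p \<in> W}, snd a)"
  have r: "r \<in> M" unfolding r_def by (rule restrict_chart[OF M aM(1) \<open>open W\<close>])
  define s where "s y = cinv c (g (snd a y))" for y
  let ?x = "\<pi> b"
  have x0: "x0 = snd a ?x" using aM(4)[OF b] by (simp add: x0_def)
  have g0: "g (snd a ?x) = snd c b" by (simp add: g_def x0 [symmetric] x0_def f0_def blinfun.zero_right)
  have x: "?x \<in> fst r" using aM(3)[OF b] b g0 by (simp add: r_def W_def)
  have sx: "s ?x = b" using g0 b ac by (simp add: s_def)
  have sc: "s y \<in> fst c" "snd c (s y) = g (snd a y)" if "y \<in> fst r" for y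
    using that cinv_in[of "g (snd a y)" c] chart_cinv[of "g (snd a y)" c] by (auto simp: s_def r_def W_def)
  have \<pi>s: "\<pi> (s y) = y" if y: "y \<in> fst r" for y
  proof (rule chart_inj[OF M aM(1)])
    show "\<pi> (s y) \<in> fst a" using aM(3)[OF sc(1)[OF y]] .
    show "y \<in> fst a" using y by (simp add: r_def)
    show "snd a (\<pi> (s y)) = snd a y" using aM(4)[OF sc(1)[OF y]] sc(2)[OF y] by (simp add: g_def)
  qed
  have rep: "(snd c \<circ> s \<circ> cinv r) z = g z" if z: "z \<in> img r" for z
  proof -
    have "cinv r z \<in> fst r" "snd r (cinv r z) = z" using cinv_in[OF z] chart_cinv[OF z] by auto
    then show ?thesis using sc(2) by (simp add: r_def)
  qed
  have opr: "open (img r)" by (rule open_img[OF M r])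
  have smr: "smooth_on (img r) (snd c \<circ> s \<circ> cinv r)"
    by (rule smooth_on_cong[OF opr gs[OF opr]]) (simp only: rep)
  have ls: "local_section M B \<pi> (fst r) s"
    unfolding local_section_def smooth_map_near
  proof (intro conjI ballI \<pi>s)
    show op: "openin (mfd_topology M) (fst r)" by (rule openin_chart_domain[OF M r])
    fix p assume "p \<in> points (open_submanifold M (fst r))"
    then have p: "p \<in> fst r" using open_submanifold_maxatlas(2)[OF M op] by simp
    have "r \<in> open_submanifold M (fst r)" using r by (simp add: open_submanifold_def)
    then show "smooth_near (open_submanifold M (fst r)) B s p"
      unfolding smooth_near_def using p aM(2) sc(1) smr by blast
  qed
  have sm: "smooth_near M B s ?x"
    unfolding smooth_near_def using r x aM(2) sc(1) smr by blast
  have rx: "r \<in> charts_at M ?x" using r x by (simp add: charts_at_iff)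
  have ax: "a \<in> charts_at M ?x" using aM(5)[OF b] .
  have cx: "c \<in> charts_at B (s ?x)" using aM(6)[OF b] sx by simp
  have Dr: "D (snd c \<circ> s \<circ> cinv r) (snd r ?x) v = (v, blinfun_apply w v)" for v
  proof -
    have "((snd c \<circ> s \<circ> cinv r) has_derivative (\<lambda>v. (v, blinfun_apply w v))) (at (snd r ?x))"
      by (rule has_derivative_transform_within_open[OF gd opr]) (use x rep in auto)
    then show ?thesis using D_eqI by metis
  qed
  have "tangent_map M B s ?x v = tvec_of B c b (v a, blinfun_apply w (v a))" if v: "v \<in> tangent_space M ?x" for v
  proof -
    \<comment> \<open>\<open>r\<close> has the coordinate function of \<open>a\<close>, so a vector
      has the same component in both.\<close>
    have "transition a r z = transition a a z" for z by (simp add: transition_def r_def)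
    then have "transition a r = transition a a" by blast
    then have va: "v r = v a"
      using tangentD[OF v ax rx] tangentD[OF v ax ax] by simp
    have "tangent_map M B s ?x v c = (v a, blinfun_apply w (v a))"
      using tangent_map_chart[OF M B sm v rx cx] Dr va by simp
    then show ?thesis
      using tvec_of_eq[OF B cx tangent_map_in[OF M B sm v]] sx by simp
  qed
  then have "jet_of M B s ?x = jet_at a c b w"
    by (auto simp: jet_of_def jet_at_def sx fun_eq_iff)
  then show ?thesis unfolding J1_points_def using ls x by force
qed

lemma jet_at_coord:
  assumes ac: "(a, c) \<in> adapted M B \<pi>" and b: "b \<in> fst c"
  shows "snd (J1_chart M B \<pi> a c) (jet_at a c b w) = (fst (snd c b), snd (snd c b), w)"
proof -
  note cs = adaptedD(5,6)[OF ac b]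
  have "snd (snd (jet_at a c b w) (tvec_of M a (\<pi> b) u) c) = blinfun_apply w u" for u
    using tvec_of[OF M cs(1)] tvec_of(2)[OF B cs(2)] by (simp add: jet_at_def)
  then have "(\<lambda>u. snd (snd (jet_at a c b w) (tvec_of M a (\<pi> b) u) c)) = blinfun_apply w" by blast
  then show ?thesis by (simp add: J1_chart_def J1_proj_def blinfun_apply_inverse)
qed

text \<open>The image of the graph of \<open>w\<close> under the derivative of the chart change,
  parametrised over the new base; \<open>u'\<close> is the base vector \<open>u\<close> in old
  coordinates.\<close>

definition jet_change :: "('m, 'e) chart \<Rightarrow> ('b, 'e \<times> 'h) chart \<Rightarrow> ('m, 'e) chart \<Rightarrow> ('b, 'e \<times> 'h) chart
    \<Rightarrow> 'e \<times> 'h \<Rightarrow> ('e \<Rightarrow>\<^sub>L 'h) \<Rightarrow> ('e \<Rightarrow>\<^sub>L 'h)" where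
  "jet_change a c a' c' z w = Blinfun (\<lambda>u.
     let u' = D (transition a' a) (fst (transition c c' z)) u
     in snd (D (transition c c') z (u', blinfun_apply w u')))"

lemma jet_change_apply:
  assumes ac: "(a, c) \<in> adapted M B \<pi>" and ac': "(a', c') \<in> adapted M B \<pi>" and b: "b \<in> fst c" "b \<in> fst c'"
  shows "blinfun_apply (jet_change a c a' c' (snd c b) w) u =
    (let u' = D (transition a' a) (fst (transition c c' (snd c b))) u
     in snd (D (transition c c') (snd c b) (u', blinfun_apply w u')))"
proof -
  have eq: "fst (transition c c' (snd c b)) = snd a' (\<pi> b)"
    using transition_rep(3)[OF B adaptedD(2)[OF ac] adaptedD(2)[OF ac'] b(1)] adaptedD(4)[OF ac' b(2)] by simp
  note l1 = linear_D_base[OF ac' ac b(2,1), folded eq] and l2 = linear_D_total[OF ac ac' b]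
  have lw: "linear (\<lambda>u. (u, blinfun_apply w u))"
    by (intro linearI) (simp_all add: blinfun.add_right blinfun.scaleR_right)
  have "linear (\<lambda>u. let u' = D (transition a' a) (fst (transition c c' (snd c b))) u
     in snd (D (transition c c') (snd c b) (u', blinfun_apply w u')))"
    using linear_compose[OF linear_compose[OF linear_compose[OF l1 lw] l2] linear_snd]
    by (simp add: o_def Let_def)
  then show ?thesis
    unfolding jet_change_def by (simp only: bounded_linear_Blinfun_apply[OF linear_imp_bounded_linear[OF fdim_euclidean]])
qed

text \<open>The derivative of the chart change carries the graph of \<open>w\<close> to the graph of
  the new jet. In this form the inverse base Jacobian has disappeared, which makes it suitable for
  differentiation.\<close>

lemma jet_change_D:
  assumes ac: "(a, c) \<in> adapted M B \<pi>" and ac': "(a', c') \<in> adapted M B \<pi>" and b: "b \<in> fst c" "b \<in> fst c'"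
  shows "D (transition c c') (snd c b) (u, blinfun_apply w u) =
    (let u' = D (transition a a') (snd a (\<pi> b)) u in (u', blinfun_apply (jet_change a c a' c' (snd c b) w) u'))"
proof -
  have eq: "fst (transition c c' (snd c b)) = snd a' (\<pi> b)"
    using transition_rep(3)[OF B adaptedD(2)[OF ac] adaptedD(2)[OF ac'] b(1)] adaptedD(4)[OF ac' b(2)] by simp
  show ?thesis
    using D_transition_fst[OF ac ac' b, of "(u, blinfun_apply w u)"] adaptedD(4)[OF ac b(1)]
      D_base_inverse[OF ac ac' b]
    by (simp add: jet_change_apply[OF ac ac' b] Let_def eq prod_eq_iff)
qed

lemma jet_at_change:
  assumes ac: "(a, c) \<in> adapted M B \<pi>" and ac': "(a', c') \<in> adapted M B \<pi>" and b: "b \<in> fst c" "b \<in> fst c'"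
  shows "jet_at a c b w = jet_at a' c' b (jet_change a c a' c' (snd c b) w)"
proof -
  note cs = adaptedD(5,6)[OF ac b(1)] and cs' = adaptedD(5,6)[OF ac' b(2)]
  have "tvec_of B c b (v a, blinfun_apply w (v a)) =
    tvec_of B c' b (v a', blinfun_apply (jet_change a c a' c' (snd c b) w) (v a'))"
    if v: "v \<in> tangent_space M (\<pi> b)" for v
  proof (rule tangent_eqI[OF tvec_of(1)[OF B cs(2)] tvec_of(1)[OF B cs'(2)] cs'(2)])
    have "tvec_of B c b (v a, blinfun_apply w (v a)) c' = D (transition c c') (snd c b) (v a, blinfun_apply w (v a))"
      using tangentD[OF tvec_of(1)[OF B cs(2)] cs(2) cs'(2)] tvec_of(2)[OF B cs(2)] by simp
    also have "\<dots> = (v a', blinfun_apply (jet_change a c a' c' (snd c b) w) (v a'))"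
      using jet_change_D[OF ac ac' b, of "v a" w] tangentD[OF v cs(1) cs'(1)] by (simp add: Let_def)
    finally show "tvec_of B c b (v a, blinfun_apply w (v a)) c'
      = tvec_of B c' b (v a', blinfun_apply (jet_change a c a' c' (snd c b) w) (v a')) c'"
      using tvec_of(2)[OF B cs'(2)] by simp
  qed
  then show ?thesis unfolding jet_at_def by (auto simp: fun_eq_iff)
qed

lemma smooth_jet_change:
  assumes ac: "(a, c) \<in> adapted M B \<pi>" and ac': "(a', c') \<in> adapted M B \<pi>"
  shows "smooth_on (dom_of c c') (\<lambda>y. jet_change a c a' c' (fst y, fst (snd y)) (snd (snd y)))"
proof (rule smooth_on_blinfunI[OF fdim_euclidean open_dom_of[OF ac ac']])
  fix u
  note op = open_dom_of[OF ac ac', where 'w = "'e \<Rightarrow>\<^sub>L 'h"]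
  have 1: "smooth_on (dom_of c c') (\<lambda>y :: 'e \<times> 'h \<times> ('e \<Rightarrow>\<^sub>L 'h).
      D (transition a' a) (fst (transition c c' (fst y, fst (snd y)))) u)"
    by (rule smooth_dom_of(5)[OF ac ac' smooth_on_const])
  show "smooth_on (dom_of c c') (\<lambda>y. blinfun_apply (jet_change a c a' c' (fst y, fst (snd y)) (snd (snd y))) u)"
  proof (rule smooth_on_cong[OF op smooth_on_snd[OF op smooth_dom_of(3)[OF ac ac' smooth_on_Pair[OF op 1
          smooth_on_blinfun_apply[OF op smooth_on_snd[OF op smooth_on_snd[OF op smooth_on_id]] 1]]]]])
    fix y :: "'e \<times> 'h \<times> ('e \<Rightarrow>\<^sub>L 'h)" assume "y \<in> dom_of c c'"
    then obtain b where b: "b \<in> fst c" "b \<in> fst c'" "(fst y, fst (snd y)) = snd c b" by auto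
    show "snd (D (transition c c') (fst y, fst (snd y)) (D (transition a' a) (fst (transition c c' (fst y, fst (snd y)))) u,
        blinfun_apply (snd (snd y)) (D (transition a' a) (fst (transition c c' (fst y, fst (snd y)))) u)))
      = blinfun_apply (jet_change a c a' c' (fst y, fst (snd y)) (snd (snd y))) u"
      unfolding b(3) jet_change_apply[OF ac ac' b(1,2)] by (simp add: Let_def)
  qed
qed

lemma fibred_atlas_J1:
  "fibred_atlas M B \<pi> (J1_points M B \<pi>) (\<lambda>a c. snd (J1_chart M B \<pi> a c)) jet_at jet_change"
proof
  show "fdim TYPE('e \<Rightarrow>\<^sub>L 'h)" using fdim_fibre by simp
  fix x assume x: "x \<in> J1_points M B \<pi>"
  then obtain s y U where j: "x = jet_of M B s y" "local_section M B \<pi> U s" "y \<in> U"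
    unfolding J1_points_def by blast
  obtain d where "d \<in> B" "s y \<in> fst d"
    using smooth_near_local_section[OF j(2,3)] unfolding smooth_near_def by blast
  then show "fst x \<in> points B"
    using j(1) chart_subset_points[of d B] by (simp add: jet_of_def)
  fix a c assume "(a, c) \<in> adapted M B \<pi>" "fst x \<in> fst c"
  then show "\<exists>w. x = jet_at a c (fst x) w"
    using jet_of_eq_jet_at[OF _ j(2,3), of a c] j(1) by (simp add: jet_of_def)
qed (rule fst_jet_at jet_at_in_J1 jet_at_coord jet_at_change smooth_jet_change; assumption)+

end

section \<open>Alternating forms in a chart\<close>

lemma linear_combinationI:
  assumes "\<And>r s x y. f (r *\<^sub>R x + s *\<^sub>R y) = r *\<^sub>R f x + s *\<^sub>R f y"
  shows "linear f"
proof (rule linearI)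
  show "f (x + y) = f x + f y" for x y using assms[of 1 x 1 y] by simp
  show "f (r *\<^sub>R x) = r *\<^sub>R f x" for r x using assms[of r x 0 x] by simp
qed

lemma nth_append_Cons_upd:
  "(us @ w # ws) ! i = (if i = length us then w else (us @ u # ws) ! i)"
  by (auto simp: nth_append nth_Cons split: nat.split)

lemma tvec_of_lincomb:
  assumes A: "maxatlas A" and c: "c \<in> charts_at A p"
  shows "tvec_of A c p (r *\<^sub>R u + s *\<^sub>R v) = lincomb r (tvec_of A c p u) s (tvec_of A c p v)"
proof (rule tangent_eqI[OF tvec_of(1)[OF A c] tangent_lincomb[OF A tvec_of(1)[OF A c] tvec_of(1)[OF A c]] c])
  show "tvec_of A c p (r *\<^sub>R u + s *\<^sub>R v) c = lincomb r (tvec_of A c p u) s (tvec_of A c p v) c"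
    using tvec_of(2)[OF A c] by (simp add: lincomb_def)
qed

text \<open>Lifting vectors of the model space to tangent vectors translates forms on lists into
  alternating functions of sequences; \<open>alt_form_of_alternating\<close> is the way
  back.\<close>

lemma alternating_of_alt_form:
  fixes A :: "('p, 'a::real_normed_vector) atlas"
  assumes A: "maxatlas A" and c: "c \<in> charts_at A p" and \<alpha>: "\<alpha> \<in> alt_forms k (tangent_space A p)"
  shows "alternating k (\<lambda>f. \<alpha> (map (\<lambda>i. tvec_of A c p (f i)) [0..<k]))"
  unfolding alternating_def
proof (intro conjI allI impI)
  let ?l = "\<lambda>f :: nat \<Rightarrow> 'a. map (\<lambda>i. tvec_of A c p (f i)) [0..<k]"
  have tup: "?l f \<in> tuples k (tangent_space A p)" for f
    using tvec_of(1)[OF A c] by (auto simp: tuples_def)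
  have lin: "\<alpha> (us @ lincomb r u s v # ws) = r * \<alpha> (us @ u # ws) + s * \<alpha> (us @ v # ws)"
    if "us @ u # ws \<in> tuples k (tangent_space A p)" "us @ v # ws \<in> tuples k (tangent_space A p)" for us ws r u s v
    using \<alpha> that unfolding alt_forms_def by blast
  fix f :: "nat \<Rightarrow> 'a" and j assume j: "j < k"
  have split: "?l (f(j := v)) = map (\<lambda>i. tvec_of A c p (f i)) [0..<j] @ tvec_of A c p v #
      map (\<lambda>i. tvec_of A c p (f i)) [Suc j..<k]" for v
  proof -
    have "[0..<k] = [0..<j] @ j # [Suc j..<k]"
      using j upt_add_eq_append[of 0 j "k - j"] upt_conv_Cons[of j k] by simp
    then show ?thesis by simp
  qed
  have *: "\<alpha> (?l (f(j := r *\<^sub>R u + s *\<^sub>R v))) = r * \<alpha> (?l (f(j := u))) + s * \<alpha> (?l (f(j := v)))" for r s u v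
    unfolding split tvec_of_lincomb[OF A c]
    by (rule lin) (use tup[of "f(j := u)"] tup[of "f(j := v)"] in \<open>simp_all only: split\<close>)
  show "linear (\<lambda>v. \<alpha> (?l (f(j := v))))"
    by (rule linear_combinationI) (simp only: * real_scaleR_def)
next
  let ?l = "\<lambda>f :: nat \<Rightarrow> 'a. map (\<lambda>i. tvec_of A c p (f i)) [0..<k]"
  fix f :: "nat \<Rightarrow> 'a" and i j assume ij: "i < k" "j < k" "i \<noteq> j" "f i = f j"
  have "?l f ! i = ?l f ! j" using ij by simp
  then have "\<not> distinct (?l f)" using ij by (metis (no_types, lifting) length_map length_upt diff_zero nth_eq_iff_index_eq)
  moreover have "?l f \<in> tuples k (tangent_space A p)"
    using tvec_of(1)[OF A c] by (auto simp: tuples_def)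
  ultimately show "\<alpha> (?l f) = 0" using \<alpha> unfolding alt_forms_def by blast
next
  fix f g :: "nat \<Rightarrow> 'a" assume "\<forall>i<k. f i = g i"
  then have "map (\<lambda>i. tvec_of A c p (f i)) [0..<k] = map (\<lambda>i. tvec_of A c p (g i)) [0..<k]" by simp
  then show "\<alpha> (map (\<lambda>i. tvec_of A c p (f i)) [0..<k]) = \<alpha> (map (\<lambda>i. tvec_of A c p (g i)) [0..<k])" by (simp only:)
qed

lemma tuples_coordinates:
  assumes A: "maxatlas A" and c: "c \<in> charts_at A p" and vs: "vs \<in> tuples k (tangent_space A p)"
  shows "map (\<lambda>i. tvec_of A c p ((vs ! i) c)) [0..<k] = vs"
proof (rule nth_equalityI)
  show "length (map (\<lambda>i. tvec_of A c p ((vs ! i) c)) [0..<k]) = length vs"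
    using vs by (simp add: tuples_def)
  fix i assume "i < length (map (\<lambda>i. tvec_of A c p ((vs ! i) c)) [0..<k])"
  then have "vs ! i \<in> tangent_space A p" "i < k" using vs nth_mem[of i vs] by (auto simp: tuples_def)
  then show "map (\<lambda>i. tvec_of A c p ((vs ! i) c)) [0..<k] ! i = vs ! i"
    using tvec_of_eq[OF A c] by simp
qed

lemma alt_form_of_alternating:
  assumes G: "alternating k G" and V: "\<And>r u s v. u \<in> V \<Longrightarrow> v \<in> V \<Longrightarrow> lincomb r u s v \<in> V"
  shows "(\<lambda>vs. if vs \<in> tuples k V then G (\<lambda>i. (vs ! i) c) else 0) \<in> alt_forms k V"
    (is "?\<alpha> \<in> _")
proof -
  have lin: "?\<alpha> (us @ lincomb r u s v # ws) = r * ?\<alpha> (us @ u # ws) + s * ?\<alpha> (us @ v # ws)"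
    if t: "us @ u # ws \<in> tuples k V" "us @ v # ws \<in> tuples k V" for us ws r u s v
  proof -
    define g where "g i = ((us @ u # ws) ! i) c" for i
    have "(\<lambda>i. ((us @ w # ws) ! i) c) = g(length us := w c)" for w
      unfolding g_def by (rule ext) (simp add: nth_append_Cons_upd[of us w ws _ u])
    moreover have l: "linear (\<lambda>x. G (g(length us := x)))"
      using t by (intro alternatingD(1)[OF G]) (auto simp: tuples_def)
    moreover have "us @ lincomb r u s v # ws \<in> tuples k V" using t V by (auto simp: tuples_def)
    moreover have "G (g(length us := lincomb r u s v c)) = r * G (g(length us := u c)) + s * G (g(length us := v c))"
      by (simp add: lincomb_def linear_add[OF l] linear_cmul[OF l])
    ultimately show ?thesis using t by simp
  qed
  have "?\<alpha> vs = 0" if vs: "vs \<in> tuples k V" "\<not> distinct vs" for vs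
  proof -
    obtain i j where "i < k" "j < k" "i \<noteq> j" "vs ! i = vs ! j"
      using vs by (auto simp: distinct_conv_nth tuples_def)
    then have "G (\<lambda>i. (vs ! i) c) = 0" by (intro alternatingD(2)[OF G, of i j]) auto
    then show ?thesis by simp
  qed
  then show ?thesis unfolding alt_forms_def using lin by simp
qed

section \<open>Bundles of vertical covectors with values in forms\<close>

text \<open>\<open>\<Phi> p \<eta>\<close> is the \<open>k\<close>-form on the model space of the base which the covector with the
  coordinates \<open>p\<close> assigns to the vertical vector with the component \<open>\<eta>\<close>.\<close>

locale form_coordinates =
  fixes k :: nat and \<Phi> :: "'w::real_normed_vector \<Rightarrow> 'h::real_normed_vector \<Rightarrow> (nat \<Rightarrow> 'e::euclidean_space) \<Rightarrow> real"
  assumes \<Phi>_alternating: "alternating k (\<Phi> p \<eta>)"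
    and \<Phi>_linear: "\<Phi> p (r *\<^sub>R \<eta> + s *\<^sub>R \<eta>') f = r * \<Phi> p \<eta> f + s * \<Phi> p \<eta>' f"
    and \<Phi>_surj: "(\<And>\<eta>. alternating k (L \<eta>)) \<Longrightarrow>
      (\<And>r s \<eta> \<eta>' f. L (r *\<^sub>R \<eta> + s *\<^sub>R \<eta>') f = r * L \<eta> f + s * L \<eta>' f) \<Longrightarrow> \<exists>p. \<forall>\<eta> f. L \<eta> f = \<Phi> p \<eta> f"
    and \<Phi>_inj: "(\<And>\<eta> f. \<Phi> p \<eta> f = \<Phi> p' \<eta> f) \<Longrightarrow> p = p'"

locale vform_bundle = adapted_bundle M B \<pi> + form_coordinates k \<Phi>
  for M :: "('m, 'e::euclidean_space) atlas" and B :: "('b, 'e \<times> 'h::real_normed_vector) atlas"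
    and \<pi> :: "'b \<Rightarrow> 'm" and k :: nat
    and \<Phi> :: "'w::real_normed_vector \<Rightarrow> 'h \<Rightarrow> (nat \<Rightarrow> 'e) \<Rightarrow> real"
begin

definition vform_at :: "('m, 'e) chart \<Rightarrow> ('b, 'e \<times> 'h) chart \<Rightarrow> 'b \<Rightarrow> 'w \<Rightarrow> ('m, 'e, 'b, 'h) vform" where
  "vform_at a c b p = (b, \<lambda>v. if v \<in> vertical_space M B \<pi> b
     then (\<lambda>vs. if vs \<in> tuples k (tangent_space M (\<pi> b)) then \<Phi> p (snd (v c)) (\<lambda>i. (vs ! i) a) else 0)
     else (\<lambda>_. 0))"

lemma fst_vform_at [simp]: "fst (vform_at a c b p) = b"
  by (simp add: vform_at_def)

lemma vertical_lincomb:
  assumes "(a, c) \<in> adapted M B \<pi>" "b \<in> fst c" "u \<in> vertical_space M B \<pi> b" "v \<in> vertical_space M B \<pi> b"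
  shows "lincomb r u s v \<in> vertical_space M B \<pi> b"
  using assms(3,4) tangent_lincomb[OF B] unfolding vertical_iff[OF assms(1,2)] by (auto simp: lincomb_def)

lemma vform_at_in:
  assumes ac: "(a, c) \<in> adapted M B \<pi>" and b: "b \<in> fst c"
  shows "vform_at a c b p \<in> vform_points k M B \<pi>"
proof -
  have "(\<lambda>vs. if vs \<in> tuples k (tangent_space M (\<pi> b)) then \<Phi> p (snd (v c)) (\<lambda>i. (vs ! i) a) else 0)
      \<in> alt_forms k (tangent_space M (\<pi> b))" for v
    by (rule alt_form_of_alternating[OF \<Phi>_alternating tangent_lincomb[OF M]])
  then show ?thesis
    using adaptedD(7)[OF ac b] vertical_lincomb[OF ac b]
    by (auto simp: vform_points_def vform_at_def lincomb_def \<Phi>_linear fun_eq_iff)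
qed

lemma vertical_tvec_of:
  assumes ac: "(a, c) \<in> adapted M B \<pi>" and b: "b \<in> fst c"
  shows "tvec_of B c b (0, \<eta>) \<in> vertical_space M B \<pi> b"
  unfolding vertical_iff[OF ac b] using tvec_of[OF B adaptedD(6)[OF ac b]] by simp

text \<open>Evaluated on lifts of model vectors, the covector becomes a linear family
  \<open>L\<close> of alternating forms, to which \<open>\<Phi>_surj\<close> assigns coordinates.
  Vertical vectors and tuples are recovered from their components.\<close>

lemma vform_at_onto:
  assumes ac: "(a, c) \<in> adapted M B \<pi>" and y: "y \<in> vform_points k M B \<pi>" and b: "fst y \<in> fst c"
  shows "\<exists>p. y = vform_at a c (fst y) p"
proof -
  obtain b' l where yl: "y = (b', l)" by (cases y)
  let ?T = "tangent_space M (\<pi> b')"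
  have b': "b' \<in> fst c" using b yl by simp
  note cs = adaptedD(5,6)[OF ac b'] and vi = vertical_iff[OF ac b']
  have l: "\<And>v. v \<in> vertical_space M B \<pi> b' \<Longrightarrow> l v \<in> alt_forms k ?T"
    "\<And>u v r s. u \<in> vertical_space M B \<pi> b' \<Longrightarrow> v \<in> vertical_space M B \<pi> b' \<Longrightarrow>
      l (lincomb r u s v) = lincomb r (l u) s (l v)"
    "\<And>v. v \<notin> vertical_space M B \<pi> b' \<Longrightarrow> l v = (\<lambda>_. 0)"
    using y unfolding yl vform_points_def by blast+
  define V where "V \<eta> = tvec_of B c b' (0, \<eta>)" for \<eta>
  have V: "V \<eta> \<in> vertical_space M B \<pi> b'" for \<eta> unfolding V_def by (rule vertical_tvec_of[OF ac b'])
  have Vl: "V (r *\<^sub>R \<eta> + s *\<^sub>R \<eta>') = lincomb r (V \<eta>) s (V \<eta>')" for r s \<eta> \<eta>'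
    using tvec_of_lincomb[OF B cs(2), of r "(0, \<eta>)" s "(0, \<eta>')"] by (simp add: V_def)
  define L where "L \<eta> f = l (V \<eta>) (map (\<lambda>i. tvec_of M a (\<pi> b') (f i)) [0..<k])" for \<eta> f
  have "\<exists>p. \<forall>\<eta> f. L \<eta> f = \<Phi> p \<eta> f"
  proof (rule \<Phi>_surj)
    show "alternating k (L \<eta>)" for \<eta>
      unfolding L_def by (rule alternating_of_alt_form[OF M cs(1) l(1)[OF V]])
    show "L (r *\<^sub>R \<eta> + s *\<^sub>R \<eta>') f = r * L \<eta> f + s * L \<eta>' f" for r s \<eta> \<eta>' f
      unfolding L_def Vl l(2)[OF V V] by (simp add: lincomb_def)
  qed
  then obtain p where p: "\<And>\<eta> f. L \<eta> f = \<Phi> p \<eta> f" by blast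
  have "l v vs = snd (vform_at a c b' p) v vs" for v vs
  proof (cases "v \<in> vertical_space M B \<pi> b'")
    case v: True
    show ?thesis
    proof (cases "vs \<in> tuples k ?T")
      case vs: True
      have "v c = (0, snd (v c))" using v unfolding vi by (metis prod.collapse)
      then have "V (snd (v c)) = v"
        unfolding V_def using tvec_of_eq[OF B cs(2), of v] v vi by metis
      then have "l v vs = L (snd (v c)) (\<lambda>i. (vs ! i) a)"
        unfolding L_def tuples_coordinates[OF M cs(1) vs] by simp
      then show ?thesis using v vs p by (simp add: vform_at_def)
    next
      case False
      then show ?thesis using l(1)[OF v] v by (simp add: vform_at_def alt_forms_def)
    qed
  qed (simp add: l(3) vform_at_def)
  then have "y = vform_at a c (fst y) p"
    unfolding yl by (intro prod_eqI) (auto simp: fun_eq_iff)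
  then show ?thesis by blast
qed

text \<open>This evaluates the \<open>THE\<close> in \<open>phase_chart\<close> and
  \<open>top_chart\<close>: testing on lifts of arbitrary model vectors reduces uniqueness to
  \<open>\<Phi>_inj\<close>.\<close>

lemma vform_at_unique:
  assumes ac: "(a, c) \<in> adapted M B \<pi>" and b: "b \<in> fst c"
  shows "(\<forall>v\<in>vertical_space M B \<pi> b. \<forall>vs\<in>tuples k (tangent_space M (\<pi> b)).
      snd (vform_at a c b p) v vs = \<Phi> q (snd (v c)) (\<lambda>i. (vs ! i) a)) \<longleftrightarrow> q = p"
proof
  note cs = adaptedD(5,6)[OF ac b]
  assume *: "\<forall>v\<in>vertical_space M B \<pi> b. \<forall>vs\<in>tuples k (tangent_space M (\<pi> b)).
      snd (vform_at a c b p) v vs = \<Phi> q (snd (v c)) (\<lambda>i. (vs ! i) a)"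
  show "q = p"
  proof (rule \<Phi>_inj)
    fix \<eta> f
    let ?v = "tvec_of B c b (0, \<eta>)" and ?vs = "map (\<lambda>i. tvec_of M a (\<pi> b) (f i)) [0..<k]"
    have v: "?v \<in> vertical_space M B \<pi> b" by (rule vertical_tvec_of[OF ac b])
    have vs: "?vs \<in> tuples k (tangent_space M (\<pi> b))" using tvec_of(1)[OF M cs(1)] by (auto simp: tuples_def)
    have "\<Phi> q \<eta> (\<lambda>i. (?vs ! i) a) = \<Phi> p \<eta> (\<lambda>i. (?vs ! i) a)"
      using *[rule_format, OF v vs] v vs tvec_of(2)[OF B cs(2)] by (simp add: vform_at_def)
    moreover have "\<Phi> q \<eta> (\<lambda>i. (?vs ! i) a) = \<Phi> q \<eta> f" for q
      by (rule alternatingD(3)[OF \<Phi>_alternating]) (simp add: tvec_of(2)[OF M cs(1)])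
    ultimately show "\<Phi> q \<eta> f = \<Phi> p \<eta> f" by simp
  qed
qed (simp add: vform_at_def)

text \<open>Reduces a change of fibre coordinates to an identity between forms on the model
  spaces.\<close>

lemma vform_at_eqI:
  assumes ac: "(a, c) \<in> adapted M B \<pi>" and ac': "(a', c') \<in> adapted M B \<pi>" and b: "b \<in> fst c" "b \<in> fst c'"
    and eq: "\<And>\<eta> f. \<Phi> p \<eta> f = \<Phi> p' (snd (D (transition c c') (snd c b) (0, \<eta>)))
      (\<lambda>i. D (transition a a') (snd a (\<pi> b)) (f i))"
  shows "vform_at a c b p = vform_at a' c' b p'"
proof -
  note cs = adaptedD(5,6)[OF ac b(1)] and cs' = adaptedD(5,6)[OF ac' b(2)]
  have "\<Phi> p (snd (v c)) (\<lambda>i. (vs ! i) a) = \<Phi> p' (snd (v c')) (\<lambda>i. (vs ! i) a')"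
    if v: "v \<in> vertical_space M B \<pi> b" and vs: "vs \<in> tuples k (tangent_space M (\<pi> b))" for v vs
  proof -
    have v': "v \<in> tangent_space B b" "v c = (0, snd (v c))"
      using v unfolding vertical_iff[OF ac b(1)] by (auto simp: prod_eq_iff)
    have "v c' = D (transition c c') (snd c b) (0, snd (v c))"
      using tangentD[OF v'(1) cs(2) cs'(2)] v'(2) by metis
    moreover have "(vs ! i) a' = D (transition a a') (snd a (\<pi> b)) ((vs ! i) a)" if "i < k" for i
      using vs that by (intro tangentD[OF _ cs(1) cs'(1)]) (auto simp: tuples_def)
    then have "\<Phi> p' (snd (v c')) (\<lambda>i. (vs ! i) a')
        = \<Phi> p' (snd (v c')) (\<lambda>i. D (transition a a') (snd a (\<pi> b)) ((vs ! i) a))"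
      by (rule alternatingD(3)[OF \<Phi>_alternating])
    ultimately show ?thesis using eq[of "snd (v c)" "\<lambda>i. (vs ! i) a"] by simp
  qed
  then show ?thesis unfolding vform_at_def by (intro prod_eqI) (auto simp: fun_eq_iff)
qed

end

section \<open>The multi-phase bundle and the bundle of top forms\<close>

lemma dnx_tuple:
  fixes vs :: "('m, 'e::euclidean_space) tvec list"
  assumes "vs \<in> tuples DIM('e) V"
  shows "dnx (map (\<lambda>w. w a) vs) = vol (\<lambda>i. (vs ! i) a)"
  using assms by (subst dnx_eq_vol) (auto simp: tuples_def intro!: alternatingD(3)[OF alternating_vol])

lemma dnx_contraction_tuple:
  fixes vs :: "('m, 'e::euclidean_space) tvec list"
  assumes "vs \<in> tuples (DIM('e) - 1) V"
  shows "dnx (u # map (\<lambda>w. w a) vs) = vol (case_nat u (\<lambda>i. (vs ! i) a))"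
proof -
  have len: "length vs = DIM('e) - 1" using assms by (simp add: tuples_def)
  then have "dnx (u # map (\<lambda>w. w a) vs) = vol ((!) (u # map (\<lambda>w. w a) vs))"
    by (intro dnx_eq_vol) (simp add: dim_pred[symmetric])
  also have "\<dots> = vol (case_nat u (\<lambda>i. (vs ! i) a))"
  proof (rule alternatingD(3)[OF alternating_vol])
    fix i assume "i < DIM('e)"
    then show "(u # map (\<lambda>w. w a) vs) ! i = case_nat u (\<lambda>i. (vs ! i) a) i"
      using len by (cases i) auto
  qed
  finally show ?thesis .
qed

lemma case_nat_comp: "(\<lambda>i. A (case_nat u f i)) = case_nat (A u) (\<lambda>i. A (f i))"
  by (auto simp: fun_eq_iff split: nat.split)

text \<open>Each (n-1)-form is the contraction of \<open>vol\<close> with a unique vector; this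
  uniqueness makes the vector depend linearly on \<eta>.\<close>

lemma phase_form_coordinates:
  assumes fd: "fdim TYPE('h::real_normed_vector)"
  shows "form_coordinates (DIM('e) - 1) (\<lambda>(p :: 'h \<Rightarrow>\<^sub>L 'e::euclidean_space) \<eta> f. vol (case_nat (blinfun_apply p \<eta>) f))"
proof
  show "alternating (DIM('e) - 1) (\<lambda>f. vol (case_nat (blinfun_apply p \<eta>) f))" for p :: "'h \<Rightarrow>\<^sub>L 'e" and \<eta>
    by (rule alternating_contraction)
  have lin: "vol (case_nat (r *\<^sub>R u + s *\<^sub>R v) f) = r * vol (case_nat u f) + s * vol (case_nat v f)"
    for r s and u v :: 'e and f
    by (simp add: linear_add[OF linear_vol_contraction] linear_cmul[OF linear_vol_contraction])
  show "vol (case_nat (blinfun_apply p (r *\<^sub>R \<eta> + s *\<^sub>R \<eta>')) f)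
      = r * vol (case_nat (blinfun_apply p \<eta>) f) + s * vol (case_nat (blinfun_apply p \<eta>') f)"
    for p :: "'h \<Rightarrow>\<^sub>L 'e" and r s \<eta> \<eta>' f
    by (simp add: blinfun.add_right blinfun.scaleR_right lin)
  show "p = p'" if "\<And>\<eta> f. vol (case_nat (blinfun_apply p \<eta>) f) = vol (case_nat (blinfun_apply p' \<eta>) f)"
    for p p' :: "'h \<Rightarrow>\<^sub>L 'e"
    by (rule blinfun_eqI, rule vol_contraction_inject, rule that)
  fix L :: "'h \<Rightarrow> (nat \<Rightarrow> 'e) \<Rightarrow> real"
  assume alt: "\<And>\<eta>. alternating (DIM('e) - 1) (L \<eta>)"
    and L: "\<And>r s \<eta> \<eta>' f. L (r *\<^sub>R \<eta> + s *\<^sub>R \<eta>') f = r * L \<eta> f + s * L \<eta>' f"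
  obtain u where u: "\<And>\<eta> f. L \<eta> f = vol (case_nat (u \<eta>) f)" using alternating_pred_dim[OF alt] by metis
  have ul: "u (r *\<^sub>R \<eta> + s *\<^sub>R \<eta>') = r *\<^sub>R u \<eta> + s *\<^sub>R u \<eta>'" for r s \<eta> \<eta>'
    by (rule vol_contraction_inject) (simp add: lin u[symmetric] L)
  have "linear u"
    by (rule linear_combinationI) (rule ul)
  then show "\<exists>p. \<forall>\<eta> f. L \<eta> f = vol (case_nat (blinfun_apply p \<eta>) f)"
    using u bounded_linear_Blinfun_apply[OF linear_imp_bounded_linear[OF fd]] by metis
qed

lemma top_form_coordinates:
  assumes fd: "fdim TYPE('h::real_normed_vector)"
  shows "form_coordinates DIM('e) (\<lambda>(r :: 'h \<Rightarrow>\<^sub>L real) \<eta> (f :: nat \<Rightarrow> 'e::euclidean_space). blinfun_apply r \<eta> * vol f)"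
proof
  show "alternating DIM('e) (\<lambda>f :: nat \<Rightarrow> 'e. blinfun_apply r \<eta> * vol f)" for r :: "'h \<Rightarrow>\<^sub>L real" and \<eta>
    by (rule alternating_cmult[OF alternating_vol])
  show "blinfun_apply p (r *\<^sub>R \<eta> + s *\<^sub>R \<eta>') * vol f
      = r * (blinfun_apply p \<eta> * vol f) + s * (blinfun_apply p \<eta>' * vol f)"
    for p :: "'h \<Rightarrow>\<^sub>L real" and r s \<eta> \<eta>' and f :: "nat \<Rightarrow> 'e"
    by (simp add: blinfun.add_right blinfun.scaleR_right algebra_simps)
  show "p = p'" if "\<And>\<eta> (f :: nat \<Rightarrow> 'e). blinfun_apply p \<eta> * vol f = blinfun_apply p' \<eta> * vol f"
    for p p' :: "'h \<Rightarrow>\<^sub>L real"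
    using that[of _ basis_enum] by (intro blinfun_eqI) (simp add: vol_basis_enum)
  fix L :: "'h \<Rightarrow> (nat \<Rightarrow> 'e) \<Rightarrow> real"
  assume alt: "\<And>\<eta>. alternating DIM('e) (L \<eta>)"
    and L: "\<And>r s \<eta> \<eta>' f. L (r *\<^sub>R \<eta> + s *\<^sub>R \<eta>') f = r * L \<eta> f + s * L \<eta>' f"
  have "linear (\<lambda>\<eta>. L \<eta> basis_enum)"
    by (rule linear_combinationI) (simp add: L)
  then have "L \<eta> f = Blinfun (\<lambda>\<eta>. L \<eta> basis_enum) \<eta> * vol f" for \<eta> f
    using alternating_top[OF alt, of \<eta> f]
    by (simp add: bounded_linear_Blinfun_apply[OF linear_imp_bounded_linear[OF fd]])
  then show "\<exists>p. \<forall>\<eta> f. L \<eta> f = blinfun_apply p \<eta> * vol f" by blast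
qed

context adapted_bundle
begin

lemma vform_bundle_phase: "vform_bundle M B \<pi> (DIM('e) - 1) (\<lambda>(p :: 'h \<Rightarrow>\<^sub>L 'e) \<eta> f. vol (case_nat (blinfun_apply p \<eta>) f))"
  unfolding vform_bundle_def using adapted_bundle_axioms phase_form_coordinates[OF fdim_fibre] by blast

lemma vform_bundle_top: "vform_bundle M B \<pi> DIM('e) (\<lambda>(r :: 'h \<Rightarrow>\<^sub>L real) \<eta> (f :: nat \<Rightarrow> 'e). blinfun_apply r \<eta> * vol f)"
  unfolding vform_bundle_def using adapted_bundle_axioms top_form_coordinates[OF fdim_fibre] by blast

definition phase_at where
  "phase_at = vform_bundle.vform_at M B \<pi> (DIM('e) - 1) (\<lambda>(p :: 'h \<Rightarrow>\<^sub>L 'e) \<eta> f. vol (case_nat (blinfun_apply p \<eta>) f))"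

lemma fst_phase_at [simp]: "fst (phase_at a c b p) = b"
  unfolding phase_at_def by (rule vform_bundle.fst_vform_at[OF vform_bundle_phase])

definition top_at where
  "top_at = vform_bundle.vform_at M B \<pi> DIM('e) (\<lambda>(r :: 'h \<Rightarrow>\<^sub>L real) \<eta> (f :: nat \<Rightarrow> 'e). blinfun_apply r \<eta> * vol f)"

lemma fst_top_at [simp]: "fst (top_at a c b p) = b"
  unfolding top_at_def by (rule vform_bundle.fst_vform_at[OF vform_bundle_top])

text \<open>The Jacobian determinant of the inverse base change, at a point given in the new
  coordinates \<open>a'\<close>.\<close>

definition vol_ratio :: "('m, 'e) chart \<Rightarrow> ('m, 'e) chart \<Rightarrow> 'e \<Rightarrow> real" where
  "vol_ratio a a' x = vol (\<lambda>i. D (transition a' a) x (basis_enum i))"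

text \<open>Apart from the inverse vertical Jacobian acting on \<eta>, this is the Piola transform:
  push-forward by the base Jacobian, divided by its determinant.\<close>

definition phase_change :: "('m, 'e) chart \<Rightarrow> ('b, 'e \<times> 'h) chart \<Rightarrow> ('m, 'e) chart \<Rightarrow> ('b, 'e \<times> 'h) chart
    \<Rightarrow> 'e \<times> 'h \<Rightarrow> ('h \<Rightarrow>\<^sub>L 'e) \<Rightarrow> ('h \<Rightarrow>\<^sub>L 'e)" where
  "phase_change a c a' c' z p = Blinfun (\<lambda>\<eta>. vol_ratio a a' (fst (transition c c' z)) *\<^sub>R
     D (transition a a') (fst z) (blinfun_apply p (snd (D (transition c' c) (transition c c' z) (0, \<eta>)))))"

definition top_change :: "('m, 'e) chart \<Rightarrow> ('b, 'e \<times> 'h) chart \<Rightarrow> ('m, 'e) chart \<Rightarrow> ('b, 'e \<times> 'h) chart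
    \<Rightarrow> 'e \<times> 'h \<Rightarrow> ('h \<Rightarrow>\<^sub>L real) \<Rightarrow> ('h \<Rightarrow>\<^sub>L real)" where
  "top_change a c a' c' z r = Blinfun (\<lambda>\<eta>. vol_ratio a a' (fst (transition c c' z)) *
     blinfun_apply r (snd (D (transition c' c) (transition c c' z) (0, \<eta>))))"

lemma transition_points:
  assumes "(a, c) \<in> adapted M B \<pi>" "(a', c') \<in> adapted M B \<pi>" "b \<in> fst c" "b \<in> fst c'"
  shows "transition c c' (snd c b) = snd c' b" "fst (snd c b) = snd a (\<pi> b)" "fst (snd c' b) = snd a' (\<pi> b)"
  using transition_rep(3)[OF B adaptedD(2)[OF assms(1)] adaptedD(2)[OF assms(2)] assms(3)]
    adaptedD(4)[OF assms(1,3)] adaptedD(4)[OF assms(2,4)] by auto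

lemma linear_vertical:
  assumes ac: "(a, c) \<in> adapted M B \<pi>" and ac': "(a', c') \<in> adapted M B \<pi>" and b: "b \<in> fst c" "b \<in> fst c'"
  shows "linear (\<lambda>\<eta>. snd (D (transition c' c) (snd c' b) (0, \<eta>)))"
proof -
  have "linear (\<lambda>\<eta> :: 'h. (0 :: 'e, \<eta>))" by (intro linearI) auto
  from linear_compose[OF linear_compose[OF this linear_D_total[OF ac' ac b(2,1)]] linear_snd]
  show ?thesis by (simp add: o_def)
qed

lemma phase_change_apply:
  assumes ac: "(a, c) \<in> adapted M B \<pi>" and ac': "(a', c') \<in> adapted M B \<pi>" and b: "b \<in> fst c" "b \<in> fst c'"
  shows "blinfun_apply (phase_change a c a' c' (snd c b) p) \<eta> = vol_ratio a a' (snd a' (\<pi> b)) *\<^sub>R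
     D (transition a a') (snd a (\<pi> b)) (blinfun_apply p (snd (D (transition c' c) (snd c' b) (0, \<eta>))))"
proof -
  have "linear (\<lambda>\<eta>. vol_ratio a a' (snd a' (\<pi> b)) *\<^sub>R
     D (transition a a') (snd a (\<pi> b)) (blinfun_apply p (snd (D (transition c' c) (snd c' b) (0, \<eta>)))))"
    using linear_compose[OF linear_compose[OF linear_vertical[OF ac ac' b]
      bounded_linear.linear[OF blinfun.bounded_linear_right[of p]]] linear_D_base[OF ac ac' b]]
    by (intro linear_compose_scale_right) (simp add: o_def)
  then show ?thesis
    unfolding phase_change_def transition_points[OF ac ac' b]
    by (simp only: bounded_linear_Blinfun_apply[OF linear_imp_bounded_linear[OF fdim_fibre]])
qed

lemma top_change_apply:
  assumes ac: "(a, c) \<in> adapted M B \<pi>" and ac': "(a', c') \<in> adapted M B \<pi>" and b: "b \<in> fst c" "b \<in> fst c'"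
  shows "blinfun_apply (top_change a c a' c' (snd c b) r) \<eta> = vol_ratio a a' (snd a' (\<pi> b)) *
     blinfun_apply r (snd (D (transition c' c) (snd c' b) (0, \<eta>)))"
proof -
  have "linear (\<lambda>\<eta>. vol_ratio a a' (snd a' (\<pi> b)) *\<^sub>R
     blinfun_apply r (snd (D (transition c' c) (snd c' b) (0, \<eta>))))"
    using linear_compose[OF linear_vertical[OF ac ac' b]
      bounded_linear.linear[OF blinfun.bounded_linear_right[of r]]]
    by (intro linear_compose_scale_right) (simp add: o_def)
  then show ?thesis
    unfolding top_change_def transition_points[OF ac ac' b] real_scaleR_def
    by (simp only: bounded_linear_Blinfun_apply[OF linear_imp_bounded_linear[OF fdim_fibre]])
qed

lemma D_vertical_inverse:
  assumes ac: "(a, c) \<in> adapted M B \<pi>" and ac': "(a', c') \<in> adapted M B \<pi>" and b: "b \<in> fst c" "b \<in> fst c'"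
  shows "snd (D (transition c' c) (snd c' b) (0, snd (D (transition c c') (snd c b) (0, \<eta>)))) = \<eta>"
proof -
  have "fst (D (transition c c') (snd c b) (0, \<eta>)) = 0"
    using D_transition_fst[OF ac ac' b, of "(0, \<eta>)"] linear_0[OF linear_D_base[OF ac ac' b]]
    by (simp add: transition_points[OF ac ac' b])
  then have "(0, snd (D (transition c c') (snd c b) (0, \<eta>))) = D (transition c c') (snd c b) (0, \<eta>)"
    by (simp add: prod_eq_iff)
  then show ?thesis using D_total_inverse[OF ac ac' b] by simp
qed

lemma vol_ratio:
  assumes ac: "(a, c) \<in> adapted M B \<pi>" and ac': "(a', c') \<in> adapted M B \<pi>" and b: "b \<in> fst c" "b \<in> fst c'"
  shows "vol_ratio a a' (snd a' (\<pi> b)) * vol (\<lambda>i. D (transition a a') (snd a (\<pi> b)) (f i)) = vol f"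
  using vol_linear_map[OF linear_D_base[OF ac' ac b(2,1)], of "\<lambda>i. D (transition a a') (snd a (\<pi> b)) (f i)"]
    D_base_inverse[OF ac ac' b] by (simp add: vol_ratio_def)

lemma phase_at_change:
  assumes ac: "(a, c) \<in> adapted M B \<pi>" and ac': "(a', c') \<in> adapted M B \<pi>" and b: "b \<in> fst c" "b \<in> fst c'"
  shows "phase_at a c b p = phase_at a' c' b (phase_change a c a' c' (snd c b) p)"
  unfolding phase_at_def
proof (rule vform_bundle.vform_at_eqI[OF vform_bundle_phase ac ac' b])
  fix \<eta> and f :: "nat \<Rightarrow> 'e"
  let ?A = "D (transition a a') (snd a (\<pi> b))" and ?k = "vol_ratio a a' (snd a' (\<pi> b))"
  have "vol (case_nat (?k *\<^sub>R ?A (blinfun_apply p \<eta>)) (\<lambda>i. ?A (f i)))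
      = ?k * vol (\<lambda>i. ?A (case_nat (blinfun_apply p \<eta>) f i))"
    by (simp add: linear_cmul[OF linear_vol_contraction] case_nat_comp)
  then show "vol (case_nat (blinfun_apply p \<eta>) f) =
    vol (case_nat (blinfun_apply (phase_change a c a' c' (snd c b) p) (snd (D (transition c c') (snd c b) (0, \<eta>))))
      (\<lambda>i. ?A (f i)))"
    unfolding phase_change_apply[OF ac ac' b] D_vertical_inverse[OF ac ac' b] by (simp add: vol_ratio[OF ac ac' b])
qed

lemma top_at_change:
  assumes ac: "(a, c) \<in> adapted M B \<pi>" and ac': "(a', c') \<in> adapted M B \<pi>" and b: "b \<in> fst c" "b \<in> fst c'"
  shows "top_at a c b r = top_at a' c' b (top_change a c a' c' (snd c b) r)"
  unfolding top_at_def
proof (rule vform_bundle.vform_at_eqI[OF vform_bundle_top ac ac' b])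
  fix \<eta> and f :: "nat \<Rightarrow> 'e"
  show "blinfun_apply r \<eta> * vol f =
    blinfun_apply (top_change a c a' c' (snd c b) r) (snd (D (transition c c') (snd c b) (0, \<eta>))) *
      vol (\<lambda>i. D (transition a a') (snd a (\<pi> b)) (f i))"
    unfolding top_change_apply[OF ac ac' b] D_vertical_inverse[OF ac ac' b]
    using vol_ratio[OF ac ac' b, of f] by (simp add: ac_simps)
qed

lemma phase_at_coord:
  assumes ac: "(a, c) \<in> adapted M B \<pi>" and b: "b \<in> fst c"
  shows "snd (phase_chart M B \<pi> a c) (phase_at a c b p) = (fst (snd c b), snd (snd c b), p)"
proof -
  interpret P: vform_bundle M B \<pi> "DIM('e) - 1" "\<lambda>(p :: 'h \<Rightarrow>\<^sub>L 'e) \<eta> f. vol (case_nat (blinfun_apply p \<eta>) f)"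
    by (rule vform_bundle_phase)
  have "(\<forall>v\<in>vertical_space M B \<pi> b. \<forall>vs\<in>tuples (DIM('e) - 1) (tangent_space M (\<pi> b)).
      snd (phase_at a c b p) v vs = dnx (blinfun_apply q (snd (v c)) # map (\<lambda>w. w a) vs)) \<longleftrightarrow> q = p" for q
    unfolding phase_at_def
    by (subst P.vform_at_unique[OF ac b, of p q, symmetric])
      (intro ball_cong refl arg_cong2[where f = "(=)"] dnx_contraction_tuple)
  then show ?thesis by (simp add: phase_chart_def)
qed

lemma top_at_coord:
  assumes ac: "(a, c) \<in> adapted M B \<pi>" and b: "b \<in> fst c"
  shows "snd (top_chart M B \<pi> a c) (top_at a c b r) = (fst (snd c b), snd (snd c b), r)"
proof -
  interpret P: vform_bundle M B \<pi> "DIM('e)" "\<lambda>(r :: 'h \<Rightarrow>\<^sub>L real) \<eta> (f :: nat \<Rightarrow> 'e). blinfun_apply r \<eta> * vol f"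
    by (rule vform_bundle_top)
  have "(\<forall>v\<in>vertical_space M B \<pi> b. \<forall>vs\<in>tuples DIM('e) (tangent_space M (\<pi> b)).
      snd (top_at a c b r) v vs = blinfun_apply q (snd (v c)) * dnx (map (\<lambda>w. w a) vs)) \<longleftrightarrow> q = r" for q
    unfolding top_at_def
    by (subst P.vform_at_unique[OF ac b, of r q, symmetric])
      (intro ball_cong refl arg_cong2[where f = "(=)"] arg_cong2[where f = "(*)"] dnx_tuple)
  then show ?thesis by (simp add: top_chart_def)
qed

lemma smooth_vol_ratio:
  assumes ac: "(a, c) \<in> adapted M B \<pi>" and ac': "(a', c') \<in> adapted M B \<pi>"
  shows "smooth_on (dom_of c c') (\<lambda>y :: 'e \<times> 'h \<times> 'w::real_normed_vector.
    vol_ratio a a' (fst (transition c c' (fst y, fst (snd y)))))"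
  unfolding vol_ratio_def
  by (rule smooth_on_vol[OF open_dom_of[OF ac ac'] smooth_dom_of(5)[OF ac ac' smooth_on_const]])

lemma smooth_vertical:
  assumes ac: "(a, c) \<in> adapted M B \<pi>" and ac': "(a', c') \<in> adapted M B \<pi>"
  shows "smooth_on (dom_of c c') (\<lambda>y :: 'e \<times> 'h \<times> 'w::real_normed_vector.
    snd (D (transition c' c) (transition c c' (fst y, fst (snd y))) (0, \<eta>)))"
  by (rule smooth_on_snd[OF open_dom_of[OF ac ac'] smooth_dom_of(4)[OF ac ac' smooth_on_const]])

lemma smooth_phase_change:
  assumes ac: "(a, c) \<in> adapted M B \<pi>" and ac': "(a', c') \<in> adapted M B \<pi>"
  shows "smooth_on (dom_of c c') (\<lambda>y. phase_change a c a' c' (fst y, fst (snd y)) (snd (snd y)))"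
proof (rule smooth_on_blinfunI[OF fdim_fibre open_dom_of[OF ac ac']])
  fix \<eta>
  note op = open_dom_of[OF ac ac', where 'w = "'h \<Rightarrow>\<^sub>L 'e"]
  show "smooth_on (dom_of c c') (\<lambda>y. blinfun_apply (phase_change a c a' c' (fst y, fst (snd y)) (snd (snd y))) \<eta>)"
  proof (rule smooth_on_cong[OF op smooth_on_scaleR[OF op smooth_vol_ratio[OF ac ac'] smooth_dom_of(6)[OF ac ac'
          smooth_on_blinfun_apply[OF op smooth_on_snd[OF op smooth_on_snd[OF op smooth_on_id]] smooth_vertical[OF ac ac']]]]])
    fix y :: "'e \<times> 'h \<times> ('h \<Rightarrow>\<^sub>L 'e)" assume "y \<in> dom_of c c'"
    then obtain b where b: "b \<in> fst c" "b \<in> fst c'" "(fst y, fst (snd y)) = snd c b" by auto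
    have "fst y = snd a (\<pi> b)" using b(3) transition_points(2)[OF ac ac' b(1,2)] by (metis fst_conv)
    then show "vol_ratio a a' (fst (transition c c' (fst y, fst (snd y)))) *\<^sub>R D (transition a a') (fst y)
        (blinfun_apply (snd (snd y)) (snd (D (transition c' c) (transition c c' (fst y, fst (snd y))) (0, \<eta>))))
      = blinfun_apply (phase_change a c a' c' (fst y, fst (snd y)) (snd (snd y))) \<eta>"
      unfolding b(3) phase_change_apply[OF ac ac' b(1,2)] by (simp add: transition_points[OF ac ac' b(1,2)])
  qed
qed

lemma smooth_top_change:
  assumes ac: "(a, c) \<in> adapted M B \<pi>" and ac': "(a', c') \<in> adapted M B \<pi>"
  shows "smooth_on (dom_of c c') (\<lambda>y. top_change a c a' c' (fst y, fst (snd y)) (snd (snd y)))"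
proof (rule smooth_on_blinfunI[OF fdim_fibre open_dom_of[OF ac ac']])
  fix \<eta>
  note op = open_dom_of[OF ac ac', where 'w = "'h \<Rightarrow>\<^sub>L real"]
  show "smooth_on (dom_of c c') (\<lambda>y. blinfun_apply (top_change a c a' c' (fst y, fst (snd y)) (snd (snd y))) \<eta>)"
  proof (rule smooth_on_cong[OF op smooth_on_mult[OF op smooth_vol_ratio[OF ac ac']
          smooth_on_blinfun_apply[OF op smooth_on_snd[OF op smooth_on_snd[OF op smooth_on_id]] smooth_vertical[OF ac ac']]]])
    fix y :: "'e \<times> 'h \<times> ('h \<Rightarrow>\<^sub>L real)" assume "y \<in> dom_of c c'"
    then obtain b where b: "b \<in> fst c" "b \<in> fst c'" "(fst y, fst (snd y)) = snd c b" by auto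
    show "vol_ratio a a' (fst (transition c c' (fst y, fst (snd y)))) *
        blinfun_apply (snd (snd y)) (snd (D (transition c' c) (transition c c' (fst y, fst (snd y))) (0, \<eta>)))
      = blinfun_apply (top_change a c a' c' (fst y, fst (snd y)) (snd (snd y))) \<eta>"
      unfolding b(3) top_change_apply[OF ac ac' b(1,2)] by (simp add: transition_points[OF ac ac' b(1,2)])
  qed
qed

lemma fibred_atlas_phase:
  "fibred_atlas M B \<pi> (phase_points M B \<pi>) (\<lambda>a c. snd (phase_chart M B \<pi> a c)) phase_at phase_change"
proof -
  interpret P: vform_bundle M B \<pi> "DIM('e) - 1" "\<lambda>(p :: 'h \<Rightarrow>\<^sub>L 'e) \<eta> f. vol (case_nat (blinfun_apply p \<eta>) f)"
    by (rule vform_bundle_phase)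
  show ?thesis
  proof
    show "fdim TYPE('h \<Rightarrow>\<^sub>L 'e)" using fdim_fibre by simp
    show "fst x \<in> points B" if "x \<in> phase_points M B \<pi>" for x
      using that by (auto simp: phase_points_def vform_points_def)
    show "phase_at a c b w \<in> phase_points M B \<pi>" if "(a, c) \<in> adapted M B \<pi>" "b \<in> fst c" for a c b w
      unfolding phase_at_def phase_points_def by (rule P.vform_at_in[OF that])
    show "\<exists>w. x = phase_at a c (fst x) w"
      if "(a, c) \<in> adapted M B \<pi>" "x \<in> phase_points M B \<pi>" "fst x \<in> fst c" for a c x
      using that unfolding phase_at_def phase_points_def by (rule P.vform_at_onto)
  qed (rule fst_phase_at phase_at_coord phase_at_change smooth_phase_change; assumption)+
qed

lemma fibred_atlas_top:
  "fibred_atlas M B \<pi> (top_points M B \<pi>) (\<lambda>a c. snd (top_chart M B \<pi> a c)) top_at top_change"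
proof -
  interpret P: vform_bundle M B \<pi> "DIM('e)" "\<lambda>(r :: 'h \<Rightarrow>\<^sub>L real) \<eta> (f :: nat \<Rightarrow> 'e). blinfun_apply r \<eta> * vol f"
    by (rule vform_bundle_top)
  show ?thesis
  proof
    show "fdim TYPE('h \<Rightarrow>\<^sub>L real)" using fdim_fibre by simp
    show "fst x \<in> points B" if "x \<in> top_points M B \<pi>" for x
      using that by (auto simp: top_points_def vform_points_def)
    show "top_at a c b w \<in> top_points M B \<pi>" if "(a, c) \<in> adapted M B \<pi>" "b \<in> fst c" for a c b w
      unfolding top_at_def top_points_def by (rule P.vform_at_in[OF that])
    show "\<exists>w. x = top_at a c (fst x) w"
      if "(a, c) \<in> adapted M B \<pi>" "x \<in> top_points M B \<pi>" "fst x \<in> fst c" for a c x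
      using that unfolding top_at_def top_points_def by (rule P.vform_at_onto)
  qed (rule fst_top_at top_at_coord top_at_change smooth_top_change; assumption)+
qed

end

section \<open>Derivatives along lines\<close>

lemma line_derivative:
  assumes "(g has_derivative g') (at y)"
  shows "((\<lambda>t. g (y + t *\<^sub>R v)) has_vector_derivative g' v) (at 0)"
proof -
  have "((\<lambda>t. y + t *\<^sub>R v) has_derivative (\<lambda>t. t *\<^sub>R v)) (at 0)"
    by (auto intro!: derivative_eq_intros)
  from has_derivative_compose[OF this, of g g'] assms
  have "((\<lambda>t. g (y + t *\<^sub>R v)) has_derivative (\<lambda>t. g' (t *\<^sub>R v))) (at 0)" by simp
  then show ?thesis
    using linear_cmul[OF has_derivative_linear[OF assms]] by (simp add: has_vector_derivative_def)
qed

lemma open_line_preimage: "open S \<Longrightarrow> open {t :: real. y + t *\<^sub>R v \<in> S}"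
  for y v :: "'a::real_normed_vector"
proof -
  assume "open S"
  then have "open ((\<lambda>t. y + t *\<^sub>R v) -` S)" by (rule open_vimage) (auto intro!: continuous_on_add continuous_on_scaleR)
  then show ?thesis by (simp add: vimage_def)
qed

text \<open>Point and direction move along lines at the same time. Linearity of the derivative
  splits off the moving part of the direction, so only derivatives in fixed directions are
  differentiated.\<close>

lemma line_derivative_D:
  fixes F :: "'a::real_normed_vector \<Rightarrow> 'b::real_normed_vector"
  assumes F: "smooth_on S F" "open S" "z \<in> S"
  shows "((\<lambda>t. D F (z + t *\<^sub>R v) (u + t *\<^sub>R w)) has_vector_derivative D (\<lambda>y. D F y u) z v + D F z w) (at 0)"
proof -
  have 1: "((\<lambda>t. D F (z + t *\<^sub>R v) u) has_vector_derivative D (\<lambda>y. D F y u) z v) (at 0)"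
    by (rule line_derivative[OF smooth_on_has_derivative[OF smooth_on_D[OF F(1)] F(3)]])
  have 2: "((\<lambda>t. D F (z + t *\<^sub>R v) w) has_vector_derivative D (\<lambda>y. D F y w) z v) (at 0)"
    by (rule line_derivative[OF smooth_on_has_derivative[OF smooth_on_D[OF F(1)] F(3)]])
  have "((\<lambda>t. t *\<^sub>R D F (z + t *\<^sub>R v) w) has_vector_derivative D F z w) (at 0)"
    using has_vector_derivative_scaleR[OF DERIV_ident 2] by simp
  from has_vector_derivative_add[OF 1 this]
  show ?thesis
  proof (rule has_vector_derivative_transform_within_open[OF _ open_line_preimage[OF F(2), of z v]])
    fix t assume "t \<in> {t. z + t *\<^sub>R v \<in> S}"
    then have l: "linear (D F (z + t *\<^sub>R v))"
      using smooth_on_has_derivative[OF F(1)] has_derivative_linear by blast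
    show "D F (z + t *\<^sub>R v) u + t *\<^sub>R D F (z + t *\<^sub>R v) w = D F (z + t *\<^sub>R v) (u + t *\<^sub>R w)"
      by (simp add: linear_add[OF l] linear_cmul[OF l])
  qed (use F(3) in simp)
qed

lemma tr_add: "tr (\<lambda>v. S v + T v) = tr S + tr T"
  by (simp add: tr_def inner_add_left sum.distrib)

lemma tr_scaleR: "tr (\<lambda>v. c *\<^sub>R T v) = c * tr T"
  by (simp add: tr_def sum_distrib_left)

lemma tr_rank_one:
  fixes u :: "'e::euclidean_space"
  assumes "linear \<rho>"
  shows "tr (\<lambda>v. \<rho> v *\<^sub>R u) = \<rho> u"
proof -
  have "\<rho> u = \<rho> (\<Sum>b\<in>Basis. (u \<bullet> b) *\<^sub>R b)" by (simp add: euclidean_representation)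
  then show ?thesis by (simp add: tr_def linear_sum[OF assms] linear_cmul[OF assms] mult.commute)
qed

text \<open>The Piola identity: the derivatives of the Jacobian matrix and of the Jacobian determinant
  cancel in the divergence of \<open>\<kappa> Df u\<close>, where \<open>\<kappa>\<close> is the inverse of the determinant.\<close>

lemma trace_transformation:
  fixes f :: "'e::euclidean_space \<Rightarrow> 'e"
  assumes f: "smooth_on S f" "open S" "x \<in> S"
    and \<kappa>: "\<And>y. y \<in> S \<Longrightarrow> \<kappa> y * vol (\<lambda>i. D f y (basis_enum i)) = 1" "(\<kappa> has_derivative \<rho>) (at x)"
    and A': "linear A'" "\<And>v. A' (D f x v) = v" "\<And>v. D f x (A' v) = v"
    and N0: "linear N0"
    and N: "\<And>v. N v = \<rho> v *\<^sub>R D f x u + \<kappa> x *\<^sub>R D (\<lambda>y. D f y u) x v + \<kappa> x *\<^sub>R D f x (N0 v)"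
  shows "tr (\<lambda>v. N (A' v)) = \<kappa> x * tr N0"
proof -
  let ?A = "D f x"
  have lA: "linear ?A" using smooth_on_has_derivative[OF f(1,3)] has_derivative_linear by blast
  have l\<rho>: "linear \<rho>" using \<kappa>(2) has_derivative_linear by blast
  \<comment> \<open>By symmetry of second derivatives, \<open>E w\<close> is also the derivative of
    \<open>y \<mapsto> D f y u\<close> in direction \<open>w\<close>; hence \<open>E\<close> is
    linear.\<close>
  define E where "E w = D (\<lambda>y. D f y w) x u" for w
  have sym: "D (\<lambda>y. D f y u) x v = E v" for v
    unfolding E_def by (rule second_derivative_symmetric[OF f])
  have lE: "linear E"
  proof -
    have "((\<lambda>y. D f y u) has_derivative D (\<lambda>y. D f y u) x) (at x)"
      by (rule smooth_on_has_derivative[OF smooth_on_D[OF f(1)] f(3)])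
    then have "linear (D (\<lambda>y. D f y u) x)" by (rule has_derivative_linear)
    moreover have "D (\<lambda>y. D f y u) x = E" using sym by blast
    ultimately show ?thesis by simp
  qed
  have \<rho>u: "\<rho> u = - \<kappa> x * tr (\<lambda>v. E (A' v))"
  proof -
    have "((\<lambda>y. \<kappa> y * vol (\<lambda>i. D f y (basis_enum i))) has_derivative
        (\<lambda>v. \<kappa> x * (\<Sum>i<DIM('e). vol ((\<lambda>j. ?A (basis_enum j))(i := D (\<lambda>y. D f y (basis_enum i)) x v)))
          + \<rho> v * vol (\<lambda>i. ?A (basis_enum i)))) (at x)"
      by (intro has_derivative_mult \<kappa>(2) has_derivative_vol smooth_on_has_derivative[OF smooth_on_D[OF f(1)] f(3)])
    moreover have "((\<lambda>y. \<kappa> y * vol (\<lambda>i. D f y (basis_enum i))) has_derivative (\<lambda>v. 0)) (at x)"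
      by (rule has_derivative_transform_within_open[OF has_derivative_const[of 1] f(2,3)]) (simp add: \<kappa>(1))
    ultimately have "(\<lambda>v. \<kappa> x * (\<Sum>i<DIM('e). vol ((\<lambda>j. ?A (basis_enum j))(i := D (\<lambda>y. D f y (basis_enum i)) x v)))
          + \<rho> v * vol (\<lambda>i. ?A (basis_enum i))) = (\<lambda>v. 0)"
      by (rule has_derivative_unique)
    \<comment> \<open>In direction \<open>u\<close> the columns of the Jacobian change by
      \<open>E\<close>. Writing each basis vector as \<open>A'\<close> of its column exhibits the
      sum as the derivation of \<open>vol\<close> by \<open>E\<close> after
      \<open>A'\<close>.\<close>
    from fun_cong[OF this, of u]
    have "\<kappa> x * (\<Sum>i<DIM('e). vol ((\<lambda>j. ?A (basis_enum j))(i := E (A' (?A (basis_enum i))))))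
          + \<rho> u * vol (\<lambda>i. ?A (basis_enum i)) = 0"
      by (simp add: E_def A'(2))
    also have "(\<Sum>i<DIM('e). vol ((\<lambda>j. ?A (basis_enum j))(i := E (A' (?A (basis_enum i))))))
        = tr (\<lambda>v. E (A' v)) * vol (\<lambda>i. ?A (basis_enum i))"
      using vol_derivation[OF linear_compose[OF A'(1) lE], of "\<lambda>j. ?A (basis_enum j)"] by (simp add: o_def)
    finally have "(\<kappa> x * tr (\<lambda>v. E (A' v)) + \<rho> u) * vol (\<lambda>i. ?A (basis_enum i)) = 0"
      by (simp add: algebra_simps)
    then show ?thesis using \<kappa>(1)[OF f(3)] by auto
  qed
  have "tr (\<lambda>v. N (A' v)) = \<rho> (A' (?A u)) + \<kappa> x * tr (\<lambda>v. E (A' v)) + \<kappa> x * tr (\<lambda>v. ?A (N0 (A' v)))"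
    unfolding N sym tr_add tr_scaleR
    using tr_rank_one[OF linear_compose[OF A'(1) l\<rho>], of "?A u"] by (simp add: o_def)
  also have "tr (\<lambda>v. ?A (N0 (A' v))) = tr N0"
    using tr_commute[OF lA linear_compose[OF A'(1) N0]] by (simp add: o_def A'(2))
  finally show ?thesis using \<rho>u by (simp add: A'(2))
qed

section \<open>The model map\<close>

definition r_of :: "('g::real_normed_vector \<Rightarrow>\<^sub>L 'e::euclidean_space) \<Rightarrow> ('e \<Rightarrow>\<^sub>L ('g \<times> ('g \<Rightarrow>\<^sub>L 'e)))
    \<Rightarrow> ('g \<times> ('e \<Rightarrow>\<^sub>L 'g)) \<Rightarrow>\<^sub>L real" where
  "r_of p w = Blinfun (\<lambda>\<delta>. tr (\<lambda>\<mu>. blinfun_apply (snd (blinfun_apply w \<mu>)) (fst \<delta>))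
     + tr (\<lambda>\<mu>. blinfun_apply p (blinfun_apply (snd \<delta>) \<mu>)))"

lemma r_of_apply: "blinfun_apply (r_of p w) \<delta> = tr (\<lambda>\<mu>. blinfun_apply (snd (blinfun_apply w \<mu>)) (fst \<delta>))
     + tr (\<lambda>\<mu>. blinfun_apply p (blinfun_apply (snd \<delta>) \<mu>))"
proof -
  have "bounded_linear (\<lambda>\<delta>. tr (\<lambda>\<mu>. blinfun_apply (snd (blinfun_apply w \<mu>)) (fst \<delta>))
     + tr (\<lambda>\<mu>. blinfun_apply p (blinfun_apply (snd \<delta>) \<mu>)))"
    unfolding tr_def
    by (intro bounded_linear_add bounded_linear_sum bounded_linear_compose[OF bounded_linear_inner_left]
        bounded_linear_compose[OF blinfun.bounded_linear_right] bounded_linear_fst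
        bounded_linear_compose[OF blinfun.bounded_linear_left] bounded_linear_snd)
  then show ?thesis unfolding r_of_def by (simp only: bounded_linear_Blinfun_apply)
qed

definition model_map :: "('e::euclidean_space, 'g::real_normed_vector) jet_phase_model \<Rightarrow> ('e, 'g) inf_form_model" where
  "model_map y = (fst y, (fst (fst (snd y)), fst_blinfun o\<^sub>L snd (snd y)), r_of (snd (fst (snd y))) (snd (snd y)))"

text \<open>With \<open>X\<close> read as a point, \<open>omega_half X\<close> is the covector part
  of the model map at \<open>X\<close>, applied to the components of \<open>Y\<close> along the jets
  of \<open>Q\<close>. As this covector is linear in \<open>X\<close>, the same expression with
  \<open>X\<close> read as a vector is its derivative.\<close>

lemma omega_half_eq:
  "omega_half X Y = blinfun_apply (r_of (snd (fst (snd X))) (snd (snd X)))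
     (fst (fst (snd Y)), fst_blinfun o\<^sub>L snd (snd Y))"
proof -
  obtain x \<phi> p w x' \<phi>' p' w' where XY: "X = (x, (\<phi>, p), w)" "Y = (x', (\<phi>', p'), w')"
    by (metis prod.collapse)
  show ?thesis unfolding XY by (simp add: r_of_apply tr_def)
qed

lemma linear_model_map:
  "linear (model_map :: ('e::euclidean_space, 'g::real_normed_vector) jet_phase_model \<Rightarrow> _)"
proof (rule linear_combinationI)
  fix r s and x y :: "('e, 'g) jet_phase_model"
  have 1: "r_of (snd (fst (snd (r *\<^sub>R x + s *\<^sub>R y)))) (snd (snd (r *\<^sub>R x + s *\<^sub>R y)))
      = r *\<^sub>R r_of (snd (fst (snd x))) (snd (snd x)) + s *\<^sub>R r_of (snd (fst (snd y))) (snd (snd y))"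
    by (rule blinfun_eqI)
      (simp add: r_of_apply blinfun.add_left blinfun.scaleR_left tr_add tr_scaleR algebra_simps)
  have 2: "fst_blinfun o\<^sub>L snd (snd (r *\<^sub>R x + s *\<^sub>R y))
      = r *\<^sub>R (fst_blinfun o\<^sub>L snd (snd x)) + s *\<^sub>R (fst_blinfun o\<^sub>L snd (snd y))"
    by (rule blinfun_eqI) (simp add: blinfun.add_left blinfun.scaleR_left)
  show "model_map (r *\<^sub>R x + s *\<^sub>R y) = r *\<^sub>R model_map x + s *\<^sub>R model_map y"
    unfolding model_map_def 1 2 by (simp add: scaleR_prod_def)
qed

lemma rank_one_blinfun: "\<exists>w. \<forall>\<mu>. blinfun_apply w \<mu> = (\<mu> \<bullet> b) *\<^sub>R v" for b :: "'e::euclidean_space"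
  by (rule exI[of _ "blinfun_scaleR_left v o\<^sub>L blinfun_inner_left b"]) (simp add: inner_commute)

lemma tr_dual: "b \<in> Basis \<Longrightarrow> tr (\<lambda>\<mu>. (\<mu> \<bullet> b) *\<^sub>R v) = v \<bullet> b" for b :: "'e::euclidean_space"
  using tr_rank_one[of "\<lambda>\<mu>. \<mu> \<bullet> b" v] bounded_linear_inner_left[of b] by (simp add: bounded_linear.linear)

text \<open>The part of \<open>r\<close> acting on variations of jets is absorbed by
  \<open>p\<close>, the part acting on variations of the field by the derivatives of
  \<open>p\<close>, independently of the prescribed jet \<open>w1\<close>.\<close>

lemma model_map_surj:
  fixes w1 :: "'e::euclidean_space \<Rightarrow>\<^sub>L 'g::real_normed_vector"
  assumes fd: "fdim TYPE('g)"
  shows "\<exists>p w. fst_blinfun o\<^sub>L w = w1 \<and> r_of p w = r"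
proof -
  define T where "T b v = blinfun_scaleR_left v o\<^sub>L blinfun_inner_left b" for b :: 'e and v :: 'g
  have T: "blinfun_apply (T b v) \<mu> = (\<mu> \<bullet> b) *\<^sub>R v" for b v \<mu> by (simp add: T_def inner_commute)
  \<comment> \<open>Component \<open>b\<close> of \<open>p v\<close> is the value of
    \<open>r\<close> on the rank-one jet variation that maps \<open>b\<close> to \<open>v\<close>;
    the rank-one variations span all of them.\<close>
  define p where "p = Blinfun (\<lambda>v. \<Sum>b\<in>Basis. blinfun_apply r (0, T b v) *\<^sub>R b)"
  have Tl: "T b (c *\<^sub>R u + d *\<^sub>R v) = c *\<^sub>R T b u + d *\<^sub>R T b v" for b u v c d
    by (rule blinfun_eqI) (simp add: T blinfun.add_left blinfun.scaleR_left algebra_simps)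
  have rl: "blinfun_apply r (0, c *\<^sub>R x + d *\<^sub>R y) = c * blinfun_apply r (0, x) + d * blinfun_apply r (0, y)" for x y c d
    using blinfun.add_right[of r "c *\<^sub>R (0, x)" "d *\<^sub>R (0, y)"]
    unfolding blinfun.scaleR_right by (simp add: scaleR_prod_def)
  have p: "blinfun_apply p v = (\<Sum>b\<in>Basis. blinfun_apply r (0, T b v) *\<^sub>R b)" for v
    unfolding p_def
    by (subst bounded_linear_Blinfun_apply[OF linear_imp_bounded_linear[OF fd linear_combinationI]])
      (simp_all add: Tl rl scaleR_left_distrib sum.distrib scaleR_sum_right)
  obtain e :: 'e where e: "e \<in> Basis" using nonempty_Basis by blast
  \<comment> \<open>A single base direction \<open>e\<close> carries the whole divergence, so its
    trace returns \<open>r\<close> on field variations.\<close>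
  obtain W where W: "\<And>\<mu>. blinfun_apply W \<mu> = (\<mu> \<bullet> e) *\<^sub>R
      (blinfun_scaleR_left e o\<^sub>L (r o\<^sub>L Blinfun (\<lambda>v. (v, 0 :: 'e \<Rightarrow>\<^sub>L 'g))))"
    using rank_one_blinfun by metis
  have bl: "bounded_linear (\<lambda>v. (v, 0 :: 'e \<Rightarrow>\<^sub>L 'g))"
    by (intro bounded_linear_Pair bounded_linear_ident bounded_linear_zero)
  define w where "w = Blinfun (\<lambda>\<mu>. (blinfun_apply w1 \<mu>, blinfun_apply W \<mu>))"
  have w: "blinfun_apply w \<mu> = (blinfun_apply w1 \<mu>, blinfun_apply W \<mu>)" for \<mu>
    unfolding w_def by (subst bounded_linear_Blinfun_apply)
      (auto intro!: bounded_linear_Pair blinfun.bounded_linear_right)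
  have "fst_blinfun o\<^sub>L w = w1" by (rule blinfun_eqI) (simp add: w)
  moreover have "r_of p w = r"
  proof (rule blinfun_eqI)
    fix \<delta> :: "'g \<times> ('e \<Rightarrow>\<^sub>L 'g)"
    have 1: "tr (\<lambda>\<mu>. blinfun_apply (snd (blinfun_apply w \<mu>)) (fst \<delta>)) = blinfun_apply r (fst \<delta>, 0)"
      using tr_dual[OF e, of "blinfun_apply r (fst \<delta>, 0) *\<^sub>R e"] e
      by (simp add: w W blinfun.scaleR_left bounded_linear_Blinfun_apply[OF bl])
    have "snd \<delta> = (\<Sum>b\<in>Basis. T b (blinfun_apply (snd \<delta>) b))"
    proof (rule blinfun_euclidean_eqI)
      fix i :: 'e assume "i \<in> Basis"
      then show "blinfun_apply (snd \<delta>) i = blinfun_apply (\<Sum>b\<in>Basis. T b (blinfun_apply (snd \<delta>) b)) i"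
        by (simp add: blinfun.sum_left T inner_Basis if_distrib[of "\<lambda>x. x *\<^sub>R _"] cong: if_cong)
    qed
    then have "blinfun_apply r (0, snd \<delta>) = blinfun_apply r (\<Sum>b\<in>Basis. (0, T b (blinfun_apply (snd \<delta>) b)))"
      by (metis (no_types, lifting) fst_conv fst_sum prod.collapse snd_conv snd_sum sum.cong sum.neutral_const)
    also have "\<dots> = (\<Sum>b\<in>Basis. blinfun_apply r (0, T b (blinfun_apply (snd \<delta>) b)))"
      by (rule blinfun.sum_right)
    also have "\<dots> = tr (\<lambda>\<mu>. blinfun_apply p (blinfun_apply (snd \<delta>) \<mu>))"
      unfolding tr_def p by (intro sum.cong) (simp_all add: inner_sum_left_Basis)
    finally have 2: "tr (\<lambda>\<mu>. blinfun_apply p (blinfun_apply (snd \<delta>) \<mu>)) = blinfun_apply r (0, snd \<delta>)" by simp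
    have "blinfun_apply r \<delta> = blinfun_apply r (fst \<delta>, 0) + blinfun_apply r (0, snd \<delta>)"
      using blinfun.add_right[of r "(fst \<delta>, 0)" "(0, snd \<delta>)"] by simp
    then show "blinfun_apply (r_of p w) \<delta> = blinfun_apply r \<delta>" unfolding r_of_apply 1 2 by simp
  qed
  ultimately show ?thesis by blast
qed

text \<open>The two halves pair the covector of \<open>X\<close> with the jet part of
  \<open>Y\<close> and conversely. Test vectors \<open>Y\<close> whose covector vanishes show that
  the covector of \<open>X\<close> is 0; afterwards rank-one choices of \<open>w'\<close> and
  \<open>p'\<close> detect every coordinate of the field and jet components of
  \<open>X\<close>.\<close>

lemma omega_coeff_degenerate:
  fixes X :: "('e::euclidean_space, 'g::real_normed_vector) jet_phase_model"
  assumes fd: "fdim TYPE('g)" and X: "fst X = 0"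
  shows "(\<forall>Y. fst Y = 0 \<longrightarrow> omega_coeff X Y = 0) \<longleftrightarrow> model_map X = 0"
proof
  assume 0: "model_map X = 0"
  then have "r_of (snd (fst (snd X))) (snd (snd X)) = 0" "fst (fst (snd X)) = 0" "fst_blinfun o\<^sub>L snd (snd X) = 0"
    by (auto simp: model_map_def zero_prod_def)
  then have "omega_coeff X Y = 0" for Y
    unfolding omega_coeff_def omega_half_eq by (simp add: zero_prod_def[symmetric] blinfun.zero_right)
  then show "\<forall>Y. fst Y = 0 \<longrightarrow> omega_coeff X Y = 0" by blast
next
  assume *: "\<forall>Y. fst Y = 0 \<longrightarrow> omega_coeff X Y = 0"
  define \<phi> where "\<phi> = fst (fst (snd X))"
  define w1 where "w1 = fst_blinfun o\<^sub>L snd (snd X)"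
  let ?r = "r_of (snd (fst (snd X))) (snd (snd X))"
  have om: "blinfun_apply ?r (\<phi>', fst_blinfun o\<^sub>L w') = blinfun_apply (r_of p' w') (\<phi>, w1)" for \<phi>' p' w'
    using *[rule_format, of "(0, (\<phi>', p'), w')"] unfolding omega_coeff_def omega_half_eq \<phi>_def w1_def by simp
  have "?r = 0"
  proof (rule blinfun_eqI)
    fix \<delta> :: "'g \<times> ('e \<Rightarrow>\<^sub>L 'g)"
    obtain w' where w': "\<And>\<mu>. blinfun_apply w' \<mu> = (blinfun_apply (snd \<delta>) \<mu>, 0 :: 'g \<Rightarrow>\<^sub>L 'e)"
    proof
      show "blinfun_apply (Blinfun (\<lambda>\<mu>. (blinfun_apply (snd \<delta>) \<mu>, 0 :: 'g \<Rightarrow>\<^sub>L 'e))) \<mu> = (blinfun_apply (snd \<delta>) \<mu>, 0)" for \<mu>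
        by (subst bounded_linear_Blinfun_apply)
          (auto intro!: bounded_linear_Pair blinfun.bounded_linear_right bounded_linear_zero)
    qed
    have "fst_blinfun o\<^sub>L w' = snd \<delta>" by (rule blinfun_eqI) (simp add: w')
    then show "blinfun_apply ?r \<delta> = blinfun_apply 0 \<delta>"
      using om[of "fst \<delta>" w' 0] by (simp add: r_of_apply w' tr_def)
  qed
  then have om0: "blinfun_apply (r_of p' w') (\<phi>, w1) = 0" for p' w' using om[of 0 w' p'] by simp
  obtain n and b :: "nat \<Rightarrow> 'g" and l where b: "\<And>x. x = (\<Sum>i<n. blinfun_apply (l i) x *\<^sub>R b i)"
    using fdim_coordinates[OF fd] by metis
  have zeroI: "x = 0" if "\<And>i. blinfun_apply (l i) x = 0" for x using b[of x] that by simp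
  have "\<phi> = 0"
  proof (rule zeroI)
    fix i
    obtain e :: 'e where e: "e \<in> Basis" using nonempty_Basis by blast
    \<comment> \<open>A test vector whose covector reads off the coordinate \<open>l i\<close> of
      the field variation.\<close>
    obtain W where W: "\<And>\<mu>. blinfun_apply W \<mu> = (\<mu> \<bullet> e) *\<^sub>R (0 :: 'g, blinfun_scaleR_left e o\<^sub>L l i)"
      using rank_one_blinfun by metis
    show "blinfun_apply (l i) \<phi> = 0"
      using om0[of 0 W] tr_dual[OF e, of "blinfun_apply (l i) \<phi> *\<^sub>R e"] e
      by (simp add: r_of_apply W blinfun.scaleR_left tr_def)
  qed
  moreover have "w1 = 0"
  proof (rule blinfun_euclidean_eqI)
    fix e :: 'e assume e: "e \<in> Basis"
    have "blinfun_apply w1 e = 0"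
    proof (rule zeroI)
      fix i
      have "tr (\<lambda>\<mu>. blinfun_apply (l i) (blinfun_apply w1 \<mu>) *\<^sub>R e) = blinfun_apply (l i) (blinfun_apply w1 e)"
        by (rule tr_rank_one) (auto intro!: linear_combinationI simp: blinfun.add_right blinfun.scaleR_right)
      then show "blinfun_apply (l i) (blinfun_apply w1 e) = 0"
        using om0[of "blinfun_scaleR_left e o\<^sub>L l i" 0] by (simp add: r_of_apply tr_def)
    qed
    then show "blinfun_apply w1 e = blinfun_apply 0 e" by simp
  qed
  ultimately show "model_map X = 0"
    using X \<open>?r = 0\<close> by (simp add: model_map_def zero_prod_def \<phi>_def w1_def)
qed

section \<open>The transformation law\<close>

text \<open>The change of bundle charts covers the change of charts of \<open>B\<close>, and so does
  its derivative.\<close>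

lemma (in fibred_atlas) D_transition_CH:
  assumes ac: "(a, c) \<in> adapted M B \<pi>" and ac': "(a', c') \<in> adapted M B \<pi>" and b: "b \<in> fst c" "b \<in> fst c'"
  shows "(fst (D (transition (CH a c) (CH a' c')) (fst (snd c b), snd (snd c b), w) v),
      fst (snd (D (transition (CH a c) (CH a' c')) (fst (snd c b), snd (snd c b), w) v)))
    = D (transition c c') (snd c b) (fst v, fst (snd v))"
proof -
  let ?y = "(fst (snd c b), snd (snd c b), w)"
  let ?t = "transition (CH a c) (CH a' c')"
  have pt: "K a c b w \<in> fst (CH a c)" "K a c b w \<in> fst (CH a' c')"
    using K_in_CH[OF ac b(1), of w] K_in[OF ac b(1)] b(2) by (auto simp: CH_def fst_K)
  have 1: "(?t has_derivative D ?t ?y) (at ?y)"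
    using has_derivative_transition[OF maxatlas_AT CH_in_AT[OF ac] CH_in_AT[OF ac'] pt] snd_CH[OF ac b(1)] by simp
  have 2: "((\<lambda>y. (fst (?t y), fst (snd (?t y)))) has_derivative (\<lambda>v. (fst (D ?t ?y v), fst (snd (D ?t ?y v))))) (at ?y)"
    by (intro has_derivative_Pair has_derivative_fst has_derivative_snd 1)
  have 3: "((\<lambda>y. (fst y, fst (snd y))) has_derivative (\<lambda>v. (fst v, fst (snd v)))) (at ?y)"
    by (intro has_derivative_Pair has_derivative_fst has_derivative_snd has_derivative_ident)
  have 4: "(transition c c' has_derivative D (transition c c') (snd c b)) (at (fst ?y, fst (snd ?y)))"
    using has_derivative_transition[OF B adaptedD(2)[OF ac] adaptedD(2)[OF ac'] b] by simp
  have "((\<lambda>y. transition c c' (fst y, fst (snd y))) has_derivative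
      (\<lambda>v. D (transition c c') (snd c b) (fst v, fst (snd v)))) (at ?y)"
    by (rule has_derivative_compose[OF 3 4])
  then have "((\<lambda>y. (fst (?t y), fst (snd (?t y)))) has_derivative
      (\<lambda>v. D (transition c c') (snd c b) (fst v, fst (snd v)))) (at ?y)"
  proof (rule has_derivative_transform_within_open[OF _ open_dom_of[OF ac ac']])
    show "?y \<in> dom_of c c'" using b by simp
    fix y :: "'e \<times> 'h \<times> 'w" assume "y \<in> dom_of c c'"
    then obtain q where q: "q \<in> fst c" "q \<in> fst c'" "(fst y, fst (snd y)) = snd c q" by auto
    then have "y = (fst (snd c q), snd (snd c q), snd (snd y))" by (metis fst_conv prod.collapse snd_conv)
    then have "?t y = (fst (snd c' q), snd (snd c' q), R a c a' c' (snd c q) (snd (snd y)))"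
      using transition_CH[OF ac ac' q(1,2)] by metis
    then show "transition c c' (fst y, fst (snd y)) = (fst (?t y), fst (snd (?t y)))"
      using q transition_rep(3)[OF B adaptedD(2)[OF ac] adaptedD(2)[OF ac'] q(1)] by simp
  qed
  from has_derivative_unique[OF 2 this] show ?thesis by metis
qed

section \<open>The tower of bundles over \<open>Q\<close> and its induced charts\<close>

locale multi_phase = Q: adapted_bundle M Q \<pi>
  for M :: "('m, 'e::euclidean_space) atlas" and Q :: "('q, 'e \<times> 'g::real_normed_vector) atlas"
    and \<pi> :: "'q \<Rightarrow> 'm"
begin

text \<open>Naming in the tower: \<open>J\<close>, \<open>Ph\<close>, \<open>JP\<close> and
  \<open>T\<close> describe the jets of \<open>Q\<close>, the phase bundle, the jets of the phase
  bundle and the target through their fibre coordinates; \<open>QI\<close>, \<open>P\<close> and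
  \<open>Y\<close> are the first three as bundles over \<open>M\<close>.\<close>

sublocale J: fibred_atlas M Q \<pi> "J1_points M Q \<pi>" "\<lambda>a c. snd (J1_chart M Q \<pi> a c)" Q.jet_at Q.jet_change
  by (rule Q.fibred_atlas_J1)

lemma J_CH: "J.CH a c = J1_chart M Q \<pi> a c"
  by (rule prod_eqI) (simp_all add: J.CH_def, simp add: J1_chart_def)

lemma J_AT: "J.AT = J1 M Q \<pi>"
  by (simp add: J.AT_def J1_def J_CH)

lemma J1_proj_eq: "J1_proj \<pi> = (\<lambda>x. \<pi> (fst x))"
  by (simp add: J1_proj_def fun_eq_iff)

sublocale QI: adapted_bundle M "J1 M Q \<pi>" "J1_proj \<pi>"
  using J.adapted_bundle_AT unfolding J_AT J1_proj_eq .

sublocale Ph: fibred_atlas M Q \<pi> "phase_points M Q \<pi>" "\<lambda>a c. snd (phase_chart M Q \<pi> a c)" Q.phase_at Q.phase_change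
  by (rule Q.fibred_atlas_phase)

lemma Ph_CH: "Ph.CH a c = phase_chart M Q \<pi> a c"
  by (rule prod_eqI) (simp_all add: Ph.CH_def, simp add: phase_chart_def)

lemma Ph_AT: "Ph.AT = phase_bundle M Q \<pi>"
  by (simp add: Ph.AT_def phase_bundle_def Ph_CH)

lemma phase_proj_eq: "phase_proj \<pi> = (\<lambda>x. \<pi> (fst x))"
  by (simp add: phase_proj_def fun_eq_iff)

sublocale P: adapted_bundle M "phase_bundle M Q \<pi>" "phase_proj \<pi>"
  using Ph.adapted_bundle_AT unfolding Ph_AT phase_proj_eq .

sublocale JP: fibred_atlas M "phase_bundle M Q \<pi>" "phase_proj \<pi>" "J1_points M (phase_bundle M Q \<pi>) (phase_proj \<pi>)"
    "\<lambda>a c. snd (J1_chart M (phase_bundle M Q \<pi>) (phase_proj \<pi>) a c)" P.jet_at P.jet_change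
  by (rule P.fibred_atlas_J1)

lemma JP_CH: "JP.CH a c = J1_chart M (phase_bundle M Q \<pi>) (phase_proj \<pi>) a c"
  by (rule prod_eqI) (simp_all add: JP.CH_def, simp add: J1_chart_def)

lemma JP_AT: "JP.AT = J1P M Q \<pi>"
  by (simp add: JP.AT_def J1P_def J1_def JP_CH)

lemma J1P_proj_eq: "J1P_proj \<pi> = (\<lambda>x. phase_proj \<pi> (fst x))"
  by (simp add: J1P_proj_def J1_proj_def fun_eq_iff)

sublocale Y: adapted_bundle M "J1P M Q \<pi>" "J1P_proj \<pi>"
  using JP.adapted_bundle_AT unfolding JP_AT J1P_proj_eq .

sublocale T: fibred_atlas M "J1 M Q \<pi>" "J1_proj \<pi>" "inf_target_points M Q \<pi>"
    "\<lambda>a c. snd (top_chart M (J1 M Q \<pi>) (J1_proj \<pi>) a c)" QI.top_at QI.top_change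
  unfolding inf_target_points_def by (rule QI.fibred_atlas_top)

lemma T_CH: "T.CH a c = top_chart M (J1 M Q \<pi>) (J1_proj \<pi>) a c"
  by (rule prod_eqI) (simp_all add: T.CH_def, simp add: top_chart_def inf_target_points_def)

lemma T_AT: "T.AT = inf_target M Q \<pi>"
  unfolding T.AT_def T_CH unfolding inf_target_def top_bundle_def inf_target_points_def ..

abbreviation "JC \<equiv> J1_chart M Q \<pi>"
abbreviation "PC \<equiv> phase_chart M Q \<pi>"
abbreviation "YC \<equiv> J1P_chart M Q \<pi>"
abbreviation "TC \<equiv> inf_target_chart M Q \<pi>"

lemma YC_CH: "YC a c = JP.CH a (PC a c)"
  by (simp add: JP_CH J1P_chart_def)

lemma TC_CH: "TC a c = T.CH a (JC a c)"
  by (simp add: T_CH inf_target_chart_def)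

lemma adapted_charts:
  assumes "(a, c) \<in> adapted M Q \<pi>"
  shows "(a, JC a c) \<in> adapted M (J1 M Q \<pi>) (J1_proj \<pi>)"
    and "(a, PC a c) \<in> adapted M (phase_bundle M Q \<pi>) (phase_proj \<pi>)"
    and "(a, YC a c) \<in> adapted M (J1P M Q \<pi>) (J1P_proj \<pi>)"
proof -
  show "(a, JC a c) \<in> adapted M (J1 M Q \<pi>) (J1_proj \<pi>)"
    using J.CH_adapted[OF assms] unfolding J_CH J_AT J1_proj_eq .
  show P: "(a, PC a c) \<in> adapted M (phase_bundle M Q \<pi>) (phase_proj \<pi>)"
    using Ph.CH_adapted[OF assms] unfolding Ph_CH Ph_AT phase_proj_eq .
  show "(a, YC a c) \<in> adapted M (J1P M Q \<pi>) (J1P_proj \<pi>)"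
    using JP.CH_adapted[OF P] unfolding YC_CH JP_AT J1P_proj_eq .
qed

definition pt :: "('m, 'e) chart \<Rightarrow> ('q, 'e \<times> 'g) chart \<Rightarrow> 'q \<Rightarrow> ('g \<Rightarrow>\<^sub>L 'e) \<Rightarrow> ('e \<Rightarrow>\<^sub>L ('g \<times> ('g \<Rightarrow>\<^sub>L 'e)))
    \<Rightarrow> ('m, 'e, 'q, 'g) jet_phase" where
  "pt a c b p w = P.jet_at a (PC a c) (Q.phase_at a c b p) w"

definition tp :: "('m, 'e) chart \<Rightarrow> ('q, 'e \<times> 'g) chart \<Rightarrow> 'q \<Rightarrow> ('e \<Rightarrow>\<^sub>L 'g) \<Rightarrow> (('g \<times> ('e \<Rightarrow>\<^sub>L 'g)) \<Rightarrow>\<^sub>L real)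
    \<Rightarrow> ('m, 'e, 'q, 'g) inf_form" where
  "tp a c b w r = QI.top_at a (JC a c) (Q.jet_at a c b w) r"

context
  fixes a c assumes ac: "(a, c) \<in> adapted M Q \<pi>"
begin

lemma in_PC: "b \<in> fst c \<Longrightarrow> Q.phase_at a c b p \<in> fst (PC a c)"
  using Ph.K_in_CH[OF ac] by (simp add: Ph_CH)

lemma in_JC: "b \<in> fst c \<Longrightarrow> Q.jet_at a c b w \<in> fst (JC a c)"
  using J.K_in_CH[OF ac] by (simp add: J_CH)

lemma pt_in: "b \<in> fst c \<Longrightarrow> pt a c b p w \<in> fst (YC a c)"
  unfolding pt_def YC_CH by (rule JP.K_in_CH[OF adapted_charts(2)[OF ac] in_PC])

lemma tp_in: "b \<in> fst c \<Longrightarrow> tp a c b w r \<in> fst (TC a c)"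
  unfolding tp_def TC_CH by (rule T.K_in_CH[OF adapted_charts(1)[OF ac] in_JC])

lemma pt_coord: "b \<in> fst c \<Longrightarrow> snd (YC a c) (pt a c b p w) = (fst (snd c b), (snd (snd c b), p), w)"
  unfolding pt_def YC_CH
  using JP.snd_CH[OF adapted_charts(2)[OF ac] in_PC] Ph.snd_CH[OF ac] by (simp add: Ph_CH)

lemma tp_coord: "b \<in> fst c \<Longrightarrow> snd (TC a c) (tp a c b w r) = (fst (snd c b), (snd (snd c b), w), r)"
  unfolding tp_def TC_CH
  using T.snd_CH[OF adapted_charts(1)[OF ac] in_JC] J.snd_CH[OF ac] by (simp add: J_CH)

lemma pt_cases:
  assumes "y \<in> fst (YC a c)"
  obtains b p w where "b \<in> fst c" "y = pt a c b p w"
proof -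
  obtain q w where q: "q \<in> fst (PC a c)" "y = P.jet_at a (PC a c) q w"
    using JP.CH_cases[OF adapted_charts(2)[OF ac] assms[unfolded YC_CH]] .
  obtain b p where b: "b \<in> fst c" "q = Q.phase_at a c b p"
  proof -
    have "q \<in> fst (Ph.CH a c)" unfolding Ph_CH by (rule q(1))
    from Ph.CH_cases[OF ac this] show ?thesis using that by blast
  qed
  show ?thesis by (rule that[OF b(1)]) (simp add: q(2) b(2) pt_def)
qed

lemma tp_cases:
  assumes "y \<in> fst (TC a c)"
  obtains b w r where "b \<in> fst c" "y = tp a c b w r"
proof -
  obtain q r where q: "q \<in> fst (JC a c)" "y = QI.top_at a (JC a c) q r"
    using T.CH_cases[OF adapted_charts(1)[OF ac] assms[unfolded TC_CH]] .
  obtain b w where b: "b \<in> fst c" "q = Q.jet_at a c b w"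
  proof -
    have "q \<in> fst (J.CH a c)" unfolding J_CH by (rule q(1))
    from J.CH_cases[OF ac this] show ?thesis using that by blast
  qed
  show ?thesis by (rule that[OF b(1)]) (simp add: q(2) b(2) tp_def)
qed

lemma img_YC: "img (YC a c) = {y. (fst y, fst (fst (snd y))) \<in> img c}"
proof -
  have "img (YC a c) = {y. (fst y, fst (snd y)) \<in> img (PC a c)}"
    using JP.img_CH_all[OF adapted_charts(2)[OF ac]] by (simp add: YC_CH)
  then show ?thesis using Ph.img_CH_all[OF ac] by (simp add: Ph_CH)
qed

end

lemma phase_proj_at [simp]: "phase_proj \<pi> (Q.phase_at a c b p) = \<pi> b"
  by (simp add: phase_proj_def)

lemma base_pt [simp]: "fst (fst (pt a c b p w)) = b" "J1P_proj \<pi> (pt a c b p w) = \<pi> b"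
  by (simp_all add: pt_def J1P_proj_def J1_proj_def)

lemma base_tp [simp]: "fst (fst (tp a c b w r)) = b" "fst (tp a c b w r) = Q.jet_at a c b w"
  by (simp_all add: tp_def)

end

section \<open>A change of adapted charts and its effect on jets, phases and covectors\<close>

locale multi_phase_change = multi_phase M Q \<pi>
  for M :: "('m, 'e::euclidean_space) atlas" and Q :: "('q, 'e \<times> 'g::real_normed_vector) atlas"
    and \<pi> :: "'q \<Rightarrow> 'm" +
  fixes a c a' c'
  assumes ac: "(a, c) \<in> adapted M Q \<pi>" and ac': "(a', c') \<in> adapted M Q \<pi>"
begin

abbreviation "F \<equiv> transition c c'"
abbreviation "\<tau>J \<equiv> transition (JC a c) (JC a' c')"
abbreviation "\<tau>P \<equiv> transition (PC a c) (PC a' c')"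
abbreviation "\<tau>Y \<equiv> transition (YC a c) (YC a' c')"
abbreviation "fc \<equiv> transition a a'"

text \<open>The reciprocal of the Jacobian determinant of \<open>fc\<close>, as a function of the
  old base coordinates.\<close>

definition \<kappa> :: "'e \<Rightarrow> real" where
  "\<kappa> x = Q.vol_ratio a a' (fc x)"

abbreviation "overlap \<equiv> snd c ` (fst c \<inter> fst c')"
abbreviation "base_overlap \<equiv> snd a ` (fst a \<inter> fst a')"

lemma a_in: "a \<in> M" "a' \<in> M" "c \<in> Q" "c' \<in> Q"
  using Q.adaptedD(1,2)[OF ac] Q.adaptedD(1,2)[OF ac'] by auto

lemmas base_trans = transition_rep[OF Q.M a_in(1,2)] transition_rep[OF Q.M a_in(2,1)]
lemmas total_trans = transition_rep[OF Q.B a_in(3,4)]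

lemma fst_overlap: "z \<in> overlap \<Longrightarrow> fst z \<in> base_overlap"
  using Q.adaptedD(3,4)[OF ac] Q.adaptedD(3)[OF ac'] by auto

lemma \<kappa>_vol:
  assumes "y \<in> base_overlap"
  shows "\<kappa> y * vol (\<lambda>i. D fc y (basis_enum i)) = 1"
proof -
  obtain q where q: "q \<in> fst a" "q \<in> fst a'" "y = snd a q" using assms by blast
  have at: "a \<in> charts_at M q" "a' \<in> charts_at M q" using q a_in by (auto simp: charts_at_iff)
  have fq: "fc y = snd a' q" using q base_trans(3) by simp
  have "linear (D (transition a' a) (snd a' q))"
    by (rule has_derivative_linear[OF has_derivative_transition[OF Q.M a_in(2,1) q(2,1)]])
  from vol_linear_map[OF this, of "\<lambda>i. D fc y (basis_enum i)"]
  show ?thesis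
    using D_transition_compose[OF Q.M at(1,2,1)] D_transition_self[OF Q.M at(1)]
    by (simp add: \<kappa>_def Q.vol_ratio_def fq[unfolded q(3)] q(3) vol_basis_enum)
qed

lemma \<kappa>_derivative:
  assumes "x \<in> base_overlap"
  shows "(\<kappa> has_derivative D \<kappa> x) (at x)"
proof -
  have "smooth_on base_overlap \<kappa>"
    unfolding \<kappa>_def Q.vol_ratio_def
    by (rule smooth_on_vol[OF base_trans(1)],
        rule smooth_on_D_apply[OF fdim_euclidean base_trans(1) base_trans(5,2) _ smooth_on_const])
      (use base_trans(3) in auto)
  then show ?thesis using assms smooth_on_has_derivative by blast
qed

lemma overlapE:
  assumes "z \<in> overlap"
  obtains b where "b \<in> fst c" "b \<in> fst c'" "z = snd c b"
  using assms by blast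

lemma \<tau>P_eq: "z \<in> overlap \<Longrightarrow> \<tau>P (fst z, snd z, p) = (fst (F z), snd (F z), Q.phase_change a c a' c' z p)"
  by (erule overlapE) (use Ph.transition_CH[OF ac ac'] total_trans(3) in \<open>simp add: Ph_CH\<close>)

lemma \<tau>J_eq: "z \<in> overlap \<Longrightarrow> \<tau>J (fst z, snd z, w) = (fst (F z), snd (F z), Q.jet_change a c a' c' z w)"
  by (erule overlapE) (use J.transition_CH[OF ac ac'] total_trans(3) in \<open>simp add: J_CH\<close>)

text \<open>Applying the new phase to a transformed vertical vector cancels the inverse vertical
  Jacobian in \<open>phase_change\<close>. The right side contains only \<kappa> and the derivative
  of \<open>fc\<close>, so the identity can be differentiated directly.\<close>

lemma phase_change_contract:
  assumes "z \<in> overlap"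
  shows "blinfun_apply (Q.phase_change a c a' c' z p) (snd (D F z (0, \<eta>)))
    = \<kappa> (fst z) *\<^sub>R D fc (fst z) (blinfun_apply p \<eta>)"
proof -
  obtain b where b: "b \<in> fst c" "b \<in> fst c'" "z = snd c b" using assms by blast
  have "fc (snd a (\<pi> b)) = snd a' (\<pi> b)"
    using base_trans(3) Q.adaptedD(3)[OF ac b(1)] by simp
  then show ?thesis
    unfolding b(3) Q.phase_change_apply[OF ac ac' b(1,2)] Q.D_vertical_inverse[OF ac ac' b(1,2)]
      Q.transition_points(2)[OF ac ac' b(1,2)] by (simp add: \<kappa>_def)
qed

lemma jet_change_contract:
  assumes "z \<in> overlap"
  shows "D F z (u, blinfun_apply w u)
    = (D fc (fst z) u, blinfun_apply (Q.jet_change a c a' c' z w) (D fc (fst z) u))"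
proof -
  obtain b where b: "b \<in> fst c" "b \<in> fst c'" "z = snd c b" using assms by blast
  show ?thesis
    using Q.jet_change_D[OF ac ac' b(1,2)] Q.transition_points(2)[OF ac ac' b(1,2)] by (simp add: b(3) Let_def)
qed

definition phase' :: "'e \<times> 'g \<Rightarrow> ('g \<Rightarrow>\<^sub>L 'e) \<Rightarrow> ('g \<Rightarrow>\<^sub>L 'e)" where
  "phase' z p = Q.phase_change a c a' c' z p"

text \<open>The jet transformation of the phase bundle, hence the first derivative of a map that
  already contains first derivatives of \<open>F\<close>; it is accessed only through
  \<open>jet'_contract\<close>.\<close>

definition jet' :: "'e \<times> 'g \<Rightarrow> ('g \<Rightarrow>\<^sub>L 'e) \<Rightarrow> ('e \<Rightarrow>\<^sub>L ('g \<times> ('g \<Rightarrow>\<^sub>L 'e))) \<Rightarrow> ('e \<Rightarrow>\<^sub>L ('g \<times> ('g \<Rightarrow>\<^sub>L 'e)))" where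
  "jet' z p w = P.jet_change a (PC a c) a' (PC a' c') (fst z, snd z, p) w"

lemma phase_at_both:
  assumes b: "b \<in> fst c" "b \<in> fst c'"
  shows "Q.phase_at a c b p \<in> fst (PC a c)" "Q.phase_at a c b p \<in> fst (PC a' c')"
    "snd (PC a c) (Q.phase_at a c b p) = (fst (snd c b), snd (snd c b), p)"
  using in_PC[OF ac b(1)] in_PC[OF ac' b(2)] Q.phase_at_change[OF ac ac' b] Ph.snd_CH[OF ac b(1)]
  by (auto simp: Ph_CH)

lemma jet'_contract:
  assumes "z \<in> overlap"
  shows "D \<tau>P (fst z, snd z, p) (u, blinfun_apply w u)
    = (D fc (fst z) u, blinfun_apply (jet' z p w) (D fc (fst z) u))"
proof -
  obtain b where b: "b \<in> fst c" "b \<in> fst c'" "z = snd c b" using assms by blast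
  note pb = phase_at_both[OF b(1,2), of p]
  show ?thesis
    using P.jet_change_D[OF adapted_charts(2)[OF ac] adapted_charts(2)[OF ac'] pb(1,2), of u w]
      Q.transition_points(2)[OF ac ac' b(1,2)]
    by (simp add: pb(3) b(3) jet'_def Let_def phase_proj_eq)
qed

lemma pt_change:
  assumes b: "b \<in> fst c" "b \<in> fst c'"
  shows "pt a c b p w = pt a' c' b (phase' (snd c b) p) (jet' (snd c b) p w)"
  unfolding pt_def phase'_def jet'_def Q.phase_at_change[OF ac ac' b, symmetric]
  using P.jet_at_change[OF adapted_charts(2)[OF ac] adapted_charts(2)[OF ac'] phase_at_both(1,2)[OF b]]
  by (simp add: phase_at_both(3)[OF b])

lemma D_\<tau>P_fst:
  assumes "z \<in> overlap"
  shows "(fst (D \<tau>P (fst z, snd z, p) v), fst (snd (D \<tau>P (fst z, snd z, p) v))) = D F z (fst v, fst (snd v))"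
proof -
  obtain b where b: "b \<in> fst c" "b \<in> fst c'" "z = snd c b" using assms by blast
  show ?thesis unfolding b(3) by (rule Ph.D_transition_CH[OF ac ac' b(1,2), unfolded Ph_CH])
qed

lemma D_\<tau>J_fst:
  assumes "z \<in> overlap"
  shows "(fst (D \<tau>J (fst z, snd z, w) v), fst (snd (D \<tau>J (fst z, snd z, w) v))) = D F z (fst v, fst (snd v))"
proof -
  obtain b where b: "b \<in> fst c" "b \<in> fst c'" "z = snd c b" using assms by blast
  show ?thesis unfolding b(3) by (rule J.D_transition_CH[OF ac ac' b(1,2), unfolded J_CH])
qed

lemma D_base_bij:
  assumes "x \<in> base_overlap"
  shows "linear (D fc x)" "linear (D (transition a' a) (fc x))"
    "D (transition a' a) (fc x) (D fc x u) = u" "D fc x (D (transition a' a) (fc x) u) = u"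
proof -
  obtain q where q: "q \<in> fst a" "q \<in> fst a'" "x = snd a q" using assms by blast
  have at: "a \<in> charts_at M q" "a' \<in> charts_at M q" using q a_in by (auto simp: charts_at_iff)
  have fq: "fc x = snd a' q" using q base_trans(3) by simp
  show "linear (D fc x)"
    unfolding q(3) by (rule has_derivative_linear[OF has_derivative_transition[OF Q.M a_in(1,2) q(1,2)]])
  show "linear (D (transition a' a) (fc x))"
    unfolding fq by (rule has_derivative_linear[OF has_derivative_transition[OF Q.M a_in(2,1) q(2,1)]])
  show "D (transition a' a) (fc x) (D fc x u) = u"
    using D_transition_compose[OF Q.M at(1,2,1)] D_transition_self[OF Q.M at(1)] by (simp add: fq[unfolded q(3)] q(3))
  show "D fc x (D (transition a' a) (fc x) u) = u"
    using D_transition_compose[OF Q.M at(2,1,2)] D_transition_self[OF Q.M at(2)] by (simp add: fq[unfolded q(3)] q(3))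
qed

text \<open>The change on the phase bundle covers \<open>F\<close>, so its action on jets covers the
  action of \<open>F\<close> on jets of \<open>Q\<close>.\<close>

lemma fst_jet':
  assumes z: "z \<in> overlap"
  shows "fst_blinfun o\<^sub>L jet' z p w = Q.jet_change a c a' c' z (fst_blinfun o\<^sub>L w)"
proof (rule blinfun_eqI)
  fix u
  note bij = D_base_bij[OF fst_overlap[OF z]]
  let ?v = "D (transition a' a) (fc (fst z)) u"
  have "D F z (?v, fst (blinfun_apply w ?v)) = (D fc (fst z) ?v, fst (blinfun_apply (jet' z p w) (D fc (fst z) ?v)))"
    using D_\<tau>P_fst[OF z, of p "(?v, blinfun_apply w ?v)"] unfolding jet'_contract[OF z] by simp
  then show "blinfun_apply (fst_blinfun o\<^sub>L jet' z p w) u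
      = blinfun_apply (Q.jet_change a c a' c' z (fst_blinfun o\<^sub>L w)) u"
    using jet_change_contract[OF z, of ?v "fst_blinfun o\<^sub>L w"] by (simp add: bij(4))
qed

lemma \<tau>P_derivative:
  assumes "z \<in> overlap"
  shows "(\<tau>P has_derivative D \<tau>P (fst z, snd z, p)) (at (fst z, snd z, p))"
proof -
  obtain b where b: "b \<in> fst c" "b \<in> fst c'" "z = snd c b" using assms by blast
  show ?thesis
    using has_derivative_transition[OF P.B P.adaptedD(2)[OF adapted_charts(2)[OF ac]]
      P.adaptedD(2)[OF adapted_charts(2)[OF ac']] phase_at_both(1,2)[OF b(1,2)], where p1 = p]
    by (simp add: phase_at_both(3)[OF b(1,2)] b(3))
qed

lemma jet_at_both:
  assumes b: "b \<in> fst c" "b \<in> fst c'"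
  shows "Q.jet_at a c b w \<in> fst (JC a c)" "Q.jet_at a c b w \<in> fst (JC a' c')"
    "snd (JC a c) (Q.jet_at a c b w) = (fst (snd c b), snd (snd c b), w)"
  using in_JC[OF ac b(1)] in_JC[OF ac' b(2)] Q.jet_at_change[OF ac ac' b] J.snd_CH[OF ac b(1)]
  by (auto simp: J_CH)

lemma \<tau>J_derivative:
  assumes "z \<in> overlap"
  shows "(\<tau>J has_derivative D \<tau>J (fst z, snd z, w)) (at (fst z, snd z, w))"
proof -
  obtain b where b: "b \<in> fst c" "b \<in> fst c'" "z = snd c b" using assms by blast
  show ?thesis
    using has_derivative_transition[OF QI.B QI.adaptedD(2)[OF adapted_charts(1)[OF ac]]
      QI.adaptedD(2)[OF adapted_charts(1)[OF ac']] jet_at_both(1,2)[OF b(1,2)], where w1 = w]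
    by (simp add: jet_at_both(3)[OF b(1,2)] b(3))
qed

text \<open>The following two identities are the derivatives of \<open>jet_change_contract\<close> in a vertical
  direction and of \<open>phase_change_contract\<close> along the given jet of a section.\<close>

lemma jet_change_derivative:
  assumes z: "z \<in> overlap"
  shows "blinfun_apply (snd (snd (D \<tau>J (fst z, snd z, w) (0, \<delta>\<phi>, \<delta>w)))) (D fc (fst z) v)
    = snd (D (\<lambda>y. D F y (v, blinfun_apply w v)) z (0, \<delta>\<phi>)) + snd (D F z (0, blinfun_apply \<delta>w v))"
proof -
  let ?y = "\<lambda>t. (fst z, snd z, w) + t *\<^sub>R (0, \<delta>\<phi>, \<delta>w)"
  let ?z = "\<lambda>t. z + t *\<^sub>R (0, \<delta>\<phi>)"
  have L: "((\<lambda>t. snd (D F (?z t) ((v, blinfun_apply w v) + t *\<^sub>R (0, blinfun_apply \<delta>w v)))) has_vector_derivative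
      snd (D (\<lambda>y. D F y (v, blinfun_apply w v)) z (0, \<delta>\<phi>) + D F z (0, blinfun_apply \<delta>w v))) (at 0)"
    by (rule bounded_linear.has_vector_derivative[OF bounded_linear_snd line_derivative_D[OF total_trans(2,1) z]])
  have "((\<lambda>t. blinfun_apply (snd (snd (\<tau>J (?y t)))) (D fc (fst z) v)) has_vector_derivative
      blinfun_apply (snd (snd (D \<tau>J (fst z, snd z, w) (0, \<delta>\<phi>, \<delta>w)))) (D fc (fst z) v)) (at 0)"
    by (rule bounded_linear.has_vector_derivative[OF blinfun.bounded_linear_left]
        bounded_linear.has_vector_derivative[OF bounded_linear_snd] line_derivative[OF \<tau>J_derivative[OF z]])+
  then have R: "((\<lambda>t. snd (D F (?z t) ((v, blinfun_apply w v) + t *\<^sub>R (0, blinfun_apply \<delta>w v)))) has_vector_derivative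
      blinfun_apply (snd (snd (D \<tau>J (fst z, snd z, w) (0, \<delta>\<phi>, \<delta>w)))) (D fc (fst z) v)) (at 0)"
  proof (rule has_vector_derivative_transform_within_open[OF _ open_line_preimage[OF total_trans(1), of z "(0, \<delta>\<phi>)"]])
    fix t assume "t \<in> {t. ?z t \<in> overlap}"
    then have zt: "?z t \<in> overlap" by simp
    have "?y t = (fst (?z t), snd (?z t), w + t *\<^sub>R \<delta>w)" by simp
    then have "snd (snd (\<tau>J (?y t))) = Q.jet_change a c a' c' (?z t) (w + t *\<^sub>R \<delta>w)"
      using \<tau>J_eq[OF zt] by simp
    then show "blinfun_apply (snd (snd (\<tau>J (?y t)))) (D fc (fst z) v)
        = snd (D F (?z t) ((v, blinfun_apply w v) + t *\<^sub>R (0, blinfun_apply \<delta>w v)))"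
      using jet_change_contract[OF zt, of v "w + t *\<^sub>R \<delta>w"]
      by (simp add: blinfun.add_left blinfun.scaleR_left)
  qed (use z in \<open>simp add: zero_prod_def[symmetric]\<close>)
  show ?thesis using vector_derivative_unique_at[OF R L] by simp
qed

lemma phase_change_derivative:
  assumes z: "z \<in> overlap"
  shows "blinfun_apply (phase' z p) (snd (D (\<lambda>y. D F y (0, \<eta>)) z (v, fst (blinfun_apply w v))))
      + blinfun_apply (snd (blinfun_apply (jet' z p w) (D fc (fst z) v))) (snd (D F z (0, \<eta>)))
    = D \<kappa> (fst z) v *\<^sub>R D fc (fst z) (blinfun_apply p \<eta>)
      + \<kappa> (fst z) *\<^sub>R (D (\<lambda>x. D fc x (blinfun_apply p \<eta>)) (fst z) v)
      + \<kappa> (fst z) *\<^sub>R D fc (fst z) (blinfun_apply (snd (blinfun_apply w v)) \<eta>)"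
proof -
  \<comment> \<open>The line through the point in the direction of the given jet of a section of the
    phase bundle; \<open>?z\<close> and \<open>?p\<close> are its parts in \<open>Q\<close> and in
    the momenta.\<close>
  let ?y = "\<lambda>t. (fst z, snd z, p) + t *\<^sub>R (v, blinfun_apply w v)"
  let ?z = "\<lambda>t. z + t *\<^sub>R (v, fst (blinfun_apply w v))"
  let ?p = "\<lambda>t. p + t *\<^sub>R snd (blinfun_apply w v)"
  note x = fst_overlap[OF z]
  have yt: "?y t = (fst (?z t), snd (?z t), ?p t)" for t by (simp add: prod_eq_iff)
  have L1: "((\<lambda>t. snd (snd (\<tau>P (?y t)))) has_vector_derivative
      snd (blinfun_apply (jet' z p w) (D fc (fst z) v))) (at 0)"
  proof -
    have "((\<lambda>t. snd (snd (\<tau>P (?y t)))) has_vector_derivative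
        snd (snd (D \<tau>P (fst z, snd z, p) (v, blinfun_apply w v)))) (at 0)"
      by (intro bounded_linear.has_vector_derivative[OF bounded_linear_snd] line_derivative \<tau>P_derivative z)
    then show ?thesis by (simp only: jet'_contract[OF z] snd_conv)
  qed
  have L2: "((\<lambda>t. snd (D F (?z t) ((0, \<eta>) + t *\<^sub>R 0))) has_vector_derivative
      snd (D (\<lambda>y. D F y (0, \<eta>)) z (v, fst (blinfun_apply w v)) + D F z 0)) (at 0)"
    by (rule bounded_linear.has_vector_derivative[OF bounded_linear_snd line_derivative_D[OF total_trans(2,1) z]])
  have "D F z 0 = 0"
    using has_derivative_linear[OF smooth_on_has_derivative[OF total_trans(2) z]] linear_0 by blast
  then have L2': "((\<lambda>t. snd (D F (?z t) (0, \<eta>))) has_vector_derivative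
      snd (D (\<lambda>y. D F y (0, \<eta>)) z (v, fst (blinfun_apply w v)))) (at 0)"
    using L2 by simp
  have L: "((\<lambda>t. blinfun_apply (snd (snd (\<tau>P (?y t)))) (snd (D F (?z t) (0, \<eta>)))) has_vector_derivative
      blinfun_apply (phase' z p) (snd (D (\<lambda>y. D F y (0, \<eta>)) z (v, fst (blinfun_apply w v))))
      + blinfun_apply (snd (blinfun_apply (jet' z p w) (D fc (fst z) v))) (snd (D F z (0, \<eta>)))) (at 0)"
  proof -
    have "?y 0 = (fst z, snd z, p)" "?z 0 = z" by (simp_all add: prod_eq_iff)
    then show ?thesis
      using bounded_bilinear.has_vector_derivative[OF bounded_bilinear_blinfun_apply L1 L2'] \<tau>P_eq[OF z, of p]
      by (simp only: phase'_def snd_conv)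
  qed
  have R1: "((\<lambda>t. \<kappa> (fst z + t *\<^sub>R v)) has_vector_derivative D \<kappa> (fst z) v) (at 0)"
    by (rule line_derivative[OF \<kappa>_derivative[OF x]])
  have R2: "((\<lambda>t. D fc (fst z + t *\<^sub>R v) (blinfun_apply p \<eta> + t *\<^sub>R blinfun_apply (snd (blinfun_apply w v)) \<eta>))
      has_vector_derivative D (\<lambda>x. D fc x (blinfun_apply p \<eta>)) (fst z) v
        + D fc (fst z) (blinfun_apply (snd (blinfun_apply w v)) \<eta>)) (at 0)"
    by (rule line_derivative_D[OF base_trans(2,1) x])
  have "((\<lambda>t. \<kappa> (fst z + t *\<^sub>R v) *\<^sub>R
        D fc (fst z + t *\<^sub>R v) (blinfun_apply p \<eta> + t *\<^sub>R blinfun_apply (snd (blinfun_apply w v)) \<eta>))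
      has_vector_derivative \<kappa> (fst z) *\<^sub>R (D (\<lambda>x. D fc x (blinfun_apply p \<eta>)) (fst z) v
        + D fc (fst z) (blinfun_apply (snd (blinfun_apply w v)) \<eta>))
        + D \<kappa> (fst z) v *\<^sub>R D fc (fst z) (blinfun_apply p \<eta>)) (at 0)"
    using bounded_bilinear.has_vector_derivative[OF bounded_bilinear_scaleR R1 R2] by simp
  then have R: "((\<lambda>t. blinfun_apply (snd (snd (\<tau>P (?y t)))) (snd (D F (?z t) (0, \<eta>))))
      has_vector_derivative \<kappa> (fst z) *\<^sub>R (D (\<lambda>x. D fc x (blinfun_apply p \<eta>)) (fst z) v
        + D fc (fst z) (blinfun_apply (snd (blinfun_apply w v)) \<eta>))
        + D \<kappa> (fst z) v *\<^sub>R D fc (fst z) (blinfun_apply p \<eta>)) (at 0)"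
  proof (rule has_vector_derivative_transform_within_open[OF _ open_line_preimage[OF total_trans(1), of z "(v, fst (blinfun_apply w v))"]])
    fix t assume "t \<in> {t. ?z t \<in> overlap}"
    then have zt: "?z t \<in> overlap" by simp
    have "snd (snd (\<tau>P (?y t))) = Q.phase_change a c a' c' (?z t) (?p t)"
      unfolding yt using \<tau>P_eq[OF zt, of "?p t"] by simp
    then show "\<kappa> (fst z + t *\<^sub>R v) *\<^sub>R
        D fc (fst z + t *\<^sub>R v) (blinfun_apply p \<eta> + t *\<^sub>R blinfun_apply (snd (blinfun_apply w v)) \<eta>)
      = blinfun_apply (snd (snd (\<tau>P (?y t)))) (snd (D F (?z t) (0, \<eta>)))"
      using phase_change_contract[OF zt, of "?p t" \<eta>] by (simp add: blinfun.add_left blinfun.scaleR_left)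
  qed (use z in \<open>simp add: zero_prod_def[symmetric]\<close>)
  show ?thesis using vector_derivative_unique_at[OF L R] by (simp add: algebra_simps)
qed

text \<open>\<open>N0 v\<close> is the derivative along \<open>v\<close> of the contracted form
  \<open>p \<delta>\<phi>\<close>, and \<open>N v\<close> is the same object in new coordinates. The
  second derivatives of \<open>F\<close> enter once through the new momentum derivatives and once
  through the new jet variation, and cancel in the sum. What remains is the derivative of
  \<open>\<kappa> Dfc (p \<delta>\<phi>)\<close>, whose trace is given by the Piola
  identity.\<close>

lemma transformation_law:
  assumes z: "z \<in> overlap"
  shows "blinfun_apply (r_of (phase' z p) (jet' z p w)) (snd (D \<tau>J (fst z, snd z, fst_blinfun o\<^sub>L w) (0, \<delta>)))
    = \<kappa> (fst z) * blinfun_apply (r_of p w) \<delta>"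
proof -
  obtain \<delta>\<phi> \<delta>w where \<delta>: "\<delta> = (\<delta>\<phi>, \<delta>w)" by (cases \<delta>)
  define w1 where "w1 = fst_blinfun o\<^sub>L w"
  define \<delta>' where "\<delta>' = snd (D \<tau>J (fst z, snd z, w1) (0, \<delta>\<phi>, \<delta>w))"
  note x = fst_overlap[OF z]
  have \<delta>\<phi>': "fst \<delta>' = snd (D F z (0, \<delta>\<phi>))"
    using D_\<tau>J_fst[OF z, of w1 "(0, \<delta>\<phi>, \<delta>w)"] by (metis \<delta>'_def fst_conv snd_conv)
  define T' where "T' v = blinfun_apply (snd (blinfun_apply (jet' z p w) v)) (fst \<delta>')
    + blinfun_apply (phase' z p) (blinfun_apply (snd \<delta>') v)" for v
  define N0 where "N0 v = blinfun_apply (snd (blinfun_apply w v)) \<delta>\<phi> + blinfun_apply p (blinfun_apply \<delta>w v)" for v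
  define N where "N v = T' (D fc (fst z) v)" for v
  have N: "N v = D \<kappa> (fst z) v *\<^sub>R D fc (fst z) (blinfun_apply p \<delta>\<phi>)
      + \<kappa> (fst z) *\<^sub>R D (\<lambda>x. D fc x (blinfun_apply p \<delta>\<phi>)) (fst z) v + \<kappa> (fst z) *\<^sub>R D fc (fst z) (N0 v)" for v
  proof -
    \<comment> \<open>Exchanging the vertical direction and the direction of the jet makes the two
      differentiated identities produce the same second derivative.\<close>
    have sym: "D (\<lambda>y. D F y (v, blinfun_apply w1 v)) z (0, \<delta>\<phi>) = D (\<lambda>y. D F y (0, \<delta>\<phi>)) z (v, fst (blinfun_apply w v))"
      using second_derivative_symmetric[OF total_trans(2,1) z, of "(v, blinfun_apply w1 v)" "(0, \<delta>\<phi>)"]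
      by (simp add: w1_def)
    have "blinfun_apply (snd \<delta>') (D fc (fst z) v) = snd (D (\<lambda>y. D F y (0, \<delta>\<phi>)) z (v, fst (blinfun_apply w v)))
        + snd (D F z (0, blinfun_apply \<delta>w v))"
      using jet_change_derivative[OF z, of w1 \<delta>\<phi> \<delta>w v] unfolding sym by (simp add: \<delta>'_def)
    then have "blinfun_apply (phase' z p) (blinfun_apply (snd \<delta>') (D fc (fst z) v))
      = blinfun_apply (phase' z p) (snd (D (\<lambda>y. D F y (0, \<delta>\<phi>)) z (v, fst (blinfun_apply w v))))
        + \<kappa> (fst z) *\<^sub>R D fc (fst z) (blinfun_apply p (blinfun_apply \<delta>w v))"
      using phase_change_contract[OF z, of p "blinfun_apply \<delta>w v"] by (simp add: blinfun.add_right phase'_def)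
    then show ?thesis
      using phase_change_derivative[OF z, of p \<delta>\<phi> v w] linear_add[OF D_base_bij(1)[OF x]]
      by (simp add: N_def T'_def N0_def \<delta>\<phi>' algebra_simps)
  qed
  have "linear N0"
    unfolding N0_def
    by (rule linear_combinationI) (simp add: blinfun.add_right blinfun.scaleR_right blinfun.add_left blinfun.scaleR_left algebra_simps)
  \<comment> \<open>Here the transported vector is \<open>p \<delta>\<phi>\<close>, and the inverse
    base Jacobian plays the part of \<open>A'\<close>.\<close>
  from trace_transformation[OF base_trans(2,1) x \<kappa>_vol \<kappa>_derivative[OF x] D_base_bij(2,3,4)[OF x] this N]
  have "tr T' = \<kappa> (fst z) * tr N0" unfolding N_def D_base_bij(4)[OF x] .
  then show ?thesis
    unfolding \<delta> w1_def[symmetric] \<delta>'_def[symmetric] r_of_apply T'_def N0_def tr_add by simp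
qed

end

section \<open>The degeneracy distribution\<close>

lemma omega_half_derivative:
  assumes X: "(X has_vector_derivative X') (at (t :: real))" and Y: "(Y has_vector_derivative Y') (at t)"
  shows "((\<lambda>t. omega_half (X t) (Y t)) has_vector_derivative omega_half (X t) Y' + omega_half X' (Y t)) (at t)"
proof -
  note fs = bounded_linear.has_vector_derivative[OF bounded_linear_fst] bounded_linear.has_vector_derivative[OF bounded_linear_snd]
  note bl = bounded_bilinear.has_vector_derivative[OF bounded_bilinear_blinfun_apply]
  have eq: "omega_half X Y = (\<Sum>\<mu>\<in>Basis. blinfun_apply (snd (blinfun_apply (snd (snd X)) \<mu>)) (fst (fst (snd Y))) \<bullet> \<mu>)
      + (\<Sum>\<mu>\<in>Basis. blinfun_apply (snd (fst (snd X))) (fst (blinfun_apply (snd (snd Y)) \<mu>)) \<bullet> \<mu>)"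
    for X Y :: "('e::euclidean_space, 'g::real_normed_vector) jet_phase_model"
    by (simp add: omega_half_eq r_of_apply tr_def)
  have 1: "((\<lambda>t. snd (blinfun_apply (snd (snd (X t))) \<mu>)) has_vector_derivative snd (blinfun_apply (snd (snd X')) \<mu>)) (at t)" for \<mu>
    by (intro fs bounded_linear.has_vector_derivative[OF blinfun.bounded_linear_left] X)
  have 2: "((\<lambda>t. fst (fst (snd (Y t)))) has_vector_derivative fst (fst (snd Y'))) (at t)"
    by (intro fs Y)
  have 3: "((\<lambda>t. fst (blinfun_apply (snd (snd (Y t))) \<mu>)) has_vector_derivative fst (blinfun_apply (snd (snd Y')) \<mu>)) (at t)" for \<mu>
    by (intro fs bounded_linear.has_vector_derivative[OF blinfun.bounded_linear_left] Y)
  have 4: "((\<lambda>t. snd (fst (snd (X t)))) has_vector_derivative snd (fst (snd X'))) (at t)"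
    by (intro fs X)
  have 5: "((\<lambda>t. blinfun_apply (snd (blinfun_apply (snd (snd (X t))) \<mu>)) (fst (fst (snd (Y t)))) \<bullet> \<mu>) has_vector_derivative
      (blinfun_apply (snd (blinfun_apply (snd (snd (X t))) \<mu>)) (fst (fst (snd Y')))
        + blinfun_apply (snd (blinfun_apply (snd (snd X')) \<mu>)) (fst (fst (snd (Y t))))) \<bullet> \<mu>) (at t)" for \<mu>
    by (rule bounded_linear.has_vector_derivative[OF bounded_linear_inner_left bl[OF 1 2]])
  have 6: "((\<lambda>t. blinfun_apply (snd (fst (snd (X t)))) (fst (blinfun_apply (snd (snd (Y t))) \<mu>)) \<bullet> \<mu>) has_vector_derivative
      (blinfun_apply (snd (fst (snd (X t)))) (fst (blinfun_apply (snd (snd Y')) \<mu>))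
        + blinfun_apply (snd (fst (snd X'))) (fst (blinfun_apply (snd (snd (Y t))) \<mu>))) \<bullet> \<mu>) (at t)" for \<mu>
    by (rule bounded_linear.has_vector_derivative[OF bounded_linear_inner_left bl[OF 4 3]])
  from has_vector_derivative_add[OF has_vector_derivative_sum[OF 5, where I = Basis] has_vector_derivative_sum[OF 6, where I = Basis]]
  show ?thesis unfolding eq by (simp add: inner_add_left sum.distrib algebra_simps)
qed

lemma omega_half_add: "omega_half (X + t *\<^sub>R X') Y = omega_half X Y + t * omega_half X' Y"
  unfolding omega_half_eq
  by (simp add: r_of_apply blinfun.add_left blinfun.scaleR_left tr_add tr_scaleR algebra_simps)

section \<open>Covariance of the one-form and of its vertical differential\<close>

context multi_phase_change
begin

text \<open>The coordinate expression of the projection to the jets of \<open>Q\<close>.\<close>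

definition pr :: "('e, 'g) jet_phase_model \<Rightarrow> 'e \<times> 'g \<times> ('e \<Rightarrow>\<^sub>L 'g)" where
  "pr y = (fst y, fst (fst (snd y)), fst_blinfun o\<^sub>L snd (snd y))"

abbreviation zz :: "('e, 'g) jet_phase_model \<Rightarrow> 'e \<times> 'g" where
  "zz y \<equiv> (fst y, fst (fst (snd y)))"

definition ydom :: "('e, 'g) jet_phase_model set" where
  "ydom = {y. zz y \<in> overlap}"

lemma bounded_linear_pr: "bounded_linear pr"
  unfolding pr_def
  by (intro bounded_linear_Pair bounded_linear_fst bounded_linear_fst_comp bounded_linear_snd_comp
      bounded_linear_compose[OF bounded_bilinear.bounded_linear_right[OF bounded_bilinear_blinfun_compose]]
      bounded_linear_snd)

lemma open_ydom: "open ydom"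
proof -
  have "open ((\<lambda>y :: ('e, 'g) jet_phase_model. zz y) -` overlap)"
    by (intro open_vimage total_trans(1) continuous_intros)
  then show ?thesis by (simp add: ydom_def vimage_def)
qed

lemma ydom_pt:
  assumes "y \<in> ydom"
  obtains b p w where "b \<in> fst c" "b \<in> fst c'" "zz y = snd c b" "p = snd (fst (snd y))" "w = snd (snd y)"
    "y = snd (YC a c) (pt a c b p w)"
proof -
  obtain b where b: "b \<in> fst c" "b \<in> fst c'" "zz y = snd c b" using assms by (auto simp: ydom_def)
  have "y = snd (YC a c) (pt a c b (snd (fst (snd y))) (snd (snd y)))"
    unfolding pt_coord[OF ac b(1)] b(3)[symmetric] by simp
  then show ?thesis using that b by blast
qed

lemma pt_both:
  assumes b: "b \<in> fst c" "b \<in> fst c'"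
  shows "pt a c b p w \<in> fst (YC a c)" "pt a c b p w \<in> fst (YC a' c')"
    "snd (YC a' c') (pt a c b p w) = (fst (snd c' b), (snd (snd c' b), phase' (snd c b) p), jet' (snd c b) p w)"
  using pt_in[OF ac b(1)] pt_in[OF ac' b(2)] pt_change[OF b] pt_coord[OF ac' b(2)] by auto

lemma YC_in: "YC a c \<in> J1P M Q \<pi>" "YC a' c' \<in> J1P M Q \<pi>"
  using Y.adaptedD(2)[OF adapted_charts(3)[OF ac]] Y.adaptedD(2)[OF adapted_charts(3)[OF ac']] by auto

lemmas Y_trans = transition_rep[OF Y.B YC_in]

lemma \<tau>Y_eq:
  assumes "y \<in> ydom"
  shows "\<tau>Y y = (fst (F (zz y)), (snd (F (zz y)), phase' (zz y) (snd (fst (snd y)))),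
    jet' (zz y) (snd (fst (snd y))) (snd (snd y)))"
proof (rule ydom_pt[OF assms])
  fix b p w assume b: "b \<in> fst c" "b \<in> fst c'" "zz y = snd c b" "p = snd (fst (snd y))" "w = snd (snd y)"
    "y = snd (YC a c) (pt a c b p w)"
  have "\<tau>Y y = snd (YC a' c') (pt a c b p w)"
    using Y_trans(3)[OF pt_both(1)[OF b(1,2)]] b(6) by simp
  then show ?thesis
    unfolding pt_both(3)[OF b(1,2)] b(3) b(4)[symmetric] b(5)[symmetric] using total_trans(3)[OF b(1)] by simp
qed

lemma smooth_\<tau>Y: "smooth_on ydom \<tau>Y"
proof (rule smooth_on_subset[OF Y_trans(2)], rule subsetI)
  fix y assume "y \<in> ydom"
  then show "y \<in> snd (YC a c) ` (fst (YC a c) \<inter> fst (YC a' c'))"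
    by (rule ydom_pt) (use pt_both(1,2) in blast)
qed

lemma pr_\<tau>Y: "y \<in> ydom \<Longrightarrow> pr (\<tau>Y y) = \<tau>J (pr y)"
  using \<tau>J_eq[of "zz y" "fst_blinfun o\<^sub>L snd (snd y)"] fst_jet'[of "zz y"]
  by (simp add: pr_def \<tau>Y_eq) (simp add: ydom_def)

lemma pr_D:
  assumes y: "y \<in> ydom"
  shows "pr (D \<tau>Y y Z) = D \<tau>J (pr y) (pr Z)"
proof -
  have z: "zz y \<in> overlap" using y by (simp add: ydom_def)
  have 1: "((\<lambda>y. pr (\<tau>Y y)) has_derivative (\<lambda>Z. pr (D \<tau>Y y Z))) (at y)"
    by (rule bounded_linear.has_derivative[OF bounded_linear_pr smooth_on_has_derivative[OF smooth_\<tau>Y y]])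
  have "(\<tau>J has_derivative D \<tau>J (pr y)) (at (pr y))"
    using \<tau>J_derivative[OF z, of "fst_blinfun o\<^sub>L snd (snd y)"] by (simp add: pr_def)
  from has_derivative_compose[OF bounded_linear_imp_has_derivative[OF bounded_linear_pr] this]
  have "((\<lambda>y. \<tau>J (pr y)) has_derivative (\<lambda>Z. D \<tau>J (pr y) (pr Z))) (at y)" .
  then have "((\<lambda>y. pr (\<tau>Y y)) has_derivative (\<lambda>Z. D \<tau>J (pr y) (pr Z))) (at y)"
    by (rule has_derivative_transform_within_open[OF _ open_ydom y]) (simp add: pr_\<tau>Y)
  from has_derivative_unique[OF 1 this] show ?thesis by metis
qed

text \<open>By \<open>omega_half_eq\<close> both sides depend on \<open>Z\<close> only through
  \<open>pr Z\<close>, and \<open>pr\<close> intertwines the changes of coordinates;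
  \<open>transformation_law\<close> applies with the vertical part of \<open>pr Z\<close>.\<close>

lemma omega_half_transformation:
  assumes y: "y \<in> ydom" and Z: "fst Z = 0"
  shows "omega_half (\<tau>Y y) (D \<tau>Y y Z) = \<kappa> (fst y) * omega_half y Z"
proof -
  have z: "zz y \<in> overlap" using y by (simp add: ydom_def)
  define \<delta> where "\<delta> = (fst (fst (snd Z)), fst_blinfun o\<^sub>L snd (snd Z))"
  have "(fst (fst (snd (D \<tau>Y y Z))), fst_blinfun o\<^sub>L snd (snd (D \<tau>Y y Z))) = snd (D \<tau>J (pr y) (pr Z))"
    using pr_D[OF y, of Z] by (metis pr_def snd_conv)
  also have "pr Z = (0, \<delta>)" using Z by (simp add: pr_def \<delta>_def)
  finally show ?thesis
    unfolding omega_half_eq \<tau>Y_eq[OF y] \<delta>_def[symmetric]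
    using transformation_law[OF z, of "snd (fst (snd y))" "snd (snd y)" \<delta>] by (simp add: pr_def)
qed

text \<open>The one-form of the previous lemma has \<open>omega_coeff\<close> as its vertical differential; in the
  differential the second derivatives of the coordinate change cancel.\<close>

lemma omega_coeff_transformation:
  assumes y: "y \<in> ydom" and X: "fst X = 0" and Z: "fst Z = 0"
  shows "omega_coeff (D \<tau>Y y X) (D \<tau>Y y Z) = \<kappa> (fst y) * omega_coeff X Z"
proof -
  have half: "omega_half (\<tau>Y y) (D (\<lambda>y. D \<tau>Y y Z) y X) + omega_half (D \<tau>Y y X) (D \<tau>Y y Z)
      = \<kappa> (fst y) * omega_half X Z" if X: "fst X = 0" and Z: "fst Z = 0" for X Z
  proof -
    have d1: "((\<lambda>t. \<tau>Y (y + t *\<^sub>R X)) has_vector_derivative D \<tau>Y y X) (at 0)"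
      by (rule line_derivative[OF smooth_on_has_derivative[OF smooth_\<tau>Y y]])
    have d2: "((\<lambda>t. D \<tau>Y (y + t *\<^sub>R X) Z) has_vector_derivative D (\<lambda>y. D \<tau>Y y Z) y X) (at 0)"
      by (rule line_derivative[OF smooth_on_has_derivative[OF smooth_on_D[OF smooth_\<tau>Y] y]])
    have L: "((\<lambda>t. omega_half (\<tau>Y (y + t *\<^sub>R X)) (D \<tau>Y (y + t *\<^sub>R X) Z)) has_vector_derivative
        omega_half (\<tau>Y y) (D (\<lambda>y. D \<tau>Y y Z) y X) + omega_half (D \<tau>Y y X) (D \<tau>Y y Z)) (at 0)"
      using omega_half_derivative[OF d1 d2] by simp
    \<comment> \<open>A vertical \<open>X\<close> keeps the base point fixed, so \<kappa> is
      constant along the line and contributes no derivative.\<close>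
    have "((\<lambda>t. \<kappa> (fst y) * (omega_half y Z + t * omega_half X Z)) has_vector_derivative
        \<kappa> (fst y) * omega_half X Z) (at 0)"
      unfolding has_real_derivative_iff_has_vector_derivative[symmetric]
      by (auto intro!: derivative_eq_intros)
    then have R: "((\<lambda>t. omega_half (\<tau>Y (y + t *\<^sub>R X)) (D \<tau>Y (y + t *\<^sub>R X) Z)) has_vector_derivative
        \<kappa> (fst y) * omega_half X Z) (at 0)"
    proof (rule has_vector_derivative_transform_within_open[OF _ open_line_preimage[OF open_ydom, of y X]])
      fix t assume "t \<in> {t. y + t *\<^sub>R X \<in> ydom}"
      then show "\<kappa> (fst y) * (omega_half y Z + t * omega_half X Z)
          = omega_half (\<tau>Y (y + t *\<^sub>R X)) (D \<tau>Y (y + t *\<^sub>R X) Z)"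
        using omega_half_transformation[of "y + t *\<^sub>R X" Z] Z X by (simp add: omega_half_add)
    qed (use y in simp)
    show ?thesis by (rule vector_derivative_unique_at[OF L R])
  qed
  have sym: "D (\<lambda>y. D \<tau>Y y Z) y X = D (\<lambda>y. D \<tau>Y y X) y Z"
    by (rule second_derivative_symmetric[OF smooth_\<tau>Y open_ydom y])
  show ?thesis
    using half[OF X Z] half[OF Z X] unfolding sym omega_coeff_def by (simp add: algebra_simps)
qed

text \<open>Well-definedness of the map on coordinates: the coordinate change of the covector,
  tested on \<eta>, is the transformation law at the preimage \<delta> of \<eta> under the
  derivative of the jet change.\<close>

lemma tp_change:
  assumes b: "b \<in> fst c" "b \<in> fst c'"
  shows "tp a c b (fst_blinfun o\<^sub>L w) (r_of p w)
    = tp a' c' b (fst_blinfun o\<^sub>L jet' (snd c b) p w) (r_of (phase' (snd c b) p) (jet' (snd c b) p w))"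
proof -
  let ?z = "snd c b" and ?w1 = "fst_blinfun o\<^sub>L w"
  let ?j = "Q.jet_at a c b ?w1"
  have z: "?z \<in> overlap" using b by blast
  note jb = jet_at_both[OF b, of ?w1]
  note ch = adapted_charts(1)[OF ac] adapted_charts(1)[OF ac']
  have j: "?j = Q.jet_at a' c' b (fst_blinfun o\<^sub>L jet' ?z p w)"
    using Q.jet_at_change[OF ac ac' b] fst_jet'[OF z] by simp
  have \<pi>j: "J1_proj \<pi> ?j = \<pi> b" by (simp add: J1_proj_def)
  have "QI.top_change a (JC a c) a' (JC a' c') (snd (JC a c) ?j) (r_of p w) = r_of (phase' ?z p) (jet' ?z p w)"
  proof (rule blinfun_eqI)
    fix \<eta>
    define \<delta> where "\<delta> = snd (D (transition (JC a' c') (JC a c)) (snd (JC a' c') ?j) (0, \<eta>))"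
    have "snd (D \<tau>J (snd (JC a c) ?j) (0, \<delta>)) = \<eta>"
      unfolding \<delta>_def by (rule QI.D_vertical_inverse[OF ch(2,1) jb(2,1)])
    then have "blinfun_apply (r_of (phase' ?z p) (jet' ?z p w)) \<eta> = \<kappa> (fst ?z) * blinfun_apply (r_of p w) \<delta>"
      using transformation_law[OF z, of p w \<delta>] unfolding jb(3) by simp
    moreover have "\<kappa> (fst ?z) = Q.vol_ratio a a' (snd a' (\<pi> b))"
      using base_trans(3)[of "\<pi> b"] Q.adaptedD(3,4)[OF ac b(1)] by (simp add: \<kappa>_def)
    ultimately show "blinfun_apply (QI.top_change a (JC a c) a' (JC a' c') (snd (JC a c) ?j) (r_of p w)) \<eta>
        = blinfun_apply (r_of (phase' ?z p) (jet' ?z p w)) \<eta>"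
      unfolding QI.top_change_apply[OF ch jb(1,2)] \<pi>j \<delta>_def by (simp add: QI.vol_ratio_def Q.vol_ratio_def)
  qed
  then show ?thesis
    unfolding tp_def j[symmetric] using QI.top_at_change[OF ch jb(1,2)] by simp
qed

end

section \<open>Coordinate description of the two-form and of its kernel\<close>

context multi_phase
begin

definition top_form :: "('m, 'e) chart \<Rightarrow> 'm \<Rightarrow> real \<Rightarrow> ('m, 'e) form" where
  "top_form a x s = (\<lambda>vs. if vs \<in> tuples DIM('e) (tangent_space M x) then s * vol (\<lambda>i. (vs ! i) a) else 0)"

lemma multi_phase_change:
  "(a, c) \<in> adapted M Q \<pi> \<Longrightarrow> (a', c') \<in> adapted M Q \<pi> \<Longrightarrow> multi_phase_change M Q \<pi> a c a' c'"
  by (simp add: multi_phase_change_def multi_phase_axioms multi_phase_change_axioms_def)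

text \<open>The \<open>THE\<close> requires one form with the right expression in all adapted
  charts. Under a change of charts the coefficient is multiplied by \<kappa> and the volume form by
  the inverse factor; uniqueness is already visible in one chart.\<close>

lemma omega_tilde_eq:
  assumes ac: "(a, c) \<in> adapted M Q \<pi>" and y: "y \<in> fst (YC a c)"
    and X: "X \<in> J1P_vertical M Q \<pi> y" and Z: "Z \<in> J1P_vertical M Q \<pi> y"
  shows "omega_tilde M Q \<pi> y X Z = top_form a (J1P_proj \<pi> y) (omega_coeff (X (YC a c)) (Z (YC a c)))"
    (is "_ = ?\<alpha>")
  unfolding omega_tilde_def
proof (rule the_equality)
  obtain b p w where b: "b \<in> fst c" "y = pt a c b p w" using pt_cases[OF ac y] .
  let ?T = "tangent_space M (J1P_proj \<pi> y)"
  have \<pi>y: "J1P_proj \<pi> y = \<pi> b" using b(2) by simp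
  note XZ = X[unfolded J1P_vertical_def Y.vertical_iff[OF adapted_charts(3)[OF ac] y]]
    Z[unfolded J1P_vertical_def Y.vertical_iff[OF adapted_charts(3)[OF ac] y]]
  have inv: "?\<alpha> vs = omega_coeff (X (YC a' c')) (Z (YC a' c')) * dnx (map (\<lambda>v. v a') vs)"
    if ac': "(a', c') \<in> adapted M Q \<pi>" and y': "y \<in> fst (YC a' c')" and vs: "vs \<in> tuples DIM('e) ?T" for a' c' vs
  proof -
    interpret C: multi_phase_change M Q \<pi> a c a' c' by (rule multi_phase_change[OF ac ac'])
    obtain b' p' w' where "b' \<in> fst c'" "y = pt a' c' b' p' w'" using pt_cases[OF ac' y'] .
    then have b': "b \<in> fst c'" using b(2) base_pt(1) by metis
    let ?y = "snd (YC a c) y"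
    have yc: "?y = (fst (snd c b), (snd (snd c b), p), w)" using pt_coord[OF ac b(1)] b(2) by simp
    have dom: "?y \<in> C.ydom" using b(1) b' by (simp add: C.ydom_def yc)
    have ch: "YC a c \<in> charts_at (J1P M Q \<pi>) y" "YC a' c' \<in> charts_at (J1P M Q \<pi>) y"
      using C.YC_in y y' by (auto simp: charts_at_iff)
    have "omega_coeff (X (YC a' c')) (Z (YC a' c')) = C.\<kappa> (fst ?y) * omega_coeff (X (YC a c)) (Z (YC a c))"
      using C.omega_coeff_transformation[OF dom, of "X (YC a c)" "Z (YC a c)"] XZ
        tangentD[OF _ ch, of X] tangentD[OF _ ch, of Z] by simp
    moreover have "C.\<kappa> (fst ?y) * vol (\<lambda>i. (vs ! i) a') = vol (\<lambda>i. (vs ! i) a)"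
    proof -
      have fy: "fst ?y = snd a (\<pi> b)" using yc Q.adaptedD(4)[OF ac b(1)] by simp
      have "C.\<kappa> (fst ?y) = Q.vol_ratio a a' (snd a' (\<pi> b))"
        using C.base_trans(3)[of "\<pi> b"] Q.adaptedD(3)[OF ac b(1)] unfolding fy C.\<kappa>_def by simp
      moreover have "vol (\<lambda>i. (vs ! i) a') = vol (\<lambda>i. D (transition a a') (snd a (\<pi> b)) ((vs ! i) a))"
      proof (rule alternatingD(3)[OF alternating_vol])
        fix i assume "i < DIM('e)"
        then have "vs ! i \<in> tangent_space M (\<pi> b)" using vs nth_mem[of i vs] by (auto simp: tuples_def \<pi>y)
        then show "(vs ! i) a' = D (transition a a') (snd a (\<pi> b)) ((vs ! i) a)"
          by (rule tangentD[OF _ Q.adaptedD(5)[OF ac b(1)] Q.adaptedD(5)[OF ac' b']])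
      qed
      ultimately show ?thesis using Q.vol_ratio[OF ac ac' b(1) b'] by simp
    qed
    ultimately show ?thesis using vs by (simp add: top_form_def dnx_tuple[OF vs] algebra_simps)
  qed
  have "?\<alpha> \<in> alt_forms DIM('e) ?T"
    unfolding top_form_def
    by (rule alt_form_of_alternating[OF alternating_cmult[OF alternating_vol] tangent_lincomb[OF Q.M]])
  then show "?\<alpha> \<in> alt_forms DIM('e) ?T \<and> (\<forall>(a, c)\<in>adapted M Q \<pi>. y \<in> fst (YC a c) \<longrightarrow>
      (\<forall>vs\<in>tuples DIM('e) ?T. ?\<alpha> vs = omega_coeff (X (YC a c)) (Z (YC a c)) * dnx (map (\<lambda>v. v a) vs)))"
    using inv by blast
  fix \<alpha> assume \<alpha>: "\<alpha> \<in> alt_forms DIM('e) ?T \<and> (\<forall>(a, c)\<in>adapted M Q \<pi>. y \<in> fst (YC a c) \<longrightarrow>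
      (\<forall>vs\<in>tuples DIM('e) ?T. \<alpha> vs = omega_coeff (X (YC a c)) (Z (YC a c)) * dnx (map (\<lambda>v. v a) vs)))"
  show "\<alpha> = ?\<alpha>"
  proof
    fix vs
    show "\<alpha> vs = ?\<alpha> vs"
    proof (cases "vs \<in> tuples DIM('e) ?T")
      case True
      then have "\<alpha> vs = omega_coeff (X (YC a c)) (Z (YC a c)) * dnx (map (\<lambda>v. v a) vs)"
        using \<alpha> ac y by blast
      then show ?thesis using True by (simp add: top_form_def dnx_tuple)
    next
      case False
      then have "\<alpha> vs = 0" using \<alpha> unfolding alt_forms_def by blast
      then show ?thesis using False by (simp add: top_form_def)
    qed
  qed
qed

text \<open>Every model vector with vanishing base component comes from a vertical vector, and a top
  form vanishes with its coefficient. Verticality is included in the kernel condition because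
  \<open>model_map\<close> keeps the base component.\<close>

lemma degeneracy_iff:
  assumes ac: "(a, c) \<in> adapted M Q \<pi>" and y: "y \<in> fst (YC a c)"
  shows "X \<in> degeneracy M Q \<pi> y \<longleftrightarrow> X \<in> tangent_space (J1P M Q \<pi>) y \<and> model_map (X (YC a c)) = 0"
proof -
  note vi = Y.vertical_iff[OF adapted_charts(3)[OF ac] y]
  note cy = Y.adaptedD(5,6)[OF adapted_charts(3)[OF ac] y]
  have zero_iff: "top_form a (J1P_proj \<pi> y) s = (\<lambda>_. 0) \<longleftrightarrow> s = 0" for s
  proof
    let ?vs = "map (\<lambda>i. tvec_of M a (J1P_proj \<pi> y) (basis_enum i)) [0..<DIM('e)]"
    assume "top_form a (J1P_proj \<pi> y) s = (\<lambda>_. 0)"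
    then have "top_form a (J1P_proj \<pi> y) s ?vs = 0" by simp
    moreover have "?vs \<in> tuples DIM('e) (tangent_space M (J1P_proj \<pi> y))"
      using tvec_of(1)[OF Q.M cy(1)] by (auto simp: tuples_def)
    moreover have "vol (\<lambda>i. (?vs ! i) a) = vol (basis_enum :: nat \<Rightarrow> 'e)"
      by (rule alternatingD(3)[OF alternating_vol]) (simp add: tvec_of(2)[OF Q.M cy(1)])
    ultimately show "s = 0" by (simp add: top_form_def vol_basis_enum)
  qed (simp add: top_form_def fun_eq_iff)
  have "X \<in> degeneracy M Q \<pi> y \<longleftrightarrow> X \<in> J1P_vertical M Q \<pi> y \<and>
      (\<forall>Z\<in>J1P_vertical M Q \<pi> y. omega_coeff (X (YC a c)) (Z (YC a c)) = 0)"
    using omega_tilde_eq[OF ac y] zero_iff unfolding degeneracy_def by auto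
  also have "\<dots> \<longleftrightarrow> X \<in> J1P_vertical M Q \<pi> y \<and> (\<forall>Z. fst Z = 0 \<longrightarrow> omega_coeff (X (YC a c)) Z = 0)"
  proof -
    have "\<exists>V\<in>J1P_vertical M Q \<pi> y. V (YC a c) = Z" if "fst Z = 0" for Z
      using tvec_of[OF Y.B cy(2), of Z] that by (intro bexI[of _ "tvec_of (J1P M Q \<pi>) (YC a c) y Z"])
        (auto simp: J1P_vertical_def vi)
    moreover have "fst (V (YC a c)) = 0" if "V \<in> J1P_vertical M Q \<pi> y" for V
      using that by (simp add: J1P_vertical_def vi)
    ultimately show ?thesis by metis
  qed
  also have "\<dots> \<longleftrightarrow> X \<in> tangent_space (J1P M Q \<pi>) y \<and> model_map (X (YC a c)) = 0"
  proof -
    have "fst (X (YC a c)) = 0" if "model_map (X (YC a c)) = 0"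
      using that by (simp add: model_map_def zero_prod_def)
    then show ?thesis
      unfolding J1P_vertical_def vi using omega_coeff_degenerate[OF Q.fdim_fibre, of "X (YC a c)"] by blast
  qed
  finally show ?thesis .
qed

section \<open>The canonical map\<close>

definition Psi :: "('m, 'e, 'q, 'g) jet_phase \<Rightarrow> ('m, 'e, 'q, 'g) inf_form" where
  "Psi y = (THE \<eta>. \<exists>a c b p w. (a, c) \<in> adapted M Q \<pi> \<and> b \<in> fst c \<and> y = pt a c b p w \<and>
     \<eta> = tp a c b (fst_blinfun o\<^sub>L w) (r_of p w))"

text \<open>If the same point is described in two adapted charts, injectivity of the coordinates
  forces the second description to be the transformed first one, and \<open>tp_change\<close>
  identifies the values.\<close>

lemma Psi_pt:
  assumes ac: "(a, c) \<in> adapted M Q \<pi>" and b: "b \<in> fst c"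
  shows "Psi (pt a c b p w) = tp a c b (fst_blinfun o\<^sub>L w) (r_of p w)"
  unfolding Psi_def
proof (rule the_equality)
  show "\<exists>a' c' b' p' w'. (a', c') \<in> adapted M Q \<pi> \<and> b' \<in> fst c' \<and> pt a c b p w = pt a' c' b' p' w' \<and>
      tp a c b (fst_blinfun o\<^sub>L w) (r_of p w) = tp a' c' b' (fst_blinfun o\<^sub>L w') (r_of p' w')"
    using ac b by blast
  fix \<eta>
  assume "\<exists>a' c' b' p' w'. (a', c') \<in> adapted M Q \<pi> \<and> b' \<in> fst c' \<and> pt a c b p w = pt a' c' b' p' w' \<and>
      \<eta> = tp a' c' b' (fst_blinfun o\<^sub>L w') (r_of p' w')"
  then obtain a' c' b' p' w' where *: "(a', c') \<in> adapted M Q \<pi>" "b' \<in> fst c'" "pt a c b p w = pt a' c' b' p' w'"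
    "\<eta> = tp a' c' b' (fst_blinfun o\<^sub>L w') (r_of p' w')" by blast
  interpret C: multi_phase_change M Q \<pi> a c a' c' by (rule multi_phase_change[OF ac *(1)])
  have bb: "b' = b" using *(3) base_pt(1) by metis
  have b': "b \<in> fst c'" using *(2) bb by simp
  have "pt a' c' b p' w' = pt a' c' b (C.phase' (snd c b) p) (C.jet' (snd c b) p w)"
    using *(3) C.pt_change[OF b b'] bb by simp
  then have "snd (YC a' c') (pt a' c' b p' w') = snd (YC a' c') (pt a' c' b (C.phase' (snd c b) p) (C.jet' (snd c b) p w))"
    by (rule arg_cong)
  then have "p' = C.phase' (snd c b) p" "w' = C.jet' (snd c b) p w"
    unfolding pt_coord[OF *(1) b'] by simp_all
  then show "\<eta> = tp a c b (fst_blinfun o\<^sub>L w) (r_of p w)"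
    using C.tp_change[OF b b'] *(4) bb by simp
qed

end

section \<open>Coordinate rule, smoothness, fibres and leaves of the map\<close>

context multi_phase
begin

text \<open>Chart domains are full preimages of chart domains of \<open>Q\<close>, so only the
  underlying point of \<open>Q\<close> matters.\<close>

lemma in_YC:
  assumes "y \<in> points (J1P M Q \<pi>)" "fst (fst y) \<in> fst c"
  shows "y \<in> fst (YC a c)"
proof -
  have y: "y \<in> J1_points M (phase_bundle M Q \<pi>) (phase_proj \<pi>)"
    using assms(1) JP.points_AT by (simp add: JP_AT)
  then have "fst y \<in> phase_points M Q \<pi>" using JP.base Ph.points_AT by (simp add: Ph_AT)
  then show ?thesis using y assms(2) by (simp add: J1P_chart_def J1_chart_def phase_chart_def)
qed

lemma base_in_Q: "y \<in> points (J1P M Q \<pi>) \<Longrightarrow> fst (fst y) \<in> points Q"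
  using JP.points_AT JP.base Ph.points_AT Ph.base by (metis JP_AT Ph_AT)

lemma YC_cover:
  assumes "y \<in> points (J1P M Q \<pi>)"
  obtains a c where "(a, c) \<in> adapted M Q \<pi>" "y \<in> fst (YC a c)"
  using Q.cover[OF base_in_Q[OF assms]] in_YC[OF assms] that by metis

lemma TC_cover:
  assumes "\<eta> \<in> inf_target_points M Q \<pi>"
  obtains a c where "(a, c) \<in> adapted M Q \<pi>" "\<eta> \<in> fst (TC a c)"
proof -
  have j: "fst \<eta> \<in> J1_points M Q \<pi>" using T.base[OF assms] J.points_AT by (simp add: J_AT)
  then obtain a c where ac: "(a, c) \<in> adapted M Q \<pi>" "fst (fst \<eta>) \<in> fst c"
    using Q.cover[OF J.base[OF j]] by blast
  then have "\<eta> \<in> fst (TC a c)"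
    using assms j by (simp add: inf_target_chart_def top_chart_def J1_chart_def inf_target_points_def)
  then show ?thesis using that ac by blast
qed

lemma charts_in:
  assumes "(a, c) \<in> adapted M Q \<pi>"
  shows "YC a c \<in> J1P M Q \<pi>" "TC a c \<in> inf_target M Q \<pi>"
  using Y.adaptedD(2)[OF adapted_charts(3)[OF assms]] T.CH_in_AT[OF adapted_charts(1)[OF assms]]
  by (simp_all add: TC_CH T_AT)

lemma maxatlas_target: "maxatlas (inf_target M Q \<pi>)"
  using T.maxatlas_AT by (simp add: T_AT)

lemma Psi_coord:
  assumes ac: "(a, c) \<in> adapted M Q \<pi>" and y: "y \<in> fst (YC a c)"
  shows "Psi y \<in> fst (TC a c)" "snd (TC a c) (Psi y) = model_map (snd (YC a c) y)"
    "fst (fst (Psi y)) = fst (fst y)"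
proof -
  obtain b p w where b: "b \<in> fst c" "y = pt a c b p w" using pt_cases[OF ac y] .
  show "Psi y \<in> fst (TC a c)" using Psi_pt[OF ac b(1)] tp_in[OF ac b(1)] b(2) by simp
  show "snd (TC a c) (Psi y) = model_map (snd (YC a c) y)"
    using Psi_pt[OF ac b(1)] tp_coord[OF ac b(1)] pt_coord[OF ac b(1)] b(2) by (simp add: model_map_def)
  show "fst (fst (Psi y)) = fst (fst y)" using Psi_pt[OF ac b(1)] b(2) by simp
qed

lemma has_coordinate_rule_Psi: "has_coordinate_rule M Q \<pi> model_map Psi"
  unfolding has_coordinate_rule_def using Psi_coord(1,2) by blast

lemma smooth_Psi: "smooth_map (J1P M Q \<pi>) (inf_target M Q \<pi>) Psi"
  unfolding smooth_map_near
proof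
  fix y assume "y \<in> points (J1P M Q \<pi>)"
  then obtain a c where ac: "(a, c) \<in> adapted M Q \<pi>" and y: "y \<in> fst (YC a c)" using YC_cover by blast
  have op: "open (img (YC a c))" by (rule open_img[OF Y.B charts_in(1)[OF ac]])
  have "smooth_on (img (YC a c)) model_map"
    using smooth_on_linear[OF linear_imp_bounded_linear[OF maxatlas_fdim[OF Y.B] linear_model_map] op smooth_on_id] .
  then have "smooth_on (img (YC a c)) (snd (TC a c) \<circ> Psi \<circ> cinv (YC a c))"
  proof (rule smooth_on_cong[OF op])
    fix z assume z: "z \<in> img (YC a c)"
    show "model_map z = (snd (TC a c) \<circ> Psi \<circ> cinv (YC a c)) z"
      using Psi_coord(2)[OF ac cinv_in[OF z]] chart_cinv[OF z] by simp
  qed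
  moreover have "Psi ` fst (YC a c) \<subseteq> fst (TC a c)" using Psi_coord(1)[OF ac] by blast
  ultimately show "smooth_near (J1P M Q \<pi>) (inf_target M Q \<pi>) Psi y"
    unfolding smooth_near_def using charts_in[OF ac] y by blast
qed

text \<open>In the charts the projection to \<open>Q\<close> forgets the momenta; this makes
  \<open>J1_prolong\<close> computable.\<close>

lemma tangent_fst:
  assumes ac: "(a, c) \<in> adapted M Q \<pi>" and q: "q \<in> fst (PC a c)"
    and u: "u \<in> tangent_space (phase_bundle M Q \<pi>) q"
  shows "tangent_map (phase_bundle M Q \<pi>) Q fst q u
    = tvec_of Q c (fst q) (fst (u (PC a c)), fst (snd (u (PC a c))))"
proof -
  have b: "fst q \<in> fst c" using q by (simp add: phase_chart_def)
  note pa = P.adaptedD[OF adapted_charts(2)[OF ac]]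
  have op: "open (img (PC a c))" by (rule open_img[OF P.B pa(2)])
  have rep: "(snd c \<circ> fst \<circ> cinv (PC a c)) z = (fst z, fst (snd z))" if z: "z \<in> img (PC a c)" for z
  proof -
    have "cinv (PC a c) z \<in> fst (Ph.CH a c)" using cinv_in[OF z] unfolding Ph_CH .
    from Ph.CH_cases[OF ac this] obtain b' p' where b': "b' \<in> fst c" "cinv (PC a c) z = Q.phase_at a c b' p'" .
    have "z = snd (PC a c) (Q.phase_at a c b' p')" using chart_cinv[OF z] b'(2) by simp
    then show ?thesis using Ph.snd_CH[OF ac b'(1), of p'] b'(2) by (simp add: Ph_CH)
  qed
  have bl: "bounded_linear (\<lambda>z :: 'e \<times> 'g \<times> ('g \<Rightarrow>\<^sub>L 'e). (fst z, fst (snd z)))"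
    by (intro bounded_linear_Pair bounded_linear_fst bounded_linear_fst_comp bounded_linear_snd)
  have "smooth_on (img (PC a c)) (snd c \<circ> fst \<circ> cinv (PC a c))"
    by (rule smooth_on_cong[OF op smooth_on_linear[OF bl op smooth_on_id]]) (simp only: rep)
  moreover have "fst ` fst (PC a c) \<subseteq> fst c" by (auto simp: phase_chart_def)
  ultimately have near: "smooth_near (phase_bundle M Q \<pi>) Q fst q"
    unfolding smooth_near_def using q pa(2) Q.adaptedD(2)[OF ac] by blast
  have "((snd c \<circ> fst \<circ> cinv (PC a c)) has_derivative (\<lambda>z. (fst z, fst (snd z)))) (at (snd (PC a c) q))"
    by (rule has_derivative_transform_within_open[OF bounded_linear_imp_has_derivative[OF bl] op])
      (use q rep in auto)
  then have "tangent_map (phase_bundle M Q \<pi>) Q fst q u c = (fst (u (PC a c)), fst (snd (u (PC a c))))"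
    unfolding tangent_map_chart[OF P.B Q.B near u pa(6)[OF q] Q.adaptedD(6)[OF ac b]] by (simp only: D_eqI)
  then show ?thesis
    using tvec_of_eq[OF Q.B Q.adaptedD(6)[OF ac b] tangent_map_in[OF P.B Q.B near u]] by simp
qed

lemma fst_Psi:
  assumes "y \<in> points (J1P M Q \<pi>)"
  shows "fst (Psi y) = J1P_to_QI M Q \<pi> y"
proof -
  obtain a c where ac: "(a, c) \<in> adapted M Q \<pi>" and y: "y \<in> fst (YC a c)" using YC_cover[OF assms] .
  obtain b p w where b: "b \<in> fst c" "y = pt a c b p w" using pt_cases[OF ac y] .
  let ?q = "Q.phase_at a c b p"
  have q: "?q \<in> fst (PC a c)" by (rule in_PC[OF ac b(1)])
  note cq = P.adaptedD(6)[OF adapted_charts(2)[OF ac] q]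
  have "tangent_map (phase_bundle M Q \<pi>) Q fst ?q (tvec_of (phase_bundle M Q \<pi>) (PC a c) ?q (v a, blinfun_apply w (v a)))
      = tvec_of Q c b (v a, fst (blinfun_apply w (v a)))" for v
    using tangent_fst[OF ac q tvec_of(1)[OF P.B cq]] tvec_of(2)[OF P.B cq] by simp
  then have "J1P_to_QI M Q \<pi> y = Q.jet_at a c b (fst_blinfun o\<^sub>L w)"
    by (auto simp: J1P_to_QI_def J1_prolong_def b(2) pt_def J1_proj_def Q.jet_at_def P.jet_at_def fun_eq_iff)
  then show ?thesis using Psi_pt[OF ac b(1)] b(2) by simp
qed

text \<open>\<open>Psi\<close> preserves the underlying point of \<open>Q\<close>, so a whole fibre
  lies in one chart domain, where it is given by the coordinate equation.\<close>

lemma fibre_eq: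
  assumes ac: "(a, c) \<in> adapted M Q \<pi>" and \<eta>: "\<eta> \<in> fst (TC a c)"
  shows "{y \<in> points (J1P M Q \<pi>). Psi y = \<eta>} = {y \<in> fst (YC a c). model_map (snd (YC a c) y) = snd (TC a c) \<eta>}"
proof (intro equalityI subsetI)
  fix y assume y: "y \<in> {y \<in> points (J1P M Q \<pi>). Psi y = \<eta>}"
  obtain b w r where "b \<in> fst c" "\<eta> = tp a c b w r" using tp_cases[OF ac \<eta>] .
  then have "fst (fst \<eta>) \<in> fst c" by simp
  moreover have "fst (fst y) = fst (fst \<eta>)"
    using y YC_cover[of y] Psi_coord(3)[of _ _ y] by (metis (mono_tags, lifting) mem_Collect_eq)
  ultimately have "y \<in> fst (YC a c)" using y in_YC[of y c a] by simp
  then show "y \<in> {y \<in> fst (YC a c). model_map (snd (YC a c) y) = snd (TC a c) \<eta>}"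
    using y Psi_coord(2)[OF ac, of y] by simp
next
  fix y assume y: "y \<in> {y \<in> fst (YC a c). model_map (snd (YC a c) y) = snd (TC a c) \<eta>}"
  then have "Psi y = \<eta>"
    using chart_inj[OF maxatlas_target charts_in(2)[OF ac] Psi_coord(1)[OF ac] \<eta>, of y] Psi_coord(2)[OF ac, of y] by simp
  then show "y \<in> {y \<in> points (J1P M Q \<pi>). Psi y = \<eta>}"
    using y chart_subset_points[OF charts_in(1)[OF ac]] by simp
qed

text \<open>\<open>model_map\<close> keeps the base and field coordinates, and the other coordinates
  of the chart are unrestricted; hence every solution of the equation is the coordinate of a
  point.\<close>

lemma fibre_img:
  assumes ac: "(a, c) \<in> adapted M Q \<pi>" and \<eta>: "\<eta> \<in> fst (TC a c)"
  shows "{z. model_map z = snd (TC a c) \<eta>} \<subseteq> img (YC a c)" "\<exists>z. model_map z = snd (TC a c) \<eta>"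
proof -
  obtain b w r where b: "b \<in> fst c" "\<eta> = tp a c b w r" using tp_cases[OF ac \<eta>] .
  have eq: "snd (TC a c) \<eta> = (fst (snd c b), (snd (snd c b), w), r)" using tp_coord[OF ac b(1)] b(2) by simp
  show "{z. model_map z = snd (TC a c) \<eta>} \<subseteq> img (YC a c)"
    unfolding img_YC[OF ac] eq model_map_def using b(1) by auto
  obtain p w' where "fst_blinfun o\<^sub>L w' = w" "r_of p w' = r" using model_map_surj[OF Q.fdim_fibre] by blast
  then have "model_map (fst (snd c b), (snd (snd c b), p), w') = snd (TC a c) \<eta>"
    unfolding eq model_map_def by simp
  then show "\<exists>z. model_map z = snd (TC a c) \<eta>" by blast
qed

lemma fibre_nonempty:
  assumes "\<eta> \<in> inf_target_points M Q \<pi>"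
  shows "\<exists>y\<in>points (J1P M Q \<pi>). Psi y = \<eta>"
proof -
  obtain a c where ac: "(a, c) \<in> adapted M Q \<pi>" and \<eta>: "\<eta> \<in> fst (TC a c)" using TC_cover[OF assms] .
  obtain z where z: "model_map z = snd (TC a c) \<eta>" using fibre_img(2)[OF ac \<eta>] by blast
  then have zi: "z \<in> img (YC a c)" using fibre_img(1)[OF ac \<eta>] by blast
  have "cinv (YC a c) z \<in> {y \<in> fst (YC a c). model_map (snd (YC a c) y) = snd (TC a c) \<eta>}"
    using cinv_in[OF zi] chart_cinv[OF zi] z by simp
  then show ?thesis unfolding fibre_eq[OF ac \<eta>, symmetric] by blast
qed

text \<open>The fibre carries the subspace topology. It is connected as the image of the convex
  solution set under the inverse chart, and a single slice, with the kernel of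
  \<open>model_map\<close> as \<open>W\<close>, describes it around every point.\<close>

lemma fibre_integral_manifold:
  assumes "\<eta> \<in> inf_target_points M Q \<pi>"
  defines "L \<equiv> {y \<in> points (J1P M Q \<pi>). Psi y = \<eta>}"
  shows "topspace (subtopology (mfd_topology (J1P M Q \<pi>)) L) = L"
    and "connected_integral_manifold (J1P M Q \<pi>) (degeneracy M Q \<pi>) (subtopology (mfd_topology (J1P M Q \<pi>)) L)"
proof -
  let ?A = "J1P M Q \<pi>"
  let ?T = "subtopology (mfd_topology ?A) L"
  obtain a c where ac: "(a, c) \<in> adapted M Q \<pi>" and \<eta>: "\<eta> \<in> fst (TC a c)" using TC_cover[OF assms(1)] .
  let ?C = "YC a c" and ?S = "{z. model_map z = snd (TC a c) \<eta>}"
  note CA = charts_in(1)[OF ac]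
  have L: "L = {y \<in> fst ?C. model_map (snd ?C y) = snd (TC a c) \<eta>}"
    unfolding L_def by (rule fibre_eq[OF ac \<eta>])
  have LS: "L = cinv ?C ` ?S"
  proof (intro equalityI subsetI)
    fix y assume y: "y \<in> L"
    then have "y = cinv ?C (snd ?C y)" using cinv_chart[OF maxatlasD(1)[OF Y.B CA]] by (simp add: L)
    then show "y \<in> cinv ?C ` ?S" using y by (auto simp: L)
  next
    fix y assume "y \<in> cinv ?C ` ?S"
    then obtain z where "z \<in> ?S" "y = cinv ?C z" by blast
    moreover have "z \<in> img ?C" using \<open>z \<in> ?S\<close> fibre_img(1)[OF ac \<eta>] by blast
    ultimately show "y \<in> L" using cinv_in[of z ?C] chart_cinv[of z ?C] by (simp add: L)
  qed
  show top: "topspace ?T = L" using topspace_mfd[OF Y.B] by (auto simp: L_def)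
  have "convex ?S"
  proof (rule convexI)
    fix x y and u v :: real assume "x \<in> ?S" "y \<in> ?S" "u + v = 1"
    then show "u *\<^sub>R x + v *\<^sub>R y \<in> ?S"
      by (simp add: linear_add[OF linear_model_map] linear_cmul[OF linear_model_map] scaleR_add_left[symmetric])
  qed
  then have "connectedin (top_of_set (img ?C)) ?S"
    using fibre_img(1)[OF ac \<eta>] by (simp add: connectedin_subtopology convex_connected)
  from connectedin_continuous_map_image[OF continuous_map_cinv[OF Y.B CA] this]
  have conn: "connected_space ?T" unfolding LS[symmetric] by (simp add: connectedin_def)
  define W where "W = {z :: ('e, 'g) jet_phase_model. model_map z = 0}"
  have W: "subspace W"
    unfolding W_def
    by (rule subspaceI) (simp_all add: linear_0[OF linear_model_map] linear_add[OF linear_model_map] linear_cmul[OF linear_model_map])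
  have "integral_manifold ?A (degeneracy M Q \<pi>) ?T"
    unfolding integral_manifold_def top
  proof
    fix p assume p: "p \<in> L"
    then have pC: "?C \<in> charts_at ?A p" using CA by (simp add: charts_at_iff L)
    \<comment> \<open>Linearity of \<open>model_map\<close> makes the slice through any point of the
      fibre equal to the fibre.\<close>
    have N: "{y \<in> fst ?C. snd ?C y - snd ?C p \<in> W} = L"
      using p unfolding W_def L by (auto simp: linear_diff[OF linear_model_map])
    have "degeneracy M Q \<pi> y = {v \<in> tangent_space ?A y. v ?C \<in> W}" if "y \<in> L" for y
      using degeneracy_iff[OF ac, of y] that by (auto simp: W_def L)
    moreover have "openin ?T L" using openin_topspace[of ?T] top by simp
    moreover have "subtopology ?T L = subtopology (mfd_topology ?A) L" by (simp add: subtopology_subtopology)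
    ultimately show "\<exists>c\<in>charts_at ?A p. \<exists>W. subspace W \<and>
        (let N = {y \<in> fst c. snd c y - snd c p \<in> W} in openin ?T N \<and>
          subtopology ?T N = subtopology (mfd_topology ?A) N \<and>
          (\<forall>y\<in>N. degeneracy M Q \<pi> y = {v \<in> tangent_space ?A y. v c \<in> W}))"
      using pC W by (intro bexI[of _ ?C] exI[of _ W]) (simp_all add: N Let_def)
  qed
  moreover have "L \<noteq> {}" using fibre_nonempty[OF assms(1)] by (auto simp: L_def)
  ultimately show "connected_integral_manifold ?A (degeneracy M Q \<pi>) ?T"
    unfolding connected_integral_manifold_def top using conn by blast
qed

text \<open>In a slice chart of an integral manifold, the coordinates of \<open>Psi\<close> have derivative zero along
  the slice.\<close>

lemma Psi_locally_constant:
  assumes T: "integral_manifold (J1P M Q \<pi>) (degeneracy M Q \<pi>) T" and p: "p \<in> topspace T"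
  shows "p \<in> points (J1P M Q \<pi>)" "\<exists>S. openin T S \<and> p \<in> S \<and> (\<forall>y\<in>S. Psi y = Psi p)"
proof -
  let ?A = "J1P M Q \<pi>"
  have "\<exists>d W. d \<in> charts_at ?A p \<and> subspace W \<and> openin T {y \<in> fst d. snd d y - snd d p \<in> W} \<and>
      subtopology T {y \<in> fst d. snd d y - snd d p \<in> W} = subtopology (mfd_topology ?A) {y \<in> fst d. snd d y - snd d p \<in> W} \<and>
      (\<forall>y\<in>{y \<in> fst d. snd d y - snd d p \<in> W}. degeneracy M Q \<pi> y = {v \<in> tangent_space ?A y. v d \<in> W})"
    using T[unfolded integral_manifold_def Let_def, rule_format, OF p] by blast
  then obtain d W where d: "d \<in> charts_at ?A p" and W: "subspace W"
    and N: "openin T {y \<in> fst d. snd d y - snd d p \<in> W}"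
      "subtopology T {y \<in> fst d. snd d y - snd d p \<in> W} = subtopology (mfd_topology ?A) {y \<in> fst d. snd d y - snd d p \<in> W}"
      "\<And>y. y \<in> fst d \<Longrightarrow> snd d y - snd d p \<in> W \<Longrightarrow> degeneracy M Q \<pi> y = {v \<in> tangent_space ?A y. v d \<in> W}"
    by blast
  define N where "N = {y \<in> fst d. snd d y - snd d p \<in> W}"
  have dA: "d \<in> ?A" "p \<in> fst d" using d by (auto simp: charts_at_iff)
  show pA: "p \<in> points ?A" using chart_subset_points[OF dA] .
  obtain a c where ac: "(a, c) \<in> adapted M Q \<pi>" and pC: "p \<in> fst (YC a c)" using YC_cover[OF pA] .
  let ?C = "YC a c" and ?t = "transition d (YC a c)"
  note CA = charts_in(1)[OF ac]
  note t = transition_rep[OF Y.B dA(1) CA]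
  let ?O = "snd d ` (fst d \<inter> fst ?C)"
  have "snd d p \<in> ?O" using dA pC by blast
  \<comment> \<open>A ball, so that the coordinate segment from \<open>p\<close> to a nearby point
    stays in the overlap with the adapted chart.\<close>
  then obtain r where r: "r > 0" "ball (snd d p) r \<subseteq> ?O" using t(1) open_contains_ball by blast
  define V where "V = {q \<in> fst d. snd d q \<in> ball (snd d p) r}"
  have V: "openin (mfd_topology ?A) V"
    using openin_chart_domain[OF Y.B restrict_chart[OF Y.B dA(1) open_ball]] by (simp add: V_def)
  \<comment> \<open>The topology of the integral manifold is compared with the ambient one only on
    the slice, where the two agree by hypothesis.\<close>
  have "openin (subtopology T N) (N \<inter> V)"
    unfolding N_def N(2) by (rule openin_subtopology_Int2[OF V])
  then have "openin T (N \<inter> V)" using N(1) by (simp add: N_def openin_open_subtopology)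
  moreover have "p \<in> N \<inter> V" using dA r(1) subspace_0[OF W] by (simp add: N_def V_def)
  moreover have "Psi y = Psi p" if y: "y \<in> N \<inter> V" for y
  proof -
    have yd: "y \<in> fst d" "snd d y - snd d p \<in> W" "snd d y \<in> ball (snd d p) r"
      using y by (auto simp: N_def V_def)
    have VC: "q \<in> fst ?C" if "q \<in> V" for q
    proof -
      have "snd d q \<in> ?O" "q \<in> fst d" using that r(2) by (auto simp: V_def)
      then obtain q' where "q' \<in> fst d" "q' \<in> fst ?C" "snd d q = snd d q'" by blast
      then show ?thesis using chart_inj[OF Y.B dA(1) \<open>q \<in> fst d\<close>, of q'] by simp
    qed
    have yC: "y \<in> fst ?C" using VC y by blast
    define u where "u = snd d y - snd d p"
    define z where "z s = snd d p + s *\<^sub>R u" for s :: real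
    have deriv: "((\<lambda>s. model_map (?t (z s))) has_vector_derivative 0) (at s within {0..1})" if s: "s \<in> {0..1}" for s
    proof -
      have zb: "z s \<in> ball (snd d p) r"
      proof -
        have "norm (s *\<^sub>R u) \<le> norm u" using s by (simp add: mult_left_le_one_le)
        also have "\<dots> < r" using yd(3) by (simp add: u_def dist_norm norm_minus_commute)
        finally show ?thesis by (simp add: z_def dist_norm)
      qed
      then have zO: "z s \<in> ?O" using r(2) by blast
      then obtain q where q: "q \<in> fst d" "q \<in> fst ?C" "z s = snd d q" by blast
      have qd: "d \<in> charts_at ?A q" "?C \<in> charts_at ?A q" using q dA CA by (auto simp: charts_at_iff)
      have "snd d q - snd d p \<in> W"
        using yd(2) subspace_scale[OF W] by (simp add: q(3)[symmetric] z_def u_def)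
      \<comment> \<open>The segment stays in the slice and its direction lies in \<open>W\<close>,
        so its velocity is degenerate at each of its points.\<close>
      then have "tvec_of ?A d q u \<in> degeneracy M Q \<pi> q"
        unfolding N(3)[OF q(1) \<open>snd d q - snd d p \<in> W\<close>]
        using tvec_of[OF Y.B qd(1), of u] yd(2) by (simp add: u_def)
      then have "model_map (tvec_of ?A d q u ?C) = 0" using degeneracy_iff[OF ac q(2)] by blast
      then have 0: "model_map (D ?t (z s) u) = 0"
        using tangentD[OF tvec_of(1)[OF Y.B qd(1)] qd] tvec_of(2)[OF Y.B qd(1)] q(3) by simp
      have "(z has_derivative (\<lambda>h. h *\<^sub>R u)) (at s within {0..1})"
        unfolding z_def by (auto intro!: derivative_eq_intros)
      from has_derivative_compose[OF this smooth_on_has_derivative[OF t(2) zO]]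
      have "((\<lambda>s. ?t (z s)) has_derivative (\<lambda>h. D ?t (z s) (h *\<^sub>R u))) (at s within {0..1})" .
      from bounded_linear.has_derivative[OF linear_imp_bounded_linear[OF maxatlas_fdim[OF Y.B] linear_model_map] this]
      show ?thesis
        using linear_cmul[OF has_derivative_linear[OF smooth_on_has_derivative[OF t(2) zO]]] 0
        by (simp add: has_vector_derivative_def linear_cmul[OF linear_model_map])
    qed
    obtain k where k: "\<And>s. s \<in> {0..1} \<Longrightarrow> model_map (?t (z s)) = k"
      by (rule has_vector_derivative_zero_constant[OF convex_real_interval(5) deriv]) (assumption | rule that)+
    have "z 0 = snd d p" "z 1 = snd d y" by (simp_all add: z_def u_def)
    then have "model_map (snd ?C y) = model_map (snd ?C p)"
      using k[of 0] k[of 1] t(3)[OF dA(2)] t(3)[OF yd(1)] by simp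
    then show ?thesis
      using chart_inj[OF maxatlas_target charts_in(2)[OF ac] Psi_coord(1)[OF ac yC] Psi_coord(1)[OF ac pC]]
        Psi_coord(2)[OF ac yC] Psi_coord(2)[OF ac pC] by simp
  qed
  ultimately show "\<exists>S. openin T S \<and> p \<in> S \<and> (\<forall>y\<in>S. Psi y = Psi p)" by blast
qed

lemma Psi_constant:
  assumes T: "connected_integral_manifold (J1P M Q \<pi>) (degeneracy M Q \<pi>) T"
    and p: "p \<in> topspace T" and q: "q \<in> topspace T"
  shows "Psi p = Psi q"
proof (rule ccontr)
  assume ne: "Psi p \<noteq> Psi q"
  note int = T[unfolded connected_integral_manifold_def]
  \<comment> \<open>The predicate \<open>R\<close> is left general to obtain a level set and its
    complement as open sets.\<close>
  have op: "openin T {y \<in> topspace T. R (Psi y)}" for R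
  proof (subst openin_subopen, intro ballI)
    fix x assume x: "x \<in> {y \<in> topspace T. R (Psi y)}"
    then obtain S where S: "openin T S" "x \<in> S" "\<forall>y\<in>S. Psi y = Psi x"
      using Psi_locally_constant(2)[of T x] int by blast
    have "S \<subseteq> {y \<in> topspace T. R (Psi y)}"
    proof
      fix y assume y: "y \<in> S"
      then have "Psi y = Psi x" "y \<in> topspace T" using S(3) openin_subset[OF S(1)] by blast+
      then show "y \<in> {y \<in> topspace T. R (Psi y)}" using x by simp
    qed
    then show "\<exists>S. openin T S \<and> x \<in> S \<and> S \<subseteq> {y \<in> topspace T. R (Psi y)}" using S by blast
  qed
  have "connected_space T" using int by blast
  moreover have "\<exists>E1 E2. openin T E1 \<and> openin T E2 \<and> topspace T \<subseteq> E1 \<union> E2 \<and> E1 \<inter> E2 = {} \<and> E1 \<noteq> {} \<and> E2 \<noteq> {}"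
    using op[of "\<lambda>e. e = Psi p"] op[of "\<lambda>e. e \<noteq> Psi p"] p q ne
    by (intro exI[of _ "{y \<in> topspace T. Psi y = Psi p}"] exI[of _ "{y \<in> topspace T. Psi y \<noteq> Psi p}"]) auto
  ultimately show False unfolding connected_space_def by blast
qed

text \<open>Maximality: a connected integral manifold containing the fibre has constant
  \<open>Psi\<close>, with the value \<eta> taken on the fibre, so it adds no points.\<close>

lemma leaf_fibre:
  assumes "\<eta> \<in> inf_target_points M Q \<pi>"
  shows "leaf (J1P M Q \<pi>) (degeneracy M Q \<pi>) {y \<in> points (J1P M Q \<pi>). Psi y = \<eta>}"
  unfolding leaf_def
proof (intro conjI allI impI)
  let ?L = "{y \<in> points (J1P M Q \<pi>). Psi y = \<eta>}"
  show "\<exists>T. topspace T = ?L \<and> connected_integral_manifold (J1P M Q \<pi>) (degeneracy M Q \<pi>) T"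
    using fibre_integral_manifold[OF assms] by blast
  fix T assume T: "connected_integral_manifold (J1P M Q \<pi>) (degeneracy M Q \<pi>) T \<and> ?L \<subseteq> topspace T"
  obtain p where p: "p \<in> ?L" using fibre_nonempty[OF assms] by blast
  have "y \<in> ?L" if y: "y \<in> topspace T" for y
    using Psi_constant[of T y p] Psi_locally_constant(1)[of T y] T p y
    unfolding connected_integral_manifold_def by auto
  then show "topspace T = ?L" using T by blast
qed

lemma image_Psi: "Psi ` points (J1P M Q \<pi>) = inf_target_points M Q \<pi>"
proof
  show "Psi ` points (J1P M Q \<pi>) \<subseteq> inf_target_points M Q \<pi>"
  proof
    fix \<eta> assume "\<eta> \<in> Psi ` points (J1P M Q \<pi>)"
    then obtain y where y: "y \<in> points (J1P M Q \<pi>)" "\<eta> = Psi y" by blast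
    obtain a c where "(a, c) \<in> adapted M Q \<pi>" "y \<in> fst (YC a c)" using YC_cover[OF y(1)] .
    then have "\<eta> \<in> fst (TC a c)" using Psi_coord(1) y(2) by simp
    then show "\<eta> \<in> inf_target_points M Q \<pi>"
      by (simp add: inf_target_chart_def top_chart_def inf_target_points_def)
  qed
  show "inf_target_points M Q \<pi> \<subseteq> Psi ` points (J1P M Q \<pi>)" using fibre_nonempty by blast
qed

end

section \<open>Adapted charts of a fibre bundle\<close>

lemma product_manifold:
  fixes A :: "('p, 'a::real_normed_vector) atlas" and B :: "('q, 'b::real_normed_vector) atlas"
  assumes A: "maxatlas A" and B: "maxatlas B"
  shows "maxatlas (product_manifold A B)" "points (product_manifold A B) = points A \<times> points B"
    "c \<in> A \<Longrightarrow> d \<in> B \<Longrightarrow> (fst c \<times> fst d, map_prod (snd c) (snd d)) \<in> product_manifold A B"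
proof -
  define P :: "('p, 'a) chart \<Rightarrow> ('q, 'b) chart \<Rightarrow> ('p \<times> 'q, 'a \<times> 'b) chart"
    where "P c d = (fst c \<times> fst d, map_prod (snd c) (snd d))" for c d
  let ?C = "{P c d | c d. c \<in> A \<and> d \<in> B}"
  have eq: "product_manifold A B = max_atlas (points A \<times> points B) ?C"
    by (simp add: product_manifold_def P_def)
  have fd: "fdim TYPE('a \<times> 'b)" using maxatlas_fdim[OF A] maxatlas_fdim[OF B] by simp
  have img: "snd (P c d) ` (fst (P c d) \<inter> fst (P c' d')) = snd c ` (fst c \<inter> fst c') \<times> snd d ` (fst d \<inter> fst d')" for c d c' d'
    by (auto simp: P_def)
  have ch: "is_chart_in (points A \<times> points B) (P c d)" if "c \<in> A" "d \<in> B" for c d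
  proof -
    have "inj_on (map_prod (snd c) (snd d)) (fst c \<times> fst d)"
      using maxatlasD(1)[OF A that(1)] maxatlasD(1)[OF B that(2)] by (intro map_prod_inj_on) (auto simp: is_chart_in_def)
    moreover have "img (P c d) = img c \<times> img d" using img[of c d c d] by simp
    moreover have "fst (P c d) \<subseteq> points A \<times> points B"
      using chart_subset_points[OF that(1)] chart_subset_points[OF that(2)] by (auto simp: P_def)
    ultimately show ?thesis
      using open_img[OF A that(1)] open_img[OF B that(2)] by (auto simp: is_chart_in_def P_def intro: open_Times)
  qed
  have tr: "smooth_transition (P c d) (P c' d')" if cd: "c \<in> A" "d \<in> B" "c' \<in> A" "d' \<in> B" for c d c' d'
  proof -
    let ?S = "snd c ` (fst c \<inter> fst c') \<times> snd d ` (fst d \<inter> fst d')"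
    note t = transition_rep[OF A cd(1,3)] and u = transition_rep[OF B cd(2,4)]
    have op: "open ?S" using t(1) u(1) by (rule open_Times)
    have "smooth_on ?S (\<lambda>z. (transition c c' (fst z), transition d d' (snd z)))"
      by (intro smooth_on_Pair op smooth_on_compose[OF maxatlas_fdim[OF A] op t(2) smooth_on_fst[OF op smooth_on_id]]
          smooth_on_compose[OF maxatlas_fdim[OF B] op u(2) smooth_on_snd[OF op smooth_on_id]]) auto
    then have "smooth_on ?S (transition (P c d) (P c' d'))"
    proof (rule smooth_on_cong[OF op])
      fix z assume "z \<in> ?S"
      then obtain p q where pq: "p \<in> fst c" "q \<in> fst d" "z = (snd c p, snd d q)" by auto
      then have pq': "(p, q) \<in> fst (P c d)" "z = snd (P c d) (p, q)" by (auto simp: P_def)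
      show "(transition c c' (fst z), transition d d' (snd z)) = transition (P c d) (P c' d') z"
        unfolding pq'(2) transition_chart[OF ch[OF cd(1,2)] pq'(1)] using t(3)[OF pq(1)] u(3)[OF pq(2)]
        by (simp add: P_def)
    qed
    then show ?thesis using op by (simp add: smooth_transition_def img)
  qed
  have cov: "\<exists>C\<in>?C. x \<in> fst C" if x: "x \<in> points A \<times> points B" for x
  proof -
    obtain c d where "c \<in> A" "d \<in> B" "fst x \<in> fst c" "snd x \<in> fst d"
      using points_cover[of "fst x" A] points_cover[of "snd x" B] x by auto
    then show ?thesis by (intro bexI[of _ "P c d"]) (auto simp: P_def mem_Times_iff)
  qed
  have ch': "\<And>C. C \<in> ?C \<Longrightarrow> is_chart_in (points A \<times> points B) C" using ch by blast
  have tr': "\<And>C C'. C \<in> ?C \<Longrightarrow> C' \<in> ?C \<Longrightarrow> smooth_transition C C'" using tr by blast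
  note m = max_atlas_maximal[OF fd ch' tr' cov, folded eq]
  show "maxatlas (product_manifold A B)" "points (product_manifold A B) = points A \<times> points B" using m by auto
  show "(fst c \<times> fst d, map_prod (snd c) (snd d)) \<in> product_manifold A B" if "c \<in> A" "d \<in> B"
    using m(1) that unfolding P_def by blast
qed

text \<open>The transitions between the pulled-back chart and the charts of \<open>A\<close> are
  local expressions of the diffeomorphism and of its inverse.\<close>

lemma pullback_chart:
  assumes A: "maxatlas A" and B: "maxatlas B" and f: "diffeomorphism A B f" and d: "d \<in> B"
  shows "({p \<in> points A. f p \<in> fst d}, snd d \<circ> f) \<in> A"
proof -
  let ?c = "({p \<in> points A. f p \<in> fst d}, snd d \<circ> f)"
  define g where "g = inv_into (points A) f"
  have bij: "bij_betw f (points A) (points B)" and near: "\<And>p. p \<in> points A \<Longrightarrow> smooth_near A B f p"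
    and near': "\<And>p. p \<in> points B \<Longrightarrow> smooth_near B A g p"
    using f unfolding diffeomorphism_def smooth_map_near g_def by blast+
  have g: "g (f p) = p" if "p \<in> points A" for p using bij that by (simp add: g_def bij_betw_def)
  have fg: "\<exists>p\<in>points A. f p = q" if "q \<in> points B" for q
    using bij_betw_imp_surj_on[OF bij] that by (metis imageE)
  have "inj_on (snd d \<circ> f) (fst ?c)"
    using chart_inj[OF B d] bij by (auto simp: inj_on_def bij_betw_def)
  moreover have "img ?c = img d"
    using fg chart_subset_points[OF d] by force
  ultimately have ch: "is_chart_in (points A) ?c"
    using open_img[OF B d] by (auto simp: is_chart_in_def)
  show ?thesis
  proof (rule maxatlasI[OF A ch], rule conjI)
    fix c assume c: "c \<in> A"
    let ?I = "fst c \<inter> fst ?c"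
    have 1: "\<exists>W. open W \<and> snd c p \<in> W \<and> W \<subseteq> snd c ` ?I \<and> smooth_on W (transition c ?c)" if p: "p \<in> ?I" for p
    proof -
      have pp: "p \<in> fst c" "p \<in> points A" "f p \<in> fst d" using p by auto
      obtain W where W: "open W" "snd c p \<in> W" "W \<subseteq> img c" "\<And>z. z \<in> W \<Longrightarrow> f (cinv c z) \<in> fst d"
        "smooth_on W (snd d \<circ> f \<circ> cinv c)"
        using smooth_near_rep[OF A B near[OF pp(2)] c pp(1) d pp(3)] by metis
      have "W \<subseteq> snd c ` ?I"
      proof
        fix z assume z: "z \<in> W"
        then have zi: "z \<in> img c" using W(3) by blast
        have "cinv c z \<in> ?I"
          using cinv_in[OF zi] W(4)[OF z] chart_subset_points[OF c] by simp
        then have "snd c (cinv c z) \<in> snd c ` ?I" by (rule imageI)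
        then show "z \<in> snd c ` ?I" using chart_cinv[OF zi] by simp
      qed
      moreover have "smooth_on W (transition c ?c)" using W(5) by (simp add: transition_def)
      ultimately show ?thesis using W(1,2) by blast
    qed
    have op: "open (snd c ` ?I)"
      by (subst open_subopen) (use 1 in blast)
    moreover have "smooth_on (snd c ` ?I) (transition c ?c)"
      by (rule smooth_on_local[OF op]) (use 1 in blast)
    ultimately show "smooth_transition c ?c" by (simp add: smooth_transition_def)
    let ?J = "fst ?c \<inter> fst c"
    have 2: "\<exists>W. open W \<and> snd ?c p \<in> W \<and> W \<subseteq> snd ?c ` ?J \<and> smooth_on W (transition ?c c)" if p: "p \<in> ?J" for p
    proof -
      have pp: "p \<in> fst c" "p \<in> points A" "f p \<in> fst d" using p by auto
      have fp: "f p \<in> points B" using chart_subset_points[OF d pp(3)] .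
      have gp: "g (f p) \<in> fst c" using g[OF pp(2)] pp(1) by simp
      obtain W where W: "open W" "snd d (f p) \<in> W" "W \<subseteq> img d" "\<And>z. z \<in> W \<Longrightarrow> g (cinv d z) \<in> fst c"
        "smooth_on W (snd c \<circ> g \<circ> cinv d)"
        using smooth_near_rep[OF B A near'[OF fp] d pp(3) c gp] by metis
      have z: "z \<in> snd ?c ` ?J \<and> transition ?c c z = (snd c \<circ> g \<circ> cinv d) z" if z: "z \<in> W" for z
      proof -
        have zi: "z \<in> img d" using W(3) z by blast
        obtain q where q: "q \<in> points A" "f q = cinv d z" using fg chart_subset_points[OF d cinv_in[OF zi]] by blast
        have gq: "g (cinv d z) = q" using g[OF q(1)] q(2) by simp
        have "q \<in> ?J" using q W(4)[OF z] gq cinv_in[OF zi] by simp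
        moreover have "snd ?c q = z" using q(2) chart_cinv[OF zi] by simp
        moreover have "transition ?c c (snd ?c q) = snd c q"
          by (rule transition_chart[OF ch]) (use \<open>q \<in> ?J\<close> in blast)
        ultimately show ?thesis using gq by auto
      qed
      have "smooth_on W (transition ?c c)" by (rule smooth_on_cong[OF W(1,5)]) (simp add: z)
      then show ?thesis using W(1,2) z by (intro exI[of _ W]) auto
    qed
    have op: "open (snd ?c ` ?J)"
      by (subst open_subopen) (use 2 in blast)
    moreover have "smooth_on (snd ?c ` ?J) (transition ?c c)"
      by (rule smooth_on_local[OF op]) (use 2 in blast)
    ultimately show "smooth_transition ?c c" by (simp add: smooth_transition_def)
  qed
qed

lemma openin_smooth_preimage:
  assumes A: "maxatlas A" and B: "maxatlas B" and f: "smooth_map A B f" and U: "openin (mfd_topology B) U"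
  shows "openin (mfd_topology A) {p \<in> points A. f p \<in> U}"
  unfolding openin_mfd[OF A]
proof (intro conjI ballI)
  fix c assume c: "c \<in> A"
  show "open (snd c ` (fst c \<inter> {p \<in> points A. f p \<in> U}))"
  proof (subst open_subopen, intro ballI)
    fix z assume "z \<in> snd c ` (fst c \<inter> {p \<in> points A. f p \<in> U})"
    then obtain p where p: "p \<in> fst c" "p \<in> points A" "f p \<in> U" "z = snd c p" by blast
    have near: "smooth_near A B f p" using f p(2) by (simp add: smooth_map_near)
    then obtain d where d: "d \<in> B" "f p \<in> fst d" unfolding smooth_near_def by blast
    \<comment> \<open>With the chart cut down to \<open>U\<close>, the neighbourhood given by
      \<open>smooth_near_rep\<close> is mapped into \<open>U\<close>.\<close>
    let ?d = "({q \<in> fst d. snd d q \<in> snd d ` (fst d \<inter> U)}, snd d)"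
    have "open (snd d ` (fst d \<inter> U))" using U d(1) openin_mfd[OF B] by blast
    then have d': "?d \<in> B" by (rule restrict_chart[OF B d(1)])
    have dU: "fst ?d \<subseteq> U" using chart_inj[OF B d(1)] by auto
    have fp: "f p \<in> fst ?d" using d p(3) by simp
    have "\<exists>W. open W \<and> snd c p \<in> W \<and> W \<subseteq> img c \<and> (\<forall>z\<in>W. f (cinv c z) \<in> fst ?d)"
      by (rule smooth_near_rep[OF A B near c p(1) d' fp]) blast
    then obtain W where W: "open W" "snd c p \<in> W" "W \<subseteq> img c" "\<And>z. z \<in> W \<Longrightarrow> f (cinv c z) \<in> fst ?d"
      by blast
    have "W \<subseteq> snd c ` (fst c \<inter> {p \<in> points A. f p \<in> U})"
    proof
      fix y assume y: "y \<in> W"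
      then have yi: "y \<in> img c" using W(3) by blast
      have "cinv c y \<in> fst c \<inter> {p \<in> points A. f p \<in> U}"
        using cinv_in[OF yi] W(4)[OF y] dU chart_subset_points[OF c] by blast
      then have "snd c (cinv c y) \<in> snd c ` (fst c \<inter> {p \<in> points A. f p \<in> U})" by (rule imageI)
      then show "y \<in> snd c ` (fst c \<inter> {p \<in> points A. f p \<in> U})" using chart_cinv[OF yi] by simp
    qed
    then show "\<exists>T. open T \<and> z \<in> T \<and> T \<subseteq> snd c ` (fst c \<inter> {p \<in> points A. f p \<in> U})"
      using W(1,2) p(4) by blast
  qed
qed blast

text \<open>A product chart of base and fibre is pulled back along a local trivialisation; the
  result is adapted because the trivialisation covers the identity of the base.\<close>

lemma adapted_bundle_smooth_fibre_bundle:
  fixes M :: "('m, 'e::euclidean_space) atlas" and F :: "('f, 'g::real_normed_vector) atlas"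
    and Q :: "('q, 'e \<times> 'g) atlas"
  assumes "smooth_fibre_bundle M F Q \<pi>"
  shows "adapted_bundle M Q \<pi>"
proof
  have ma: "maxatlas M" "maxatlas F" "maxatlas Q" and \<pi>: "smooth_map Q M \<pi>" "\<pi> ` points Q = points M"
    and triv: "\<And>x. x \<in> points M \<Longrightarrow> \<exists>U \<Phi>. openin (mfd_topology M) U \<and> x \<in> U \<and>
        diffeomorphism (open_submanifold Q {q \<in> points Q. \<pi> q \<in> U})
          (product_manifold (open_submanifold M U) F) \<Phi> \<and>
        (\<forall>q\<in>points Q. \<pi> q \<in> U \<longrightarrow> fst (\<Phi> q) = \<pi> q)"
    using assms smooth_manifold_maxatlas unfolding smooth_fibre_bundle_def by blast+
  show "maxatlas M" "maxatlas Q" using ma by auto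
  show "fdim TYPE('g)" by (rule maxatlas_fdim[OF ma(2)])
  fix b assume b: "b \<in> points Q"
  then obtain U \<Phi> where U: "openin (mfd_topology M) U" "\<pi> b \<in> U"
    and \<Phi>: "diffeomorphism (open_submanifold Q {q \<in> points Q. \<pi> q \<in> U}) (product_manifold (open_submanifold M U) F) \<Phi>"
      "\<And>q. q \<in> points Q \<Longrightarrow> \<pi> q \<in> U \<Longrightarrow> fst (\<Phi> q) = \<pi> q"
    using triv[of "\<pi> b"] \<pi>(2) by blast
  let ?V = "{q \<in> points Q. \<pi> q \<in> U}"
  have V: "openin (mfd_topology Q) ?V" by (rule openin_smooth_preimage[OF ma(3,1) \<pi>(1) U(1)])
  note OQ = open_submanifold_maxatlas[OF ma(3) V] and OM = open_submanifold_maxatlas[OF ma(1) U(1)]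
  note PR = product_manifold[OF OM(1) ma(2)]
  have "\<Phi> b \<in> U \<times> points F"
    using \<Phi>(1) b U(2) unfolding diffeomorphism_def OQ(2) PR(2) OM(2) bij_betw_def by blast
  then obtain a e where a: "a \<in> open_submanifold M U" "fst (\<Phi> b) \<in> fst a" and e: "e \<in> F" "snd (\<Phi> b) \<in> fst e"
    using points_cover[of _ "open_submanifold M U"] points_cover[of _ F] OM(2) by (metis mem_Times_iff)
  define c where "c = ({q \<in> points (open_submanifold Q ?V). \<Phi> q \<in> fst (fst a \<times> fst e, map_prod (snd a) (snd e))},
    snd (fst a \<times> fst e, map_prod (snd a) (snd e)) \<circ> \<Phi>)"
  have "c \<in> open_submanifold Q ?V"
    unfolding c_def by (rule pullback_chart[OF OQ(1) PR(1) \<Phi>(1) PR(3)[OF a(1) e(1)]])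
  then have "c \<in> Q" by (simp add: open_submanifold_def)
  moreover have "a \<in> M" using a(1) by (simp add: open_submanifold_def)
  moreover have c: "q \<in> fst c \<longleftrightarrow> q \<in> points Q \<and> \<pi> q \<in> U \<and> \<Phi> q \<in> fst a \<times> fst e" for q
    unfolding c_def by (simp add: OQ(2))
  moreover have "fst (snd c q) = snd a (\<pi> q)" if "q \<in> fst c" for q
    using that \<Phi>(2)[of q] unfolding c by (simp add: c_def)
  moreover have "\<pi> q \<in> fst a" if "q \<in> fst c" for q
    using that \<Phi>(2)[of q] unfolding c by (metis mem_Times_iff)
  ultimately have "(a, c) \<in> adapted M Q \<pi>" by (auto simp: adapted_def)
  moreover have "b \<in> fst c" using b U(2) a(2) e(2) by (simp add: c mem_Times_iff)
  ultimately show "\<exists>a c. (a, c) \<in> adapted M Q \<pi> \<and> b \<in> fst c" by blast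
qed

theorem theorem7:
  shows "\<exists>G :: ('e::euclidean_space, 'g::real_normed_vector) jet_phase_model
                 \<Rightarrow> ('e, 'g) inf_form_model.
    \<forall>(M :: ('m, 'e) atlas) (F :: ('f, 'g) atlas) (Q :: ('q, 'e \<times> 'g) atlas) (\<pi> :: 'q \<Rightarrow> 'm).
      smooth_fibre_bundle M F Q \<pi> \<longrightarrow>
      (\<exists>\<Psi> :: ('m, 'e, 'q, 'g) jet_phase \<Rightarrow> ('m, 'e, 'q, 'g) inf_form.
         has_coordinate_rule M Q \<pi> G \<Psi> \<and>
         smooth_map (J1P M Q \<pi>) (inf_target M Q \<pi>) \<Psi> \<and>
         (\<forall>y\<in>points (J1P M Q \<pi>). fst (\<Psi> y) = J1P_to_QI M Q \<pi> y) \<and>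
         (\<forall>\<eta>\<in>inf_target_points M Q \<pi>.
            leaf (J1P M Q \<pi>) (degeneracy M Q \<pi>) {y \<in> points (J1P M Q \<pi>). \<Psi> y = \<eta>}) \<and>
         \<Psi> ` points (J1P M Q \<pi>) = inf_target_points M Q \<pi>)"
\<comment> \<open>The witness depends only on the model types, so one rule serves all bundles and
  all adapted charts.\<close>
proof (intro exI[of _ model_map] allI impI)
  fix M :: "('m, 'e) atlas" and F :: "('f, 'g) atlas" and Q :: "('q, 'e \<times> 'g) atlas" and \<pi> :: "'q \<Rightarrow> 'm"
  assume "smooth_fibre_bundle M F Q \<pi>"
  then interpret multi_phase M Q \<pi>
    unfolding multi_phase_def by (rule adapted_bundle_smooth_fibre_bundle)
  show "\<exists>\<Psi>. has_coordinate_rule M Q \<pi> model_map \<Psi> \<and>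
         smooth_map (J1P M Q \<pi>) (inf_target M Q \<pi>) \<Psi> \<and>
         (\<forall>y\<in>points (J1P M Q \<pi>). fst (\<Psi> y) = J1P_to_QI M Q \<pi> y) \<and>
         (\<forall>\<eta>\<in>inf_target_points M Q \<pi>.
            leaf (J1P M Q \<pi>) (degeneracy M Q \<pi>) {y \<in> points (J1P M Q \<pi>). \<Psi> y = \<eta>}) \<and>
         \<Psi> ` points (J1P M Q \<pi>) = inf_target_points M Q \<pi>"
    using has_coordinate_rule_Psi smooth_Psi fst_Psi leaf_fibre image_Psi by blast
qed

end
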